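(* For every $K\ge1$ there is a constant $c=c(K)$ such that the following holds. Let $f$ be a $K$-qc mapping of the plane with $f(0)=0$ and $f(\infty)=\infty$, and let $\alpha=K^{-1}$. If $z_1,z_2\in\mathbb{C}^*=\mathbb{C}\setminus\{0\}$ with $|z_1|=|z_2|$, and $\theta\in[0,\pi]$ (respectively $\theta^*\in[0,\pi]$) is the measure of the convex angle between $z_1,z_2$ (respectively between $f(z_1),f(z_2)$), then $$\theta^*\le c\,\max\{\theta^{\alpha},\theta\}.$$ In particular, if $\theta\le 1$, then $\theta^*\le c\,\theta^{\alpha}$.
   Context: A homeomorphism $f$ between planar domains is $K$-quasiconformal ($K$-qc), $K\ge1$, if it is absolutely continuous on a.e. horizontal and a.e. vertical line and $|f_{\bar z}|\le k|f_z|$ a.e., where $k=\frac{K-1}{K+1}$. A $K$-qc mapping of the plane is such a homeomorphism of $\mathbb{C}$ onto $\mathbb{C}$ (extended by $f(\infty)=\infty$). The convex angle between $z_1,z_2\in\mathbb{C}^*$ is the angle in $[0,\pi]$ at the origin between the rays from $0$ through $z_1$ and through $z_2$. *)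

theory Defs
  imports "HOL-Analysis.Analysis"
begin

definition abs_continuous_on :: "real set \<Rightarrow> (real \<Rightarrow> 'a::real_normed_vector) \<Rightarrow> bool" where
  "abs_continuous_on S g \<longleftrightarrow>
    (\<forall>\<epsilon>>0. \<exists>\<delta>>0. \<forall>(n::nat) u v.
      (\<forall>i<n. u i \<le> v i \<and> {u i..v i} \<subseteq> S) \<and>
      disjoint_family_on (\<lambda>i. {u i<..<v i}) {..<n} \<and>
      (\<Sum>i<n. v i - u i) < \<delta>
      \<longrightarrow> (\<Sum>i<n. norm (g (v i) - g (u i))) < \<epsilon>)"

text \<open>
  As usual, absolute continuity along a line is meant locally, that is, on every compact
  segment of the line that is contained in the domain.
\<close>

definition ACL_on :: "complex set \<Rightarrow> (complex \<Rightarrow> complex) \<Rightarrow> bool" where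
  "ACL_on D f \<longleftrightarrow>
    (AE y in lebesgue. \<forall>a b. (\<forall>x\<in>{a..b}. Complex x y \<in> D) \<longrightarrow>
        abs_continuous_on {a..b} (\<lambda>x. f (Complex x y))) \<and>
    (AE x in lebesgue. \<forall>a b. (\<forall>y\<in>{a..b}. Complex x y \<in> D) \<longrightarrow>
        abs_continuous_on {a..b} (\<lambda>y. f (Complex x y)))"

definition partial_x :: "(complex \<Rightarrow> complex) \<Rightarrow> complex \<Rightarrow> complex" where
  "partial_x f z = vector_derivative (\<lambda>x. f (Complex x (Im z))) (at (Re z))"

definition partial_y :: "(complex \<Rightarrow> complex) \<Rightarrow> complex \<Rightarrow> complex" where
  "partial_y f z = vector_derivative (\<lambda>y. f (Complex (Re z) y)) (at (Im z))"

definition dz :: "(complex \<Rightarrow> complex) \<Rightarrow> complex \<Rightarrow> complex" where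
  "dz f z = (partial_x f z - \<i> * partial_y f z) / 2"

definition dzbar :: "(complex \<Rightarrow> complex) \<Rightarrow> complex \<Rightarrow> complex" where
  "dzbar f z = (partial_x f z + \<i> * partial_y f z) / 2"

definition planar_domain :: "complex set \<Rightarrow> bool" where
  "planar_domain D \<longleftrightarrow> open D \<and> connected D \<and> D \<noteq> {}"

text \<open>
  For a continuous function that is absolutely continuous on almost every line, the partial
  derivatives exist almost everywhere in the domain, so the arbitrary value of
  \<^const>\<open>vector_derivative\<close> at points of non-differentiability plays no role below.
\<close>

definition quasiconformal ::
    "real \<Rightarrow> complex set \<Rightarrow> complex set \<Rightarrow> (complex \<Rightarrow> complex) \<Rightarrow> bool" where
  "quasiconformal K D D' f \<longleftrightarrow>
    1 \<le> K \<and> planar_domain D \<and> planar_domain D' \<and>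
    (\<exists>g. homeomorphism D D' f g) \<and>
    ACL_on D f \<and>
    (AE z in lebesgue. z \<in> D \<longrightarrow> cmod (dzbar f z) \<le> (K - 1) / (K + 1) * cmod (dz f z))"

text \<open>
  The extension to the Riemann sphere by \<open>f(\<infinity>) = \<infinity>\<close> is part of the convention for mappings of
  the plane and imposes no further condition on \<open>f\<close>: a homeomorphism of the plane onto itself
  is proper.
\<close>

definition quasiconformal_plane :: "real \<Rightarrow> (complex \<Rightarrow> complex) \<Rightarrow> bool" where
  "quasiconformal_plane K f \<longleftrightarrow> quasiconformal K UNIV UNIV f"

text \<open>Only meaningful for nonzero arguments; the value then lies in \<open>[0, \<pi>]\<close>.\<close>

definition convex_angle :: "complex \<Rightarrow> complex \<Rightarrow> real" where
  "convex_angle z w = arccos (z \<bullet> w / (norm z * norm w))"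

end

theory Submission
  imports Defs
begin

text \<open>
  The proof is Morrey's. The dilatation condition says \<open>|\<partial>\<^sub>e f|\<^sup>2 \<le> K J\<close> for every unit vector \<open>e\<close> almost
  everywhere, where \<open>J\<close> is the Jacobian, and the integral of \<open>J\<close> over a set is at most the area of its
  image. A length-area estimate on squares bounds the oscillation of a map on some square contour by its
  Dirichlet integral. Applied to the truncated logarithm of \<open>|f|\<close>, whose Dirichlet integral is
  controlled by the logarithmic area of an annulus, it gives \<open>|f z'| \<le> 2\<^sup>N |f z|\<close> for \<open>|z'| \<le> 2 |z|\<close>.

  For the exponent \<open>1 / K\<close>, Wirtinger's inequality shows that the area \<open>W r\<close> of the image of a disc of radius
  \<open>r\<close> is at most \<open>(K r / 2) W' r\<close>, so \<open>W r / r powr (2 / K)\<close> increases. As \<open>f\<close> is not smooth, this is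
  carried out in the integrated form \<open>2 \<integral> \<eta> J \<le> \<integral> w |\<partial>\<^sub>\<theta> f|\<^sup>2\<close> for a radial cut-off \<open>\<eta>\<close> with gradient
  \<open>- w z\<close>, which passes to the limit from averages of \<open>f\<close> over small squares. Combined with the length-area
  estimate and the maximum principle, the growth bound yields
  \<open>|f z\<^sub>1 - f z\<^sub>2| \<le> C |f z\<^sub>1| (|z\<^sub>1 - z\<^sub>2| / |z\<^sub>1|) powr (1 / K)\<close>, and angles are comparable with chords.
\<close>

subsection \<open>Absolutely continuous functions on an interval\<close>

text \<open>The growth bound sets two orders of magnitude against each other. If
  \<open>|f z'| > 2^N |f z|\<close>, the truncated logarithm has to climb \<open>N ln 2\<close>,
  while its Dirichlet integral is at most a constant times \<open>K (N + 1)\<close>, which permits a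
  climb of order \<open>sqrt (K (N + 1))\<close> only. Hence \<open>N\<close> depends on
  \<open>K\<close> alone, and the image of the disc of radius \<open>|z|\<close> about
  \<open>z\<close> has area at most \<open>pi (2^N |f z|)^2\<close>: this is what brings
  \<open>|f z|\<close> into the final estimate.

  Oscillation is controlled by the square root of an energy, hence of an image area, so the area
  exponent \<open>2 / K\<close> becomes the exponent \<open>1 / K\<close>.

  The obstacle is that \<open>f\<close> has only partial derivatives, and these only almost
  everywhere. Every pointwise argument is therefore made either on almost every line parallel to an
  axis, which is why contours are squares, or on countably many sets of uniform convergence of the
  difference quotients, which cover almost everything. The null set left over is the reason that the
  Jacobian is compared with image area by an inequality.\<close>

text \<open>The intervals are indexed by an arbitrary finite set, so that members of a division or
  of a tagged division can serve as their own indices.\<close>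

lemma abs_continuous_onD:
  fixes g :: "real \<Rightarrow> 'a::real_normed_vector"
  assumes "abs_continuous_on S g" "\<epsilon> > 0"
  obtains \<delta> where "\<delta> > 0"
    "\<And>(P::'i set) u v. finite P \<Longrightarrow> (\<And>i. i \<in> P \<Longrightarrow> u i \<le> v i \<and> {u i..v i} \<subseteq> S) \<Longrightarrow>
      disjoint_family_on (\<lambda>i. {u i<..<v i}) P \<Longrightarrow> (\<Sum>i\<in>P. v i - u i) < \<delta> \<Longrightarrow>
      (\<Sum>i\<in>P. norm (g (v i) - g (u i))) < \<epsilon>"
proof -
  obtain \<delta> where \<delta>: "\<delta> > 0" "\<And>n u v. (\<forall>i<n. u i \<le> v i \<and> {u i..v i} \<subseteq> S) \<Longrightarrow>
      disjoint_family_on (\<lambda>i. {u i<..<v i}) {..<n::nat} \<Longrightarrow> (\<Sum>i<n. v i - u i) < \<delta> \<Longrightarrow>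
      (\<Sum>i<n. norm (g (v i) - g (u i))) < \<epsilon>"
    using assms unfolding abs_continuous_on_def by meson
  show ?thesis
  proof (rule that[OF \<delta>(1)])
    fix P :: "'i set" and u v
    assume P: "finite P" and uv: "\<And>i. i \<in> P \<Longrightarrow> u i \<le> v i \<and> {u i..v i} \<subseteq> S"
      and dis: "disjoint_family_on (\<lambda>i. {u i<..<v i}) P" and sm: "(\<Sum>i\<in>P. v i - u i) < \<delta>"
    obtain h where h: "bij_betw h {..<card P} P"
      using ex_bij_betw_nat_finite[OF P] by (auto simp: atLeast0LessThan)
    have re: "(\<Sum>i<card P. w (h i)) = sum w P" for w :: "'i \<Rightarrow> real"
      by (rule sum.reindex_bij_betw[OF h])
    have hP: "h i \<in> P" if "i < card P" for i
      using h that by (auto dest: bij_betwE)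
    have inj: "inj_on h {..<card P}" using h bij_betw_def by blast
    have "(\<Sum>i<card P. norm (g ((v \<circ> h) i) - g ((u \<circ> h) i))) < \<epsilon>"
    proof (rule \<delta>(2))
      show "\<forall>i<card P. (u \<circ> h) i \<le> (v \<circ> h) i \<and> {(u \<circ> h) i..(v \<circ> h) i} \<subseteq> S"
        using uv hP by auto
      show "disjoint_family_on (\<lambda>i. {(u \<circ> h) i<..<(v \<circ> h) i}) {..<card P}"
        unfolding disjoint_family_on_def
    proof (intro ballI impI)
      fix i j assume ij: "i \<in> {..<card P}" "j \<in> {..<card P}" "i \<noteq> j"
      then have "h i \<noteq> h j" using inj by (simp add: inj_on_eq_iff)
      then show "{(u \<circ> h) i<..<(v \<circ> h) i} \<inter> {(u \<circ> h) j<..<(v \<circ> h) j} = {}"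
        using dis hP ij unfolding disjoint_family_on_def by auto
    qed
      show "(\<Sum>i<card P. (v \<circ> h) i - (u \<circ> h) i) < \<delta>"
        using re[of "\<lambda>i. v i - u i"] sm by simp
    qed
    then show "(\<Sum>i\<in>P. norm (g (v i) - g (u i))) < \<epsilon>"
      using re[of "\<lambda>i. norm (g (v i) - g (u i))"] by simp
  qed
qed

lemma abs_continuous_on_lipschitz_compose:
  fixes g :: "real \<Rightarrow> 'a::real_normed_vector" and h :: "real \<Rightarrow> 'b::real_normed_vector"
  assumes g: "abs_continuous_on S g"
    and le: "\<And>x y. x \<in> S \<Longrightarrow> y \<in> S \<Longrightarrow> norm (h x - h y) \<le> L * norm (g x - g y)"
  shows "abs_continuous_on S h"
  unfolding abs_continuous_on_def
proof (intro allI impI)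
  fix \<epsilon> :: real assume \<epsilon>: "\<epsilon> > 0"
  \<comment> \<open>\<open>L\<close> may be zero or negative; \<open>M\<close> is a positive
    Lipschitz constant by which \<open>\<epsilon>\<close> can be divided.\<close>
  define M where "M = max L 1"
  have M: "M > 0" "L \<le> M" unfolding M_def by auto
  obtain \<delta> where \<delta>: "\<delta> > 0" "\<And>(n::nat) u v. (\<forall>i<n. u i \<le> v i \<and> {u i..v i} \<subseteq> S) \<and>
      disjoint_family_on (\<lambda>i. {u i<..<v i}) {..<n} \<and> (\<Sum>i<n. v i - u i) < \<delta> \<longrightarrow>
      (\<Sum>i<n. norm (g (v i) - g (u i))) < \<epsilon> / M"
    using g[unfolded abs_continuous_on_def, rule_format, of "\<epsilon> / M"] \<epsilon> M by auto
  show "\<exists>\<delta>>0. \<forall>n u v. (\<forall>i<n. u i \<le> v i \<and> {u i..v i} \<subseteq> S) \<and>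
      disjoint_family_on (\<lambda>i. {u i<..<v i}) {..<n::nat} \<and> (\<Sum>i<n. v i - u i) < \<delta> \<longrightarrow>
      (\<Sum>i<n. norm (h (v i) - h (u i))) < \<epsilon>"
  proof (intro exI[of _ \<delta>] conjI allI impI \<delta>(1))
    fix n :: nat and u v
    assume *: "(\<forall>i<n. u i \<le> v i \<and> {u i..v i} \<subseteq> S) \<and>
      disjoint_family_on (\<lambda>i. {u i<..<v i}) {..<n::nat} \<and> (\<Sum>i<n. v i - u i) < \<delta>"
    have "(\<Sum>i<n. norm (h (v i) - h (u i))) \<le> (\<Sum>i<n. M * norm (g (v i) - g (u i)))"
    proof (rule sum_mono)
      fix i assume "i \<in> {..<n}"
      with * have "u i \<in> {u i..v i}" "v i \<in> {u i..v i}" "{u i..v i} \<subseteq> S" by auto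
      then have "u i \<in> S" "v i \<in> S" by blast+
      then show "norm (h (v i) - h (u i)) \<le> M * norm (g (v i) - g (u i))"
        using le[of "v i" "u i"] M by (meson mult_right_mono norm_ge_zero order_trans)
    qed
    also have "\<dots> = M * (\<Sum>i<n. norm (g (v i) - g (u i)))" by (simp add: sum_distrib_left)
    also have "\<dots> < M * (\<epsilon> / M)" using \<delta>(2)[of n u v] * M by (intro mult_strict_left_mono) auto
    finally show "(\<Sum>i<n. norm (h (v i) - h (u i))) < \<epsilon>" using M by simp
  qed
qed

section \<open>Bounded variation and differentiability almost everywhere\<close>

definition vsum :: "(real \<Rightarrow> real) \<Rightarrow> real set set \<Rightarrow> real" where
  "vsum g D = (\<Sum>I\<in>D. \<bar>g (Sup I) - g (Inf I)\<bar>)"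

text \<open>The interval is covered by \<open>N\<close> windows of length
  \<open>\<delta> / 2\<close>. Clipping a division to one window leaves disjoint intervals of total
  length below \<open>\<delta>\<close>, whose increments sum to less than 1, so \<open>N\<close>
  bounds the variation.\<close>

lemma vsum_bounded:
  fixes g :: "real \<Rightarrow> real"
  assumes ac: "abs_continuous_on {a..b} g"
  obtains V where "\<And>D S. D division_of S \<Longrightarrow> S \<subseteq> {a..b} \<Longrightarrow> vsum g D \<le> V"
proof -
  obtain \<delta> where \<delta>: "\<delta> > 0"
    "\<And>(P::real set set) u v. finite P \<Longrightarrow> (\<And>i. i \<in> P \<Longrightarrow> u i \<le> v i \<and> {u i..v i} \<subseteq> {a..b}) \<Longrightarrow>
      disjoint_family_on (\<lambda>i. {u i<..<v i}) P \<Longrightarrow> (\<Sum>i\<in>P. v i - u i) < \<delta> \<Longrightarrow>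
      (\<Sum>i\<in>P. norm (g (v i) - g (u i))) < 1"
    using abs_continuous_onD[OF ac zero_less_one] by blast
  obtain N :: nat where N: "N > 0" "b - a < N * (\<delta> / 2)"
  proof -
    obtain M where "b - a < real M * (\<delta>/2)" using ex_less_of_nat_mult[of "\<delta>/2" "b-a"] \<delta>(1) by auto
    then show ?thesis using that[of "Suc M"] \<delta>(1) by (auto simp: algebra_simps)
  qed
  define t where "t k = a + real k * (\<delta> / 2)" for k
  \<comment> \<open>\<open>cl k\<close> projects the line onto the \<open>k\<close>-th window, so an
    interval is cut by applying it to both end points.\<close>
  define cl where "cl k x = max (t k) (min (t (Suc k)) x)" for k x
  have clmono: "cl k x \<le> cl k y" if "x \<le> y" for k x y
    using that unfolding cl_def by auto
  have tel: "(\<Sum>k<n. \<bar>g (cl k v) - g (cl k u)\<bar>) \<ge> \<bar>g v - g u\<bar>"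
    if "a \<le> u" "u \<le> v" "v \<le> t n" for u v n
    using that
  proof (induction n arbitrary: u v)
    case 0
    then have "u = a" "v = a" by (auto simp: t_def)
    then show ?case by simp
  next
    case (Suc n)
    let ?c = "min (t n)"
    have tn: "t n \<le> t (Suc n)" "a \<le> t n" using \<delta>(1) by (auto simp: t_def)
    have IH: "\<bar>g (?c v) - g (?c u)\<bar> \<le> (\<Sum>k<n. \<bar>g (cl k (?c v)) - g (cl k (?c u))\<bar>)"
      using Suc.prems tn by (intro Suc.IH) auto
    have "cl k (?c x) = cl k x" if "k < n" for k x
    proof -
      have "t (Suc k) \<le> t n" using that \<delta>(1) by (auto simp: t_def)
      then show ?thesis unfolding cl_def by auto
    qed
    then have IH': "\<bar>g (?c v) - g (?c u)\<bar> \<le> (\<Sum>k<n. \<bar>g (cl k v) - g (cl k u)\<bar>)"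
      using IH by simp
    have "\<bar>g v - g u\<bar> \<le> \<bar>g (?c v) - g (?c u)\<bar> + \<bar>g (cl n v) - g (cl n u)\<bar>"
    proof (cases "v \<le> t n")
      case True then show ?thesis using Suc.prems by (auto simp: min_def)
    next
      case False
      then have "cl n v = v" "?c v = t n" using Suc.prems by (auto simp: cl_def)
      moreover have "?c u = u \<and> cl n u = t n \<or> ?c u = t n \<and> cl n u = u"
        using Suc.prems tn by (auto simp: cl_def)
      ultimately show ?thesis by auto
    qed
    then show ?case using IH' by simp
  qed
  have tN: "b \<le> t N" using N unfolding t_def by simp
  show ?thesis
  proof (rule that[of "real N"])
    fix D S assume D: "D division_of S" and S: "S \<subseteq> {a..b}"
    note Dd = division_ofD[OF D]
    have I: "\<exists>c d. I = {c..d} \<and> c \<le> d \<and> a \<le> c \<and> d \<le> b" if ID: "I \<in> D" for I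
    proof -
      obtain c d where cd: "I = {c..d}" using Dd(4)[OF ID] by (auto simp: box_real)
      moreover have "c \<le> d" using Dd(3)[OF ID] cd by auto
      moreover have "{c..d} \<subseteq> {a..b}" using Dd(2)[OF ID] S cd by blast
      ultimately show ?thesis by auto
    qed
    have "vsum g D \<le> (\<Sum>I\<in>D. \<Sum>k<N. \<bar>g (cl k (Sup I)) - g (cl k (Inf I))\<bar>)"
      unfolding vsum_def
    proof (rule sum_mono)
      fix I assume "I \<in> D"
      then obtain c d where "I = {c..d}" "c \<le> d" "a \<le> c" "d \<le> b" using I by blast
      then show "\<bar>g (Sup I) - g (Inf I)\<bar> \<le> (\<Sum>k<N. \<bar>g (cl k (Sup I)) - g (cl k (Inf I))\<bar>)"
        using tel[of c d N] tN by auto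
    qed
    also have "\<dots> = (\<Sum>k<N. \<Sum>I\<in>D. \<bar>g (cl k (Sup I)) - g (cl k (Inf I))\<bar>)"
      by (rule sum.swap)
    also have "\<dots> \<le> (\<Sum>k<N. 1)"
    proof (rule sum_mono)
      fix k assume "k \<in> {..<N}"
      \<comment> \<open>If the window starts at or before \<open>b\<close>, clipping keeps the end
        points inside \<open>[a, b]\<close> and \<open>u\<close>, \<open>v\<close> agree with the
        clipped end points. If it starts beyond \<open>b\<close>, clipping sends every end point to
        \<open>t k\<close> and all increments vanish.\<close>
      define u where "u I = min b (cl k (Inf I))" for I
      define v where "v I = min b (cl k (Sup I))" for I
      show "(\<Sum>I\<in>D. \<bar>g (cl k (Sup I)) - g (cl k (Inf I))\<bar>) \<le> 1"
      proof (cases "t k \<le> b")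
        case True
        have tk: "a \<le> t k" "t k \<le> t (Suc k)" "t (Suc k) - t k = \<delta>/2" using \<delta>(1) by (auto simp: t_def field_simps)
        have uv: "u I = cl k (Inf I)" "v I = cl k (Sup I)" "u I \<le> v I" "{u I..v I} \<subseteq> {a..b}"
          if ID: "I \<in> D" for I
        proof -
          obtain c d where cd: "I = {c..d}" "c \<le> d" "a \<le> c" "d \<le> b" using I ID by blast
          then show "u I = cl k (Inf I)" "v I = cl k (Sup I)" "u I \<le> v I" "{u I..v I} \<subseteq> {a..b}"
            using True tk by (auto simp: u_def v_def cl_def)
        qed
        have dis: "disjoint_family_on (\<lambda>i. {u i<..<v i}) D"
          unfolding disjoint_family_on_def
        proof (intro ballI impI)
          fix I J assume IJ: "I \<in> D" "J \<in> D" "I \<noteq> J"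
          have "{u I<..<v I} \<subseteq> interior I" if ID: "I \<in> D" for I
          proof -
            obtain c d where cd: "I = {c..d}" "c \<le> d" using I ID by blast
            then show ?thesis using uv[OF ID] by (auto simp: cl_def)
          qed
          then show "{u I<..<v I} \<inter> {u J<..<v J} = {}"
            using Dd(5)[OF IJ] IJ by blast
        qed
        have len: "(\<Sum>I\<in>D. v I - u I) \<le> \<delta>/2"
        proof -
          have "(\<Sum>I\<in>D. v I - u I) = (\<Sum>I\<in>D. measure lborel {u I<..<v I})"
            using uv by (intro sum.cong) auto
          also have "\<dots> = measure lborel (\<Union>I\<in>D. {u I<..<v I})"
            by (rule measure_finite_Union[symmetric]) (use Dd(1) dis in \<open>auto simp: uv(3)\<close>)
          also have "\<dots> \<le> measure lborel {t k..t (Suc k)}"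
          proof (rule measure_mono_fmeasurable)
            show "(\<Union>I\<in>D. {u I<..<v I}) \<subseteq> {t k..t (Suc k)}"
              using uv tk by (fastforce simp: cl_def)
            show "(\<Union>I\<in>D. {u I<..<v I}) \<in> sets lborel" using Dd(1) by auto
            show "{t k..t (Suc k)} \<in> fmeasurable lborel" using fmeasurable_cbox[of "t k" "t (Suc k)"] by simp
          qed
          also have "\<dots> = \<delta>/2" using tk by simp
          finally show ?thesis .
        qed
        have "(\<Sum>I\<in>D. norm (g (v I) - g (u I))) < 1"
          using \<delta>(2)[OF Dd(1) _ dis] uv len \<delta>(1) by auto
        then show ?thesis using uv by simp
      next
        case False
        have "cl k (Sup I) = cl k (Inf I)" if ID: "I \<in> D" for I
        proof -
          obtain c d where cd: "I = {c..d}" "c \<le> d" "a \<le> c" "d \<le> b" using I ID by blast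
          have "t k \<le> t (Suc k)" using \<delta>(1) by (auto simp: t_def)
          then show ?thesis using cd False by (auto simp: cl_def)
        qed
        then show ?thesis by simp
      qed
    qed
    finally show "vsum g D \<le> real N" by simp
  qed
qed

lemma additive_division_1:
  fixes f :: "real \<Rightarrow> real"
  assumes "a \<le> b" and q: "q division_of {a..b}"
  shows "(\<Sum>K\<in>q. f (Sup K) - f (Inf K)) = f b - f a"
proof -
  define p where "p = (\<lambda>K. (Inf K, K)) ` q"
  note qd = division_ofD[OF q]
  have p: "p tagged_division_of {a..b}"
  proof (rule tagged_division_ofI)
    show "finite p" using qd(1) by (simp add: p_def)
    show "x \<in> K" if "(x, K) \<in> p" for x K
    proof -
      have K: "K \<in> q" "x = Inf K" using that by (auto simp: p_def)
      then obtain c d where "K = {c..d}" "c \<le> d" using qd(3,4)[OF K(1)] by (auto simp: box_real)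
      then show ?thesis using K by auto
    qed
    show "K \<subseteq> {a..b}" if "(x, K) \<in> p" for x K using that qd(2) by (auto simp: p_def)
    show "\<exists>c d. K = cbox c d" if "(x, K) \<in> p" for x K using that qd(4) by (auto simp: p_def)
    show "interior K1 \<inter> interior K2 = {}" if "(x1, K1) \<in> p" "(x2, K2) \<in> p" "(x1, K1) \<noteq> (x2, K2)"
      for x1 x2 K1 K2 using that qd(5) by (auto simp: p_def)
    have "{K. \<exists>x. (x, K) \<in> p} = q" by (auto simp: p_def)
    then show "\<Union>{K. \<exists>x. (x, K) \<in> p} = {a..b}" using qd(6) by simp
  qed
  have "(\<Sum>(x, K)\<in>p. f (Sup K) - f (Inf K)) = (\<Sum>K\<in>q. f (Sup K) - f (Inf K))"
    unfolding p_def by (subst sum.reindex) (auto simp: inj_on_def)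
  then show ?thesis using additive_tagged_division_1[OF assms(1) p, of f] by simp
qed

text \<open>The signed increments over \<open>q\<close> add up to \<open>g d - g c\<close>, whose
  sign is \<open>\<sigma>\<close>. Where an increment has the opposite sign and size at least
  \<open>s\<close> times the length, passing to its absolute value gains twice that size.\<close>

lemma vsum_opposite:
  assumes "c \<le> d" and P: "P \<subseteq> q" and q: "q division_of {c..d}" and "0 \<le> s"
    and \<sigma>: "\<sigma> = 1 \<or> \<sigma> = - 1" "0 \<le> \<sigma> * (g d - g c)"
    and opp: "\<And>J. J \<in> P \<Longrightarrow> \<sigma> * (g (Sup J) - g (Inf J)) \<le> - s * (Sup J - Inf J)"
  shows "vsum g q \<ge> \<bar>g d - g c\<bar> + 2 * s * (\<Sum>J\<in>P. Sup J - Inf J)"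
proof -
  note qd = division_ofD[OF q]
  have fP: "finite P" using P qd(1) finite_subset by blast
  let ?D = "\<lambda>J. \<sigma> * (g (Sup J) - g (Inf J))"
  have tot: "(\<Sum>J\<in>q. ?D J) = \<bar>g d - g c\<bar>"
    using additive_division_1[OF assms(1) q, of g] \<sigma> by (auto simp: sum_distrib_left[symmetric])
  have "vsum g q = (\<Sum>J\<in>q - P. \<bar>?D J\<bar>) + (\<Sum>J\<in>P. \<bar>?D J\<bar>)"
    unfolding vsum_def using sum.subset_diff[OF P qd(1), of "\<lambda>J. \<bar>?D J\<bar>"] \<sigma>(1) by (auto simp: abs_mult)
  moreover have "(\<Sum>J\<in>q - P. \<bar>?D J\<bar>) \<ge> (\<Sum>J\<in>q - P. ?D J)" by (intro sum_mono) auto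
  moreover have "(\<Sum>J\<in>P. \<bar>?D J\<bar>) \<ge> (\<Sum>J\<in>P. ?D J + 2 * s * (Sup J - Inf J))"
  proof (intro sum_mono)
    fix J assume J: "J \<in> P"
    show "?D J + 2 * s * (Sup J - Inf J) \<le> \<bar>?D J\<bar>" using opp[OF J] by (auto simp: abs_if)
  qed
  moreover have "(\<Sum>J\<in>q. ?D J) = (\<Sum>J\<in>q - P. ?D J) + (\<Sum>J\<in>P. ?D J)"
    by (rule sum.subset_diff[OF P qd(1)])
  ultimately show ?thesis using tot by (simp add: sum.distrib sum_distrib_left)
qed

text \<open>Take a division whose variation is within \<open>2 s \<epsilon>\<close> of the supremum. By Vitali's theorem almost all of
  the set is covered by disjoint intervals on which \<open>g\<close> moves against the increment over the surrounding
  interval of the division; inserting them raises the variation by \<open>2 s\<close> times their total length.\<close>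

lemma opposite_slopes_negligible:
  fixes g :: "real \<Rightarrow> real"
  assumes ac: "abs_continuous_on {a..b} g" and s: "s > 0"
  shows "negligible {x\<in>{a<..<b}. (\<forall>d>0. \<exists>y. y \<noteq> x \<and> \<bar>y - x\<bar> < d \<and> (g y - g x) / (y - x) > s) \<and>
                               (\<forall>d>0. \<exists>y. y \<noteq> x \<and> \<bar>y - x\<bar> < d \<and> (g y - g x) / (y - x) < - s)}"
    (is "negligible ?E")
proof (cases "a < b")
  case False then show ?thesis by auto
next
  case ab: True
  obtain V where V: "\<And>D S. D division_of S \<Longrightarrow> S \<subseteq> {a..b} \<Longrightarrow> vsum g D \<le> V"
    using vsum_bounded[OF ac] by blast
  show ?thesis
    unfolding negligible_outer_le
  proof (intro allI impI)
    fix \<epsilon> :: real assume \<epsilon>: "\<epsilon> > 0"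
    define VS where "VS = {vsum g D | D S. D division_of S \<and> S \<subseteq> {a..b}}"
    have VSne: "VS \<noteq> {}" unfolding VS_def using division_of_trivial by blast
    have VSb: "bdd_above VS" unfolding VS_def using V by (auto intro!: bdd_aboveI[of _ V])
    obtain D0 S0 where D0: "D0 division_of S0" "S0 \<subseteq> {a..b}" "vsum g D0 > Sup VS - 2 * s * \<epsilon>"
    proof -
      have "Sup VS - 2 * s * \<epsilon> < Sup VS" using s \<epsilon> by simp
      then obtain w where "w \<in> VS" "Sup VS - 2 * s * \<epsilon> < w"
        using less_cSup_iff[OF VSne VSb] by blast
      then show ?thesis using that unfolding VS_def by blast
    qed
    \<comment> \<open>The near-optimal division need not cover \<open>[a, b]\<close>; extending it
      only adds nonnegative terms to the variation.\<close>
    obtain D where D: "D0 \<subseteq> D" "D division_of cbox a b"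
      using partial_division_extend_interval[of D0 a b] D0(1,2) division_ofD(6)[OF D0(1)] by (metis box_real(2))
    note Dd = division_ofD[OF D(2)]
    have "vsum g D0 \<le> vsum g D"
      unfolding vsum_def by (rule sum_mono2) (use D Dd in auto)
    with D0(3) have Dbig: "vsum g D > Sup VS - 2 * s * \<epsilon>" by simp
    have DI: "\<exists>c d. I = {c..d} \<and> c \<le> d" if "I \<in> D" for I
      using Dd(3,4)[OF that] by (auto simp: box_real)
    define \<sigma> where "\<sigma> I = (if g (Sup I) \<ge> g (Inf I) then 1 else - 1 :: real)" for I
    define K where "K = {{u..v} | u v I. u < v \<and> I \<in> D \<and> {u..v} \<subseteq> interior I \<and>
                           \<sigma> I * (g v - g u) \<le> - s * (v - u)}"
    \<comment> \<open>End points of \<open>D\<close> are excluded so that every remaining point is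
      interior to its interval. They are finitely many and are put back at the end as a null
      set.\<close>
    define F where "F = (\<Union>I\<in>D. {Inf I, Sup I})"
    have finF: "finite F" unfolding F_def using Dd(1) by (intro finite_UN_I) simp_all
    have Kuv: "\<exists>u v. J = {u..v} \<and> u < v" if "J \<in> K" for J using that unfolding K_def by auto
    have cb: "cball ((Inf J + Sup J) / 2) ((Sup J - Inf J) / 2) = J" if "J \<in> K" for J
    proof -
      obtain u v where "u < v" "J = {u..v}" using Kuv[OF \<open>J \<in> K\<close>] by blast
      then show ?thesis by (simp add: cball_eq_atLeastAtMost field_simps)
    qed
    obtain C where C: "countable C" "C \<subseteq> K"
      "pairwise (\<lambda>i j. disjnt (cball ((Inf i + Sup i) / 2) ((Sup i - Inf i) / 2))
                              (cball ((Inf j + Sup j) / 2) ((Sup j - Inf j) / 2))) C"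
      "negligible ((?E - F) - (\<Union>J\<in>C. cball ((Inf J + Sup J) / 2) ((Sup J - Inf J) / 2)))"
    proof (rule Vitali_covering_theorem_cballs[of K "\<lambda>J. (Sup J - Inf J) / 2" "?E - F" "\<lambda>J. (Inf J + Sup J) / 2"])
      show "0 < (Sup J - Inf J) / 2" if "J \<in> K" for J
      proof -
        obtain u v where "u < v" "J = {u..v}" using Kuv[OF \<open>J \<in> K\<close>] by blast
        then show ?thesis by simp
      qed
      fix x d :: real assume x: "x \<in> ?E - F" and d: "0 < d"
      have "x \<in> \<Union>D" using x Dd(6) by (auto simp: box_real)
      then obtain I where I: "I \<in> D" "x \<in> I" by blast
      then obtain c e where ce: "I = {c..e}" "c \<le> e" using DI by blast
      then have "Inf I = c" "Sup I = e" by auto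
      then have "x \<noteq> c" "x \<noteq> e" using x I unfolding F_def by auto
      then have cxe: "c < x" "x < e" using I ce by auto
      define r where "r = min d (min (x - c) (e - x))"
      have r: "r > 0" "r \<le> d" "r \<le> x - c" "r \<le> e - x" using d cxe by (auto simp: r_def)
      obtain y where y: "y \<noteq> x" "\<bar>y - x\<bar> < r" "\<sigma> I * ((g y - g x) / (y - x)) < - s"
      proof (cases "g (Sup I) \<ge> g (Inf I)")
        case True
        then have "\<sigma> I = 1" by (simp add: \<sigma>_def)
        moreover obtain y where "y \<noteq> x" "\<bar>y - x\<bar> < r" "(g y - g x) / (y - x) < - s"
          using x r(1) by blast
        ultimately show ?thesis using that by simp
      next
        case False
        then have \<sigma>I: "\<sigma> I = - 1" by (simp add: \<sigma>_def)
        obtain y where y: "y \<noteq> x" "\<bar>y - x\<bar> < r" "(g y - g x) / (y - x) > s"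
          using x r(1) by blast
        have "\<sigma> I * ((g y - g x) / (y - x)) = - ((g y - g x) / (y - x))" by (simp only: \<sigma>I mult_minus1)
        with y(3) have "\<sigma> I * ((g y - g x) / (y - x)) < - s" by linarith
        then show ?thesis by (rule that[OF y(1,2)])
      qed
      define u where "u = min x y"
      define v where "v = max x y"
      have uv: "u < v" "c < u" "v < e" "v - u < d" "x \<in> {u..v}" using y r cxe by (auto simp: u_def v_def)
      have q: "(g v - g u) / (v - u) = (g y - g x) / (y - x)"
      proof (cases "x < y")
        case True then show ?thesis by (simp add: u_def v_def)
      next
        case False
        then have "u = y" "v = x" by (auto simp: u_def v_def)
        then show ?thesis by (metis minus_diff_eq minus_divide_divide)
      qed
      have "\<sigma> I * (g v - g u) / (v - u) < - s" using y(3) q by (simp add: times_divide_eq_right[symmetric] del: times_divide_eq_right)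
      then have "\<sigma> I * (g v - g u) \<le> - s * (v - u)" using uv(1) by (simp add: field_simps)
      moreover have "{u..v} \<subseteq> interior I" using uv ce by auto
      ultimately have JK: "{u..v} \<in> K" unfolding K_def using uv(1) I(1) by blast
      then show "\<exists>J. J \<in> K \<and> x \<in> cball ((Inf J + Sup J) / 2) ((Sup J - Inf J) / 2) \<and> (Sup J - Inf J) / 2 < d"
        using cb[OF JK] uv by (intro exI[of _ "{u..v}"]) auto
    qed
    have CK: "J \<in> K" if "J \<in> C" for J using that C(2) by auto
    have Cdis: "disjnt J L" if "J \<in> C" "L \<in> C" "J \<noteq> L" for J L
      using C(3) that cb[OF CK] by (auto simp: pairwise_def)
    have neg: "negligible ((?E - F) - \<Union>C)" using C(4) cb[OF CK] by simp
    have bound: "measure lebesgue (\<Union>\<E>) \<le> \<epsilon>" if \<E>: "\<E> \<subseteq> C" "finite \<E>" for \<E>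
    proof -
      define P where "P I = {J\<in>\<E>. J \<subseteq> interior I \<and> \<sigma> I * (g (Sup J) - g (Inf J)) \<le> - s * (Sup J - Inf J)}" for I
      have Puv: "\<exists>u v. J = {u..v} \<and> u < v" if "J \<in> P I" for I J
        using Kuv[OF CK, of J] that \<E>(1) by (auto simp: P_def)
      have Pint: "J \<subseteq> I" if "J \<in> P I" for I J using that interior_subset unfolding P_def by blast
      have "\<exists>q. P I \<subseteq> q \<and> q division_of I" if ID: "I \<in> D" for I
      proof -
        obtain c d where cd: "I = cbox c d" using Dd(4)[OF ID] by blast
        have "P I division_of \<Union>(P I)"
        proof (rule division_ofI)
          show "finite (P I)" using \<E>(2) by (simp add: P_def)
          show "J \<subseteq> \<Union>(P I)" if "J \<in> P I" for J using that by blast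
          show "J \<noteq> {}" if "J \<in> P I" for J using Puv[OF that] by force
          show "\<exists>a b. J = cbox a b" if "J \<in> P I" for J using Puv[OF that] by (metis box_real(2))
          show "interior J \<inter> interior L = {}" if "J \<in> P I" "L \<in> P I" "J \<noteq> L" for J L
          proof -
            have "disjnt J L" using Cdis that \<E> by (auto simp: P_def)
            then show ?thesis using interior_subset unfolding disjnt_def by blast
          qed
        qed simp
        moreover have "\<Union>(P I) \<subseteq> cbox c d" using Pint cd by blast
        ultimately show ?thesis using partial_division_extend_interval[of "P I" c d] cd by metis
      qed
      then obtain q where q: "\<And>I. I \<in> D \<Longrightarrow> P I \<subseteq> q I" "\<And>I. I \<in> D \<Longrightarrow> q I division_of I" by metis
      \<comment> \<open>Degenerate members carry no variation but could belong to the refinements of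
        two adjacent intervals. Without them the families are disjoint and the variations add
        up.\<close>
      define q' where "q' I = {J\<in>q I. interior J \<noteq> {}}" for I
      have vq': "vsum g (q' I) = vsum g (q I)" if ID: "I \<in> D" for I
        unfolding vsum_def
      proof (rule sum.mono_neutral_left)
        show "finite (q I)" using q(2)[OF that] by blast
        show "q' I \<subseteq> q I" by (auto simp: q'_def)
        show "\<forall>J\<in>q I - q' I. \<bar>g (Sup J) - g (Inf J)\<bar> = 0"
        proof
          fix J assume J: "J \<in> q I - q' I"
          obtain c d where cd: "J = {c..d}" using division_ofD(4)[OF q(2)[OF ID], of J] J by (auto simp: box_real)
          moreover have "J \<noteq> {}" using division_ofD(3)[OF q(2)[OF that], of J] J by auto
          moreover have "interior J = {}" using J by (auto simp: q'_def)
          ultimately have "c = d" by (auto simp: interior_atLeastAtMost_real)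
          then show "\<bar>g (Sup J) - g (Inf J)\<bar> = 0" using cd by simp
        qed
      qed
      have dsub: "J \<subseteq> I" if "I \<in> D" "J \<in> q I" for I J using division_ofD(2)[OF q(2)] that by blast
      have disjq: "q' I \<inter> q' L = {}" if "I \<in> D" "L \<in> D" "I \<noteq> L" for I L
      proof (rule ccontr)
        assume "q' I \<inter> q' L \<noteq> {}"
        then obtain J where "J \<in> q I" "J \<in> q L" "interior J \<noteq> {}" unfolding q'_def by blast
        then have "interior J \<subseteq> interior I \<inter> interior L" using dsub that interior_mono by blast
        then show False using Dd(5) that \<open>interior J \<noteq> {}\<close> by blast
      qed
      define Q where "Q = (\<Union>I\<in>D. q' I)"
      have "Q division_of \<Union>Q"
      proof (rule division_ofI)
        show "finite Q" unfolding Q_def q'_def using Dd(1) division_ofD(1)[OF q(2)] by auto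
        show "J \<subseteq> \<Union>Q" if "J \<in> Q" for J using that by blast
        show "J \<noteq> {}" if "J \<in> Q" for J using that by (auto simp: Q_def q'_def)
        show "\<exists>a b. J = cbox a b" if "J \<in> Q" for J
          using that division_ofD(4)[OF q(2)] by (auto simp: Q_def q'_def)
        show "interior J \<inter> interior L = {}" if JL: "J \<in> Q" "L \<in> Q" "J \<noteq> L" for J L
        proof -
          obtain I1 I2 where I: "I1 \<in> D" "I2 \<in> D" "J \<in> q I1" "L \<in> q I2"
            using JL by (auto simp: Q_def q'_def)
          show ?thesis
          proof (cases "I1 = I2")
            case True then show ?thesis using division_ofD(5)[OF q(2)[OF I(1)]] I JL by blast
          next
            case False
            have "interior J \<subseteq> interior I1" "interior L \<subseteq> interior I2"
              using interior_mono[OF dsub[OF I(1,3)]] interior_mono[OF dsub[OF I(2,4)]] by auto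
            then show ?thesis using Dd(5)[OF I(1,2) False] by blast
          qed
        qed
      qed simp
      moreover have "\<Union>Q \<subseteq> {a..b}"
        using dsub Dd(2) unfolding Q_def q'_def by (fastforce simp: box_real)
      ultimately have "vsum g Q \<in> VS" unfolding VS_def by blast
      then have Qle: "vsum g Q \<le> Sup VS" using VSb by (rule cSup_upper)
      have "vsum g Q = (\<Sum>I\<in>D. vsum g (q' I))"
        unfolding vsum_def Q_def
        by (rule sum.UNION_disjoint) (use Dd(1) division_ofD(1)[OF q(2)] disjq in \<open>auto simp: q'_def\<close>)
      also have "\<dots> = (\<Sum>I\<in>D. vsum g (q I))" using vq' by simp
      also have "\<dots> \<ge> (\<Sum>I\<in>D. \<bar>g (Sup I) - g (Inf I)\<bar> + 2 * s * (\<Sum>J\<in>P I. Sup J - Inf J))"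
      proof (rule sum_mono)
        fix I assume I: "I \<in> D"
        then obtain c d where cd: "I = {c..d}" "c \<le> d" using DI by blast
        have "vsum g (q I) \<ge> \<bar>g d - g c\<bar> + 2 * s * (\<Sum>J\<in>P I. Sup J - Inf J)"
        proof (rule vsum_opposite[of c d "P I" "q I" s "\<sigma> I"])
          show "q I division_of {c..d}" using q(2)[OF I] cd by simp
          show "0 \<le> \<sigma> I * (g d - g c)" using cd by (auto simp: \<sigma>_def)
        qed (use cd q(1)[OF I] s in \<open>auto simp: \<sigma>_def P_def\<close>)
        then show "\<bar>g (Sup I) - g (Inf I)\<bar> + 2 * s * (\<Sum>J\<in>P I. Sup J - Inf J) \<le> vsum g (q I)"
          using cd by simp
      qed
      finally have "vsum g D + 2 * s * (\<Sum>I\<in>D. \<Sum>J\<in>P I. Sup J - Inf J) \<le> vsum g Q"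
        by (simp add: vsum_def sum.distrib sum_distrib_left)
      then have "2 * s * (\<Sum>I\<in>D. \<Sum>J\<in>P I. Sup J - Inf J) \<le> 2 * s * \<epsilon>" using Qle Dbig by simp
      then have sumP: "(\<Sum>I\<in>D. \<Sum>J\<in>P I. Sup J - Inf J) \<le> \<epsilon>" using s by simp
      have "measure lebesgue (\<Union>\<E>) \<le> (\<Sum>J\<in>\<E>. measure lebesgue J)"
        using measure_UNION_le[OF \<E>(2), of "\<lambda>J. J" lebesgue] Kuv[OF CK] \<E>(1) by fastforce
      also have "\<dots> = (\<Sum>J\<in>\<E>. Sup J - Inf J)"
      proof (rule sum.cong[OF refl])
        fix J assume "J \<in> \<E>"
        then obtain u v where "J = {u..v}" "u < v" using Kuv[OF CK] \<E>(1) by blast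
        then show "measure lebesgue J = Sup J - Inf J" by simp
      qed
      also have "\<dots> \<le> (\<Sum>J\<in>(\<Union>I\<in>D. P I). Sup J - Inf J)"
      proof (rule sum_mono2)
        show "finite (\<Union> (P ` D))" using Dd(1) \<E>(2) by (auto simp: P_def)
        show "\<E> \<subseteq> \<Union> (P ` D)"
        proof
          fix J assume J: "J \<in> \<E>"
          then have "J \<in> K" using CK \<E>(1) by blast
          then obtain u v I where *: "J = {u..v}" "u < v" "I \<in> D" "{u..v} \<subseteq> interior I"
                           "\<sigma> I * (g v - g u) \<le> - s * (v - u)" unfolding K_def by blast
          then have "J \<in> P I" using J by (auto simp: P_def)
          then show "J \<in> \<Union> (P ` D)" using *(3) by blast
        qed
        \<comment> \<open>Vacuous, since every \<open>P I\<close> is a subset of the finite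
          family.\<close>
        show "0 \<le> Sup J - Inf J" if "J \<in> \<Union> (P ` D) - \<E>" for J using that unfolding P_def by blast
      qed
      also have "\<dots> \<le> (\<Sum>I\<in>D. \<Sum>J\<in>P I. Sup J - Inf J)"
      proof -
        have nn: "0 \<le> Sup J - Inf J" if J: "J \<in> P I" for I J
        proof -
          obtain u v where "J = {u..v}" "u < v" using Puv[OF J] by blast
          then show ?thesis by simp
        qed
        have "(\<Sum>J\<in>(\<Union>I\<in>A. P I). Sup J - Inf J) \<le> (\<Sum>I\<in>A. \<Sum>J\<in>P I. Sup J - Inf J)"
          if "finite A" for A
          using that
        proof (induction A rule: finite_induct)
          case (insert I A)
          have fin: "finite (P I)" "finite (\<Union> (P ` A))" using \<E>(2) insert by (auto simp: P_def)
          have "(\<Sum>J\<in>P I \<union> \<Union> (P ` A). Sup J - Inf J) =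
            (\<Sum>J\<in>P I. Sup J - Inf J) + (\<Sum>J\<in>\<Union> (P ` A). Sup J - Inf J) - (\<Sum>J\<in>P I \<inter> \<Union> (P ` A). Sup J - Inf J)"
            by (rule sum_Un[OF fin])
          moreover have "0 \<le> (\<Sum>J\<in>P I \<inter> \<Union> (P ` A). Sup J - Inf J)"
            using nn by (intro sum_nonneg) blast
          ultimately show ?case using insert by simp
        qed simp
        then show ?thesis using Dd(1) by blast
      qed
      finally show ?thesis using sumP by simp
    qed
    have fm: "J \<in> lmeasurable" if "J \<in> C" for J using Kuv[OF CK[OF that]] by auto
    have UC: "\<Union>C \<in> lmeasurable" "measure lebesgue (\<Union>C) \<le> \<epsilon>"
      using fmeasurable_Union_bound[OF C(1) fm bound] measure_Union_bound[OF C(1) fm bound] by auto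
    have N: "negligible (((?E - F) - \<Union>C) \<union> F)" using neg finF by (simp add: negligible_Un negligible_finite)
    show "\<exists>T. ?E \<subseteq> T \<and> T \<in> lmeasurable \<and> measure lebesgue T \<le> \<epsilon>"
    proof (intro exI conjI)
      let ?T = "\<Union>C \<union> (((?E - F) - \<Union>C) \<union> F)"
      show "?E \<subseteq> ?T" by blast
      show "?T \<in> lmeasurable" using UC(1) N negligible_imp_measurable by (intro fmeasurable.Un) auto
      have "measure lebesgue ?T \<le> measure lebesgue (\<Union>C) + measure lebesgue (((?E - F) - \<Union>C) \<union> F)"
        using UC(1) N negligible_imp_measurable by (intro measure_Un_le) auto
      then show "measure lebesgue ?T \<le> \<epsilon>" using UC(2) negligible_imp_measure0[OF N] by simp
    qed
  qed
qed

text \<open>Vitali's theorem covers almost all of the set by disjoint intervals of slope at least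
  \<open>s = (V + 1) / \<epsilon>\<close>. Their lengths add up to at most \<open>V / s\<close>,
  because \<open>V\<close> bounds the variation.\<close>

lemma unbounded_slopes_negligible:
  fixes g :: "real \<Rightarrow> real"
  assumes ac: "abs_continuous_on {a..b} g"
  shows "negligible {x\<in>{a<..<b}. \<forall>s. \<forall>d>0. \<exists>y. y \<noteq> x \<and> \<bar>y - x\<bar> < d \<and> \<bar>(g y - g x) / (y - x)\<bar> > s}"
    (is "negligible ?E")
proof -
  obtain V where V: "\<And>D S. D division_of S \<Longrightarrow> S \<subseteq> {a..b} \<Longrightarrow> vsum g D \<le> V"
    using vsum_bounded[OF ac] by blast
  have V0: "V \<ge> 0" using V[OF division_of_trivial[THEN iffD2, OF refl]] by (simp add: vsum_def)
  show ?thesis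
    unfolding negligible_outer_le
  proof (intro allI impI)
    fix \<epsilon> :: real assume \<epsilon>: "\<epsilon> > 0"
    define s where "s = (V + 1) / \<epsilon>"
    have s: "s > 0" "V \<le> s * \<epsilon>" using V0 \<epsilon> by (auto simp: s_def)
    define K where "K = {{u..v} | u v. u < v \<and> {u..v} \<subseteq> {a..b} \<and> \<bar>g v - g u\<bar> \<ge> s * (v - u)}"
    have Kuv: "\<exists>u v. J = {u..v} \<and> u < v \<and> {u..v} \<subseteq> {a..b} \<and> \<bar>g v - g u\<bar> \<ge> s * (v - u)" if "J \<in> K" for J
      using that unfolding K_def by auto
    have cb: "cball ((Inf J + Sup J) / 2) ((Sup J - Inf J) / 2) = J" if "J \<in> K" for J
    proof -
      obtain u v where "u < v" "J = {u..v}" using Kuv[OF \<open>J \<in> K\<close>] by blast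
      then show ?thesis by (simp add: cball_eq_atLeastAtMost field_simps)
    qed
    obtain C where C: "countable C" "C \<subseteq> K"
      "pairwise (\<lambda>i j. disjnt (cball ((Inf i + Sup i) / 2) ((Sup i - Inf i) / 2))
                              (cball ((Inf j + Sup j) / 2) ((Sup j - Inf j) / 2))) C"
      "negligible (?E - (\<Union>J\<in>C. cball ((Inf J + Sup J) / 2) ((Sup J - Inf J) / 2)))"
    proof (rule Vitali_covering_theorem_cballs[of K "\<lambda>J. (Sup J - Inf J) / 2" "?E" "\<lambda>J. (Inf J + Sup J) / 2"])
      show "0 < (Sup J - Inf J) / 2" if "J \<in> K" for J
      proof -
        obtain u v where "u < v" "J = {u..v}" using Kuv[OF \<open>J \<in> K\<close>] by blast
        then show ?thesis by simp
      qed
      fix x d :: real assume x: "x \<in> ?E" and d: "0 < d"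
      define r where "r = min d (min (x - a) (b - x))"
      have r: "r > 0" "r \<le> d" "r \<le> x - a" "r \<le> b - x" using d x by (auto simp: r_def)
      obtain y where y: "y \<noteq> x" "\<bar>y - x\<bar> < r" "\<bar>(g y - g x) / (y - x)\<bar> > s" using x r(1) by blast
      define u where "u = min x y"
      define v where "v = max x y"
      have uv: "u < v" "a < u" "v < b" "v - u < d" "x \<in> {u..v}" using y r by (auto simp: u_def v_def)
      have "\<bar>g v - g u\<bar> = \<bar>g y - g x\<bar>" "v - u = \<bar>y - x\<bar>" by (auto simp: u_def v_def max_def min_def)
      then have "\<bar>g v - g u\<bar> \<ge> s * (v - u)" using y(1,3) by (simp add: abs_divide field_simps)
      then have JK: "{u..v} \<in> K" unfolding K_def using uv by force
      then show "\<exists>J. J \<in> K \<and> x \<in> cball ((Inf J + Sup J) / 2) ((Sup J - Inf J) / 2) \<and> (Sup J - Inf J) / 2 < d"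
        using cb[OF JK] uv by (intro exI[of _ "{u..v}"]) auto
    qed
    have CK: "J \<in> K" if "J \<in> C" for J using that C(2) by auto
    have Cdis: "disjnt J L" if "J \<in> C" "L \<in> C" "J \<noteq> L" for J L
      using C(3) that cb[OF CK] by (auto simp: pairwise_def)
    have neg: "negligible (?E - \<Union>C)" using C(4) cb[OF CK] by simp
    have bound: "measure lebesgue (\<Union>\<E>) \<le> \<epsilon>" if \<E>: "\<E> \<subseteq> C" "finite \<E>" for \<E>
    proof -
      have Euv: "\<exists>u v. J = {u..v} \<and> u < v \<and> {u..v} \<subseteq> {a..b} \<and> \<bar>g v - g u\<bar> \<ge> s * (v - u)" if "J \<in> \<E>" for J
        using Kuv[OF CK, of J] that \<E>(1) by auto
      have "\<E> division_of \<Union>\<E>"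
      proof (rule division_ofI)
        show "finite \<E>" by (rule \<E>(2))
        show "J \<subseteq> \<Union>\<E>" if "J \<in> \<E>" for J using that by blast
        show "J \<noteq> {}" if "J \<in> \<E>" for J using Euv[OF that] by force
        show "\<exists>a b. J = cbox a b" if "J \<in> \<E>" for J using Euv[OF that] by (metis box_real(2))
        show "interior J \<inter> interior L = {}" if "J \<in> \<E>" "L \<in> \<E>" "J \<noteq> L" for J L
        proof -
          have "disjnt J L" using Cdis that \<E> by auto
          then show ?thesis using interior_subset unfolding disjnt_def by blast
        qed
      qed simp
      moreover have "\<Union>\<E> \<subseteq> {a..b}" using Euv by blast
      ultimately have "vsum g \<E> \<le> V" using V by blast
      moreover have "(\<Sum>J\<in>\<E>. s * (Sup J - Inf J)) \<le> vsum g \<E>"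
        unfolding vsum_def
      proof (rule sum_mono)
        fix J assume "J \<in> \<E>"
        then obtain u v where "J = {u..v}" "u < v" "\<bar>g v - g u\<bar> \<ge> s * (v - u)" using Euv by blast
        then show "s * (Sup J - Inf J) \<le> \<bar>g (Sup J) - g (Inf J)\<bar>" by simp
      qed
      ultimately have "s * (\<Sum>J\<in>\<E>. Sup J - Inf J) \<le> s * \<epsilon>" using s by (simp add: sum_distrib_left)
      then have sm: "(\<Sum>J\<in>\<E>. Sup J - Inf J) \<le> \<epsilon>" using s by simp
      have "measure lebesgue (\<Union>\<E>) \<le> (\<Sum>J\<in>\<E>. measure lebesgue J)"
        using measure_UNION_le[OF \<E>(2), of "\<lambda>J. J" lebesgue] Euv by fastforce
      also have "\<dots> = (\<Sum>J\<in>\<E>. Sup J - Inf J)"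
      proof (rule sum.cong[OF refl])
        fix J assume "J \<in> \<E>"
        then obtain u v where "J = {u..v}" "u < v" using Euv by blast
        then show "measure lebesgue J = Sup J - Inf J" by simp
      qed
      finally show ?thesis using sm by simp
    qed
    have fm: "J \<in> lmeasurable" if "J \<in> C" for J using Kuv[OF CK[OF that]] by auto
    have UC: "\<Union>C \<in> lmeasurable" "measure lebesgue (\<Union>C) \<le> \<epsilon>"
      using fmeasurable_Union_bound[OF C(1) fm bound] measure_Union_bound[OF C(1) fm bound] by auto
    show "\<exists>T. ?E \<subseteq> T \<and> T \<in> lmeasurable \<and> measure lebesgue T \<le> \<epsilon>"
    proof (intro exI conjI)
      let ?T = "\<Union>C \<union> (?E - \<Union>C)"
      show "?E \<subseteq> ?T" by blast
      show "?T \<in> lmeasurable" using UC(1) neg negligible_imp_measurable by (intro fmeasurable.Un) auto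
      have "measure lebesgue ?T \<le> measure lebesgue (\<Union>C) + measure lebesgue (?E - \<Union>C)"
        using UC(1) neg negligible_imp_measurable by (intro measure_Un_le) auto
      then show "measure lebesgue ?T \<le> \<epsilon>" using UC(2) negligible_imp_measure0[OF neg] by simp
    qed
  qed
qed

text \<open>Tilting the graph by the slope \<open>m\<close> moves an arbitrary gap between two
  slopes to one symmetric about 0, the case treated by
  \<open>opposite_slopes_negligible\<close>.\<close>

lemma abs_continuous_on_diff_linear:
  fixes g :: "real \<Rightarrow> real"
  assumes ac: "abs_continuous_on S g"
  shows "abs_continuous_on S (\<lambda>x. g x - m * x)"
  unfolding abs_continuous_on_def
proof (intro allI impI)
  fix \<epsilon> :: real assume \<epsilon>: "\<epsilon> > 0"
  then obtain \<delta> where \<delta>: "\<delta> > 0" "\<forall>(n::nat) u v. (\<forall>i<n. u i \<le> v i \<and> {u i..v i} \<subseteq> S) \<and>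
      disjoint_family_on (\<lambda>i. {u i<..<v i}) {..<n} \<and> (\<Sum>i<n. v i - u i) < \<delta> \<longrightarrow>
      (\<Sum>i<n. norm (g (v i) - g (u i))) < \<epsilon> / 2"
    using ac[unfolded abs_continuous_on_def, rule_format, of "\<epsilon> / 2"] by auto
  define \<delta>' where "\<delta>' = min \<delta> (\<epsilon> / (2 * (\<bar>m\<bar> + 1)))"
  have \<delta>': "\<delta>' > 0" "\<delta>' \<le> \<delta>" "\<bar>m\<bar> * \<delta>' \<le> \<epsilon> / 2"
  proof -
    show "\<delta>' > 0" "\<delta>' \<le> \<delta>" using \<delta>(1) \<epsilon> by (auto simp: \<delta>'_def)
    have "\<bar>m\<bar> * \<delta>' \<le> (\<bar>m\<bar> + 1) * (\<epsilon> / (2 * (\<bar>m\<bar> + 1)))"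
      using \<epsilon> \<delta>(1) by (intro mult_mono) (auto simp: \<delta>'_def)
    also have "\<dots> = \<epsilon> / 2" by (simp add: field_simps)
    finally show "\<bar>m\<bar> * \<delta>' \<le> \<epsilon> / 2" .
  qed
  show "\<exists>\<delta>>0. \<forall>(n::nat) u v. (\<forall>i<n. u i \<le> v i \<and> {u i..v i} \<subseteq> S) \<and>
      disjoint_family_on (\<lambda>i. {u i<..<v i}) {..<n} \<and> (\<Sum>i<n. v i - u i) < \<delta> \<longrightarrow>
      (\<Sum>i<n. norm (g (v i) - m * v i - (g (u i) - m * u i))) < \<epsilon>"
  proof (intro exI[of _ \<delta>'] conjI allI impI \<delta>'(1))
    fix n :: nat and u v
    assume *: "(\<forall>i<n. u i \<le> v i \<and> {u i..v i} \<subseteq> S) \<and>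
      disjoint_family_on (\<lambda>i. {u i<..<v i}) {..<n} \<and> (\<Sum>i<n. v i - u i) < \<delta>'"
    have "(\<Sum>i<n. norm (g (v i) - m * v i - (g (u i) - m * u i)))
        \<le> (\<Sum>i<n. norm (g (v i) - g (u i)) + \<bar>m\<bar> * (v i - u i))"
    proof (rule sum_mono)
      fix i assume "i \<in> {..<n}"
      then have "u i \<le> v i" using * by blast
      then have "\<bar>m * (v i - u i)\<bar> = \<bar>m\<bar> * (v i - u i)" by (simp add: abs_mult)
      then show "norm (g (v i) - m * v i - (g (u i) - m * u i)) \<le> norm (g (v i) - g (u i)) + \<bar>m\<bar> * (v i - u i)"
        by (simp add: algebra_simps)
    qed
    also have "\<dots> = (\<Sum>i<n. norm (g (v i) - g (u i))) + \<bar>m\<bar> * (\<Sum>i<n. v i - u i)"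
      by (simp add: sum.distrib sum_distrib_left)
    also have "\<dots> < \<epsilon>"
    proof -
      have "(\<Sum>i<n. norm (g (v i) - g (u i))) < \<epsilon> / 2" using \<delta>(2) * \<delta>'(2) by auto
      moreover have "\<bar>m\<bar> * (\<Sum>i<n. v i - u i) \<le> \<bar>m\<bar> * \<delta>'" using * by (intro mult_left_mono) auto
      ultimately show ?thesis using \<delta>'(3) by linarith
    qed
    finally show "(\<Sum>i<n. norm (g (v i) - m * v i - (g (u i) - m * u i))) < \<epsilon>" .
  qed
qed

text \<open>The limit is the infimum of all eventual upper bounds: \<open>sep\<close> excludes that
  \<open>q\<close> is frequently above \<open>p\<close> and frequently below \<open>r\<close> for
  rational \<open>r < p\<close>, so nothing separates the lower from the upper limit.\<close>

lemma slopes_converge: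
  fixes q :: "real \<Rightarrow> real"
  assumes F: "F \<noteq> bot" and bnd: "eventually (\<lambda>y. \<bar>q y\<bar> \<le> s) F"
    and sep: "\<And>p r. p \<in> \<rat> \<Longrightarrow> r \<in> \<rat> \<Longrightarrow> r < p \<Longrightarrow> eventually (\<lambda>y. q y \<le> p) F \<or> eventually (\<lambda>y. q y \<ge> r) F"
  shows "\<exists>L. (q \<longlongrightarrow> L) F"
proof -
  define S where "S = {r. eventually (\<lambda>y. q y \<le> r) F}"
  have lb: "- s \<le> r" if "r \<in> S" for r
  proof -
    have "eventually (\<lambda>y. - s \<le> r) F"
      using bnd that[unfolded S_def, simplified] by eventually_elim linarith
    then show ?thesis using F by (simp add: eventually_const)
  qed
  have sS: "s \<in> S" unfolding S_def using bnd by (auto elim!: eventually_mono)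
  have bb: "bdd_below S" using lb by (intro bdd_belowI)
  define L where "L = Inf S"
  have "(q \<longlongrightarrow> L) F"
  proof (rule order_tendstoI)
    fix a assume a: "a < L"
    obtain r where r: "r \<in> \<rat>" "a < r" "r < L" using Rats_dense_in_real[OF a] by blast
    obtain p where p: "p \<in> \<rat>" "r < p" "p < L" using Rats_dense_in_real[OF r(3)] by blast
    have "p \<notin> S" using p(3) cInf_lower[OF _ bb, of p] unfolding L_def by auto
    then have "eventually (\<lambda>y. q y \<ge> r) F" using sep[OF p(1) r(1) p(2)] unfolding S_def by auto
    then show "eventually (\<lambda>y. a < q y) F" by eventually_elim (use r in auto)
  next
    fix a assume a: "L < a"
    obtain r where "r \<in> S" "r < a" using cInf_less_iff[of S a] a bb sS unfolding L_def by blast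
    then show "eventually (\<lambda>y. q y < a) F" unfolding S_def by (auto elim!: eventually_mono)
  qed
  then show ?thesis by blast
qed

text \<open>Where \<open>g\<close> has no derivative, either the difference quotients are unbounded,
  or there are rationals \<open>r < p\<close> such that the quotients exceed \<open>p\<close> and
  fall below \<open>r\<close> arbitrarily close to the point. The first set is null, and the second
  is a countable union of null sets.\<close>

lemma abs_continuous_on_differentiable_ae_real:
  fixes g :: "real \<Rightarrow> real"
  assumes ac: "abs_continuous_on {a..b} g"
  shows "negligible {x\<in>{a<..<b}. \<not> (\<exists>D. (g has_field_derivative D) (at x))}"
proof -
  define U where "U = {x\<in>{a<..<b}. \<forall>s. \<forall>d>0. \<exists>y. y \<noteq> x \<and> \<bar>y - x\<bar> < d \<and> \<bar>(g y - g x) / (y - x)\<bar> > s}"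
  define W where "W p r = {x\<in>{a<..<b}. (\<forall>d>0. \<exists>y. y \<noteq> x \<and> \<bar>y - x\<bar> < d \<and> (g y - g x) / (y - x) > p) \<and>
                               (\<forall>d>0. \<exists>y. y \<noteq> x \<and> \<bar>y - x\<bar> < d \<and> (g y - g x) / (y - x) < r)}" for p r
  have nU: "negligible U" unfolding U_def by (rule unbounded_slopes_negligible[OF ac])
  have nW: "negligible (W p r)" if "r < p" for p r
  proof -
    \<comment> \<open>Subtracting the mean slope turns the thresholds \<open>p\<close> and
      \<open>r\<close> into \<open>(p - r) / 2\<close> and its negative.\<close>
    define h where "h x = g x - ((p + r) / 2) * x" for x
    have *: "(g y - g x) / (y - x) = (h y - h x) / (y - x) + (p + r) / 2" if "y \<noteq> x" for x y
      using that by (simp add: h_def divide_simps) (simp add: algebra_simps)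
    have "W p r = {x\<in>{a<..<b}. (\<forall>d>0. \<exists>y. y \<noteq> x \<and> \<bar>y - x\<bar> < d \<and> (h y - h x) / (y - x) > (p - r) / 2) \<and>
                               (\<forall>d>0. \<exists>y. y \<noteq> x \<and> \<bar>y - x\<bar> < d \<and> (h y - h x) / (y - x) < - ((p - r) / 2))}"
    proof -
      have "(y \<noteq> x \<and> \<bar>y - x\<bar> < d \<and> (g y - g x) / (y - x) > p) \<longleftrightarrow> (y \<noteq> x \<and> \<bar>y - x\<bar> < d \<and> (h y - h x) / (y - x) > (p - r) / 2)"
           "(y \<noteq> x \<and> \<bar>y - x\<bar> < d \<and> (g y - g x) / (y - x) < r) \<longleftrightarrow> (y \<noteq> x \<and> \<bar>y - x\<bar> < d \<and> (h y - h x) / (y - x) < - ((p - r) / 2))"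
        for x y d
      proof -
        have aux: "B + (p + r) / 2 > p \<longleftrightarrow> B > (p - r) / 2" "B + (p + r) / 2 < r \<longleftrightarrow> B < - ((p - r) / 2)" for B
          by (auto simp: field_simps)
        show "(y \<noteq> x \<and> \<bar>y - x\<bar> < d \<and> (g y - g x) / (y - x) > p) \<longleftrightarrow> (y \<noteq> x \<and> \<bar>y - x\<bar> < d \<and> (h y - h x) / (y - x) > (p - r) / 2)"
           "(y \<noteq> x \<and> \<bar>y - x\<bar> < d \<and> (g y - g x) / (y - x) < r) \<longleftrightarrow> (y \<noteq> x \<and> \<bar>y - x\<bar> < d \<and> (h y - h x) / (y - x) < - ((p - r) / 2))"
          by (cases "y = x"; simp add: * aux)+
      qed
      then show ?thesis unfolding W_def by simp
    qed
    moreover have "abs_continuous_on {a..b} h" unfolding h_def by (rule abs_continuous_on_diff_linear[OF ac])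
    ultimately show ?thesis using opposite_slopes_negligible[of a b h "(p - r) / 2"] that by simp
  qed
  define A where "A = {(p, r). p \<in> \<rat> \<and> r \<in> \<rat> \<and> r < (p::real)}"
  have cA: "countable A"
    by (rule countable_subset[of _ "\<rat> \<times> \<rat>"]) (auto simp: A_def countable_rat)
  have "negligible (\<Union>z\<in>A. W (fst z) (snd z))"
    using cA nW by (intro negligible_countable_Union[of "(\<lambda>z. W (fst z) (snd z)) ` A"]) (auto simp: A_def)
  with nU have "negligible (U \<union> (\<Union>z\<in>A. W (fst z) (snd z)))" by (rule negligible_Un)
  moreover have "{x\<in>{a<..<b}. \<not> (\<exists>D. (g has_field_derivative D) (at x))} \<subseteq> U \<union> (\<Union>z\<in>A. W (fst z) (snd z))"
  proof
    fix x assume x: "x \<in> {x\<in>{a<..<b}. \<not> (\<exists>D. (g has_field_derivative D) (at x))}"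
    show "x \<in> U \<union> (\<Union>z\<in>A. W (fst z) (snd z))"
    proof (rule ccontr)
      assume nx: "x \<notin> U \<union> (\<Union>z\<in>A. W (fst z) (snd z))"
      define q where "q y = (g y - g x) / (y - x)" for y
      have "\<not> (\<forall>s. \<forall>d>0. \<exists>y. y \<noteq> x \<and> \<bar>y - x\<bar> < d \<and> \<bar>q y\<bar> > s)"
        using nx x unfolding U_def q_def by simp
      then obtain s d where d: "d > 0" and "\<not> (\<exists>y. y \<noteq> x \<and> \<bar>y - x\<bar> < d \<and> \<bar>q y\<bar> > s)"
        by blast
      then have sd: "\<bar>q y\<bar> \<le> s" if "y \<noteq> x" "\<bar>y - x\<bar> < d" for y using that by (meson not_le)
      have "\<exists>L. (q \<longlongrightarrow> L) (at x)"
      proof (rule slopes_converge)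
        show "eventually (\<lambda>y. \<bar>q y\<bar> \<le> s) (at x)"
          unfolding eventually_at using sd d by (auto simp: dist_real_def)
        fix p r :: real assume pr: "p \<in> \<rat>" "r \<in> \<rat>" "r < p"
        then have "(p, r) \<in> A" by (simp add: A_def)
        then have "x \<notin> W (fst (p, r)) (snd (p, r))" using nx by blast
        then have "\<not> (\<forall>d>0. \<exists>y. y \<noteq> x \<and> \<bar>y - x\<bar> < d \<and> q y > p) \<or> \<not> (\<forall>d>0. \<exists>y. y \<noteq> x \<and> \<bar>y - x\<bar> < d \<and> q y < r)"
          using x unfolding W_def q_def by simp
        then show "eventually (\<lambda>y. q y \<le> p) (at x) \<or> eventually (\<lambda>y. q y \<ge> r) (at x)"
          unfolding eventually_at dist_real_def by (meson not_le)
      qed simp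
      then show False using x unfolding q_def has_field_derivative_iff by blast
    qed
  qed
  ultimately show ?thesis using negligible_subset by blast
qed

lemma abs_continuous_on_differentiable_ae:
  fixes f :: "real \<Rightarrow> complex"
  assumes ac: "abs_continuous_on {a..b} f"
  shows "negligible {x\<in>{a<..<b}. \<not> (\<exists>D. (f has_vector_derivative D) (at x))}"
proof -
  let ?N = "\<lambda>g. {x\<in>{a<..<b}. \<not> (\<exists>D. (g has_field_derivative D) (at x))}"
  have "abs_continuous_on {a..b} (\<lambda>x. Re (f x))" "abs_continuous_on {a..b} (\<lambda>x. Im (f x))"
    by (rule abs_continuous_on_lipschitz_compose[OF ac, of _ 1],
        simp flip: minus_complex.sel add: abs_Re_le_cmod abs_Im_le_cmod)+
  then have "negligible (?N (\<lambda>x. Re (f x)) \<union> ?N (\<lambda>x. Im (f x)))"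
    by (intro negligible_Un abs_continuous_on_differentiable_ae_real)
  moreover have "{x\<in>{a<..<b}. \<not> (\<exists>D. (f has_vector_derivative D) (at x))} \<subseteq> ?N (\<lambda>x. Re (f x)) \<union> ?N (\<lambda>x. Im (f x))"
  proof (rule ccontr)
    assume "\<not> ?thesis"
    then obtain x where x: "\<not> (\<exists>D. (f has_vector_derivative D) (at x))"
      and "\<exists>D. ((\<lambda>x. Re (f x)) has_field_derivative D) (at x)" "\<exists>D. ((\<lambda>x. Im (f x)) has_field_derivative D) (at x)"
      by blast
    then obtain c d where "((\<lambda>x. Re (f x)) has_field_derivative c) (at x)" "((\<lambda>x. Im (f x)) has_field_derivative d) (at x)"
      by blast
    then have "((\<lambda>x. complex_of_real (Re (f x)) + \<i> * complex_of_real (Im (f x))) has_vector_derivative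
        (complex_of_real c + \<i> * complex_of_real d)) (at x)"
      by (intro has_vector_derivative_add has_vector_derivative_mult_right has_vector_derivative_of_real)
         (simp_all add: has_real_derivative_iff_has_vector_derivative)
    then show False using x by (metis (no_types, lifting) complex_eq has_vector_derivative_transform UNIV_I has_vector_derivative_weaken)
  qed
  ultimately show ?thesis using negligible_subset by blast
qed

section \<open>Recovering a function from its derivative along a line\<close>

text \<open>Henstock's gauge is chosen differently on and off the exceptional null set. Off it, the
  gauge comes from differentiability, with error \<open>e / 2\<close> times the length. For tags on
  it, the intervals are confined to an open set of measure below \<open>\<delta>\<close>, so
  absolute continuity makes the increments sum to less than \<open>e (b - a) / 2\<close>.\<close>

lemma abs_continuous_on_has_integral:
  fixes f :: "real \<Rightarrow> complex"
  assumes ac: "abs_continuous_on {a..b} f" and ab: "a \<le> b" and N: "negligible N"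
    and der: "\<And>x. x \<in> {a<..<b} - N \<Longrightarrow> (f has_vector_derivative f' x) (at x)"
  shows "(f' has_integral (f b - f a)) {a..b}"
proof (cases "a = b")
  case True then show ?thesis by auto
next
  case False
  then have ab: "a < b" using ab by simp
  define M where "M = N \<union> {a, b}"
  have M: "negligible M" unfolding M_def using N by auto
  \<comment> \<open>The value 0 on the null set leaves only the increments of \<open>f\<close> to be
    estimated for tags in it.\<close>
  define F where "F x = (if x \<in> M then 0 else f' x)" for x
  have derF: "(f has_vector_derivative F x) (at x)" if "x \<in> {a..b}" "x \<notin> M" for x
    using der[of x] that unfolding F_def M_def by auto
  have "(F has_integral (f b - f a)) {a..b}"
    unfolding has_integral_factor_content_real
  proof (intro allI impI)
    fix e :: real assume e: "e > 0"
    have e2: "e * (b - a) / 2 > 0" using e ab by simp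
    obtain \<delta> where \<delta>: "\<delta> > 0"
      "\<And>(P::(real \<times> real set) set) u v. finite P \<Longrightarrow> (\<And>i. i \<in> P \<Longrightarrow> u i \<le> v i \<and> {u i..v i} \<subseteq> {a..b}) \<Longrightarrow>
        disjoint_family_on (\<lambda>i. {u i<..<v i}) P \<Longrightarrow> (\<Sum>i\<in>P. v i - u i) < \<delta> \<Longrightarrow>
        (\<Sum>i\<in>P. norm (f (v i) - f (u i))) < e * (b - a) / 2"
      using abs_continuous_onD[OF ac e2] by blast
    obtain U where U: "open U" "M \<subseteq> U" "U \<in> lmeasurable" "measure lebesgue U < \<delta>"
    proof -
      have "M \<in> sets lebesgue" using M by (simp add: negligible_imp_sets)
      then obtain T where T: "open T" "M \<subseteq> T" "T - M \<in> lmeasurable" "emeasure lebesgue (T - M) < ennreal \<delta>"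
        using sets_lebesgue_outer_open[of M \<delta>] \<delta>(1) by blast
      have TM: "T = (T - M) \<union> M" using T(2) by blast
      have Tm: "T \<in> lmeasurable"
        using fmeasurable.Un[OF T(3) negligible_imp_measurable[OF M]] TM by simp
      have "measure lebesgue T \<le> measure lebesgue (T - M) + measure lebesgue M"
        using measure_Un_le[of "T - M" lebesgue M] T(3) negligible_imp_measurable[OF M] TM by auto
      also have "\<dots> = measure lebesgue (T - M)" using negligible_imp_measure0[OF M] by simp
      also have "\<dots> < \<delta>"
      proof -
        have "ennreal (measure lebesgue (T - M)) < ennreal \<delta>"
          using T(3,4) by (simp add: emeasure_eq_measure2)
        then show ?thesis using ennreal_less_iff[of "measure lebesgue (T - M)" \<delta>] by simp
      qed
      finally show ?thesis using that[OF T(1,2) Tm] by blast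
    qed
    have "\<exists>r>0. (x \<in> M \<longrightarrow> ball x r \<subseteq> U) \<and> (x \<in> {a..b} - M \<longrightarrow>
       (\<forall>y. \<bar>y - x\<bar> < r \<longrightarrow> norm (f y - f x - (y - x) *\<^sub>R F x) \<le> e / 2 * \<bar>y - x\<bar>))" for x
    proof (cases "x \<in> M")
      case True
      then show ?thesis using U(1,2) open_contains_ball[of U] by blast
    next
      case xM: False
      show ?thesis
      proof (cases "x \<in> {a..b}")
        case True
        have "e / 2 > 0" using e by simp
        then obtain d where "d > 0" "\<And>y. norm (y - x) < d \<Longrightarrow> norm (f y - f x - (y - x) *\<^sub>R F x) \<le> e / 2 * norm (y - x)"
          using derF[OF True xM] unfolding has_vector_derivative_def has_derivative_at_alt by blast
        then show ?thesis using xM by (intro exI[of _ d]) auto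
      next
        case False then show ?thesis using xM by (intro exI[of _ 1]) auto
      qed
    qed
    then obtain r where r: "\<And>x. r x > 0" "\<And>x. x \<in> M \<Longrightarrow> ball x (r x) \<subseteq> U"
      "\<And>x y. x \<in> {a..b} - M \<Longrightarrow> \<bar>y - x\<bar> < r x \<Longrightarrow> norm (f y - f x - (y - x) *\<^sub>R F x) \<le> e / 2 * \<bar>y - x\<bar>"
      by metis
    show "\<exists>d. gauge d \<and> (\<forall>p. p tagged_division_of {a..b} \<and> d fine p \<longrightarrow>
        norm ((\<Sum>(x, k)\<in>p. measure lborel k *\<^sub>R F x) - (f b - f a)) \<le> e * measure lborel {a..b})"
    proof (intro exI[of _ "\<lambda>x. ball x (r x)"] conjI allI impI)
      show "gauge (\<lambda>x. ball x (r x))" using r(1) by (simp add: gauge_ball_dependent)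
      fix p assume "p tagged_division_of {a..b} \<and> (\<lambda>x. ball x (r x)) fine p"
      then have p: "p tagged_division_of {a..b}" and fine: "\<And>x K. (x, K) \<in> p \<Longrightarrow> K \<subseteq> ball x (r x)"
        by (auto simp: fine_def)
      note pd = tagged_division_ofD[OF p]
      have pK: "\<exists>u v. K = {u..v} \<and> u \<le> x \<and> x \<le> v \<and> a \<le> u \<and> v \<le> b" if xK: "(x, K) \<in> p" for x K
      proof -
        obtain u v where uv: "K = {u..v}" using pd(4)[OF xK] by (auto simp: box_real)
        then have "u \<le> x" "x \<le> v" using pd(2)[OF xK] by auto
        moreover have "{u..v} \<subseteq> {a..b}" using pd(3)[OF xK] uv by simp
        ultimately show ?thesis using uv by auto
      qed
      define P where "P = {z\<in>p. fst z \<in> M}"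
      define \<phi> where "\<phi> z = measure lborel (snd z) *\<^sub>R F (fst z) - (f (Sup (snd z)) - f (Inf (snd z)))" for z
      have finP: "finite P" using pd(1) by (simp add: P_def)
      have "(\<Sum>(x, k)\<in>p. measure lborel k *\<^sub>R F x) - (f b - f a) = (\<Sum>z\<in>p. \<phi> z)"
        using additive_tagged_division_1[OF less_imp_le[OF ab] p, of f]
        by (simp add: \<phi>_def sum_subtractf case_prod_beta)
      also have "norm \<dots> \<le> (\<Sum>z\<in>p. norm (\<phi> z))" by (rule norm_sum)
      also have "\<dots> = (\<Sum>z\<in>p - P. norm (\<phi> z)) + (\<Sum>z\<in>P. norm (\<phi> z))"
        by (rule sum.subset_diff) (use pd(1) in \<open>auto simp: P_def\<close>)
      also have "(\<Sum>z\<in>P. norm (\<phi> z)) \<le> e * (b - a) / 2"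
      proof -
        have "(\<Sum>z\<in>P. norm (\<phi> z)) = (\<Sum>z\<in>P. norm (f (Sup (snd z)) - f (Inf (snd z))))"
          by (intro sum.cong) (auto simp: \<phi>_def F_def P_def norm_minus_commute)
        also have "\<dots> < e * (b - a) / 2"
        proof (rule \<delta>(2)[OF finP])
          have PK: "\<exists>u v. snd z = {u..v} \<and> u \<le> v \<and> a \<le> u \<and> v \<le> b" if z: "z \<in> P" for z
          proof -
            have "(fst z, snd z) \<in> p" using z by (simp add: P_def)
            then obtain u v where "snd z = {u..v}" "u \<le> fst z" "fst z \<le> v" "a \<le> u" "v \<le> b" using pK by blast
            then show ?thesis by (metis order_trans)
          qed
          show "Inf (snd z) \<le> Sup (snd z) \<and> {Inf (snd z)..Sup (snd z)} \<subseteq> {a..b}" if z: "z \<in> P" for z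
          proof -
            obtain u v where "snd z = {u..v}" "u \<le> v" "a \<le> u" "v \<le> b" using PK[OF z] by blast
            then show ?thesis by simp
          qed
          have PI: "{Inf (snd z)<..<Sup (snd z)} = interior (snd z)" "{Inf (snd z)..Sup (snd z)} = snd z" if z: "z \<in> P" for z
          proof -
            obtain u v where "snd z = {u..v}" "u \<le> v" using PK[OF z] by blast
            then show "{Inf (snd z)<..<Sup (snd z)} = interior (snd z)" "{Inf (snd z)..Sup (snd z)} = snd z"
              by (simp_all add: interior_atLeastAtMost_real)
          qed
          show dis: "disjoint_family_on (\<lambda>i. {Inf (snd i)<..<Sup (snd i)}) P"
            unfolding disjoint_family_on_def
          proof (intro ballI impI)
            fix z w assume zw: "z \<in> P" "w \<in> P" "z \<noteq> w"
            then show "{Inf (snd z)<..<Sup (snd z)} \<inter> {Inf (snd w)<..<Sup (snd w)} = {}"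
              using PI pd(5)[of "fst z" "snd z" "fst w" "snd w"] by (auto simp: P_def)
          qed
          have "(\<Sum>z\<in>P. Sup (snd z) - Inf (snd z)) = (\<Sum>z\<in>P. measure lebesgue {Inf (snd z)<..<Sup (snd z)})"
          proof (rule sum.cong[OF refl])
            fix z assume "z \<in> P"
            show "Sup (snd z) - Inf (snd z) = measure lebesgue {Inf (snd z)<..<Sup (snd z)}"
            proof -
              obtain u v where "snd z = {u..v}" "u \<le> v" using PK[OF \<open>z \<in> P\<close>] by blast
              then show ?thesis by simp
            qed
          qed
          also have "\<dots> = measure lebesgue (\<Union>z\<in>P. {Inf (snd z)<..<Sup (snd z)})"
          proof (rule measure_finite_Union[symmetric, OF finP _ dis])
            show "(\<lambda>i. {Inf (snd i)<..<Sup (snd i)}) ` P \<subseteq> sets lebesgue" by auto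
            fix z assume "z \<in> P"
            show "emeasure lebesgue {Inf (snd z)<..<Sup (snd z)} \<noteq> \<infinity>"
            proof -
              obtain u v where "snd z = {u..v}" "u \<le> v" using PK[OF \<open>z \<in> P\<close>] by blast
              then show ?thesis by simp
            qed
          qed
          also have "\<dots> \<le> measure lebesgue U"
          proof (rule measure_mono_fmeasurable)
            show "(\<Union>z\<in>P. {Inf (snd z)<..<Sup (snd z)}) \<subseteq> U"
            proof (rule UN_least)
              fix z assume z: "z \<in> P"
              then have "snd z \<subseteq> ball (fst z) (r (fst z))" using fine[of "fst z" "snd z"] by (auto simp: P_def)
              also have "\<dots> \<subseteq> U" using r(2) z by (auto simp: P_def)
              finally show "{Inf (snd z)<..<Sup (snd z)} \<subseteq> U" using PI(1)[OF z] interior_subset by blast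
            qed
            show "(\<Union>z\<in>P. {Inf (snd z)<..<Sup (snd z)}) \<in> sets lebesgue" using finP by auto
          qed (rule U(3))
          finally show "(\<Sum>z\<in>P. Sup (snd z) - Inf (snd z)) < \<delta>" using U(4) by simp
        qed
        finally show ?thesis by simp
      qed
      also have "(\<Sum>z\<in>p - P. norm (\<phi> z)) \<le> (\<Sum>z\<in>p - P. e / 2 * measure lborel (snd z))"
      proof (rule sum_mono)
        fix z assume z: "z \<in> p - P"
        obtain x K where xK: "z = (x, K)" by fastforce
        have xKp: "(x, K) \<in> p" using z xK by simp
        then obtain u v where uv: "K = {u..v}" "u \<le> x" "x \<le> v" "a \<le> u" "v \<le> b" using pK by blast
        have x: "x \<in> {a..b} - M" using uv z xK by (auto simp: P_def)
        have "u \<in> K" "v \<in> K" using uv by auto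
        then have "u \<in> ball x (r x)" "v \<in> ball x (r x)" using fine[OF xKp] by blast+
        then have uvr: "\<bar>u - x\<bar> < r x" "\<bar>v - x\<bar> < r x" by (auto simp: dist_real_def)
        have "\<phi> z = - ((f v - f x - (v - x) *\<^sub>R F x) - (f u - f x - (u - x) *\<^sub>R F x))"
          using uv by (simp add: \<phi>_def xK algebra_simps)
        then have "norm (\<phi> z) \<le> norm (f v - f x - (v - x) *\<^sub>R F x) + norm (f u - f x - (u - x) *\<^sub>R F x)"
          by (metis norm_minus_cancel norm_triangle_ineq4)
        also have "\<dots> \<le> e / 2 * \<bar>v - x\<bar> + e / 2 * \<bar>u - x\<bar>"
          using r(3)[OF x uvr(1)] r(3)[OF x uvr(2)] by simp
        also have "\<dots> = e / 2 * measure lborel (snd z)" using uv by (simp add: xK field_simps)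
        finally show "norm (\<phi> z) \<le> e / 2 * measure lborel (snd z)" .
      qed
      also have "(\<Sum>z\<in>p - P. e / 2 * measure lborel (snd z)) \<le> (\<Sum>z\<in>p. e / 2 * measure lborel (snd z))"
        by (rule sum_mono2) (use pd(1) e in auto)
      also have "\<dots> = e / 2 * (b - a)"
        using additive_content_tagged_division[of p a b] p ab by (simp add: sum_distrib_left[symmetric] case_prod_beta sum_divide_distrib[symmetric])
      finally show "norm ((\<Sum>(x, k)\<in>p. measure lborel k *\<^sub>R F x) - (f b - f a)) \<le> e * measure lborel {a..b}"
        using ab by (simp add: field_simps)
    qed
  qed
  then show ?thesis
    by (rule has_integral_spike[OF M, rotated]) (simp add: F_def)
qed

text \<open>Turns a pointwise bound on derivatives into a bound on increments. The bound
  \<open>\<rho>\<close> may take infinite values: if its integral is infinite the claim is trivial,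
  otherwise it is finite almost everywhere.\<close>

lemma abs_continuous_on_norm_diff_le:
  fixes f :: "real \<Rightarrow> complex" and \<rho> :: "real \<Rightarrow> ennreal"
  assumes ac: "abs_continuous_on {a..b} f" and ab: "a \<le> b"
    and [measurable]: "\<rho> \<in> borel_measurable borel"
    and le: "AE t in lborel. t \<in> {a<..<b} \<longrightarrow> (\<forall>D. (f has_vector_derivative D) (at t) \<longrightarrow> ennreal (norm D) \<le> \<rho> t)"
  shows "ennreal (norm (f b - f a)) \<le> (\<integral>\<^sup>+t\<in>{a..b}. \<rho> t \<partial>lborel)"
proof (cases "(\<integral>\<^sup>+t\<in>{a..b}. \<rho> t \<partial>lborel) = \<infinity>")
  case True then show ?thesis by simp
next
  case fin: False
  \<comment> \<open>\<open>enn2real\<close> replaces infinite values by 0, which happens on a null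
    set only.\<close>
  define r where "r t = enn2real (\<rho> t * indicator {a..b} t)" for t
  have [measurable]: "r \<in> borel_measurable borel" unfolding r_def by measurable
  have ninf: "AE t in lborel. \<rho> t * indicator {a..b} t \<noteq> \<infinity>"
    by (rule nn_integral_PInf_AE) (use fin in auto)
  have req: "(\<integral>\<^sup>+t. ennreal (r t) \<partial>lborel) = (\<integral>\<^sup>+t\<in>{a..b}. \<rho> t \<partial>lborel)"
    by (rule nn_integral_cong_AE) (use ninf in eventually_elim, simp add: r_def less_top)
  obtain R where R: "R \<ge> 0" "(\<integral>\<^sup>+t\<in>{a..b}. \<rho> t \<partial>lborel) = ennreal R"
    using fin by (cases "\<integral>\<^sup>+t\<in>{a..b}. \<rho> t \<partial>lborel" rule: ennreal_cases) auto
  have "(r has_integral R) UNIV"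
    by (rule nn_integral_has_integral) (use req R in \<open>auto simp: r_def\<close>)
  moreover have "r t = (if t \<in> {a..b} then r t else 0)" for t by (simp add: r_def)
  ultimately have "((\<lambda>t. if t \<in> {a..b} then r t else 0) has_integral R) UNIV" by simp
  then have rR: "(r has_integral R) {a..b}" by (simp only: has_integral_restrict_UNIV)
  define N1 where "N1 = {x\<in>{a<..<b}. \<not> (\<exists>D. (f has_vector_derivative D) (at x))}"
  have N1: "negligible N1" unfolding N1_def by (rule abs_continuous_on_differentiable_ae[OF ac])
  from le ninf have "AE t in lborel. (t \<in> {a<..<b} \<longrightarrow> (\<forall>D. (f has_vector_derivative D) (at t) \<longrightarrow> ennreal (norm D) \<le> \<rho> t)) \<and>
      \<rho> t * indicator {a..b} t \<noteq> \<infinity>" by auto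
  then obtain N2 where N2: "{t. \<not> ((t \<in> {a<..<b} \<longrightarrow> (\<forall>D. (f has_vector_derivative D) (at t) \<longrightarrow> ennreal (norm D) \<le> \<rho> t)) \<and>
      \<rho> t * indicator {a..b} t \<noteq> \<infinity>)} \<subseteq> N2" "N2 \<in> null_sets lborel"
    unfolding eventually_ae_filter by auto
  have nN2: "negligible N2" using N2(2) by (simp add: negligible_iff_null_sets null_sets_completionI)
  define N where "N = N1 \<union> N2 \<union> {a, b}"
  have nN: "negligible N" unfolding N_def using N1 nN2 by auto
  define f' where "f' t = (if t \<in> N then 0 else vector_derivative f (at t))" for t
  have der: "(f has_vector_derivative f' t) (at t)" if "t \<in> {a<..<b} - N" for t
    using that unfolding f'_def N_def N1_def by (auto simp: vector_derivative_works[symmetric] differentiableI_vector)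
  have int: "(f' has_integral (f b - f a)) {a..b}"
    by (rule abs_continuous_on_has_integral[OF ac ab nN der])
  have "norm (integral {a..b} f') \<le> integral {a..b} r"
  proof (rule integral_norm_bound_integral)
    show "f' integrable_on {a..b}" "r integrable_on {a..b}" using int rR by blast+
    fix t assume t: "t \<in> {a..b}"
    show "norm (f' t) \<le> r t"
    proof (cases "t \<in> N")
      case True then show ?thesis by (simp add: f'_def r_def)
    next
      case False
      then have tt: "t \<in> {a<..<b} - N" using t by (auto simp: N_def)
      have "ennreal (norm (f' t)) \<le> \<rho> t" "\<rho> t \<noteq> \<infinity>"
        using N2(1) False der[OF tt] tt t unfolding N_def by auto
      then show ?thesis using t unfolding r_def
        by (cases "\<rho> t" rule: ennreal_cases) auto
    qed
  qed
  then have "norm (f b - f a) \<le> R" using int rR by (simp add: integral_unique)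
  then show ?thesis using R by (simp add: ennreal_leI)
qed

subsection \<open>Lebesgue measure on the complex plane\<close>

lemma measurable_Complex [measurable (raw)]:
  assumes [measurable]: "f \<in> borel_measurable M" "g \<in> borel_measurable M"
  shows "(\<lambda>x. Complex (f x) (g x)) \<in> borel_measurable M"
proof -
  have "(\<lambda>x. complex_of_real (f x) + \<i> * complex_of_real (g x)) \<in> borel_measurable M" by measurable
  then show ?thesis by (simp add: Complex_eq)
qed

lemma borel_measurable_cnj [measurable (raw)]:
  assumes "f \<in> borel_measurable M"
  shows "(\<lambda>x. cnj (f x)) \<in> borel_measurable M"
  using borel_measurable_continuous_on[OF continuous_on_cnj[OF continuous_on_id] assms] by simp

lemma lborel_complex:
  "(lborel :: complex measure) = distr (lborel \<Otimes>\<^sub>M lborel) borel (\<lambda>(x, y). Complex x y)"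
proof (rule lborel_eqI)
  fix l u :: complex assume lu: "\<And>b. b \<in> Basis \<Longrightarrow> l \<bullet> b \<le> u \<bullet> b"
  have le: "Re l \<le> Re u" "Im l \<le> Im u"
    using lu[of 1] lu[of \<i>] by (auto simp: Basis_complex_def)
  have "(\<lambda>(x, y). Complex x y) -` box l u \<inter> space (lborel \<Otimes>\<^sub>M lborel) = {Re l<..<Re u} \<times> {Im l<..<Im u}"
    by (auto simp: box_def Basis_complex_def space_pair_measure)
  then have "emeasure (distr (lborel \<Otimes>\<^sub>M lborel) borel (\<lambda>(x, y). Complex x y)) (box l u) =
      emeasure (lborel \<Otimes>\<^sub>M lborel) ({Re l<..<Re u} \<times> {Im l<..<Im u})"
    by (subst emeasure_distr) auto
  also have "\<dots> = ennreal (Re u - Re l) * ennreal (Im u - Im l)"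
    using le by (subst lborel.emeasure_pair_measure_Times) auto
  also have "\<dots> = ennreal (\<Prod>b\<in>Basis. (u - l) \<bullet> b)"
    using le by (simp add: Basis_complex_def ennreal_mult)
  finally show "emeasure (distr (lborel \<Otimes>\<^sub>M lborel) borel (\<lambda>(x, y). Complex x y)) (box l u) = ennreal (\<Prod>b\<in>Basis. (u - l) \<bullet> b)" .
qed simp

lemma nn_integral_complex:
  fixes f :: "complex \<Rightarrow> ennreal"
  assumes [measurable]: "f \<in> borel_measurable borel"
  shows nn_integral_complex_xy: "(\<integral>\<^sup>+z. f z \<partial>lborel) = (\<integral>\<^sup>+x. \<integral>\<^sup>+y. f (Complex x y) \<partial>lborel \<partial>lborel)"
    and nn_integral_complex_yx: "(\<integral>\<^sup>+z. f z \<partial>lborel) = (\<integral>\<^sup>+y. \<integral>\<^sup>+x. f (Complex x y) \<partial>lborel \<partial>lborel)"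
proof -
  have *: "(\<integral>\<^sup>+z. f z \<partial>lborel) = (\<integral>\<^sup>+z. f (Complex (fst z) (snd z)) \<partial>(lborel \<Otimes>\<^sub>M lborel))"
    by (subst lborel_complex, subst nn_integral_distr) (auto simp: case_prod_beta)
  show "(\<integral>\<^sup>+z. f z \<partial>lborel) = (\<integral>\<^sup>+x. \<integral>\<^sup>+y. f (Complex x y) \<partial>lborel \<partial>lborel)"
    unfolding * by (subst lborel.nn_integral_fst[symmetric]) auto
  show "(\<integral>\<^sup>+z. f z \<partial>lborel) = (\<integral>\<^sup>+y. \<integral>\<^sup>+x. f (Complex x y) \<partial>lborel \<partial>lborel)"
    unfolding * by (subst lborel_pair.nn_integral_snd[symmetric]) auto
qed

lemma AE_complex:
  assumes [measurable]: "Measurable.pred borel P"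
  shows AE_complex_xy: "(AE z in lborel. P z) \<longleftrightarrow> (AE x in lborel. AE y in lborel. P (Complex x y))"
    and AE_complex_yx: "(AE z in lborel. P z) \<longleftrightarrow> (AE y in lborel. AE x in lborel. P (Complex x y))"
proof -
  define N where "N = {z. \<not> P z}"
  have [measurable]: "N \<in> sets borel" unfolding N_def by measurable
  have *: "(AE z in lborel. P z) \<longleftrightarrow> (\<integral>\<^sup>+z. indicator N z \<partial>lborel) = 0"
    by (subst nn_integral_0_iff_AE) (auto simp: indicator_def N_def)
  have x: "(\<integral>\<^sup>+y. indicator N (Complex x y) \<partial>lborel) = 0 \<longleftrightarrow> (AE y in lborel. P (Complex x y))" for x
    by (subst nn_integral_0_iff_AE) (auto simp: indicator_def N_def)
  have y: "(\<integral>\<^sup>+x. indicator N (Complex x y) \<partial>lborel) = 0 \<longleftrightarrow> (AE x in lborel. P (Complex x y))" for y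
    by (subst nn_integral_0_iff_AE) (auto simp: indicator_def N_def)
  have "(\<integral>\<^sup>+z. indicator N z \<partial>lborel) = 0 \<longleftrightarrow> (AE x in lborel. (\<integral>\<^sup>+y. indicator N (Complex x y) \<partial>lborel) = 0)"
    by (subst nn_integral_complex_xy, measurable, subst nn_integral_0_iff_AE, measurable)
  then show "(AE z in lborel. P z) \<longleftrightarrow> (AE x in lborel. AE y in lborel. P (Complex x y))"
    unfolding * x .
  have "(\<integral>\<^sup>+z. indicator N z \<partial>lborel) = 0 \<longleftrightarrow> (AE y in lborel. (\<integral>\<^sup>+x. indicator N (Complex x y) \<partial>lborel) = 0)"
    by (subst nn_integral_complex_yx, measurable, subst nn_integral_0_iff_AE, measurable)
  then show "(AE z in lborel. P z) \<longleftrightarrow> (AE y in lborel. AE x in lborel. P (Complex x y))"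
    unfolding * y .
qed

lemma integral_complex:
  fixes f :: "complex \<Rightarrow> 'a::{banach, second_countable_topology}"
  assumes f: "integrable lborel f"
  shows integral_complex_xy: "(\<integral>z. f z \<partial>lborel) = (\<integral>x. \<integral>y. f (Complex x y) \<partial>lborel \<partial>lborel)"
    and integral_complex_yx: "(\<integral>z. f z \<partial>lborel) = (\<integral>y. \<integral>x. f (Complex x y) \<partial>lborel \<partial>lborel)"
    and integrable_complex_x: "AE y in lborel. integrable lborel (\<lambda>x. f (Complex x y))"
    and integrable_complex_y: "AE x in lborel. integrable lborel (\<lambda>y. f (Complex x y))"
proof -
  have [measurable]: "f \<in> borel_measurable borel" using borel_measurable_integrable[OF f] by simp
  have *: "(\<integral>z. f z \<partial>lborel) = (\<integral>z. f (Complex (fst z) (snd z)) \<partial>(lborel \<Otimes>\<^sub>M lborel))"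
    by (subst lborel_complex, subst integral_distr) (auto simp: case_prod_beta)
  have i: "integrable (lborel \<Otimes>\<^sub>M lborel) (\<lambda>z. f (Complex (fst z) (snd z)))"
    using f by (subst (asm) lborel_complex, subst (asm) integrable_distr_eq) (auto simp: case_prod_beta)
  moreover have "(\<lambda>z. f (Complex (fst z) (snd z))) = (\<lambda>(x, y). f (Complex x y))" by auto
  ultimately have i': "integrable (lborel \<Otimes>\<^sub>M lborel) (\<lambda>(x, y). f (Complex x y))" by simp
  show "(\<integral>z. f z \<partial>lborel) = (\<integral>x. \<integral>y. f (Complex x y) \<partial>lborel \<partial>lborel)"
    using lborel_pair.integral_fst'[OF i] by (simp add: *)
  show "(\<integral>z. f z \<partial>lborel) = (\<integral>y. \<integral>x. f (Complex x y) \<partial>lborel \<partial>lborel)"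
    using lborel_pair.integral_snd[OF i'] by (simp add: * case_prod_beta')
  show "AE y in lborel. integrable lborel (\<lambda>x. f (Complex x y))"
    using lborel_pair.AE_integrable_snd[OF i'] by simp
  show "AE x in lborel. integrable lborel (\<lambda>y. f (Complex x y))"
    using lborel_pair.AE_integrable_fst'[OF i] by simp
qed

section \<open>The area formula in complex notation and rotation invariance\<close>

definition vec_of_complex :: "complex \<Rightarrow> real^2" where
  "vec_of_complex z = vector [Re z, Im z]"

definition complex_of_vec :: "real^2 \<Rightarrow> complex" where
  "complex_of_vec v = Complex (v $ 1) (v $ 2)"

lemma vec_complex_inverse [simp]:
  "complex_of_vec (vec_of_complex z) = z" "vec_of_complex (complex_of_vec v) = v"
  by (auto simp: vec_of_complex_def complex_of_vec_def vec_eq_iff forall_2)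

lemma linear_vec_of_complex: "linear vec_of_complex"
  by (rule linearI) (auto simp: vec_of_complex_def vec_eq_iff forall_2)

lemma linear_complex_of_vec: "linear complex_of_vec"
  by (rule linearI) (auto simp: complex_of_vec_def complex_eq_iff)

lemma bounded_linear_vec_of_complex: "bounded_linear vec_of_complex"
  by (simp add: linear_conv_bounded_linear[symmetric] linear_vec_of_complex)

lemma bounded_linear_complex_of_vec: "bounded_linear complex_of_vec"
  by (simp add: linear_conv_bounded_linear[symmetric] linear_complex_of_vec)

lemma vec_of_complex_measurable [measurable]: "vec_of_complex \<in> borel_measurable borel"
  using linear_continuous_on[OF bounded_linear_vec_of_complex] by (rule borel_measurable_continuous_onI)

lemma complex_of_vec_measurable [measurable]: "complex_of_vec \<in> borel_measurable borel"
  using linear_continuous_on[OF bounded_linear_complex_of_vec] by (rule borel_measurable_continuous_onI)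

lemma lborel_vec_of_complex: "(lborel :: (real^2) measure) = distr lborel borel vec_of_complex"
proof (rule lborel_eqI)
  fix l u :: "real^2" assume lu: "\<And>b. b \<in> Basis \<Longrightarrow> l \<bullet> b \<le> u \<bullet> b"
  have le: "l $ i \<le> u $ i" for i
    using lu[of "axis i 1"] by (simp add: inner_axis axis_in_Basis_iff)
  have "vec_of_complex -` box l u \<inter> space lborel = box (complex_of_vec l) (complex_of_vec u)"
    by (auto simp: box_def Basis_complex_def vec_of_complex_def complex_of_vec_def Basis_vec_def inner_axis forall_2)
  then have "emeasure (distr lborel borel vec_of_complex) (box l u) = emeasure lborel (box (complex_of_vec l) (complex_of_vec u))"
    by (subst emeasure_distr) auto
  also have "\<dots> = ennreal (\<Prod>b\<in>Basis. (complex_of_vec u - complex_of_vec l) \<bullet> b)"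
    by (subst emeasure_lborel_box) (use le in \<open>auto simp: Basis_complex_def complex_of_vec_def\<close>)
  also have "(\<Prod>b\<in>Basis. (complex_of_vec u - complex_of_vec l) \<bullet> b) = (u $ 1 - l $ 1) * (u $ 2 - l $ 2)"
    by (simp add: Basis_complex_def complex_of_vec_def)
  also have "\<dots> = (\<Prod>i\<in>UNIV. (u - l) $ i)" by (simp add: UNIV_2)
  also have "\<dots> = (\<Prod>b\<in>Basis. (u - l) \<bullet> b)"
  proof -
    have B: "Basis = (\<lambda>i. axis i 1 :: real^2) ` UNIV" by (auto simp: Basis_vec_def)
    have "inj (\<lambda>i. axis i 1 :: real^2)" by (auto simp: inj_def axis_eq_axis)
    then show ?thesis unfolding B by (subst prod.reindex) (simp_all add: inner_axis)
  qed
  finally show "emeasure (distr lborel borel vec_of_complex) (box l u) = ennreal (\<Prod>b\<in>Basis. (u - l) \<bullet> b)" .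
qed simp

lemma nn_integral_vec_of_complex:
  assumes [measurable]: "h \<in> borel_measurable borel"
  shows "(\<integral>\<^sup>+v. h v \<partial>lborel) = (\<integral>\<^sup>+z. h (vec_of_complex z) \<partial>lborel)"
  by (subst lborel_vec_of_complex, subst nn_integral_distr) auto

text \<open>Transport of the area formula of HOL-Analysis from \<open>real^2\<close> to the complex plane. The derivative
  is only taken relative to the set, so that no total differentiability is needed.\<close>

lemma area_formula:
  fixes f :: "complex \<Rightarrow> complex" and P Q :: "complex \<Rightarrow> complex"
  assumes S: "S \<in> sets borel" and fS: "f ` S \<in> sets borel" and inj: "inj_on f S"
    and der: "\<And>z. z \<in> S \<Longrightarrow> (f has_derivative (\<lambda>h. Re h *\<^sub>R P z + Im h *\<^sub>R Q z)) (at z within S)"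
    and [measurable]: "P \<in> borel_measurable borel" "Q \<in> borel_measurable borel"
  shows "(\<integral>\<^sup>+z\<in>S. ennreal \<bar>Im (cnj (P z) * Q z)\<bar> \<partial>lborel) = emeasure lborel (f ` S)"
proof -
  define T where "T = complex_of_vec -` S"
  define F where "F = vec_of_complex \<circ> f \<circ> complex_of_vec"
  define F' where "F' v h = vec_of_complex (Re (complex_of_vec h) *\<^sub>R P (complex_of_vec v) + Im (complex_of_vec h) *\<^sub>R Q (complex_of_vec v))" for v h
  define J where "J z = \<bar>Im (cnj (P z) * Q z)\<bar>" for z
  have [measurable]: "J \<in> borel_measurable borel" unfolding J_def by measurable
  have Tb: "T \<in> sets borel" using measurable_sets[OF complex_of_vec_measurable S] by (simp add: T_def)
  have TS: "T = vec_of_complex ` S"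
  proof
    show "T \<subseteq> vec_of_complex ` S"
    proof
      fix v assume "v \<in> T"
      then show "v \<in> vec_of_complex ` S" unfolding T_def by (intro image_eqI[of _ _ "complex_of_vec v"]) auto
    qed
    show "vec_of_complex ` S \<subseteq> T" unfolding T_def by auto
  qed
  have FT: "F ` T = complex_of_vec -` (f ` S)"
  proof
    show "F ` T \<subseteq> complex_of_vec -` (f ` S)" unfolding F_def T_def by auto
    show "complex_of_vec -` (f ` S) \<subseteq> F ` T"
    proof
      fix v assume "v \<in> complex_of_vec -` (f ` S)"
      then obtain z where z: "z \<in> S" "complex_of_vec v = f z" by auto
      then have "v = F (vec_of_complex z)" unfolding F_def by (metis comp_apply vec_complex_inverse)
      then show "v \<in> F ` T" using z(1) TS by blast
    qed
  qed
  have FTb: "F ` T \<in> sets borel" using measurable_sets[OF complex_of_vec_measurable fS] by (simp add: FT)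
  have derF: "(F has_derivative F' v) (at v within T)" if "v \<in> T" for v
  proof -
    have "complex_of_vec ` T = S" unfolding TS by (simp add: image_comp)
    moreover have "(complex_of_vec has_derivative complex_of_vec) (at v within T)"
      by (rule bounded_linear_imp_has_derivative[OF bounded_linear_complex_of_vec])
    ultimately have "(f \<circ> complex_of_vec has_derivative
        (\<lambda>h. Re h *\<^sub>R P (complex_of_vec v) + Im h *\<^sub>R Q (complex_of_vec v)) \<circ> complex_of_vec) (at v within T)"
      using der[of "complex_of_vec v"] that by (intro diff_chain_within) (auto simp: T_def)
    then show ?thesis
      using bounded_linear.has_derivative[OF bounded_linear_vec_of_complex] unfolding F_def F'_def o_def by blast
  qed
  \<comment> \<open>\<open>Im (cnj p * q)\<close> is the determinant of the real matrix with columns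
    \<open>p\<close> and \<open>q\<close>.\<close>
  have detF: "\<bar>det (matrix (F' v))\<bar> = J (complex_of_vec v)" for v
    by (simp add: det_2 matrix_def F'_def J_def complex_of_vec_def vec_of_complex_def axis_def algebra_simps)
  have injF: "inj_on F T"
    unfolding inj_on_def
  proof (intro ballI impI)
    fix x y assume "x \<in> T" "y \<in> T" "F x = F y"
    then have "f (complex_of_vec x) = f (complex_of_vec y)" unfolding F_def by (metis comp_apply vec_complex_inverse(1))
    then have "complex_of_vec x = complex_of_vec y" using inj \<open>x \<in> T\<close> \<open>y \<in> T\<close> by (auto simp: T_def dest: inj_onD)
    then show "x = y" by (metis vec_complex_inverse(2))
  qed
  have iff: "F ` T \<in> lmeasurable \<and> measure lebesgue (F ` T) = m \<longleftrightarrow> ((\<lambda>v. J (complex_of_vec v)) has_integral m) T" for m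
    using has_measure_differentiable_image[of T F F' m] Tb derF injF detF by (simp add: sets_completionI_sets)
  have e1: "emeasure lborel (f ` S) = emeasure lebesgue (F ` T)"
  proof -
    have "emeasure lborel (F ` T) = emeasure lborel (vec_of_complex -` (F ` T) \<inter> space lborel)"
      using FTb by (subst lborel_vec_of_complex, subst emeasure_distr) auto
    also have "vec_of_complex -` (F ` T) \<inter> space lborel = f ` S" unfolding FT by auto
    finally show ?thesis using FTb by simp
  qed
  have e2: "(\<integral>\<^sup>+z\<in>S. ennreal (J z) \<partial>lborel) = (\<integral>\<^sup>+v. ennreal (J (complex_of_vec v)) * indicator T v \<partial>lborel)"
  proof -
    have m: "(\<lambda>v. ennreal (J (complex_of_vec v)) * indicator T v) \<in> borel_measurable borel"
      using Tb by measurable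
    show ?thesis unfolding nn_integral_vec_of_complex[OF m]
      by (intro nn_integral_cong) (auto simp: T_def indicator_def)
  qed
  have m2: "(\<lambda>v. J (complex_of_vec v) * indicator T v) \<in> borel_measurable borel" using Tb by measurable
  have "emeasure lebesgue (F ` T) = (\<integral>\<^sup>+v. ennreal (J (complex_of_vec v)) * indicator T v \<partial>lborel)"
  proof (cases "F ` T \<in> lmeasurable")
    case True
    then have "((\<lambda>v. J (complex_of_vec v)) has_integral measure lebesgue (F ` T)) T" using iff by blast
    then have "(\<integral>\<^sup>+v. ennreal (J (complex_of_vec v)) * indicator T v \<partial>lborel) = ennreal (measure lebesgue (F ` T))"
      by (intro nn_integral_has_integral_lebesgue') (auto simp: J_def)
    then show ?thesis using True by (simp add: emeasure_eq_measure2)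
  next
    \<comment> \<open>The formula is an equivalence between finite values; if the image has infinite
      measure, a finite integral would contradict it.\<close>
    case False
    have "(\<integral>\<^sup>+v. ennreal (J (complex_of_vec v)) * indicator T v \<partial>lborel) = \<infinity>"
    proof (rule ccontr)
      assume "\<not> ?thesis"
      then obtain r where r: "r \<ge> 0" "(\<integral>\<^sup>+v. ennreal (J (complex_of_vec v)) * indicator T v \<partial>lborel) = ennreal r"
        by (cases "\<integral>\<^sup>+v. ennreal (J (complex_of_vec v)) * indicator T v \<partial>lborel" rule: ennreal_cases) auto
      have "((\<lambda>v. J (complex_of_vec v) * indicator T v) has_integral r) UNIV"
      proof (rule nn_integral_has_integral[OF m2])
        have "ennreal (J (complex_of_vec v)) * indicator T v = ennreal (J (complex_of_vec v) * indicator T v)" for v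
          by (auto simp: indicator_def)
        then show "(\<integral>\<^sup>+v. ennreal (J (complex_of_vec v) * indicator T v) \<partial>lborel) = ennreal r" using r by simp
      qed (use r in \<open>auto simp: J_def\<close>)
      moreover have "J (complex_of_vec v) * indicator T v = (if v \<in> T then J (complex_of_vec v) else 0)" for v by auto
      ultimately have "((\<lambda>v. if v \<in> T then J (complex_of_vec v) else 0) has_integral r) UNIV" by simp
      then have "((\<lambda>v. J (complex_of_vec v)) has_integral r) T" by (simp only: has_integral_restrict_UNIV)
      then show False using iff False by blast
    qed
    moreover have "emeasure lebesgue (F ` T) = \<infinity>"
      using False FTb by (auto simp: fmeasurable_def less_top[symmetric])
    ultimately show ?thesis by simp
  qed
  then show ?thesis using e1 e2 by (simp add: J_def)
qed

lemma nn_integral_translation: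
  fixes f :: "'a::euclidean_space \<Rightarrow> ennreal"
  assumes [measurable]: "f \<in> borel_measurable borel"
  shows "(\<integral>\<^sup>+z. f (a + z) \<partial>lborel) = (\<integral>\<^sup>+z. f z \<partial>lborel)"
  by (subst (2) lborel_distr_plus[symmetric, of a]) (simp add: nn_integral_distr)

text \<open>Multiplication by \<open>c\<close> is linear with determinant \<open>|c|^2 = 1\<close>,
  so the area formula gives equality of measures.\<close>

lemma lborel_rotation:
  assumes "cmod c = 1"
  shows "distr lborel borel ((*) c) = lborel"
proof (rule measure_eqI)
  fix A assume "A \<in> sets (distr lborel borel ((*) c))"
  then have A: "A \<in> sets borel" by simp
  have c0: "c \<noteq> 0" using assms by auto
  have cc: "c * cnj c = 1" using assms by (simp add: complex_norm_square[symmetric])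
  define S where "S = (*) c -` A"
  have [measurable]: "(*) c \<in> borel_measurable borel" by measurable
  have S: "S \<in> sets borel" unfolding S_def using measurable_sets[of "(*) c" borel borel A] A by simp
  have im: "(*) c ` S = A"
  proof -
    have "x \<in> (*) c ` S" if "x \<in> A" for x
      using that c0 unfolding S_def by (intro image_eqI[of _ _ "x / c"]) auto
    then show ?thesis unfolding S_def by auto
  qed
  have "(\<integral>\<^sup>+z\<in>S. ennreal \<bar>Im (cnj c * (c * \<i>))\<bar> \<partial>lborel) = emeasure lborel ((*) c ` S)"
  proof (rule area_formula[of S "(*) c" "\<lambda>_. c" "\<lambda>_. c * \<i>"])
    show "((*) c has_derivative (\<lambda>h. Re h *\<^sub>R c + Im h *\<^sub>R (c * \<i>))) (at z within S)" for z
    proof -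
      have "((*) c has_derivative (\<lambda>h. c * h)) (at z within S)" by (auto intro!: derivative_eq_intros)
      moreover have "(\<lambda>h. c * h) = (\<lambda>h. Re h *\<^sub>R c + Im h *\<^sub>R (c * \<i>))"
        by (rule ext) (auto simp: complex_eq_iff)
      ultimately show ?thesis by (rule has_derivative_eq_rhs)
    qed
  qed (use S A im c0 in \<open>auto simp: inj_on_def\<close>)
  moreover have "cnj c * (c * \<i>) = \<i>" using cc by (simp add: mult_ac)
  ultimately have "emeasure lborel S = emeasure lborel A" using im S by simp
  then show "emeasure (distr lborel borel ((*) c)) A = emeasure lborel A"
    using A by (subst emeasure_distr) (auto simp: S_def)
qed simp

subsection \<open>Directional derivatives and the area inequality\<close>

definition dirq :: "complex \<Rightarrow> (complex \<Rightarrow> complex) \<Rightarrow> real \<Rightarrow> complex \<Rightarrow> complex" where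
  "dirq e f h z = (f (z + of_real h * e) - f z) /\<^sub>R h"

text \<open>The limit along one sequence is a total function that is Borel measurable for continuous
  \<open>f\<close>. On \<open>dirset e f\<close> it is the two-sided directional derivative;
  elsewhere its value carries no meaning.\<close>

definition dird :: "complex \<Rightarrow> (complex \<Rightarrow> complex) \<Rightarrow> complex \<Rightarrow> complex" where
  "dird e f z = lim (\<lambda>n. dirq e f (1 / real (Suc n)) z)"

definition dirset :: "complex \<Rightarrow> (complex \<Rightarrow> complex) \<Rightarrow> complex set" where
  "dirset e f = {z. \<exists>D. ((\<lambda>h. dirq e f h z) \<longlongrightarrow> D) (at 0)}"

text \<open>The determinant of the real matrix whose columns are the partial derivatives.\<close>

definition jac :: "(complex \<Rightarrow> complex) \<Rightarrow> complex \<Rightarrow> real" where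
  "jac f z = Im (cnj (dird 1 f z) * dird \<i> f z)"

lemma has_vector_derivative_iff_quotient:
  fixes g :: "real \<Rightarrow> 'a::real_normed_vector"
  shows "(g has_vector_derivative D) (at x) \<longleftrightarrow> ((\<lambda>h. (g (x + h) - g x) /\<^sub>R h) \<longlongrightarrow> D) (at 0)"
proof -
  have "(g has_vector_derivative D) (at x) \<longleftrightarrow> ((\<lambda>h. norm (g (x + h) - g x - h *\<^sub>R D) / norm h) \<longlongrightarrow> 0) (at 0)"
    unfolding has_vector_derivative_def has_derivative_at by (simp add: bounded_linear_scaleR_left)
  also have "\<dots> \<longleftrightarrow> ((\<lambda>h. norm ((g (x + h) - g x) /\<^sub>R h - D)) \<longlongrightarrow> 0) (at 0)"
  proof (rule tendsto_cong)
    have "norm (g (x + h) - g x - h *\<^sub>R D) / norm h = norm ((g (x + h) - g x) /\<^sub>R h - D)" if "h \<noteq> 0" for h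
    proof -
      have "(g (x + h) - g x) /\<^sub>R h - D = (g (x + h) - g x - h *\<^sub>R D) /\<^sub>R h"
        using that by (simp add: scaleR_diff_right)
      then show ?thesis by (simp add: divide_inverse_commute)
    qed
    then show "\<forall>\<^sub>F h in at 0. norm (g (x + h) - g x - h *\<^sub>R D) / norm h = norm ((g (x + h) - g x) /\<^sub>R h - D)"
      by (simp add: eventually_at_filter)
  qed
  also have "\<dots> \<longleftrightarrow> ((\<lambda>h. (g (x + h) - g x) /\<^sub>R h) \<longlongrightarrow> D) (at 0)"
    by (simp add: tendsto_norm_zero_iff LIM_zero_iff)
  finally show ?thesis .
qed

lemma dird_tendsto:
  assumes "((\<lambda>h. dirq e f h z) \<longlongrightarrow> D) (at 0)"
  shows "dird e f z = D"
proof -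
  have "filterlim (\<lambda>n. 1 / real (Suc n)) (at 0) sequentially"
    unfolding filterlim_at using LIMSEQ_inverse_real_of_nat by (auto simp: inverse_eq_divide)
  then have "(\<lambda>n. dirq e f (1 / real (Suc n)) z) \<longlonglongrightarrow> D"
    using filterlim_compose[OF assms] by blast
  then show ?thesis unfolding dird_def by (rule limI)
qed

lemma dirq_Complex:
  "dirq 1 f h (Complex x y) = (f (Complex (x + h) y) - f (Complex x y)) /\<^sub>R h"
  "dirq \<i> f h (Complex x y) = (f (Complex x (y + h)) - f (Complex x y)) /\<^sub>R h"
proof -
  have "Complex x y + of_real h * 1 = Complex (x + h) y" "Complex x y + of_real h * \<i> = Complex x (y + h)"
    by (auto simp: complex_eq_iff)
  then show "dirq 1 f h (Complex x y) = (f (Complex (x + h) y) - f (Complex x y)) /\<^sub>R h"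
    "dirq \<i> f h (Complex x y) = (f (Complex x (y + h)) - f (Complex x y)) /\<^sub>R h"
    unfolding dirq_def by simp_all
qed

lemma line_derivative_iff:
  "((\<lambda>x. f (Complex x y)) has_vector_derivative D) (at x) \<longleftrightarrow> ((\<lambda>h. dirq 1 f h (Complex x y)) \<longlongrightarrow> D) (at 0)"
  "((\<lambda>y. f (Complex x y)) has_vector_derivative D) (at y) \<longleftrightarrow> ((\<lambda>h. dirq \<i> f h (Complex x y)) \<longlongrightarrow> D) (at 0)"
  unfolding has_vector_derivative_iff_quotient dirq_Complex by (rule refl)+

text \<open>Connects the partial derivatives in the definition of quasiconformality with the
  measurable \<open>dird\<close>. Where a derivative fails to exist the two may differ.\<close>

lemma partial_eq_dird:
  "z \<in> dirset 1 f \<Longrightarrow> partial_x f z = dird 1 f z"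
  "z \<in> dirset \<i> f \<Longrightarrow> partial_y f z = dird \<i> f z"
proof -
  assume "z \<in> dirset 1 f"
  then obtain D where D: "((\<lambda>h. dirq 1 f h (Complex (Re z) (Im z))) \<longlongrightarrow> D) (at 0)"
    unfolding dirset_def by auto
  then have "((\<lambda>x. f (Complex x (Im z))) has_vector_derivative D) (at (Re z))"
    by (simp only: line_derivative_iff)
  then show "partial_x f z = dird 1 f z"
    using dird_tendsto[OF D] by (simp add: partial_x_def vector_derivative_at)
next
  assume "z \<in> dirset \<i> f"
  then obtain D where D: "((\<lambda>h. dirq \<i> f h (Complex (Re z) (Im z))) \<longlongrightarrow> D) (at 0)"
    unfolding dirset_def by auto
  then have "((\<lambda>y. f (Complex (Re z) y)) has_vector_derivative D) (at (Im z))"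
    by (simp only: line_derivative_iff)
  then show "partial_y f z = dird \<i> f z"
    using dird_tendsto[OF D] by (simp add: partial_y_def vector_derivative_at)
qed

text \<open>A Cauchy condition on difference quotients, in which the limit does not occur. For
  continuous \<open>f\<close> it is an intersection of closed conditions on \<open>z\<close>, hence
  closed, which yields the measurability of \<open>dirset\<close>.\<close>

definition cauchy_set :: "complex \<Rightarrow> (complex \<Rightarrow> complex) \<Rightarrow> real \<Rightarrow> real \<Rightarrow> complex set" where
  "cauchy_set e f \<epsilon> \<delta> = {z. \<forall>h k. 0 < \<bar>h\<bar> \<and> \<bar>h\<bar> < \<delta> \<and> 0 < \<bar>k\<bar> \<and> \<bar>k\<bar> < \<delta> \<longrightarrow> norm (dirq e f h z - dirq e f k z) \<le> \<epsilon>}"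

lemma continuous_dirq:
  assumes "continuous_on UNIV f"
  shows "continuous_on UNIV (dirq e f h)"
proof -
  have "continuous_on UNIV (\<lambda>z. f (z + of_real h * e))"
    by (rule continuous_on_compose2[OF assms]) (auto intro!: continuous_intros)
  then have "continuous_on UNIV (\<lambda>z. (f (z + of_real h * e) - f z) /\<^sub>R h)"
    using assms by (intro continuous_intros) auto
  then show ?thesis by (simp add: dirq_def[abs_def])
qed

lemma closed_cauchy_set:
  assumes "continuous_on UNIV f"
  shows "closed (cauchy_set e f \<epsilon> \<delta>)"
proof -
  have "cauchy_set e f \<epsilon> \<delta> = (\<Inter>h\<in>{h. 0 < \<bar>h\<bar> \<and> \<bar>h\<bar> < \<delta>}. \<Inter>k\<in>{k. 0 < \<bar>k\<bar> \<and> \<bar>k\<bar> < \<delta>}. {z. norm (dirq e f h z - dirq e f k z) \<le> \<epsilon>})"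
    unfolding cauchy_set_def by auto
  then show ?thesis
    using continuous_dirq[OF assms]
    by (auto intro!: closed_INT closed_Collect_le continuous_intros)
qed

lemma cauchy_set_mono: "\<delta>' \<le> \<delta> \<Longrightarrow> cauchy_set e f \<epsilon> \<delta> \<subseteq> cauchy_set e f \<epsilon> \<delta>'"
  unfolding cauchy_set_def by auto

lemma cauchy_set_limit:
  assumes z: "\<And>n. z \<in> cauchy_set e f (1 / real (Suc n)) (\<delta> n)" and \<delta>: "\<And>n. \<delta> n > 0"
  shows "((\<lambda>h. dirq e f h z) \<longlongrightarrow> dird e f z) (at 0)"
    and "\<And>n h. 0 < \<bar>h\<bar> \<Longrightarrow> \<bar>h\<bar> < \<delta> n \<Longrightarrow> norm (dirq e f h z - dird e f z) \<le> 1 / real (Suc n)"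
proof -
  define q where "q n = dirq e f (1 / real (Suc n)) z" for n
  have small: "\<exists>N. \<forall>m\<ge>N. 1 / real (Suc m) < \<delta> n" for n
  proof -
    obtain N where N: "inverse (real (Suc N)) < \<delta> n" using reals_Archimedean[OF \<delta>[of n]] by blast
    have "1 / real (Suc m) < \<delta> n" if "m \<ge> N" for m
    proof -
      have "1 / real (Suc m) \<le> 1 / real (Suc N)" using that by (intro divide_left_mono) auto
      then show ?thesis using N by (simp add: inverse_eq_divide)
    qed
    then show ?thesis by blast
  qed
  have "Cauchy q"
  proof (rule metric_CauchyI)
    fix \<epsilon> :: real assume "\<epsilon> > 0"
    then obtain n where n: "inverse (real (Suc n)) < \<epsilon>" using reals_Archimedean by blast
    obtain N where N: "\<And>m. m \<ge> N \<Longrightarrow> 1 / real (Suc m) < \<delta> n" using small by blast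
    have "dist (q m) (q k) < \<epsilon>" if "m \<ge> N" "k \<ge> N" for m k
    proof -
      have "norm (dirq e f (1 / real (Suc m)) z - dirq e f (1 / real (Suc k)) z) \<le> 1 / real (Suc n)"
        using z[of n] N[OF that(1)] N[OF that(2)] unfolding cauchy_set_def by auto
      then show ?thesis using n by (simp add: q_def dist_norm inverse_eq_divide)
    qed
    then show "\<exists>M. \<forall>m\<ge>M. \<forall>n\<ge>M. dist (q m) (q n) < \<epsilon>" by blast
  qed
  then have lim: "q \<longlonglongrightarrow> dird e f z"
    unfolding dird_def q_def[symmetric] by (simp add: Cauchy_convergent convergent_LIMSEQ_iff[symmetric])
  show *: "norm (dirq e f h z - dird e f z) \<le> 1 / real (Suc n)" if h: "0 < \<bar>h\<bar>" "\<bar>h\<bar> < \<delta> n" for n h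
  proof -
    have "(\<lambda>m. norm (dirq e f h z - q m)) \<longlonglongrightarrow> norm (dirq e f h z - dird e f z)"
      by (intro tendsto_intros lim)
    moreover obtain N where N: "\<And>m. m \<ge> N \<Longrightarrow> 1 / real (Suc m) < \<delta> n" using small by blast
    have "\<forall>m\<ge>N. norm (dirq e f h z - q m) \<le> 1 / real (Suc n)"
      using z[of n] h N unfolding cauchy_set_def q_def by auto
    ultimately show ?thesis by (rule Lim_bounded)
  qed
  show "((\<lambda>h. dirq e f h z) \<longlongrightarrow> dird e f z) (at 0)"
  proof (rule tendstoI)
    fix \<epsilon> :: real assume "\<epsilon> > 0"
    then obtain n where n: "inverse (real (Suc n)) < \<epsilon>" using reals_Archimedean by blast
    show "\<forall>\<^sub>F h in at 0. dist (dirq e f h z) (dird e f z) < \<epsilon>"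
      unfolding eventually_at
    proof (intro exI[of _ "\<delta> n"] conjI \<delta> ballI impI)
      fix h :: real assume "h \<noteq> 0 \<and> dist h 0 < \<delta> n"
      then have "norm (dirq e f h z - dird e f z) \<le> 1 / real (Suc n)" by (intro *) auto
      then show "dist (dirq e f h z) (dird e f z) < \<epsilon>" using n by (simp add: dist_norm inverse_eq_divide)
    qed
  qed
qed

lemma dirset_iff:
  "z \<in> dirset e f \<longleftrightarrow> (\<forall>n. \<exists>m. z \<in> cauchy_set e f (1 / real (Suc n)) (1 / real (Suc m)))"
proof
  assume "z \<in> dirset e f"
  then obtain D where D: "((\<lambda>h. dirq e f h z) \<longlongrightarrow> D) (at 0)" unfolding dirset_def by blast
  show "\<forall>n. \<exists>m. z \<in> cauchy_set e f (1 / real (Suc n)) (1 / real (Suc m))"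
  proof
    fix n
    have "\<forall>\<^sub>F h in at 0. dist (dirq e f h z) D < (1 / real (Suc n)) / 2" using D by (rule tendstoD) simp
    then obtain d where d: "d > 0" "\<And>h. h \<noteq> 0 \<Longrightarrow> dist h 0 < d \<Longrightarrow> dist (dirq e f h z) D < (1 / real (Suc n)) / 2"
      unfolding eventually_at by blast
    obtain m where m: "inverse (real (Suc m)) < d" using reals_Archimedean[OF d(1)] by blast
    have "z \<in> cauchy_set e f (1 / real (Suc n)) (1 / real (Suc m))"
      unfolding cauchy_set_def
    proof (intro CollectI allI impI)
      fix h k assume "0 < \<bar>h\<bar> \<and> \<bar>h\<bar> < 1 / real (Suc m) \<and> 0 < \<bar>k\<bar> \<and> \<bar>k\<bar> < 1 / real (Suc m)"
      moreover have "dist (dirq e f t z) D < (1 / real (Suc n)) / 2" if "0 < \<bar>t\<bar>" "\<bar>t\<bar> < 1 / real (Suc m)" for t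
        by (rule d(2)) (use that m in \<open>auto simp: inverse_eq_divide\<close>)
      ultimately have "dist (dirq e f h z) D < (1 / real (Suc n)) / 2" "dist (dirq e f k z) D < (1 / real (Suc n)) / 2"
        by blast+
      then have "dist (dirq e f h z) (dirq e f k z) < 1 / real (Suc n)" by (rule dist_triangle_half_l)
      then show "norm (dirq e f h z - dirq e f k z) \<le> 1 / real (Suc n)" by (simp add: dist_norm)
    qed
    then show "\<exists>m. z \<in> cauchy_set e f (1 / real (Suc n)) (1 / real (Suc m))" by blast
  qed
next
  assume "\<forall>n. \<exists>m. z \<in> cauchy_set e f (1 / real (Suc n)) (1 / real (Suc m))"
  then obtain m where m: "\<And>n. z \<in> cauchy_set e f (1 / real (Suc n)) (1 / real (Suc (m n)))" by metis
  have "((\<lambda>h. dirq e f h z) \<longlongrightarrow> dird e f z) (at 0)"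
    by (rule cauchy_set_limit[of z e f "\<lambda>n. 1 / real (Suc (m n))"]) (use m in auto)
  then show "z \<in> dirset e f" unfolding dirset_def by blast
qed

lemma dirset_tendsto: "z \<in> dirset e f \<Longrightarrow> ((\<lambda>h. dirq e f h z) \<longlongrightarrow> dird e f z) (at 0)"
  using dird_tendsto unfolding dirset_def by blast

lemma dirset_measurable [measurable]:
  assumes "continuous_on UNIV f"
  shows "dirset e f \<in> sets borel"
proof -
  have "dirset e f = (\<Inter>n. \<Union>m. cauchy_set e f (1 / real (Suc n)) (1 / real (Suc m)))"
    by (auto simp: dirset_iff)
  moreover have "cauchy_set e f a b \<in> sets borel" for a b using closed_cauchy_set[OF assms] by auto
  ultimately show ?thesis by auto
qed

lemma dird_measurable:
  assumes "continuous_on UNIV f"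
  shows "dird e f \<in> borel_measurable borel"
  unfolding dird_def[abs_def]
  by (rule borel_measurable_lim_metric) (use continuous_dirq[OF assms] in \<open>auto intro: borel_measurable_continuous_onI\<close>)

section \<open>Uniform convergence off small sets, and the area inequality\<close>

text \<open>Egorov's argument. For each \<open>j\<close>, the thresholds \<open>\<delta> j n\<close>
  are chosen such that \<open>A n (\<delta> j n)\<close> misses less than \<open>(1/2)^(n+j)\<close>
  of the ball of radius \<open>j\<close>. Summing over \<open>n\<close>, the set of points lying in
  all of them misses at most \<open>2 * (1/2)^j\<close> of that ball, so these sets exhaust almost
  everything as \<open>j\<close> grows.\<close>

lemma egorov_exhaustion:
  fixes A :: "nat \<Rightarrow> nat \<Rightarrow> 'a::euclidean_space set"
  assumes [measurable]: "\<And>n m. A n m \<in> sets borel" and mono: "\<And>n. incseq (A n)"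
    and ae: "AE z in lborel. \<forall>n. \<exists>m. z \<in> A n m"
  shows "\<exists>\<delta> :: nat \<Rightarrow> nat \<Rightarrow> nat. AE z in lborel. \<exists>j. \<forall>n. z \<in> A n (\<delta> j n)"
proof -
  have "\<exists>m. emeasure lborel (ball 0 (real j) - A n m) < ennreal ((1/2)^(n+j))" for j n
  proof -
    let ?B = "\<lambda>m. ball 0 (real j) - A n m"
    have "(\<lambda>m. emeasure lborel (?B m)) \<longlonglongrightarrow> emeasure lborel (\<Inter>m. ?B m)"
    proof (rule Lim_emeasure_decseq)
      show "decseq ?B" using mono[of n] unfolding incseq_def decseq_def by blast
      show "emeasure lborel (?B m) \<noteq> \<infinity>" for m
      proof -
        have "emeasure lborel (?B m) \<le> emeasure lborel (ball (0::'a) (real j))" by (rule emeasure_mono) auto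
        also have "\<dots> < \<infinity>" by (rule emeasure_lborel_ball_finite)
        finally show ?thesis by simp
      qed
    qed auto
    moreover have "emeasure lborel (\<Inter>m. ?B m) = 0"
    proof -
      have "(\<Inter>m. ?B m) \<in> null_sets lborel"
        by (rule AE_iff_null_sets[THEN iffD2]) (use ae in \<open>auto elim!: eventually_mono\<close>)
      then show ?thesis by auto
    qed
    ultimately have "(\<lambda>m. emeasure lborel (?B m)) \<longlonglongrightarrow> 0" by simp
    then have "\<forall>\<^sub>F m in sequentially. emeasure lborel (?B m) < ennreal ((1/2)^(n+j))"
      by (rule order_tendstoD) (simp add: ennreal_less_zero_iff)
    then show ?thesis by (auto simp: eventually_sequentially)
  qed
  then obtain \<delta> where \<delta>: "\<And>j n. emeasure lborel (ball 0 (real j) - A n (\<delta> j n)) < ennreal ((1/2)^(n+j))" by metis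
  define N where "N = {z. \<forall>j. \<exists>n. z \<notin> A n (\<delta> j n)}"
  have [measurable]: "N \<in> sets borel" unfolding N_def by measurable
  have "emeasure lborel (N \<inter> ball 0 (real k)) = 0" for k
  proof -
    have le: "emeasure lborel (N \<inter> ball 0 (real k)) \<le> ennreal (2 * (1/2)^j)" if "k \<le> j" for j
    proof -
      have "N \<inter> ball 0 (real k) \<subseteq> (\<Union>n. ball 0 (real j) - A n (\<delta> j n))" using that unfolding N_def by force
      then have "emeasure lborel (N \<inter> ball 0 (real k)) \<le> emeasure lborel (\<Union>n. ball 0 (real j) - A n (\<delta> j n))"
        by (rule emeasure_mono) auto
      also have "\<dots> \<le> (\<Sum>n. emeasure lborel (ball 0 (real j) - A n (\<delta> j n)))"
        by (rule emeasure_subadditive_countably) auto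
      also have "\<dots> \<le> (\<Sum>n. ennreal ((1/2)^j * (1/2)^n))"
        using \<delta>[of j] by (intro suminf_le) (auto simp: power_add mult.commute intro: less_imp_le)
      also have "\<dots> = ennreal (\<Sum>n. (1/2)^j * (1/2)^n)"
        by (intro suminf_ennreal_eq summable_sums summable_mult summable_geometric) auto
      also have "(\<Sum>n. (1/2)^j * (1/2)^n) = 2 * (1/2::real)^j"
        by (subst suminf_mult) (auto simp: suminf_geometric)
      finally show ?thesis .
    qed
    have "(\<lambda>j. ennreal (2 * (1/2)^j)) \<longlonglongrightarrow> ennreal (2 * 0)"
      by (intro tendsto_ennrealI tendsto_mult tendsto_const LIMSEQ_power_zero) auto
    then have "emeasure lborel (N \<inter> ball 0 (real k)) \<le> ennreal (2 * 0)"
      by (rule Lim_bounded2) (use le in blast)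
    then show ?thesis by simp
  qed
  then have "emeasure lborel (\<Union>k. N \<inter> ball 0 (real k)) = 0"
    by (intro emeasure_UN_eq_0) auto
  moreover have "(\<Union>k. N \<inter> ball 0 (real k)) = N"
  proof -
    have "\<exists>k. z \<in> ball 0 (real k)" for z :: 'a using reals_Archimedean2[of "norm z"] by auto
    then show ?thesis by blast
  qed
  ultimately have "N \<in> null_sets lborel" by auto
  then have "AE z in lborel. z \<notin> N" by (rule AE_not_in)
  then have "AE z in lborel. \<exists>j. \<forall>n. z \<in> A n (\<delta> j n)" unfolding N_def by simp
  then show ?thesis by (intro exI[where x = \<delta>])
qed

text \<open>On a set where the difference quotients in both coordinate directions converge uniformly, the
  partial derivatives are continuous, and \<open>f\<close> is differentiable relative to that set: from \<open>z\<close> to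
  \<open>w\<close> one moves vertically, using the expansion at \<open>z\<close>, and then horizontally, using the expansion
  at \<open>w\<close>.\<close>

lemma derivative_within_uniform_set:
  assumes f: "continuous_on UNIV f" and \<delta>: "\<And>n. \<delta> n > 0" and z: "z \<in> G"
    and G: "\<And>z n. z \<in> G \<Longrightarrow> z \<in> cauchy_set 1 f (1 / real (Suc n)) (\<delta> n)"
           "\<And>z n. z \<in> G \<Longrightarrow> z \<in> cauchy_set \<i> f (1 / real (Suc n)) (\<delta> n)"
  shows "(f has_derivative (\<lambda>h. Re h *\<^sub>R dird 1 f z + Im h *\<^sub>R dird \<i> f z)) (at z within G)"
  unfolding has_derivative_within_alt
proof (intro conjI allI impI)
  show "bounded_linear (\<lambda>h. Re h *\<^sub>R dird 1 f z + Im h *\<^sub>R dird \<i> f z)"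
    by (intro bounded_linear_add bounded_linear_scaleR_const bounded_linear_Re bounded_linear_Im)
  fix \<epsilon> :: real assume \<epsilon>: "\<epsilon> > 0"
  \<comment> \<open>One \<open>\<eta>\<close> is spent on each of the two legs and three on the
    oscillation of \<open>dird 1 f\<close> between \<open>w\<close> and \<open>z\<close>.\<close>
  obtain n where n: "inverse (real (Suc n)) < \<epsilon> / 5" using reals_Archimedean[of "\<epsilon>/5"] \<epsilon> by auto
  define \<eta> where "\<eta> = 1 / real (Suc n)"
  have \<eta>: "0 < \<eta>" "5 * \<eta> \<le> \<epsilon>" using n by (auto simp: \<eta>_def inverse_eq_divide)
  have px: "norm (dirq 1 f h w - dird 1 f w) \<le> \<eta>" if "w \<in> G" "0 < \<bar>h\<bar>" "\<bar>h\<bar> < \<delta> n" for w h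
    unfolding \<eta>_def by (rule cauchy_set_limit(2)[OF G(1)[OF that(1)] \<delta> that(2,3)])
  have py: "norm (dirq \<i> f h w - dird \<i> f w) \<le> \<eta>" if "w \<in> G" "0 < \<bar>h\<bar>" "\<bar>h\<bar> < \<delta> n" for w h
    unfolding \<eta>_def by (rule cauchy_set_limit(2)[OF G(2)[OF that(1)] \<delta> that(2,3)])
  \<comment> \<open>Continuity of \<open>dird 1 f\<close> on \<open>G\<close> is inherited from the
    difference quotient with the fixed step \<open>h0\<close>, which approximates it within
    \<open>\<eta>\<close> at every point of \<open>G\<close>.\<close>
  define h0 where "h0 = \<delta> n / 2"
  have h0: "0 < \<bar>h0\<bar>" "\<bar>h0\<bar> < \<delta> n" using \<delta>[of n] by (auto simp: h0_def)
  have "continuous (at z) (dirq 1 f h0)"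
    using continuous_dirq[OF f] by (simp add: continuous_on_eq_continuous_at)
  then obtain d where d: "d > 0" "\<And>w. dist w z < d \<Longrightarrow> dist (dirq 1 f h0 w) (dirq 1 f h0 z) < \<eta>"
    unfolding continuous_at_eps_delta using \<eta>(1) by blast
  have cont: "norm (dird 1 f w - dird 1 f z) \<le> 3 * \<eta>" if "w \<in> G" "dist w z < d" for w
  proof -
    have "dird 1 f w - dird 1 f z = - (dirq 1 f h0 w - dird 1 f w) + ((dirq 1 f h0 w - dirq 1 f h0 z) + (dirq 1 f h0 z - dird 1 f z))"
      by simp
    also have "norm \<dots> \<le> norm (- (dirq 1 f h0 w - dird 1 f w)) + (norm (dirq 1 f h0 w - dirq 1 f h0 z) + norm (dirq 1 f h0 z - dird 1 f z))"
      by (intro norm_triangle_le add_left_mono norm_triangle_ineq)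
    also have "\<dots> \<le> \<eta> + (\<eta> + \<eta>)"
      using px[OF that(1) h0] px[OF z h0] d(2)[OF that(2)] by (auto simp: dist_norm norm_minus_commute)
    finally show ?thesis by simp
  qed
  show "\<exists>d>0. \<forall>w\<in>G. norm (w - z) < d \<longrightarrow>
      norm (f w - f z - (Re (w - z) *\<^sub>R dird 1 f z + Im (w - z) *\<^sub>R dird \<i> f z)) \<le> \<epsilon> * norm (w - z)"
  proof (intro exI[of _ "min d (\<delta> n)"] conjI ballI impI)
    show "min d (\<delta> n) > 0" using d(1) \<delta> by simp
    fix w assume w: "w \<in> G" "norm (w - z) < min d (\<delta> n)"
    define a where "a = Re (w - z)"
    define b where "b = Im (w - z)"
    define m where "m = z + of_real b * \<i>"
    have ab: "\<bar>a\<bar> \<le> norm (w - z)" "\<bar>b\<bar> \<le> norm (w - z)" unfolding a_def b_def by (rule abs_Re_le_cmod abs_Im_le_cmod)+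
    have mw: "m = w + of_real (- a) * 1" unfolding m_def a_def b_def by (auto simp: complex_eq_iff)
    have 1: "norm (f m - f z - b *\<^sub>R dird \<i> f z) \<le> \<eta> * norm (w - z)"
    proof (cases "b = 0")
      case True then show ?thesis using \<eta> by (simp add: m_def)
    next
      case False
      have "f m - f z = b *\<^sub>R dirq \<i> f b z" using False by (simp add: dirq_def m_def)
      then have "f m - f z - b *\<^sub>R dird \<i> f z = b *\<^sub>R (dirq \<i> f b z - dird \<i> f z)" by (simp add: scaleR_diff_right)
      then have "norm (f m - f z - b *\<^sub>R dird \<i> f z) = \<bar>b\<bar> * norm (dirq \<i> f b z - dird \<i> f z)" by simp
      also have "\<dots> \<le> norm (w - z) * \<eta>"
        using py[OF z, of b] False w ab by (intro mult_mono) auto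
      finally show ?thesis by (simp add: mult.commute)
    qed
    have 2: "norm (f w - f m - a *\<^sub>R dird 1 f w) \<le> \<eta> * norm (w - z)"
    proof (cases "a = 0")
      case True then show ?thesis using \<eta> by (simp add: mw)
    next
      case False
      have "f w - f m = a *\<^sub>R dirq 1 f (- a) w" using False by (simp add: dirq_def mw scaleR_diff_right)
      then have "f w - f m - a *\<^sub>R dird 1 f w = a *\<^sub>R (dirq 1 f (- a) w - dird 1 f w)" by (simp add: scaleR_diff_right)
      then have "norm (f w - f m - a *\<^sub>R dird 1 f w) = \<bar>a\<bar> * norm (dirq 1 f (- a) w - dird 1 f w)" by simp
      also have "\<dots> \<le> norm (w - z) * \<eta>"
        using px[OF w(1), of "- a"] False w ab by (intro mult_mono) auto
      finally show ?thesis by (simp add: mult.commute)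
    qed
    have 3: "norm (a *\<^sub>R dird 1 f w - a *\<^sub>R dird 1 f z) \<le> 3 * \<eta> * norm (w - z)"
    proof -
      have "norm (a *\<^sub>R dird 1 f w - a *\<^sub>R dird 1 f z) = \<bar>a\<bar> * norm (dird 1 f w - dird 1 f z)"
        by (simp add: scaleR_diff_right[symmetric])
      also have "\<dots> \<le> norm (w - z) * (3 * \<eta>)"
        using cont[OF w(1)] w(2) ab by (intro mult_mono) (auto simp: dist_norm)
      finally show ?thesis by (simp add: mult.commute)
    qed
    have "f w - f z - (Re (w - z) *\<^sub>R dird 1 f z + Im (w - z) *\<^sub>R dird \<i> f z) =
      (f m - f z - b *\<^sub>R dird \<i> f z) + ((f w - f m - a *\<^sub>R dird 1 f w) + (a *\<^sub>R dird 1 f w - a *\<^sub>R dird 1 f z))"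
      by (simp add: a_def b_def)
    also have "norm \<dots> \<le> norm (f m - f z - b *\<^sub>R dird \<i> f z) + (norm (f w - f m - a *\<^sub>R dird 1 f w) + norm (a *\<^sub>R dird 1 f w - a *\<^sub>R dird 1 f z))"
      by (intro norm_triangle_le add_left_mono norm_triangle_ineq)
    also have "\<dots> \<le> 5 * \<eta> * norm (w - z)" using 1 2 3 by (simp add: algebra_simps)
    also have "\<dots> \<le> \<epsilon> * norm (w - z)" using \<eta> by (intro mult_right_mono) auto
    finally show "norm (f w - f z - (Re (w - z) *\<^sub>R dird 1 f z + Im (w - z) *\<^sub>R dird \<i> f z)) \<le> \<epsilon> * norm (w - z)" .
  qed
qed

text \<open>Up to a null set, the plane is split into countably many disjoint Borel pieces inside
  sets of uniform convergence. The area formula holds on each piece, and injectivity makes the image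
  areas add up. The image of the remaining null set is not controlled, so the total is only bounded
  by the area of the whole image.\<close>

lemma area_inequality:
  fixes f g :: "complex \<Rightarrow> complex"
  assumes hom: "homeomorphism UNIV UNIV f g"
    and ae: "AE z in lborel. z \<in> dirset 1 f" "AE z in lborel. z \<in> dirset \<i> f"
    and X: "X \<in> sets borel"
  shows "(\<integral>\<^sup>+z\<in>X. ennreal \<bar>jac f z\<bar> \<partial>lborel) \<le> emeasure lborel (f ` X)"
proof -
  have f: "continuous_on UNIV f" and g: "continuous_on UNIV g"
    and fg: "f (g x) = x" "g (f x) = x" for x
    using hom by (auto simp: homeomorphism_def)
  have [measurable]: "dird 1 f \<in> borel_measurable borel" "dird \<i> f \<in> borel_measurable borel"
    using dird_measurable[OF f] by auto
  have J[measurable]: "jac f \<in> borel_measurable borel" unfolding jac_def[abs_def] by measurable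
  have im: "f ` S = g -` S" for S
  proof
    show "g -` S \<subseteq> f ` S"
    proof
      fix x assume "x \<in> g -` S" then show "x \<in> f ` S" using fg(1)[of x] by (intro image_eqI[of _ _ "g x"]) auto
    qed
  qed (use fg in auto)
  have imb: "f ` S \<in> sets borel" if "S \<in> sets borel" for S
    unfolding im using measurable_sets[OF borel_measurable_continuous_onI[OF g] that] by simp
  define A where "A n m = cauchy_set 1 f (1 / real (Suc n)) (1 / real (Suc m)) \<inter> cauchy_set \<i> f (1 / real (Suc n)) (1 / real (Suc m))" for n m
  have Am[measurable]: "A n m \<in> sets borel" for n m
    unfolding A_def using closed_cauchy_set[OF f] by auto
  have inc: "incseq (A n)" for n
  proof (rule incseq_SucI)
    fix m
    have "1 / real (Suc (Suc m)) \<le> 1 / real (Suc m)" by (intro divide_left_mono) auto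
    then show "A n m \<subseteq> A n (Suc m)" unfolding A_def using cauchy_set_mono by blast
  qed
  have Aae: "AE z in lborel. \<forall>n. \<exists>m. z \<in> A n m"
    using ae
  proof eventually_elim
    case (elim z)
    show ?case
    proof
      fix n
      obtain m1 m2 where m: "z \<in> cauchy_set 1 f (1 / real (Suc n)) (1 / real (Suc m1))" "z \<in> cauchy_set \<i> f (1 / real (Suc n)) (1 / real (Suc m2))"
        using elim unfolding dirset_iff by blast
      have "1 / real (Suc (max m1 m2)) \<le> 1 / real (Suc m1)" "1 / real (Suc (max m1 m2)) \<le> 1 / real (Suc m2)"
        by (intro divide_left_mono; simp)+
      then have "z \<in> A n (max m1 m2)" unfolding A_def using m cauchy_set_mono by blast
      then show "\<exists>m. z \<in> A n m" by blast
    qed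
  qed
  obtain \<delta> :: "nat \<Rightarrow> nat \<Rightarrow> nat" where \<delta>: "AE z in lborel. \<exists>j. \<forall>n. z \<in> A n (\<delta> j n)"
    using egorov_exhaustion[OF Am inc Aae] by (rule exE)
  define G where "G j = (\<Inter>n. A n (\<delta> j n))" for j
  define D where "D = disjointed G"
  have Gm: "G j \<in> sets borel" for j unfolding G_def by measurable
  have Dm[measurable]: "D j \<in> sets borel" for j unfolding D_def using Gm sets.range_disjointed_sets[of G borel] by blast
  have DG: "D j \<subseteq> G j" for j unfolding D_def by (rule disjointed_subset)
  have Ddis: "disjoint_family D" unfolding D_def by (rule disjoint_family_disjointed)
  have Dae: "AE z in lborel. z \<in> (\<Union>j. D j)"
    using \<delta> unfolding D_def UN_disjointed_eq G_def by simp
  have inj: "inj_on f S" for S by (rule inj_on_inverseI[of _ g]) (use fg in auto)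
  have part: "(\<integral>\<^sup>+z\<in>X \<inter> D j. ennreal \<bar>jac f z\<bar> \<partial>lborel) = emeasure lborel (f ` (X \<inter> D j))" for j
    unfolding jac_def
  proof (rule area_formula)
    show "X \<inter> D j \<in> sets borel" using X by measurable
    then show "f ` (X \<inter> D j) \<in> sets borel" by (rule imb)
    fix z assume z: "z \<in> X \<inter> D j"
    have "(f has_derivative (\<lambda>h. Re h *\<^sub>R dird 1 f z + Im h *\<^sub>R dird \<i> f z)) (at z within G j)"
      by (rule derivative_within_uniform_set[OF f, of "\<lambda>n. 1 / real (Suc (\<delta> j n))"])
        (use z DG in \<open>auto simp: G_def A_def\<close>)
    then show "(f has_derivative (\<lambda>h. Re h *\<^sub>R dird 1 f z + Im h *\<^sub>R dird \<i> f z)) (at z within X \<inter> D j)"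
      by (rule has_derivative_subset) (simp add: DG le_infI2)
  qed (use inj in auto)
  have "(\<integral>\<^sup>+z\<in>X. ennreal \<bar>jac f z\<bar> \<partial>lborel) = (\<integral>\<^sup>+z\<in>(\<Union>j. X \<inter> D j). ennreal \<bar>jac f z\<bar> \<partial>lborel)"
    by (rule nn_integral_cong_AE) (use Dae in eventually_elim, auto simp: indicator_def)
  also have "\<dots> = (\<Sum>j. \<integral>\<^sup>+z\<in>X \<inter> D j. ennreal \<bar>jac f z\<bar> \<partial>lborel)"
  proof -
    have "indicator (\<Union>j. X \<inter> D j) z = (\<Sum>j. indicator (X \<inter> D j) z :: ennreal)" for z
      by (rule suminf_indicator[symmetric]) (use Ddis in \<open>auto simp: disjoint_family_on_def\<close>)
    then have "(\<integral>\<^sup>+z\<in>(\<Union>j. X \<inter> D j). ennreal \<bar>jac f z\<bar> \<partial>lborel) = (\<integral>\<^sup>+z. (\<Sum>j. ennreal \<bar>jac f z\<bar> * indicator (X \<inter> D j) z) \<partial>lborel)"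
      by (simp add: ennreal_suminf_cmult)
    also have "\<dots> = (\<Sum>j. \<integral>\<^sup>+z\<in>X \<inter> D j. ennreal \<bar>jac f z\<bar> \<partial>lborel)"
      by (rule nn_integral_suminf) (use X in measurable)
    finally show ?thesis .
  qed
  also have "\<dots> = (\<Sum>j. emeasure lborel (f ` (X \<inter> D j)))" by (simp add: part)
  also have "\<dots> = emeasure lborel (\<Union>j. f ` (X \<inter> D j))"
  proof (rule suminf_emeasure)
    have "f ` (X \<inter> D j) \<in> sets lborel" for j
      using imb[OF sets.Int[OF X Dm[of j]]] by (simp only: sets_lborel)
    then show "range (\<lambda>j. f ` (X \<inter> D j)) \<subseteq> sets lborel" by (rule image_subsetI)
    show "disjoint_family (\<lambda>j. f ` (X \<inter> D j))"
      unfolding disjoint_family_on_def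
    proof (intro ballI impI)
      fix i j :: nat assume "i \<noteq> j"
      then have "D i \<inter> D j = {}" using Ddis by (simp add: disjoint_family_on_def)
      then show "f ` (X \<inter> D i) \<inter> f ` (X \<inter> D j) = {}" unfolding im by auto
    qed
  qed
  also have "\<dots> \<le> emeasure lborel (f ` X)"
  proof (rule emeasure_mono)
    show "(\<Union>j. f ` (X \<inter> D j)) \<subseteq> f ` X" by (intro UN_least image_mono Int_lower1)
    show "f ` X \<in> sets lborel" using imb[OF X] by (simp only: sets_lborel)
  qed
  finally show ?thesis .
qed

text \<open>The inequality for sets says that the image under \<open>f\<close> of the measure with
  density \<open>|jac f|\<close> is dominated by Lebesgue measure; integrating \<open>\<rho>\<close>
  against both gives the claim.\<close>

lemma area_inequality_weighted:
  fixes f g :: "complex \<Rightarrow> complex" and \<rho> :: "complex \<Rightarrow> ennreal"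
  assumes hom: "homeomorphism UNIV UNIV f g"
    and ae: "AE z in lborel. z \<in> dirset 1 f" "AE z in lborel. z \<in> dirset \<i> f"
    and [measurable]: "\<rho> \<in> borel_measurable borel"
  shows "(\<integral>\<^sup>+z. ennreal \<bar>jac f z\<bar> * \<rho> (f z) \<partial>lborel) \<le> (\<integral>\<^sup>+w. \<rho> w \<partial>lborel)"
proof -
  have f: "continuous_on UNIV f" using hom by (auto simp: homeomorphism_def)
  have [measurable]: "f \<in> borel_measurable borel" using f by (rule borel_measurable_continuous_onI)
  have [measurable]: "dird 1 f \<in> borel_measurable borel" "dird \<i> f \<in> borel_measurable borel"
    using dird_measurable[OF f] by auto
  have J[measurable]: "jac f \<in> borel_measurable borel" unfolding jac_def[abs_def] by measurable
  let ?M = "distr (density lborel (\<lambda>z. ennreal \<bar>jac f z\<bar>)) borel f"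
  have "(\<integral>\<^sup>+z. ennreal \<bar>jac f z\<bar> * \<rho> (f z) \<partial>lborel) = (\<integral>\<^sup>+w. \<rho> w \<partial>?M)"
    by (subst nn_integral_distr, simp, simp, subst nn_integral_density) auto
  also have "\<dots> \<le> (\<integral>\<^sup>+w. \<rho> w \<partial>lborel)"
  proof (rule nn_integral_mono_measure)
    show "?M \<le> lborel"
    proof (subst le_measure)
      show "\<forall>A\<in>sets ?M. emeasure ?M A \<le> emeasure lborel A"
      proof
        fix A assume "A \<in> sets ?M"
        then have A[measurable]: "A \<in> sets borel" by simp
        have fA: "f -` A \<in> sets borel" using measurable_sets[of f borel borel A] A by simp
        have "emeasure ?M A = (\<integral>\<^sup>+z\<in>f -` A. ennreal \<bar>jac f z\<bar> \<partial>lborel)"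
          using fA by (subst emeasure_distr, simp, simp, subst emeasure_density) auto
        also have "\<dots> \<le> emeasure lborel (f ` (f -` A))" by (rule area_inequality[OF hom ae fA])
        also have "f ` (f -` A) = A" using hom by (auto simp: homeomorphism_def)
        finally show "emeasure ?M A \<le> emeasure lborel A" .
      qed
    qed simp
  qed simp
  finally show ?thesis .
qed

subsection \<open>Quasiconformal mappings of the plane\<close>

text \<open>The upper gradient inequality of analysis on metric spaces, required on the segments of
  almost every line parallel to an axis.\<close>

definition upper_gradient :: "(complex \<Rightarrow> complex) \<Rightarrow> (complex \<Rightarrow> ennreal) \<Rightarrow> bool" where
  "upper_gradient u \<rho> \<longleftrightarrow>
    (AE y in lborel. \<forall>a b. a \<le> b \<longrightarrow> ennreal (cmod (u (Complex b y) - u (Complex a y))) \<le> (\<integral>\<^sup>+x\<in>{a..b}. \<rho> (Complex x y) \<partial>lborel)) \<and>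
    (AE x in lborel. \<forall>a b. a \<le> b \<longrightarrow> ennreal (cmod (u (Complex x b) - u (Complex x a))) \<le> (\<integral>\<^sup>+y\<in>{a..b}. \<rho> (Complex x y) \<partial>lborel))"

text \<open>A chain rule inequality for an outer map \<open>T\<close> known only by its local
  Lipschitz constant \<open>\<sigma>\<close> at the point. It covers truncated functions at the
  circles where truncation destroys differentiability.\<close>

lemma derivative_compose_bound:
  fixes h :: "real \<Rightarrow> complex" and T :: "complex \<Rightarrow> complex"
  assumes h: "(h has_vector_derivative P) (at t)"
    and Th: "((\<lambda>t. T (h t)) has_vector_derivative D) (at t)"
    and T: "\<And>\<epsilon>. \<epsilon> > 0 \<Longrightarrow> \<forall>\<^sub>F w in nhds (h t). cmod (T w - T (h t)) \<le> (\<sigma> + \<epsilon>) * cmod (w - h t)"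
  shows "cmod D \<le> \<sigma> * cmod P"
proof -
  have le: "cmod D \<le> (\<sigma> + \<epsilon>) * cmod P" if \<epsilon>: "\<epsilon> > 0" for \<epsilon>
  proof (rule tendsto_le)
    show "((\<lambda>s. cmod ((T (h (t + s)) - T (h t)) /\<^sub>R s)) \<longlongrightarrow> cmod D) (at 0)"
      using Th unfolding has_vector_derivative_iff_quotient by (rule tendsto_norm)
    show "((\<lambda>s. (\<sigma> + \<epsilon>) * cmod ((h (t + s) - h t) /\<^sub>R s)) \<longlongrightarrow> (\<sigma> + \<epsilon>) * cmod P) (at 0)"
      using h unfolding has_vector_derivative_iff_quotient by (intro tendsto_intros)
    have "isCont h t" using h by (rule has_vector_derivative_continuous)
    then have "((\<lambda>s. h (t + s)) \<longlongrightarrow> h t) (at 0)" by (simp add: isCont_iff)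
    then have "\<forall>\<^sub>F s in at 0. cmod (T (h (t + s)) - T (h t)) \<le> (\<sigma> + \<epsilon>) * cmod (h (t + s) - h t)"
      using T[OF \<epsilon>] unfolding filterlim_iff by blast
    then show "\<forall>\<^sub>F s in at 0. cmod ((T (h (t + s)) - T (h t)) /\<^sub>R s) \<le> (\<sigma> + \<epsilon>) * cmod ((h (t + s) - h t) /\<^sub>R s)"
    proof eventually_elim
      case (elim s)
      have "cmod ((T (h (t + s)) - T (h t)) /\<^sub>R s) = cmod (T (h (t + s)) - T (h t)) * \<bar>inverse s\<bar>"
        by (simp only: norm_scaleR mult.commute)
      also have "\<dots> \<le> (\<sigma> + \<epsilon>) * cmod (h (t + s) - h t) * \<bar>inverse s\<bar>"
        using elim by (rule mult_right_mono) simp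
      also have "\<dots> = (\<sigma> + \<epsilon>) * cmod ((h (t + s) - h t) /\<^sub>R s)"
        by (simp only: norm_scaleR mult.commute mult.left_commute)
      finally show ?case .
    qed
  qed simp
  show ?thesis
  proof (rule ccontr)
    assume n: "\<not> ?thesis"
    define d where "d = cmod D - \<sigma> * cmod P"
    have d: "d > 0" using n by (simp add: d_def)
    define e where "e = (d / 2) / (cmod P + 1)"
    have P1: "cmod P + 1 > 0" by (simp add: add_nonneg_pos)
    then have "e > 0" using d by (simp add: e_def)
    then have "d \<le> e * cmod P" using le[of e] by (simp add: d_def algebra_simps)
    also have "\<dots> \<le> e * (cmod P + 1)" using \<open>e > 0\<close> by simp
    also have "\<dots> = d / 2" using P1 by (auto simp: e_def field_simps)
    finally show False using d by simp
  qed
qed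

locale qc_plane =
  fixes K :: real and f g :: "complex \<Rightarrow> complex"
  assumes K: "1 \<le> K" and hom: "homeomorphism UNIV UNIV f g" and acl: "ACL_on UNIV f"
    and dilatation: "AE z in lebesgue. cmod (dzbar f z) \<le> (K - 1) / (K + 1) * cmod (dz f z)"
begin

lemma continuous_f: "continuous_on S f" and continuous_g: "continuous_on S g"
  using hom continuous_on_subset[of UNIV f S] continuous_on_subset[of UNIV g S] by (auto simp: homeomorphism_def)

lemma fg [simp]: "f (g w) = w" and gf [simp]: "g (f z) = z"
  using hom by (auto simp: homeomorphism_def)

lemma image_f: "f ` S = g -` S"
proof
  show "g -` S \<subseteq> f ` S"
  proof
    fix x assume "x \<in> g -` S" then show "x \<in> f ` S" by (intro image_eqI[of _ _ "g x"]) auto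
  qed
qed auto

lemma f_measurable [measurable]: "f \<in> borel_measurable borel"
  by (rule borel_measurable_continuous_onI[OF continuous_f])

lemma image_f_measurable: "S \<in> sets borel \<Longrightarrow> f ` S \<in> sets borel"
  unfolding image_f using measurable_sets[OF borel_measurable_continuous_onI[OF continuous_g]] by auto

lemma dird_f_measurable [measurable]: "dird e f \<in> borel_measurable borel"
  by (rule dird_measurable[OF continuous_f])

lemma dirset_f_measurable [measurable]: "dirset e f \<in> sets borel"
  by (rule dirset_measurable[OF continuous_f])

lemma jac_measurable [measurable]: "jac f \<in> borel_measurable borel"
  unfolding jac_def[abs_def] by measurable

lemma ae_lines:
  shows ae_line_x: "AE y in lborel. \<forall>a b. abs_continuous_on {a..b} (\<lambda>x. f (Complex x y))"
    and ae_line_y: "AE x in lborel. \<forall>a b. abs_continuous_on {a..b} (\<lambda>y. f (Complex x y))"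
  using acl unfolding ACL_on_def AE_completion_iff by auto

lemma ae_differentiable_line:
  assumes "\<forall>a b. abs_continuous_on {a..b} (h :: real \<Rightarrow> complex)"
  shows "AE t in lborel. \<exists>D. (h has_vector_derivative D) (at t)"
proof -
  define N where "N n = {x\<in>{- real n<..<real n}. \<not> (\<exists>D. (h has_vector_derivative D) (at x))}" for n
  have "negligible (N n)" for n
    unfolding N_def using assms by (intro abs_continuous_on_differentiable_ae) auto
  then have "negligible (\<Union>n. N n)" by (intro negligible_countable_Union) auto
  then have "(\<Union>n. N n) \<in> null_sets lebesgue" by (simp add: negligible_iff_null_sets)
  then have "AE t in lebesgue. t \<notin> (\<Union>n. N n)" by (rule AE_not_in)
  then have "AE t in lborel. t \<notin> (\<Union>n. N n)" by (simp only: AE_completion_iff)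
  then show ?thesis
  proof eventually_elim
    case (elim t)
    obtain n where "\<bar>t\<bar> < real n" using reals_Archimedean2 by blast
    then have "t \<in> {- real n<..<real n}" by auto
    moreover have "t \<notin> N n" using elim by blast
    ultimately show ?case unfolding N_def by simp
  qed
qed

lemma ae_dirset:
  shows ae_dirset_x: "AE z in lborel. z \<in> dirset 1 f"
    and ae_dirset_y: "AE z in lborel. z \<in> dirset \<i> f"
proof -
  have "AE y in lborel. AE x in lborel. Complex x y \<in> dirset 1 f"
    using ae_line_x
  proof eventually_elim
    case (elim y)
    show ?case using ae_differentiable_line[OF elim]
      by eventually_elim (simp only: dirset_def line_derivative_iff mem_Collect_eq)
  qed
  then show "AE z in lborel. z \<in> dirset 1 f" by (subst AE_complex_yx) auto
  have "AE x in lborel. AE y in lborel. Complex x y \<in> dirset \<i> f"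
    using ae_line_y
  proof eventually_elim
    case (elim x)
    show ?case using ae_differentiable_line[OF elim]
      by eventually_elim (simp only: dirset_def line_derivative_iff mem_Collect_eq)
  qed
  then show "AE z in lborel. z \<in> dirset \<i> f" by (subst AE_complex_xy) auto
qed

text \<open>Stated with \<open>dird\<close> so that it is a Borel predicate; almost everywhere it
  expresses the dilatation condition on \<open>dz\<close> and \<open>dzbar\<close>.\<close>

definition good_point :: "complex \<Rightarrow> bool" where
  "good_point z \<longleftrightarrow> z \<in> dirset 1 f \<and> z \<in> dirset \<i> f \<and>
     (cmod ((dird 1 f z + \<i> * dird \<i> f z) / 2) \<le> (K - 1) / (K + 1) * cmod ((dird 1 f z - \<i> * dird \<i> f z) / 2))"

lemma good_point_measurable [measurable]: "Measurable.pred borel good_point"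
  unfolding good_point_def[abs_def] by measurable

lemma ae_good_point: "AE z in lborel. good_point z"
  using ae_dirset_x ae_dirset_y dilatation[unfolded AE_completion_iff]
  by eventually_elim (simp add: good_point_def dzbar_def dz_def partial_eq_dird)

text \<open>With \<open>\<alpha> = |f_z|\<close> and \<open>\<beta> = |f_zbar|\<close>, the
  dilatation condition amounts to \<open>\<alpha> + \<beta> \<le> K (\<alpha> - \<beta>)\<close>. A
  derivative in a unit direction has modulus at most \<open>\<alpha> + \<beta>\<close>, and the
  Jacobian is \<open>(\<alpha> + \<beta>) (\<alpha> - \<beta>)\<close>.\<close>

lemma good_point_dilatation:
  assumes "good_point z"
  shows "(cmod (of_real a * dird 1 f z + of_real b * dird \<i> f z))\<^sup>2 \<le> K * jac f z * (a\<^sup>2 + b\<^sup>2)"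
proof -
  define P where "P = dird 1 f z"
  define Q where "Q = dird \<i> f z"
  define A where "A = (P - \<i> * Q) / 2"
  define B where "B = (P + \<i> * Q) / 2"
  define \<alpha> where "\<alpha> = cmod A"
  define \<beta> where "\<beta> = cmod B"
  have PQ: "P = A + B" "Q = \<i> * (A - B)" by (simp_all add: A_def B_def field_simps)
  have \<beta>\<alpha>: "\<beta> \<le> (K - 1) / (K + 1) * \<alpha>" using assms unfolding good_point_def \<alpha>_def \<beta>_def A_def B_def P_def Q_def by simp
  then have "\<beta> * (K + 1) \<le> (K - 1) * \<alpha>" using K by (simp add: field_simps)
  then have c: "\<alpha> + \<beta> \<le> K * (\<alpha> - \<beta>)" by (simp add: algebra_simps)
  have J: "jac f z = \<alpha>\<^sup>2 - \<beta>\<^sup>2"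
    unfolding jac_def P_def[symmetric] Q_def[symmetric] PQ \<alpha>_def \<beta>_def cmod_power2
    by (simp add: power2_eq_square algebra_simps)
  have "of_real a * P + of_real b * Q = A * Complex a b + B * Complex a (- b)"
    unfolding PQ by (simp add: complex_eq_iff algebra_simps)
  then have "cmod (of_real a * P + of_real b * Q) \<le> \<alpha> * cmod (Complex a b) + \<beta> * cmod (Complex a (- b))"
    by (metis norm_triangle_ineq norm_mult \<alpha>_def \<beta>_def)
  also have "\<dots> = (\<alpha> + \<beta>) * sqrt (a\<^sup>2 + b\<^sup>2)" by (simp add: complex_norm algebra_simps)
  finally have "(cmod (of_real a * P + of_real b * Q))\<^sup>2 \<le> ((\<alpha> + \<beta>) * sqrt (a\<^sup>2 + b\<^sup>2))\<^sup>2"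
    by (intro power_mono) auto
  also have "\<dots> = (\<alpha> + \<beta>) * (\<alpha> + \<beta>) * (a\<^sup>2 + b\<^sup>2)" by (simp add: power_mult_distrib power2_eq_square)
  also have "\<dots> \<le> (\<alpha> + \<beta>) * (K * (\<alpha> - \<beta>)) * (a\<^sup>2 + b\<^sup>2)"
    using c by (intro mult_right_mono mult_left_mono) (auto simp: \<alpha>_def \<beta>_def)
  also have "\<dots> = K * jac f z * (a\<^sup>2 + b\<^sup>2)" unfolding J by (simp add: power2_eq_square algebra_simps)
  finally show ?thesis by (simp add: P_def Q_def)
qed

lemma good_point_jac:
  assumes "good_point z"
  shows "jac f z \<ge> 0" "cmod (dird 1 f z) \<le> sqrt (K * jac f z)" "cmod (dird \<i> f z) \<le> sqrt (K * jac f z)"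
proof -
  have 1: "(cmod (dird 1 f z))\<^sup>2 \<le> K * jac f z" using good_point_dilatation[OF assms, of 1 0] by simp
  have 2: "(cmod (dird \<i> f z))\<^sup>2 \<le> K * jac f z" using good_point_dilatation[OF assms, of 0 1] by simp
  have "0 \<le> K * jac f z" using 1 by (meson order_trans zero_le_power2)
  then show "jac f z \<ge> 0" using K by (simp add: zero_le_mult_iff)
  show "cmod (dird 1 f z) \<le> sqrt (K * jac f z)" "cmod (dird \<i> f z) \<le> sqrt (K * jac f z)"
    using 1 2 by (auto intro: real_le_rsqrt)
qed

lemma area_bound:
  assumes "\<rho> \<in> borel_measurable borel"
  shows "(\<integral>\<^sup>+z. ennreal (jac f z) * \<rho> (f z) \<partial>lborel) \<le> (\<integral>\<^sup>+w. \<rho> w \<partial>lborel)"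
proof -
  have "(\<integral>\<^sup>+z. ennreal (jac f z) * \<rho> (f z) \<partial>lborel) = (\<integral>\<^sup>+z. ennreal \<bar>jac f z\<bar> * \<rho> (f z) \<partial>lborel)"
    by (rule nn_integral_cong_AE) (use ae_good_point in eventually_elim, simp add: good_point_jac)
  then show ?thesis using area_inequality_weighted[OF hom ae_dirset_x ae_dirset_y assms] by simp
qed

text \<open>The global constant \<open>L\<close> carries absolute continuity on lines over from
  \<open>f\<close> to the composite. The size of the gradient comes from the local constant
  \<open>\<sigma>\<close> and the bound \<open>sqrt (K * jac f z)\<close> for the partial
  derivatives.\<close>

lemma upper_gradient_compose:
  fixes T :: "complex \<Rightarrow> complex"
  assumes lip: "\<And>w w'. cmod (T w - T w') \<le> L * cmod (w - w')"
    and [measurable]: "\<sigma> \<in> borel_measurable borel" and \<sigma>0: "\<And>w. \<sigma> w \<ge> 0"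
    and \<sigma>: "\<And>w \<epsilon>. \<epsilon> > 0 \<Longrightarrow> \<forall>\<^sub>F w' in nhds w. cmod (T w' - T w) \<le> (\<sigma> w + \<epsilon>) * cmod (w' - w)"
  shows "upper_gradient (\<lambda>z. T (f z)) (\<lambda>z. ennreal (\<sigma> (f z) * sqrt (K * jac f z)))"
  unfolding upper_gradient_def
proof
  let ?\<rho> = "\<lambda>z. ennreal (\<sigma> (f z) * sqrt (K * jac f z))"
  have gx: "AE y in lborel. AE x in lborel. good_point (Complex x y)"
    using ae_good_point by (subst (asm) AE_complex_yx) auto
  have gy: "AE x in lborel. AE y in lborel. good_point (Complex x y)"
    using ae_good_point by (subst (asm) AE_complex_xy) auto
  show "AE y in lborel. \<forall>a b. a \<le> b \<longrightarrow> ennreal (cmod (T (f (Complex b y)) - T (f (Complex a y)))) \<le> (\<integral>\<^sup>+x\<in>{a..b}. ?\<rho> (Complex x y) \<partial>lborel)"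
    using ae_line_x gx
  proof eventually_elim
    case (elim y)
    show ?case
    proof (intro allI impI)
      fix a b :: real assume ab: "a \<le> b"
      have ac: "abs_continuous_on {a..b} (\<lambda>x. T (f (Complex x y)))"
        using elim(1)[rule_format] lip by (rule abs_continuous_on_lipschitz_compose)
      show "ennreal (cmod (T (f (Complex b y)) - T (f (Complex a y)))) \<le> (\<integral>\<^sup>+x\<in>{a..b}. ?\<rho> (Complex x y) \<partial>lborel)"
      proof (rule abs_continuous_on_norm_diff_le[OF ac ab])
        show "AE t in lborel. t \<in> {a<..<b} \<longrightarrow> (\<forall>D. ((\<lambda>x. T (f (Complex x y))) has_vector_derivative D) (at t) \<longrightarrow> ennreal (norm D) \<le> ?\<rho> (Complex t y))"
          using elim(2)
        proof eventually_elim
          case (elim t)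
          show ?case
          proof (intro impI allI)
            fix D assume D: "((\<lambda>x. T (f (Complex x y))) has_vector_derivative D) (at t)"
            have "((\<lambda>x. f (Complex x y)) has_vector_derivative dird 1 f (Complex t y)) (at t)"
              unfolding line_derivative_iff using elim by (auto simp: good_point_def intro: dirset_tendsto)
            then have "cmod D \<le> \<sigma> (f (Complex t y)) * cmod (dird 1 f (Complex t y))"
              using D \<sigma> by (rule derivative_compose_bound)
            also have "\<dots> \<le> \<sigma> (f (Complex t y)) * sqrt (K * jac f (Complex t y))"
              using elim \<sigma>0 by (intro mult_left_mono good_point_jac)
            finally show "ennreal (norm D) \<le> ?\<rho> (Complex t y)" by (rule ennreal_leI)
          qed
        qed
      qed measurable
    qed
  qed
  show "AE x in lborel. \<forall>a b. a \<le> b \<longrightarrow> ennreal (cmod (T (f (Complex x b)) - T (f (Complex x a)))) \<le> (\<integral>\<^sup>+y\<in>{a..b}. ?\<rho> (Complex x y) \<partial>lborel)"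
    using ae_line_y gy
  proof eventually_elim
    case (elim x)
    show ?case
    proof (intro allI impI)
      fix a b :: real assume ab: "a \<le> b"
      have ac: "abs_continuous_on {a..b} (\<lambda>y. T (f (Complex x y)))"
        using elim(1)[rule_format] lip by (rule abs_continuous_on_lipschitz_compose)
      show "ennreal (cmod (T (f (Complex x b)) - T (f (Complex x a)))) \<le> (\<integral>\<^sup>+y\<in>{a..b}. ?\<rho> (Complex x y) \<partial>lborel)"
      proof (rule abs_continuous_on_norm_diff_le[OF ac ab])
        show "AE t in lborel. t \<in> {a<..<b} \<longrightarrow> (\<forall>D. ((\<lambda>y. T (f (Complex x y))) has_vector_derivative D) (at t) \<longrightarrow> ennreal (norm D) \<le> ?\<rho> (Complex x t))"
          using elim(2)
        proof eventually_elim
          case (elim t)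
          show ?case
          proof (intro impI allI)
            fix D assume D: "((\<lambda>y. T (f (Complex x y))) has_vector_derivative D) (at t)"
            have "((\<lambda>y. f (Complex x y)) has_vector_derivative dird \<i> f (Complex x t)) (at t)"
              unfolding line_derivative_iff using elim by (auto simp: good_point_def intro: dirset_tendsto)
            then have "cmod D \<le> \<sigma> (f (Complex x t)) * cmod (dird \<i> f (Complex x t))"
              using D \<sigma> by (rule derivative_compose_bound)
            also have "\<dots> \<le> \<sigma> (f (Complex x t)) * sqrt (K * jac f (Complex x t))"
              using elim \<sigma>0 by (intro mult_left_mono good_point_jac)
            finally show "ennreal (norm D) \<le> ?\<rho> (Complex x t)" by (rule ennreal_leI)
          qed
        qed
      qed measurable
    qed
  qed
qed

text \<open>Dirichlet integrals are quasi-invariant: changing variables by \<open>f\<close> costs a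
  factor \<open>K\<close>.\<close>

lemma energy_bound:
  assumes [measurable]: "\<sigma> \<in> borel_measurable borel" and \<sigma>0: "\<And>w. \<sigma> w \<ge> 0" and X[measurable]: "X \<in> sets borel"
  shows "(\<integral>\<^sup>+z\<in>X. (ennreal (\<sigma> (f z) * sqrt (K * jac f z)))\<^sup>2 \<partial>lborel) \<le> ennreal K * (\<integral>\<^sup>+w\<in>f ` X. (ennreal (\<sigma> w))\<^sup>2 \<partial>lborel)"
proof -
  have [measurable]: "f ` X \<in> sets borel" by (rule image_f_measurable[OF X])
  have "(\<integral>\<^sup>+z\<in>X. (ennreal (\<sigma> (f z) * sqrt (K * jac f z)))\<^sup>2 \<partial>lborel) =
      (\<integral>\<^sup>+z. ennreal K * (ennreal (jac f z) * ((ennreal (\<sigma> (f z)))\<^sup>2 * indicator (f ` X) (f z))) \<partial>lborel)"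
  proof (rule nn_integral_cong_AE)
    show "AE z in lborel. (ennreal (\<sigma> (f z) * sqrt (K * jac f z)))\<^sup>2 * indicator X z = ennreal K * (ennreal (jac f z) * ((ennreal (\<sigma> (f z)))\<^sup>2 * indicator (f ` X) (f z)))"
      using ae_good_point
    proof eventually_elim
      case (elim z)
      have J: "jac f z \<ge> 0" using good_point_jac(1)[OF elim] .
      have "(\<sigma> (f z) * sqrt (K * jac f z))\<^sup>2 = K * (jac f z * (\<sigma> (f z))\<^sup>2)"
        using J K by (simp add: power_mult_distrib)
      moreover have "0 \<le> \<sigma> (f z) * sqrt (K * jac f z)" using J K \<sigma>0 by simp
      ultimately have "(ennreal (\<sigma> (f z) * sqrt (K * jac f z)))\<^sup>2 = ennreal (K * (jac f z * (\<sigma> (f z))\<^sup>2))"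
        by (simp only: ennreal_power)
      also have "\<dots> = ennreal K * (ennreal (jac f z) * (ennreal (\<sigma> (f z)))\<^sup>2)"
        using J K \<sigma>0 by (simp add: ennreal_mult ennreal_power)
      finally have "(ennreal (\<sigma> (f z) * sqrt (K * jac f z)))\<^sup>2 = ennreal K * (ennreal (jac f z) * (ennreal (\<sigma> (f z)))\<^sup>2)" .
      moreover have "f z \<in> f ` X \<longleftrightarrow> z \<in> X" unfolding image_f by simp
      ultimately show ?case by (simp add: indicator_def)
    qed
  qed
  also have "\<dots> = ennreal K * (\<integral>\<^sup>+z. ennreal (jac f z) * ((ennreal (\<sigma> (f z)))\<^sup>2 * indicator (f ` X) (f z)) \<partial>lborel)"
    by (rule nn_integral_cmult) measurable
  also have "\<dots> \<le> ennreal K * (\<integral>\<^sup>+w\<in>f ` X. (ennreal (\<sigma> w))\<^sup>2 \<partial>lborel)"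
    by (intro mult_left_mono area_bound) auto
  finally show ?thesis .
qed

end

subsection \<open>Oscillation on squares\<close>

definition square :: "complex \<Rightarrow> real \<Rightarrow> complex set" where
  "square c s = {z. \<bar>Re z - Re c\<bar> \<le> s \<and> \<bar>Im z - Im c\<bar> \<le> s}"

definition square_bd :: "complex \<Rightarrow> real \<Rightarrow> complex set" where
  "square_bd c s = {z. max \<bar>Re z - Re c\<bar> \<bar>Im z - Im c\<bar> = s}"

lemma square_eq_cbox: "square c s = cbox (c - Complex s s) (c + Complex s s)"
  by (auto simp: square_def cbox_def Basis_complex_def abs_le_iff)

lemma frontier_square: "frontier (square c s) \<subseteq> square_bd c s"
proof
  fix z assume "z \<in> frontier (square c s)"
  then have "z \<in> cbox (c - Complex s s) (c + Complex s s)" "z \<notin> box (c - Complex s s) (c + Complex s s)"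
    unfolding square_eq_cbox frontier_cbox by auto
  then show "z \<in> square_bd c s"
    by (auto simp: square_bd_def cbox_def box_def Basis_complex_def max_def abs_if split: if_splits)
qed

lemma square_measurable [measurable]: "square c s \<in> sets borel"
  unfolding square_eq_cbox by simp

lemma emeasure_square: "s \<ge> 0 \<Longrightarrow> emeasure lborel (square c s) = ennreal (4 * s\<^sup>2)"
  unfolding square_eq_cbox
  by (subst emeasure_lborel_cbox) (auto simp: Basis_complex_def power2_eq_square)

lemma nn_integral_square:
  fixes \<rho> :: "complex \<Rightarrow> ennreal"
  assumes [measurable]: "\<rho> \<in> borel_measurable borel"
  shows "(\<integral>\<^sup>+z\<in>square c s. \<rho> z \<partial>lborel) = (\<integral>\<^sup>+x\<in>{Re c - s..Re c + s}. (\<integral>\<^sup>+y\<in>{Im c - s..Im c + s}. \<rho> (Complex x y) \<partial>lborel) \<partial>lborel)"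
    and "(\<integral>\<^sup>+z\<in>square c s. \<rho> z \<partial>lborel) = (\<integral>\<^sup>+y\<in>{Im c - s..Im c + s}. (\<integral>\<^sup>+x\<in>{Re c - s..Re c + s}. \<rho> (Complex x y) \<partial>lborel) \<partial>lborel)"
proof -
  have ind: "indicator (square c s) (Complex x y) = (indicator {Re c - s..Re c + s} x * indicator {Im c - s..Im c + s} y :: ennreal)" for x y
    by (auto simp: square_def indicator_def abs_le_iff)
  show "(\<integral>\<^sup>+z\<in>square c s. \<rho> z \<partial>lborel) = (\<integral>\<^sup>+x\<in>{Re c - s..Re c + s}. (\<integral>\<^sup>+y\<in>{Im c - s..Im c + s}. \<rho> (Complex x y) \<partial>lborel) \<partial>lborel)"
    by (subst nn_integral_complex_xy, measurable, intro nn_integral_cong, subst nn_integral_multc[symmetric])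
       (simp_all add: ind mult_ac)
  show "(\<integral>\<^sup>+z\<in>square c s. \<rho> z \<partial>lborel) = (\<integral>\<^sup>+y\<in>{Im c - s..Im c + s}. (\<integral>\<^sup>+x\<in>{Re c - s..Re c + s}. \<rho> (Complex x y) \<partial>lborel) \<partial>lborel)"
    by (subst nn_integral_complex_yx, measurable, intro nn_integral_cong, subst nn_integral_multc[symmetric])
       (simp_all add: ind mult_ac)
qed

lemma ennreal_power2_le_imp_le:
  fixes x y :: ennreal
  assumes "x\<^sup>2 \<le> y\<^sup>2"
  shows "x \<le> y"
proof (cases y rule: ennreal_cases)
  case (real r)
  show ?thesis
  proof (cases x rule: ennreal_cases)
    case (real t)
    then have "t\<^sup>2 \<le> r\<^sup>2" using assms \<open>y = ennreal r\<close> \<open>0 \<le> r\<close> by (simp add: ennreal_power)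
    then have "t \<le> r" using \<open>0 \<le> r\<close> by (rule power2_le_imp_le)
    then show ?thesis using real \<open>y = ennreal r\<close> by (simp add: ennreal_leI)
  next
    case top
    then show ?thesis using assms real by (simp add: ennreal_power power2_eq_square ennreal_mult[symmetric] ennreal_top_mult top_unique)
  qed
qed simp

text \<open>The factor \<open>2 * s\<close> is the square root of the area of the square.\<close>

lemma cauchy_schwarz_square:
  fixes \<rho> :: "complex \<Rightarrow> ennreal"
  assumes [measurable]: "\<rho> \<in> borel_measurable borel" and s: "s \<ge> 0" and E: "E \<ge> 0"
    and le: "(\<integral>\<^sup>+z\<in>square c s. (\<rho> z)\<^sup>2 \<partial>lborel) \<le> ennreal E"
  shows "(\<integral>\<^sup>+z\<in>square c s. \<rho> z \<partial>lborel) \<le> ennreal (2 * s * sqrt E)"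
proof -
  let ?I = "\<integral>\<^sup>+z\<in>square c s. \<rho> z \<partial>lborel"
  have "?I = (\<integral>\<^sup>+z. (\<rho> z * indicator (square c s) z) * indicator (square c s) z \<partial>lborel)"
    by (intro nn_integral_cong) (simp add: indicator_def)
  then have "?I\<^sup>2 = (\<integral>\<^sup>+z. (\<rho> z * indicator (square c s) z) * indicator (square c s) z \<partial>lborel)\<^sup>2"
    by simp
  also have "\<dots> \<le> (\<integral>\<^sup>+z. (\<rho> z * indicator (square c s) z)\<^sup>2 \<partial>lborel) * (\<integral>\<^sup>+z. (indicator (square c s) z)\<^sup>2 \<partial>lborel)"
    by (rule Cauchy_Schwarz_nn_integral) measurable
  also have "(\<integral>\<^sup>+z. (\<rho> z * indicator (square c s) z)\<^sup>2 \<partial>lborel) = (\<integral>\<^sup>+z\<in>square c s. (\<rho> z)\<^sup>2 \<partial>lborel)"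
    by (intro nn_integral_cong) (simp add: indicator_def)
  also have "(\<integral>\<^sup>+z. (indicator (square c s) z)\<^sup>2 \<partial>lborel) = (\<integral>\<^sup>+z. indicator (square c s) z \<partial>lborel)"
    by (intro nn_integral_cong) (simp add: indicator_def)
  also have "\<dots> = ennreal (4 * s\<^sup>2)" by (simp add: emeasure_square[OF s])
  also have "(\<integral>\<^sup>+z\<in>square c s. (\<rho> z)\<^sup>2 \<partial>lborel) * ennreal (4 * s\<^sup>2) \<le> ennreal E * ennreal (4 * s\<^sup>2)"
    by (intro mult_right_mono le) auto
  also have "\<dots> = (ennreal (2 * s * sqrt E))\<^sup>2"
    using s E by (simp add: ennreal_mult[symmetric] ennreal_power power_mult_distrib mult.commute)
  finally show ?thesis by (rule ennreal_power2_le_imp_le)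
qed

lemma AE_lborel_shift:
  assumes "AE x in lborel. P (x :: real)" "c \<noteq> 0"
  shows "AE s in lborel. P (t + c * s)"
proof -
  obtain N where N: "{x. \<not> P x} \<subseteq> N" "N \<in> null_sets lborel"
    using assms(1) unfolding eventually_ae_filter by auto
  have Nb: "N \<in> sets borel" using N(2) by (auto simp: null_sets_def)
  have "emeasure lborel N = emeasure (density (distr lborel borel (\<lambda>x. t + c * x)) (\<lambda>_. ennreal \<bar>c\<bar>)) N"
    by (subst lborel_real_affine[OF assms(2), of t]) simp
  also have "\<dots> = ennreal \<bar>c\<bar> * emeasure lborel ((\<lambda>x. t + c * x) -` N)"
    using Nb by (subst emeasure_density_const) (auto simp: emeasure_distr)
  finally have "emeasure lborel ((\<lambda>x. t + c * x) -` N) = 0" using N(2) assms(2) by auto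
  moreover have "(\<lambda>x. t + c * x) -` N \<in> sets borel"
    using measurable_sets[of "\<lambda>x. t + c * x" borel borel N] Nb by simp
  ultimately have "(\<lambda>x. t + c * x) -` N \<in> null_sets lborel" by (auto simp: null_sets_def)
  then show ?thesis by (rule AE_I') (use N(1) in auto)
qed

text \<open>The values 1 and -1 of \<open>c\<close> treat opposite sides of a growing square alike:
  as the half-width runs through \<open>{r..2*r}\<close>, each side sweeps part of the window of
  width \<open>4 * r\<close>.\<close>

lemma nn_integral_shift:
  fixes F :: "real \<Rightarrow> ennreal"
  assumes [measurable]: "F \<in> borel_measurable borel" and c: "c = 1 \<or> c = - 1" and r: "0 \<le> r"
  shows "(\<integral>\<^sup>+s\<in>{r..2*r}. F (t + c * s) \<partial>lborel) \<le> (\<integral>\<^sup>+x\<in>{t - 2*r..t + 2*r}. F x \<partial>lborel)"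
proof -
  have "(\<integral>\<^sup>+x\<in>{t - 2*r..t + 2*r}. F x \<partial>lborel) = ennreal \<bar>c\<bar> * (\<integral>\<^sup>+s. F (t + c * s) * indicator {t - 2*r..t + 2*r} (t + c * s) \<partial>lborel)"
    using c by (intro nn_integral_real_affine) auto
  also have "\<dots> = (\<integral>\<^sup>+s. F (t + c * s) * indicator {t - 2*r..t + 2*r} (t + c * s) \<partial>lborel)"
    using c by auto
  also have "\<dots> \<ge> (\<integral>\<^sup>+s\<in>{r..2*r}. F (t + c * s) \<partial>lborel)"
    using c r by (intro nn_integral_mono) (auto simp: indicator_def)
  finally show ?thesis .
qed

lemma upper_gradient_diff:
  fixes v :: "real \<Rightarrow> complex" and \<rho> :: "real \<Rightarrow> ennreal"
  assumes "\<forall>a b. a \<le> b \<longrightarrow> ennreal (cmod (v b - v a)) \<le> (\<integral>\<^sup>+x\<in>{a..b}. \<rho> x \<partial>lborel)"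
    and "a \<in> {l..h}" "b \<in> {l..h}"
  shows "ennreal (cmod (v b - v a)) \<le> (\<integral>\<^sup>+x\<in>{l..h}. \<rho> x \<partial>lborel)"
proof -
  have "ennreal (cmod (v b - v a)) = ennreal (cmod (v (max a b) - v (min a b)))"
    by (auto simp: max_def min_def norm_minus_commute)
  also have "\<dots> \<le> (\<integral>\<^sup>+x\<in>{min a b..max a b}. \<rho> x \<partial>lborel)"
    using assms(1)[rule_format, of "min a b" "max a b"] by simp
  also have "\<dots> \<le> (\<integral>\<^sup>+x\<in>{l..h}. \<rho> x \<partial>lborel)"
    by (intro nn_integral_mono) (use assms(2,3) in \<open>auto simp: indicator_def\<close>)
  finally show ?thesis .
qed

text \<open>The length-area argument. The integrals of \<open>\<rho>\<close> along the four lines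
  carrying the sides, integrated over half-widths from \<open>r\<close> to \<open>2 * r\<close>,
  total at most four times the integral over the large square, that is \<open>16 r sqrt E\<close>.
  Hence some half-width has a total of at most \<open>20 sqrt E\<close>; the slack above 16 keeps
  the contradiction strict. Each contour point reaches a fixed corner along at most two sides, so
  two points differ by at most twice that.\<close>

lemma square_oscillation:
  fixes \<rho> :: "complex \<Rightarrow> ennreal"
  assumes ug: "upper_gradient u \<rho>" and [measurable]: "\<rho> \<in> borel_measurable borel" and r: "r > 0" and E: "E > 0"
    and le: "(\<integral>\<^sup>+z\<in>square c (2 * r). (\<rho> z)\<^sup>2 \<partial>lborel) \<le> ennreal E"
  shows "\<exists>s\<in>{r<..<2*r}. \<forall>p\<in>square_bd c s. \<forall>q\<in>square_bd c s. cmod (u p - u q) \<le> 40 * sqrt E"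
proof -
  define l where "l x = (\<integral>\<^sup>+y\<in>{Im c - 2*r..Im c + 2*r}. \<rho> (Complex x y) \<partial>lborel)" for x
  define k where "k y = (\<integral>\<^sup>+x\<in>{Re c - 2*r..Re c + 2*r}. \<rho> (Complex x y) \<partial>lborel)" for y
  have [measurable]: "l \<in> borel_measurable borel" unfolding l_def[abs_def] by measurable
  have [measurable]: "k \<in> borel_measurable borel" unfolding k_def[abs_def] by measurable
  define I where "I = (\<integral>\<^sup>+z\<in>square c (2 * r). \<rho> z \<partial>lborel)"
  have I: "I \<le> ennreal (4 * r * sqrt E)"
    unfolding I_def using cauchy_schwarz_square[of \<rho> "2*r" E c] r E le by simp
  have Il: "I = (\<integral>\<^sup>+x\<in>{Re c - 2*r..Re c + 2*r}. l x \<partial>lborel)" and Ik: "I = (\<integral>\<^sup>+y\<in>{Im c - 2*r..Im c + 2*r}. k y \<partial>lborel)"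
    unfolding I_def l_def k_def by (rule nn_integral_square; simp)+
  \<comment> \<open>The integrals run over the full width of the large square rather than over the
    sides, so \<open>l\<close> and \<open>k\<close> depend on one coordinate only and Fubini's
    theorem applies.\<close>
  define L where "L s = l (Re c + 1 * s) + (l (Re c + (-1) * s) + (k (Im c + 1 * s) + k (Im c + (-1) * s)))" for s
  have [measurable]: "L \<in> borel_measurable borel" unfolding L_def[abs_def] by measurable
  have "(\<integral>\<^sup>+s\<in>{r..2*r}. L s \<partial>lborel) =
     (\<integral>\<^sup>+s\<in>{r..2*r}. l (Re c + 1 * s) \<partial>lborel) + ((\<integral>\<^sup>+s\<in>{r..2*r}. l (Re c + (-1) * s) \<partial>lborel) +
     ((\<integral>\<^sup>+s\<in>{r..2*r}. k (Im c + 1 * s) \<partial>lborel) + (\<integral>\<^sup>+s\<in>{r..2*r}. k (Im c + (-1) * s) \<partial>lborel)))"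
    unfolding L_def distrib_right by (subst nn_integral_add; measurable)+
  also have "\<dots> \<le> I + (I + (I + I))"
    by (intro add_mono; (unfold Il)?, (intro nn_integral_shift | unfold Il[symmetric] Ik)+) (use r in auto)
  also have "\<dots> \<le> ennreal (4 * r * sqrt E) + (ennreal (4 * r * sqrt E) + (ennreal (4 * r * sqrt E) + ennreal (4 * r * sqrt E)))"
    by (intro add_mono I)
  also have "\<dots> = ennreal (16 * r * sqrt E)" using r E by (simp flip: ennreal_plus)
  finally have intL: "(\<integral>\<^sup>+s\<in>{r..2*r}. L s \<partial>lborel) \<le> ennreal (16 * r * sqrt E)" .
  define GX where "GX y \<longleftrightarrow> (\<forall>a b. a \<le> b \<longrightarrow> ennreal (cmod (u (Complex b y) - u (Complex a y))) \<le> (\<integral>\<^sup>+x\<in>{a..b}. \<rho> (Complex x y) \<partial>lborel))" for y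
  define GY where "GY x \<longleftrightarrow> (\<forall>a b. a \<le> b \<longrightarrow> ennreal (cmod (u (Complex x b) - u (Complex x a))) \<le> (\<integral>\<^sup>+y\<in>{a..b}. \<rho> (Complex x y) \<partial>lborel))" for x
  have GX: "AE y in lborel. GX y" and GY: "AE x in lborel. GY x"
    using ug unfolding upper_gradient_def GX_def GY_def by auto
  have good: "AE s in lborel. GX (Im c + 1 * s) \<and> GX (Im c + (-1) * s) \<and> GY (Re c + 1 * s) \<and> GY (Re c + (-1) * s)"
    using AE_lborel_shift[OF GX, of 1 "Im c"] AE_lborel_shift[OF GX, of "-1" "Im c"]
      AE_lborel_shift[OF GY, of 1 "Re c"] AE_lborel_shift[OF GY, of "-1" "Re c"] by auto
  have "\<exists>s\<in>{r<..<2*r}. (GX (Im c + 1 * s) \<and> GX (Im c + (-1) * s) \<and> GY (Re c + 1 * s) \<and> GY (Re c + (-1) * s)) \<and> L s \<le> ennreal (20 * sqrt E)"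
  proof (rule ccontr)
    assume "\<not> ?thesis"
    then have *: "\<not> (L s \<le> ennreal (20 * sqrt E))" if "s \<in> {r<..<2*r}"
      "GX (Im c + 1 * s) \<and> GX (Im c + (-1) * s) \<and> GY (Re c + 1 * s) \<and> GY (Re c + (-1) * s)" for s
      using that by blast
    have "ennreal (20 * sqrt E) * ennreal r = (\<integral>\<^sup>+s. ennreal (20 * sqrt E) * indicator {r<..<2*r} s \<partial>lborel)"
      using r by (subst nn_integral_cmult_indicator) auto
    also have "\<dots> \<le> (\<integral>\<^sup>+s\<in>{r..2*r}. L s \<partial>lborel)"
      by (rule nn_integral_mono_AE) (use good in eventually_elim, use * in \<open>auto simp: indicator_def not_le less_imp_le\<close>)
    also have "\<dots> \<le> ennreal (16 * r * sqrt E)" by (rule intL)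
    finally have "20 * sqrt E * r \<le> 16 * r * sqrt E" using r E by (simp add: ennreal_mult[symmetric])
    moreover have "r * sqrt E > 0" using r E by simp
    ultimately show False by simp
  qed
  then obtain s where s: "s \<in> {r<..<2*r}" "L s \<le> ennreal (20 * sqrt E)"
    "GX (Im c + s)" "GX (Im c - s)" "GY (Re c + s)" "GY (Re c - s)" by auto
  \<comment> \<open>The upper right corner. A point on the left or lower side reaches it through the
    adjacent corner \<open>m\<close>.\<close>
  define q0 where "q0 = Complex (Re c + s) (Im c + s)"
  have xr: "x \<in> {Re c - 2*r..Re c + 2*r}" if "\<bar>x - Re c\<bar> \<le> s" for x using that s(1) by (auto simp: abs_le_iff)
  have yr: "y \<in> {Im c - 2*r..Im c + 2*r}" if "\<bar>y - Im c\<bar> \<le> s" for y using that s(1) by (auto simp: abs_le_iff)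
  have s0: "s > 0" using s(1) r by auto
  have hor: "ennreal (cmod (u (Complex a y) - u (Complex b y))) \<le> k y" if "GX y" "\<bar>a - Re c\<bar> \<le> s" "\<bar>b - Re c\<bar> \<le> s" for a b y
    using upper_gradient_diff[OF that(1)[unfolded GX_def] xr[OF that(3)] xr[OF that(2)]] by (simp add: k_def)
  have ver: "ennreal (cmod (u (Complex x a) - u (Complex x b))) \<le> l x" if "GY x" "\<bar>a - Im c\<bar> \<le> s" "\<bar>b - Im c\<bar> \<le> s" for a b x
    using upper_gradient_diff[OF that(1)[unfolded GY_def] yr[OF that(3)] yr[OF that(2)]] by (simp add: l_def)
  have Ls: "L s = l (Re c + s) + (l (Re c - s) + (k (Im c + s) + k (Im c - s)))" by (simp add: L_def)
  have corner: "cmod (u p - u q0) \<le> 20 * sqrt E" if p: "p \<in> square_bd c s" for p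
  proof -
    obtain x y where xy: "p = Complex x y" by (cases p)
    have m: "max \<bar>x - Re c\<bar> \<bar>y - Im c\<bar> = s" using p by (simp add: square_bd_def xy)
    then have xs: "\<bar>x - Re c\<bar> \<le> s" and ys: "\<bar>y - Im c\<bar> \<le> s" by auto
    have "x = Re c + s \<or> x = Re c - s \<or> y = Im c + s \<or> y = Im c - s" using m by (auto simp: max_def abs_if split: if_splits)
    then have "ennreal (cmod (u p - u q0)) \<le> L s"
    proof (elim disjE)
      assume x: "x = Re c + s"
      have "ennreal (cmod (u p - u q0)) \<le> l (Re c + s)"
        unfolding xy q0_def x by (rule ver) (use s ys s0 in auto)
      also have "\<dots> \<le> L s" unfolding Ls by simp
      finally show ?thesis .
    next
      assume y: "y = Im c + s"
      have "ennreal (cmod (u p - u q0)) \<le> k (Im c + s)"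
        unfolding xy q0_def y by (rule hor) (use s xs s0 in auto)
      also have "\<dots> \<le> L s" unfolding Ls by (simp add: add.commute add.left_commute)
      finally show ?thesis .
    next
      assume x: "x = Re c - s"
      define m where "m = Complex (Re c - s) (Im c + s)"
      have "ennreal (cmod (u p - u q0)) \<le> ennreal (cmod (u p - u m) + cmod (u m - u q0))"
        by (intro ennreal_leI norm_diff_triangle_le[OF order_refl order_refl])
      also have "\<dots> = ennreal (cmod (u p - u m)) + ennreal (cmod (u m - u q0))" by simp
      also have "\<dots> \<le> l (Re c - s) + k (Im c + s)"
      proof (rule add_mono)
        show "ennreal (cmod (u p - u m)) \<le> l (Re c - s)" unfolding xy m_def x by (rule ver) (use s ys s0 in auto)
        show "ennreal (cmod (u m - u q0)) \<le> k (Im c + s)" unfolding q0_def m_def by (rule hor) (use s s0 in auto)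
      qed
      also have "\<dots> \<le> L s"
      proof -
        have "L s = (l (Re c - s) + k (Im c + s)) + (l (Re c + s) + k (Im c - s))"
          unfolding Ls by (simp only: add.commute add.left_commute)
        then show ?thesis by simp
      qed
      finally show ?thesis .
    next
      assume y: "y = Im c - s"
      define m where "m = Complex (Re c + s) (Im c - s)"
      have "ennreal (cmod (u p - u q0)) \<le> ennreal (cmod (u p - u m) + cmod (u m - u q0))"
        by (intro ennreal_leI norm_diff_triangle_le[OF order_refl order_refl])
      also have "\<dots> = ennreal (cmod (u p - u m)) + ennreal (cmod (u m - u q0))" by simp
      also have "\<dots> \<le> k (Im c - s) + l (Re c + s)"
      proof (rule add_mono)
        show "ennreal (cmod (u p - u m)) \<le> k (Im c - s)" unfolding xy m_def y by (rule hor) (use s xs s0 in auto)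
        show "ennreal (cmod (u m - u q0)) \<le> l (Re c + s)" unfolding q0_def m_def by (rule ver) (use s s0 in auto)
      qed
      also have "\<dots> \<le> L s"
      proof -
        have "L s = (k (Im c - s) + l (Re c + s)) + (k (Im c + s) + l (Re c - s))"
          unfolding Ls by (simp only: add.commute add.left_commute)
        then show ?thesis by simp
      qed
      finally show ?thesis .
    qed
    then have "ennreal (cmod (u p - u q0)) \<le> ennreal (20 * sqrt E)" using s(2) by (rule order_trans)
    then show ?thesis using E by simp
  qed
  have "cmod (u p - u q) \<le> 40 * sqrt E" if "p \<in> square_bd c s" "q \<in> square_bd c s" for p q
  proof -
    have "cmod (u p - u q) \<le> cmod (u p - u q0) + cmod (u q - u q0)"
      by (metis norm_diff_triangle_le norm_minus_commute order_refl)
    also have "\<dots> \<le> 20 * sqrt E + 20 * sqrt E" using corner that by (intro add_mono) auto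
    finally show ?thesis by simp
  qed
  then show ?thesis using s(1) by blast
qed

lemma square_compact: "compact (square c s)"
  unfolding square_eq_cbox by auto

section \<open>Contours met by preimages, and the maximum principle for homeomorphisms\<close>

context qc_plane
begin

lemma preimage_connected: "connected S \<Longrightarrow> connected (f -` S)"
proof -
  assume S: "connected S"
  have "f -` S = g ` S"
  proof
    show "f -` S \<subseteq> g ` S"
    proof
      fix x assume "x \<in> f -` S" then show "x \<in> g ` S" by (intro image_eqI[of _ _ "f x"]) auto
    qed
  qed auto
  then show ?thesis using connected_continuous_image[OF continuous_g S] by simp
qed

lemma preimage_complement_unbounded:
  assumes "bounded B" "compact Q"
  shows "f -` (- B) - Q \<noteq> {}"
proof
  assume "f -` (- B) - Q = {}"
  then have "- B \<subseteq> f ` Q" unfolding image_f by (metis Diff_eq_empty_iff fg subsetI subsetD vimageI vimage_eq)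
  moreover have "bounded (f ` Q)"
    using compact_continuous_image[OF continuous_f assms(2)] by (rule compact_imp_bounded)
  ultimately have "bounded (- B)" using bounded_subset by blast
  then have "bounded (UNIV :: complex set)" using assms(1) by (metis Compl_partition bounded_Un)
  then show False by simp
qed

text \<open>The complement of a bounded convex set is connected in the plane. Its preimage is
  connected and leaves every square, so it crosses the boundary of any square that it meets.\<close>

lemma meets_square_bd_outer:
  assumes z: "z \<in> square c s" and B: "bounded B" "convex B" and fz: "f z \<notin> B"
  shows "\<exists>q\<in>square_bd c s. f q \<notin> B"
proof -
  have "connected (f -` (- B))"
    by (intro preimage_connected connected_complement_bounded_convex B) simp
  moreover have "f -` (- B) \<inter> square c s \<noteq> {}" using z fz by auto
  moreover have "f -` (- B) - square c s \<noteq> {}" by (rule preimage_complement_unbounded[OF B(1) square_compact])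
  ultimately have "f -` (- B) \<inter> frontier (square c s) \<noteq> {}" by (rule connected_Int_frontier)
  then show ?thesis using frontier_square by auto
qed

text \<open>A value outside the disc of radius \<open>D\<close> about \<open>f p\<close> would force
  such a value on the contour as well.\<close>

lemma oscillation_max_principle:
  assumes "z \<in> square c s" "p \<in> square_bd c s"
    and "\<And>q. q \<in> square_bd c s \<Longrightarrow> cmod (f q - f p) \<le> D"
  shows "cmod (f z - f p) \<le> D"
proof (rule ccontr)
  assume "\<not> ?thesis"
  then have "f z \<notin> cball (f p) D" by (simp add: dist_norm norm_minus_commute)
  then obtain q where "q \<in> square_bd c s" "f q \<notin> cball (f p) D"
    using meets_square_bd_outer[OF assms(1), of "cball (f p) D"] by auto
  then show False using assms(3)[of q] by (simp add: dist_norm norm_minus_commute)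
qed

text \<open>The preimage of the closed disc of radius \<open>|f z|\<close> about 0 is connected and
  contains both 0 and \<open>z\<close>, so it crosses the contour that separates them.\<close>

lemma meets_square_bd_inner:
  assumes f0: "f 0 = 0" and z: "z \<notin> square 0 s" and s: "s > 0"
  shows "\<exists>q\<in>square_bd 0 s. cmod (f q) \<le> cmod (f z)"
proof -
  have "connected (f -` cball 0 (cmod (f z)))" by (rule preimage_connected) (rule connected_cball)
  moreover have "0 \<in> f -` cball 0 (cmod (f z)) \<inter> square 0 s" using f0 s by (simp add: square_def)
  moreover have "z \<in> f -` cball 0 (cmod (f z)) - square 0 s" using z by simp
  ultimately have "f -` cball 0 (cmod (f z)) \<inter> frontier (square 0 s) \<noteq> {}"
    by (intro connected_Int_frontier) blast+
  then show ?thesis using frontier_square by fastforce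
qed

end

subsection \<open>Distortion of circles\<close>

lemma ln_diff_abs_le:
  fixes a b c :: real
  assumes "0 < c" "c \<le> a" "c \<le> b"
  shows "\<bar>ln a - ln b\<bar> \<le> \<bar>a - b\<bar> / c"
proof -
  have *: "ln x - ln y \<le> \<bar>x - y\<bar> / c" if "c \<le> x" "c \<le> y" for x y
  proof -
    have "ln x - ln y \<le> (x - y) / y" using that assms(1) by (intro ln_diff_le) auto
    also have "\<dots> \<le> \<bar>x - y\<bar> / c" using that assms(1) by (intro frac_le) auto
    finally show ?thesis .
  qed
  show ?thesis using *[OF assms(2,3)] *[OF assms(3,2)] by (auto simp: abs_le_iff abs_minus_commute)
qed

text \<open>A crude product of the largest value of the integrand and the area of the disc of radius
  \<open>b\<close>. For \<open>b = 2 * a\<close> it is \<open>4 * pi\<close>, independently of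
  scale.\<close>

lemma shell_weight_integral:
  fixes a b :: real
  assumes that: "0 < a" "0 \<le> b"
  shows "(\<integral>\<^sup>+w\<in>{w::complex. a \<le> cmod w \<and> cmod w \<le> b}. (ennreal (1 / cmod w))\<^sup>2 \<partial>lborel) \<le> ennreal (pi * (b / a)\<^sup>2)"
  proof -
    have "(\<integral>\<^sup>+w\<in>{w::complex. a \<le> cmod w \<and> cmod w \<le> b}. (ennreal (1 / cmod w))\<^sup>2 \<partial>lborel)
        \<le> (\<integral>\<^sup>+w. ennreal ((1 / a)\<^sup>2) * indicator (cball (0::complex) b) w \<partial>lborel)"
    proof (rule nn_integral_mono)
      fix w :: complex
      show "(ennreal (1 / cmod w))\<^sup>2 * indicator {w. a \<le> cmod w \<and> cmod w \<le> b} w \<le> ennreal ((1 / a)\<^sup>2) * indicator (cball 0 b) w"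
      proof (cases "a \<le> cmod w \<and> cmod w \<le> b")
        case True
        moreover from True that have "0 < cmod w" by linarith
        ultimately have "(1 / cmod w)\<^sup>2 \<le> (1 / a)\<^sup>2" using that by (intro power_mono divide_left_mono) auto
        then show ?thesis using True by (simp add: ennreal_power ennreal_leI)
      qed simp
    qed
    also have "\<dots> = ennreal ((1 / a)\<^sup>2) * ennreal (pi * b\<^sup>2)"
      using that by (subst nn_integral_cmult_indicator) (auto simp: emeasure_cball unit_ball_vol_2)
    also have "\<dots> = ennreal (pi * (b / a)\<^sup>2)"
      using that by (simp add: ennreal_mult[symmetric] power_divide)
    finally show ?thesis .
  qed

text \<open>Each dyadic shell contributes at most \<open>4 * pi\<close> whatever its size. What
  matters later is that the bound is linear in \<open>N\<close>.\<close>

lemma annulus_weight_integral: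
  fixes m :: real
  assumes m: "m > 0"
  shows "(\<integral>\<^sup>+w\<in>{w::complex. m \<le> cmod w \<and> cmod w \<le> 2 ^ N * m}. (ennreal (1 / cmod w))\<^sup>2 \<partial>lborel) \<le> ennreal (4 * pi * (real N + 1))"
proof (induction N)
  case 0
    have "(\<integral>\<^sup>+w\<in>{w::complex. m \<le> cmod w \<and> cmod w \<le> 2 ^ 0 * m}. (ennreal (1 / cmod w))\<^sup>2 \<partial>lborel) \<le> ennreal (pi * (m / m)\<^sup>2)"
      using shell_weight_integral[of m "2 ^ 0 * m"] m by simp
    also have "\<dots> \<le> ennreal (4 * pi * (real 0 + 1))" using m by (intro ennreal_leI) simp
    finally show ?case .
  next
    case (Suc N)
    let ?A = "{w::complex. m \<le> cmod w \<and> cmod w \<le> 2 ^ N * m}"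
    let ?B = "{w::complex. 2 ^ N * m \<le> cmod w \<and> cmod w \<le> 2 ^ Suc N * m}"
    let ?F = "\<lambda>w::complex. (ennreal (1 / cmod w))\<^sup>2"
    have "(\<integral>\<^sup>+w\<in>{w. m \<le> cmod w \<and> cmod w \<le> 2 ^ Suc N * m}. ?F w \<partial>lborel) \<le> (\<integral>\<^sup>+w. ?F w * indicator ?A w + ?F w * indicator ?B w \<partial>lborel)"
      by (intro nn_integral_mono) (auto simp: indicator_def)
    also have "\<dots> = (\<integral>\<^sup>+w\<in>?A. ?F w \<partial>lborel) + (\<integral>\<^sup>+w\<in>?B. ?F w \<partial>lborel)"
      by (rule nn_integral_add) measurable
    also have "\<dots> \<le> ennreal (4 * pi * (real N + 1)) + ennreal (pi * ((2 ^ Suc N * m) / (2 ^ N * m))\<^sup>2)"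
      using Suc m by (intro add_mono shell_weight_integral) auto
    also have "(2 ^ Suc N * m) / (2 ^ N * m) = 2" using m by simp
    also have "ennreal (4 * pi * (real N + 1)) + ennreal (pi * 2\<^sup>2) = ennreal (4 * pi * (real (Suc N) + 1))"
      by (subst ennreal_plus[symmetric]) (auto simp: algebra_simps)
    finally show ?case .
qed

context qc_plane
begin

text \<open>Argument by contradiction with \<open>u\<close>, the logarithm of \<open>|f|\<close>
  truncated to \<open>[ln m, ln M]\<close>. A small contour carries a point where \<open>u\<close>
  is \<open>ln m\<close>, a large one a point where \<open>u\<close> is \<open>ln M\<close>.
  Oscillation costs \<open>40 sqrt E\<close> on each contour, so every horizontal segment from one
  right-hand side to the other must carry at least \<open>\<Delta> = N ln 2 - 80 sqrt E\<close>.
  Integrating over these segments, Cauchy-Schwarz gives \<open>\<Delta> \<le> 16 sqrt E\<close>. The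
  constant 96 is \<open>80 + 16\<close>.\<close>

lemma distortion:
  assumes f0: "f 0 = 0" and N: "96 * sqrt (K * (4 * pi * (real N + 1))) < real N * ln 2"
    and z: "z \<noteq> 0" and z': "cmod z' \<le> 2 * cmod z"
  shows "cmod (f z') \<le> 2 ^ N * cmod (f z)"
proof (rule ccontr)
  assume neg: "\<not> ?thesis"
  define R where "R = cmod z"
  define m where "m = cmod (f z)"
  define M where "M = 2 ^ N * m"
  define E where "E = K * (4 * pi * (real N + 1))"
  have R: "R > 0" using z by (simp add: R_def)
  have "f z \<noteq> f 0" using z by (metis gf)
  then have m: "m > 0" using f0 by (simp add: m_def)
  have mM: "m \<le> M" unfolding M_def using m by simp
  have fz': "cmod (f z') > M" using neg by (simp add: M_def m_def)
  have E: "E > 0" using K by (simp add: E_def)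
  define t where "t w = ln (max m (min M (cmod w)))" for w
  define T where "T w = complex_of_real (t w)" for w
  \<comment> \<open>The local Lipschitz constant of \<open>T\<close>. On the two truncation circles
    it takes the larger of the one-sided values.\<close>
  define \<sigma> where "\<sigma> w = (if m \<le> cmod w \<and> cmod w \<le> M then 1 / cmod w else 0)" for w :: complex
  have Tt: "cmod (T w - T w') = \<bar>t w - t w'\<bar>" for w w'
    unfolding T_def by (simp flip: of_real_diff)
  have clamp: "\<bar>max m (min M a) - max m (min M b)\<bar> \<le> \<bar>a - b\<bar>" for a b :: real by (auto simp: max_def min_def abs_if)
  have lip: "cmod (T w - T w') \<le> (1 / m) * cmod (w - w')" for w w'
  proof -
    have "\<bar>t w - t w'\<bar> \<le> \<bar>max m (min M (cmod w)) - max m (min M (cmod w'))\<bar> / m"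
      unfolding t_def using m by (intro ln_diff_abs_le) auto
    also have "\<dots> \<le> cmod (w - w') / m"
      using clamp[of "cmod w" "cmod w'"] norm_triangle_ineq3[of w w'] m by (intro divide_right_mono) auto
    finally show ?thesis by (simp add: Tt)
  qed
  have \<sigma>m[measurable]: "\<sigma> \<in> borel_measurable borel" unfolding \<sigma>_def[abs_def] by measurable
  have \<sigma>0: "\<sigma> w \<ge> 0" for w by (simp add: \<sigma>_def)
  have loc: "\<forall>\<^sub>F w' in nhds w. cmod (T w' - T w) \<le> (\<sigma> w + \<epsilon>) * cmod (w' - w)" if \<epsilon>: "\<epsilon> > 0" for w \<epsilon>
  proof -
    have nt: "((\<lambda>w'. cmod w') \<longlongrightarrow> cmod w) (nhds w)" by (intro tendsto_norm filterlim_ident)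
    consider "cmod w < m" | "cmod w > M" | "m \<le> cmod w" "cmod w \<le> M" by linarith
    then show ?thesis
    proof cases
      case 1
      have "\<forall>\<^sub>F w' in nhds w. cmod w' < m" using nt 1 by (rule order_tendstoD(2))
      then show ?thesis
      proof eventually_elim
        case (elim w')
        then have "t w' = t w" using 1 mM by (simp add: t_def)
        then show ?case using \<sigma>0[of w] \<epsilon> by (simp add: Tt)
      qed
    next
      case 2
      have "\<forall>\<^sub>F w' in nhds w. cmod w' > M" using nt 2 by (rule order_tendstoD(1))
      then show ?thesis
      proof eventually_elim
        case (elim w')
        then have "t w' = t w" using 2 mM by (simp add: t_def)
        then show ?case using \<sigma>0[of w] \<epsilon> by (simp add: Tt)
      qed
    next
      case 3
      have w0: "cmod w > 0" using 3 m by linarith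
      have "((\<lambda>w'. 1 / cmod w') \<longlongrightarrow> 1 / cmod w) (nhds w)" using w0 by (intro tendsto_intros nt) auto
      then have "\<forall>\<^sub>F w' in nhds w. 1 / cmod w' < 1 / cmod w + \<epsilon>" by (rule order_tendstoD(2)) (use \<epsilon> in simp)
      moreover have "\<forall>\<^sub>F w' in nhds w. 0 < cmod w'" using nt w0 by (rule order_tendstoD(1))
      ultimately show ?thesis
      proof eventually_elim
        case (elim w')
        define c where "c = min (cmod w) (cmod w')"
        have c: "0 < c" "c \<le> cmod w" "c \<le> cmod w'" using elim w0 by (auto simp: c_def)
        have ic: "1 / c \<le> \<sigma> w + \<epsilon>" using elim 3 \<epsilon> by (auto simp: c_def \<sigma>_def min_def)
        have "max m (min M (cmod w)) = cmod w" using 3 by simp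
        have "\<bar>t w' - t w\<bar> \<le> \<bar>max m (min M (cmod w')) - max m (min M (cmod w))\<bar> / c"
        proof -
          have "c \<le> max m (min M (cmod w))" "c \<le> max m (min M (cmod w'))" using c 3 mM by auto
          then show ?thesis unfolding t_def using c by (intro ln_diff_abs_le)
        qed
        also have "\<dots> \<le> cmod (w' - w) / c"
          using clamp[of "cmod w'" "cmod w"] norm_triangle_ineq3[of w' w] c by (intro divide_right_mono) auto
        also have "\<dots> = (1 / c) * cmod (w' - w)" by simp
        also have "\<dots> \<le> (\<sigma> w + \<epsilon>) * cmod (w' - w)" by (intro mult_right_mono ic) simp
        finally show ?case by (simp add: Tt)
      qed
    qed
  qed
  define u where "u z = T (f z)" for z
  define \<rho> where "\<rho> z = ennreal (\<sigma> (f z) * sqrt (K * jac f z))" for z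
  have [measurable]: "\<rho> \<in> borel_measurable borel" unfolding \<rho>_def[abs_def] by measurable
  have ug: "upper_gradient u \<rho>"
    unfolding u_def[abs_def] \<rho>_def[abs_def] by (rule upper_gradient_compose[OF lip \<sigma>m \<sigma>0 loc])
  have energy: "(\<integral>\<^sup>+z\<in>X. (\<rho> z)\<^sup>2 \<partial>lborel) \<le> ennreal E" if X: "X \<in> sets borel" for X
  proof -
    have "(\<integral>\<^sup>+z\<in>X. (\<rho> z)\<^sup>2 \<partial>lborel) \<le> ennreal K * (\<integral>\<^sup>+w\<in>f ` X. (ennreal (\<sigma> w))\<^sup>2 \<partial>lborel)"
      unfolding \<rho>_def by (rule energy_bound[OF \<sigma>m \<sigma>0 X])
    also have "\<dots> \<le> ennreal K * (\<integral>\<^sup>+w\<in>{w. m \<le> cmod w \<and> cmod w \<le> 2 ^ N * m}. (ennreal (1 / cmod w))\<^sup>2 \<partial>lborel)"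
      by (intro mult_left_mono nn_integral_mono) (auto simp: \<sigma>_def M_def indicator_def)
    also have "\<dots> \<le> ennreal K * ennreal (4 * pi * (real N + 1))"
      by (intro mult_left_mono annulus_weight_integral[OF m]) simp
    also have "\<dots> = ennreal E" using K by (simp add: E_def ennreal_mult)
    finally show ?thesis .
  qed
  \<comment> \<open>The half-width stays below \<open>R / 2\<close>, so the square misses
    \<open>z\<close>, one of whose coordinates has modulus at least
    \<open>R / sqrt 2\<close>.\<close>
  obtain s1 where s1: "s1 \<in> {R/4<..<2*(R/4)}" and osc1: "\<And>p q. p \<in> square_bd 0 s1 \<Longrightarrow> q \<in> square_bd 0 s1 \<Longrightarrow> cmod (u p - u q) \<le> 40 * sqrt E"
    using square_oscillation[OF ug _ _ E energy, of "R/4" 0] R by auto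
  \<comment> \<open>The half-width exceeds \<open>2 * R\<close>, so the square contains
    \<open>z'\<close>.\<close>
  obtain s2 where s2: "s2 \<in> {2*R<..<2*(2*R)}" and osc2: "\<And>p q. p \<in> square_bd 0 s2 \<Longrightarrow> q \<in> square_bd 0 s2 \<Longrightarrow> cmod (u p - u q) \<le> 40 * sqrt E"
    using square_oscillation[OF ug _ _ E energy, of "2*R" 0] R by auto
  have "z \<notin> square 0 s1"
  proof
    assume "z \<in> square 0 s1"
    then have "\<bar>Re z\<bar> \<le> R / 2" "\<bar>Im z\<bar> \<le> R / 2" using s1 by (auto simp: square_def)
    then have "(Re z)\<^sup>2 \<le> (R/2)\<^sup>2" "(Im z)\<^sup>2 \<le> (R/2)\<^sup>2" using R by (auto simp: abs_le_square_iff[symmetric])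
    then have "R\<^sup>2 \<le> (R/2)\<^sup>2 + (R/2)\<^sup>2" unfolding R_def cmod_power2 by linarith
    then show False using R by (simp add: power2_eq_square)
  qed
  then obtain q1 where q1: "q1 \<in> square_bd 0 s1" "cmod (f q1) \<le> m"
    using meets_square_bd_inner[OF f0, of z s1] s1 R by (auto simp: m_def)
  have "z' \<in> square 0 s2"
    using abs_Re_le_cmod[of z'] abs_Im_le_cmod[of z'] z' s2 by (auto simp: square_def R_def)
  then obtain q2 where q2: "q2 \<in> square_bd 0 s2" "cmod (f q2) \<ge> M"
    using meets_square_bd_outer[of z' 0 s2 "ball 0 M"] fz' by (auto simp: not_less)
  have u1: "u q1 = complex_of_real (ln m)" using q1 mM by (simp add: u_def T_def t_def)
  have u2: "u q2 = complex_of_real (ln M)" using q2 mM by (simp add: u_def T_def t_def)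
  have lnM: "ln M - ln m = real N * ln 2" using m by (simp add: M_def ln_mult ln_realpow)
  \<comment> \<open>Heights up to \<open>R / 4\<close> meet the right-hand sides of both squares,
    because both half-widths exceed \<open>R / 4\<close>.\<close>
  have cross: "real N * ln 2 - 80 * sqrt E \<le> cmod (u (Complex s2 y) - u (Complex s1 y))" if "\<bar>y\<bar> \<le> R/4" for y
  proof -
    have p: "Complex s1 y \<in> square_bd 0 s1" "Complex s2 y \<in> square_bd 0 s2" using that s1 s2 R by (auto simp: square_bd_def max_def)
    have "real N * ln 2 = cmod (u q2 - u q1)"
      unfolding u1 u2 of_real_diff[symmetric] norm_of_real lnM by simp
    also have "u q2 - u q1 = (u q2 - u (Complex s2 y)) + ((u (Complex s2 y) - u (Complex s1 y)) + (u (Complex s1 y) - u q1))" by simp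
    also have "cmod \<dots> \<le> cmod (u q2 - u (Complex s2 y)) + (cmod (u (Complex s2 y) - u (Complex s1 y)) + cmod (u (Complex s1 y) - u q1))"
      by (intro norm_triangle_le add_left_mono norm_triangle_ineq)
    also have "\<dots> \<le> 40 * sqrt E + (cmod (u (Complex s2 y) - u (Complex s1 y)) + 40 * sqrt E)"
      by (intro add_mono osc1 osc2 order_refl p q1 q2)
    finally show ?thesis by simp
  qed
  define \<Delta> where "\<Delta> = real N * ln 2 - 80 * sqrt E"
  have \<Delta>: "\<Delta> > 16 * sqrt E" using N unfolding \<Delta>_def E_def[symmetric] by linarith
  have \<Delta>0: "\<Delta> \<ge> 0" using \<Delta> E by (meson less_imp_le mult_nonneg_nonneg order_trans real_sqrt_ge_zero zero_le_numeral)
  have "ennreal (\<Delta> * (R/2)) = (\<integral>\<^sup>+y. ennreal \<Delta> * indicator {- (R/4)..R/4} y \<partial>lborel)"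
    using R \<Delta>0 by (subst nn_integral_cmult_indicator) (auto simp: ennreal_mult[symmetric])
  also have "\<dots> \<le> (\<integral>\<^sup>+y\<in>{Im 0 - 4*R..Im 0 + 4*R}. (\<integral>\<^sup>+x\<in>{Re 0 - 4*R..Re 0 + 4*R}. \<rho> (Complex x y) \<partial>lborel) \<partial>lborel)"
  proof (rule nn_integral_mono_AE)
    show "AE y in lborel. ennreal \<Delta> * indicator {- (R/4)..R/4} y \<le> (\<integral>\<^sup>+x\<in>{Re 0 - 4*R..Re 0 + 4*R}. \<rho> (Complex x y) \<partial>lborel) * indicator {Im 0 - 4*R..Im 0 + 4*R} y"
      using ug[unfolded upper_gradient_def, THEN conjunct1]
    proof eventually_elim
      case (elim y)
      show ?case
      proof (cases "\<bar>y\<bar> \<le> R/4")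
        case True
        have "ennreal \<Delta> \<le> ennreal (cmod (u (Complex s2 y) - u (Complex s1 y)))"
          unfolding \<Delta>_def by (intro ennreal_leI cross True)
        also have "\<dots> \<le> (\<integral>\<^sup>+x\<in>{Re 0 - 4*R..Re 0 + 4*R}. \<rho> (Complex x y) \<partial>lborel)"
          by (rule upper_gradient_diff[OF elim]) (use s1 s2 R in auto)
        finally show ?thesis using True R by (auto simp: indicator_def)
      next
        case False
        then have "y \<notin> {- (R/4)..R/4}" by auto
        then show ?thesis by simp
      qed
    qed
  qed
  also have "\<dots> = (\<integral>\<^sup>+z\<in>square 0 (4*R). \<rho> z \<partial>lborel)" by (rule nn_integral_square(2)[symmetric]) measurable
  also have "\<dots> \<le> ennreal (2 * (4*R) * sqrt E)"
    by (rule cauchy_schwarz_square) (use R E energy in auto)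
  finally have "\<Delta> * (R/2) \<le> 2 * (4*R) * sqrt E" using R E by simp
  then have "\<Delta> * R \<le> (16 * sqrt E) * R" by (simp add: mult_ac)
  then have "\<Delta> \<le> 16 * sqrt E" using R by simp
  then show False using \<Delta> by simp
qed

end

text \<open>The left side grows like \<open>sqrt N\<close> and the right side like \<open>N\<close>;
  the explicit threshold for \<open>N\<close> comes from \<open>N + 1 \<le> 2 N\<close>.\<close>

lemma distortion_constant_exists: "\<exists>N. 96 * sqrt (K * (4 * pi * (real N + 1))) < real N * ln 2" if K: "K \<ge> 1"
proof -
  obtain N :: nat where N: "96\<^sup>2 * (K * (8 * pi)) / (ln 2)\<^sup>2 < real N" using reals_Archimedean2 by blast
  have "0 < 96\<^sup>2 * (K * (8 * pi)) / (ln 2)\<^sup>2" using K by simp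
  then have "real N > 0" using N by linarith
  then have N1: "real N \<ge> 1" by simp
  have l2: "(ln 2 :: real)\<^sup>2 > 0" by simp
  have "96\<^sup>2 * (K * (4 * pi * (real N + 1))) \<le> 96\<^sup>2 * (K * (8 * pi)) * real N"
  proof -
    have "K * (4 * pi * (real N + 1)) \<le> K * (4 * pi * (2 * real N))" using K N1 by (intro mult_left_mono) auto
    then show ?thesis by (simp add: algebra_simps)
  qed
  also have "\<dots> < (real N * (ln 2)\<^sup>2) * real N"
    using N l2 N1 by (intro mult_strict_right_mono) (auto simp: field_simps)
  also have "\<dots> = (real N * ln 2)\<^sup>2" by (simp add: power2_eq_square)
  finally have "sqrt (96\<^sup>2 * (K * (4 * pi * (real N + 1)))) < sqrt ((real N * ln 2)\<^sup>2)" by (rule real_sqrt_less_mono)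
  then have "96 * sqrt (K * (4 * pi * (real N + 1))) < real N * ln 2"
    unfolding real_sqrt_mult by (simp add: real_sqrt_mult)
  then show ?thesis by blast
qed

subsection \<open>The isoperimetric inequality for smooth maps\<close>

text \<open>For \<open>\<kappa> < 1\<close> the function \<open>p = - \<kappa> tan (\<kappa> (t - c - \<pi>/2))\<close> solves \<open>p' = - \<kappa>\<^sup>2 - p\<^sup>2\<close> on the whole closed
  interval, so \<open>w'\<^sup>2 - \<kappa>\<^sup>2 w\<^sup>2 = (w' - w p)\<^sup>2 + (w\<^sup>2 p)'\<close>; letting \<open>\<kappa> \<rightarrow> 1\<close> avoids boundary singularities.\<close>

lemma wirtinger_dirichlet:
  fixes w w' :: "real \<Rightarrow> real"
  assumes der: "\<And>t. (w has_real_derivative w' t) (at t)" and cont: "continuous_on UNIV w'"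
    and zero: "w c = 0" "w (c + pi) = 0"
  shows "integral {c..c + pi} (\<lambda>t. (w t)\<^sup>2) \<le> integral {c..c + pi} (\<lambda>t. (w' t)\<^sup>2)"
proof -
  have cw: "continuous_on S w" for S
    using der by (meson DERIV_isCont continuous_at_imp_continuous_on)
  have cw': "continuous_on S w'" for S using cont continuous_on_subset by blast
  have i1: "(\<lambda>t. (w t)\<^sup>2) integrable_on {c..c + pi}" and i2: "(\<lambda>t. (w' t)\<^sup>2) integrable_on {c..c + pi}"
    by (intro integrable_continuous_interval continuous_intros cw cw')+
  have k: "\<kappa>\<^sup>2 * integral {c..c + pi} (\<lambda>t. (w t)\<^sup>2) \<le> integral {c..c + pi} (\<lambda>t. (w' t)\<^sup>2)" if \<kappa>: "0 < \<kappa>" "\<kappa> < 1" for \<kappa>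
  proof -
    define p where "p t = - \<kappa> * tan (\<kappa> * (t - c - pi / 2))" for t
    have cos: "cos (\<kappa> * (t - c - pi / 2)) \<noteq> 0" if t: "t \<in> {c..c + pi}" for t
    proof -
      have "\<bar>t - c - pi / 2\<bar> \<le> pi / 2" using t unfolding atLeastAtMost_iff by linarith
      then have "\<bar>\<kappa> * (t - c - pi / 2)\<bar> \<le> \<kappa> * (pi / 2)" using \<kappa> by (simp add: abs_mult)
      also have "\<dots> < pi / 2" using \<kappa> by simp
      finally have "cos (\<kappa> * (t - c - pi / 2)) > 0" by (intro cos_gt_zero_pi) auto
      then show ?thesis by simp
    qed
    have dp: "(p has_real_derivative (- \<kappa>\<^sup>2 - (p t)\<^sup>2)) (at t)" if t: "t \<in> {c..c + pi}" for t
    proof -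
      let ?\<theta> = "\<kappa> * (t - c - pi / 2)"
      have "(p has_real_derivative (- \<kappa> * (inverse ((cos ?\<theta>)\<^sup>2) * \<kappa>))) (at t)"
        unfolding p_def[abs_def] by (rule derivative_eq_intros refl cos[OF t] | simp)+
      moreover have "- \<kappa> * (inverse ((cos ?\<theta>)\<^sup>2) * \<kappa>) = - \<kappa>\<^sup>2 - (p t)\<^sup>2"
      proof -
        have "inverse ((cos ?\<theta>)\<^sup>2) = 1 + (tan ?\<theta>)\<^sup>2"
          using cos[OF t] sin_cos_squared_add[of ?\<theta>] by (simp add: tan_def power_divide field_simps)
        then show ?thesis by (simp add: p_def power2_eq_square algebra_simps)
      qed
      ultimately show ?thesis by simp
    qed
    have cp: "continuous_on {c..c + pi} p"
      using dp by (meson DERIV_isCont continuous_at_imp_continuous_on)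
    have "((\<lambda>t. 2 * w t * w' t * p t + (w t)\<^sup>2 * (- \<kappa>\<^sup>2 - (p t)\<^sup>2)) has_integral ((w (c + pi))\<^sup>2 * p (c + pi) - (w c)\<^sup>2 * p c)) {c..c + pi}"
    proof (rule fundamental_theorem_of_calculus)
      fix t assume t: "t \<in> {c..c + pi}"
      have "((\<lambda>t. (w t)\<^sup>2 * p t) has_real_derivative (2 * w t * w' t * p t + (w t)\<^sup>2 * (- \<kappa>\<^sup>2 - (p t)\<^sup>2))) (at t)"
        by (rule derivative_eq_intros der dp[OF t] refl | simp add: algebra_simps)+
      then show "((\<lambda>t. (w t)\<^sup>2 * p t) has_vector_derivative (2 * w t * w' t * p t + (w t)\<^sup>2 * (- \<kappa>\<^sup>2 - (p t)\<^sup>2))) (at t within {c..c + pi})"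
        by (simp add: has_real_derivative_iff_has_vector_derivative has_vector_derivative_at_within)
    qed simp
    then have z: "((\<lambda>t. 2 * w t * w' t * p t + (w t)\<^sup>2 * (- \<kappa>\<^sup>2 - (p t)\<^sup>2)) has_integral 0) {c..c + pi}"
      by (simp add: zero)
    have "((\<lambda>t. (w' t)\<^sup>2 - \<kappa>\<^sup>2 * (w t)\<^sup>2 - (2 * w t * w' t * p t + (w t)\<^sup>2 * (- \<kappa>\<^sup>2 - (p t)\<^sup>2))) has_integral
      (integral {c..c + pi} (\<lambda>t. (w' t)\<^sup>2) - \<kappa>\<^sup>2 * integral {c..c + pi} (\<lambda>t. (w t)\<^sup>2) - 0)) {c..c + pi}"
      by (intro has_integral_diff z has_integral_mult_right integrable_integral i1 i2)
    moreover have "(w' t)\<^sup>2 - \<kappa>\<^sup>2 * (w t)\<^sup>2 - (2 * w t * w' t * p t + (w t)\<^sup>2 * (- \<kappa>\<^sup>2 - (p t)\<^sup>2)) = (w' t - w t * p t)\<^sup>2" for t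
      by (simp add: power2_eq_square algebra_simps)
    ultimately have "((\<lambda>t. (w' t - w t * p t)\<^sup>2) has_integral
      (integral {c..c + pi} (\<lambda>t. (w' t)\<^sup>2) - \<kappa>\<^sup>2 * integral {c..c + pi} (\<lambda>t. (w t)\<^sup>2))) {c..c + pi}" by simp
    then have "0 \<le> integral {c..c + pi} (\<lambda>t. (w' t)\<^sup>2) - \<kappa>\<^sup>2 * integral {c..c + pi} (\<lambda>t. (w t)\<^sup>2)"
      by (rule has_integral_nonneg) simp
    then show ?thesis by simp
  qed
  have "((\<lambda>\<kappa>. \<kappa>\<^sup>2 * integral {c..c + pi} (\<lambda>t. (w t)\<^sup>2)) \<longlongrightarrow> 1\<^sup>2 * integral {c..c + pi} (\<lambda>t. (w t)\<^sup>2)) (at_left 1)"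
    by (intro tendsto_intros)
  moreover have "\<forall>\<^sub>F \<kappa> in at_left (1::real). \<kappa>\<^sup>2 * integral {c..c + pi} (\<lambda>t. (w t)\<^sup>2) \<le> integral {c..c + pi} (\<lambda>t. (w' t)\<^sup>2)"
    using eventually_at_left_real[of 0 1] by (auto elim!: eventually_mono intro: k)
  ultimately have "1\<^sup>2 * integral {c..c + pi} (\<lambda>t. (w t)\<^sup>2) \<le> integral {c..c + pi} (\<lambda>t. (w' t)\<^sup>2)"
    by (rule tendsto_upperbound) simp
  then show ?thesis by simp
qed

lemma integral_periodic:
  fixes h :: "real \<Rightarrow> real"
  assumes h: "continuous_on UNIV h" and per: "\<And>t. h (t + p) = h t" and a: "0 \<le> a" "a \<le> p"
  shows "integral {a..a + p} h = integral {0..p} h"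
proof -
  have int: "h integrable_on {x..y}" for x y
    using h continuous_on_subset by (intro integrable_continuous_interval) blast
  have "integral {a..a + p} h = integral {a..p} h + integral {p..a + p} h"
    using a by (intro Henstock_Kurzweil_Integration.integral_combine[symmetric] int) auto
  also have "integral {p..a + p} h = integral {0..a} h"
    using integral_shift_real_ivl[of p p "a + p" h] by (simp add: per)
  also have "integral {a..p} h + integral {0..a} h = integral {0..p} h"
    using Henstock_Kurzweil_Integration.integral_combine[of 0 a p h] a int by simp
  finally show ?thesis .
qed

text \<open>Subtracting from the real part its value at a point \<open>c\<close> with
  \<open>u (c + pi) = u c\<close> makes it vanish at both ends of two consecutive half-periods, so
  \<open>wirtinger_dirichlet\<close> applies to each half. This takes the place of removing the
  mean. The left side is twice the signed area enclosed by the curve.\<close>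

lemma wirtinger_circle:
  fixes F F' :: "real \<Rightarrow> complex"
  assumes der: "\<And>t. (F has_vector_derivative F' t) (at t)" and cont: "continuous_on UNIV F'"
    and per: "\<And>t. F (t + 2 * pi) = F t" "\<And>t. F' (t + 2 * pi) = F' t"
  shows "integral {0..2 * pi} (\<lambda>t. Im (cnj (F t) * F' t)) \<le> integral {0..2 * pi} (\<lambda>t. (cmod (F' t))\<^sup>2)"
proof -
  define u where "u t = Re (F t)" for t
  define v where "v t = Im (F t)" for t
  define u' where "u' t = Re (F' t)" for t
  define v' where "v' t = Im (F' t)" for t
  have du: "(u has_real_derivative u' t) (at t)" and dv: "(v has_real_derivative v' t) (at t)" for t
    using bounded_linear.has_vector_derivative[OF bounded_linear_Re der[of t]]
      bounded_linear.has_vector_derivative[OF bounded_linear_Im der[of t]]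
    by (simp_all add: has_real_derivative_iff_has_vector_derivative u_def[abs_def] v_def[abs_def] u'_def v'_def)
  have cu: "continuous_on S u" and cv: "continuous_on S v" for S
    using du dv by (meson DERIV_isCont continuous_at_imp_continuous_on)+
  have cu': "continuous_on S u'" and cv': "continuous_on S v'" for S
    unfolding u'_def[abs_def] v'_def[abs_def] using continuous_on_subset[OF cont, of S] by (auto intro!: continuous_intros)
  have pu: "u (t + 2 * pi) = u t" "v (t + 2 * pi) = v t" "u' (t + 2 * pi) = u' t" "v' (t + 2 * pi) = v' t" for t
    by (simp_all add: u_def v_def u'_def v'_def per)
  have "\<exists>c\<ge>0. c \<le> pi \<and> u (c + pi) - u c = 0"
  proof -
    \<comment> \<open>\<open>d\<close> takes opposite values at the two ends of a half-period, by
      periodicity of \<open>u\<close>, so it has a zero.\<close>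
    define d where "d t = u (t + pi) - u t" for t
    have "continuous_on UNIV (\<lambda>t. u (t + pi))" by (rule continuous_on_compose2[OF cu[of UNIV]]) (auto intro!: continuous_intros)
    then have cd: "continuous_on {0..pi} d"
      unfolding d_def[abs_def] using cu continuous_on_subset by (intro continuous_intros) blast+
    have "d pi = - d 0" using pu(1)[of 0] by (simp add: d_def)
    then have "d 0 \<le> 0 \<and> 0 \<le> d pi \<or> d pi \<le> 0 \<and> 0 \<le> d 0" by linarith
    then obtain c where "0 \<le> c" "c \<le> pi" "d c = 0"
      using IVT'[of d 0 0 pi] IVT2'[of d pi 0 0] cd by auto
    then show ?thesis unfolding d_def by blast
  qed
  then obtain c where c: "0 \<le> c" "c \<le> pi" "u (c + pi) = u c" by auto
  define w where "w t = u t - u c" for t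
  have dw: "(w has_real_derivative u' t) (at t)" for t
    unfolding w_def[abs_def] by (rule derivative_eq_intros du | simp)+
  have cw: "continuous_on S w" for S unfolding w_def[abs_def] by (intro continuous_intros cu)
  have int: "h integrable_on {a..b}" if "\<And>S. continuous_on S h" for h :: "real \<Rightarrow> real" and a b
    by (rule integrable_continuous_interval[OF that])
  have w2: "integral {c..c + 2 * pi} (\<lambda>t. (w t)\<^sup>2) \<le> integral {c..c + 2 * pi} (\<lambda>t. (u' t)\<^sup>2)"
  proof -
    have "integral {c..c + pi} (\<lambda>t. (w t)\<^sup>2) \<le> integral {c..c + pi} (\<lambda>t. (u' t)\<^sup>2)"
      by (rule wirtinger_dirichlet[OF dw cu']) (auto simp: w_def c)
    moreover have "integral {c + pi..c + pi + pi} (\<lambda>t. (w t)\<^sup>2) \<le> integral {c + pi..c + pi + pi} (\<lambda>t. (u' t)\<^sup>2)"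
      by (rule wirtinger_dirichlet[OF dw cu']) (use c pu(1)[of c] in \<open>auto simp: w_def add.assoc\<close>)
    moreover have e: "c + pi + pi = c + 2 * pi" by simp
    moreover have "integral {c..c + pi} h + integral {c + pi..c + pi + pi} h = integral {c..c + 2 * pi} h"
      if "\<And>S. continuous_on S h" for h :: "real \<Rightarrow> real"
      unfolding e using Henstock_Kurzweil_Integration.integral_combine[of c "c + pi" "c + 2 * pi" h] int[OF that] by simp
    from this[of "\<lambda>t. (w t)\<^sup>2"] this[of "\<lambda>t. (u' t)\<^sup>2"] cw cu'
    have "integral {c..c + pi} (\<lambda>t. (w t)\<^sup>2) + integral {c + pi..c + pi + pi} (\<lambda>t. (w t)\<^sup>2) = integral {c..c + 2 * pi} (\<lambda>t. (w t)\<^sup>2)"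
      "integral {c..c + pi} (\<lambda>t. (u' t)\<^sup>2) + integral {c + pi..c + pi + pi} (\<lambda>t. (u' t)\<^sup>2) = integral {c..c + 2 * pi} (\<lambda>t. (u' t)\<^sup>2)"
      by (simp_all add: continuous_on_power)
    ultimately show ?thesis by linarith
  qed
  have uv: "integral {c..c + 2 * pi} (\<lambda>t. w t * v' t + u' t * v t) = 0"
  proof -
    have "((\<lambda>t. w t * v' t + u' t * v t) has_integral (w (c + 2 * pi) * v (c + 2 * pi) - w c * v c)) {c..c + 2 * pi}"
    proof (rule fundamental_theorem_of_calculus)
      fix t
      have "((\<lambda>t. w t * v t) has_real_derivative (w t * v' t + u' t * v t)) (at t)"
        by (rule derivative_eq_intros dw dv refl | simp)+
      then show "((\<lambda>t. w t * v t) has_vector_derivative (w t * v' t + u' t * v t)) (at t within {c..c + 2 * pi})"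
        by (simp add: has_real_derivative_iff_has_vector_derivative has_vector_derivative_at_within)
    qed simp
    then show ?thesis using pu by (simp add: w_def integral_unique)
  qed
  have v0: "integral {c..c + 2 * pi} v' = 0"
  proof -
    have "(v' has_integral (v (c + 2 * pi) - v c)) {c..c + 2 * pi}"
      by (rule fundamental_theorem_of_calculus)
        (use dv in \<open>auto simp: has_real_derivative_iff_has_vector_derivative has_vector_derivative_at_within\<close>)
    then show ?thesis using pu by (simp add: integral_unique)
  qed
  \<comment> \<open>The integrand equals \<open>2 w v'\<close> up to the derivative of
    \<open>w v\<close> and a multiple of \<open>v'\<close>, both of which integrate to 0 over a
    period.\<close>
  have "integral {c..c + 2 * pi} (\<lambda>t. Im (cnj (F t) * F' t)) = integral {c..c + 2 * pi} (\<lambda>t. 2 * (w t * v' t) - (w t * v' t + u' t * v t) + u c * v' t)"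
    by (rule integral_cong) (simp add: u_def v_def u'_def v'_def w_def algebra_simps)
  also have "\<dots> = integral {c..c + 2 * pi} (\<lambda>t. 2 * (w t * v' t)) - integral {c..c + 2 * pi} (\<lambda>t. w t * v' t + u' t * v t) + integral {c..c + 2 * pi} (\<lambda>t. u c * v' t)"
    by (subst integral_add, (intro int continuous_intros cw cv cu' cv')+,
        subst integral_diff, (intro int continuous_intros cw cv cu' cv')+, rule refl)
  also have "\<dots> = integral {c..c + 2 * pi} (\<lambda>t. 2 * (w t * v' t))" by (simp add: uv v0)
  also have "\<dots> \<le> integral {c..c + 2 * pi} (\<lambda>t. (w t)\<^sup>2 + (v' t)\<^sup>2)"
    by (rule integral_le) (use sum_squares_bound in \<open>auto intro!: int continuous_intros cw cv' simp: mult.assoc\<close>)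
  also have "\<dots> = integral {c..c + 2 * pi} (\<lambda>t. (w t)\<^sup>2) + integral {c..c + 2 * pi} (\<lambda>t. (v' t)\<^sup>2)"
    by (intro integral_add int continuous_intros cw cv')
  also have "\<dots> \<le> integral {c..c + 2 * pi} (\<lambda>t. (u' t)\<^sup>2) + integral {c..c + 2 * pi} (\<lambda>t. (v' t)\<^sup>2)"
    using w2 by simp
  also have "\<dots> = integral {c..c + 2 * pi} (\<lambda>t. (u' t)\<^sup>2 + (v' t)\<^sup>2)"
    by (intro integral_add[symmetric] int continuous_intros cu' cv')
  also have "\<dots> = integral {c..c + 2 * pi} (\<lambda>t. (cmod (F' t))\<^sup>2)"
    by (simp add: u'_def v'_def cmod_power2)
  finally have main: "integral {c..c + 2 * pi} (\<lambda>t. Im (cnj (F t) * F' t)) \<le> integral {c..c + 2 * pi} (\<lambda>t. (cmod (F' t))\<^sup>2)" .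
  have cF: "continuous_on UNIV F"
    using der by (meson has_vector_derivative_continuous continuous_at_imp_continuous_on)
  have "integral {c..c + 2 * pi} (\<lambda>t. Im (cnj (F t) * F' t)) = integral {0..2 * pi} (\<lambda>t. Im (cnj (F t) * F' t))"
    by (rule integral_periodic) (use c per cF cont in \<open>auto intro!: continuous_intros\<close>)
  moreover have "integral {c..c + 2 * pi} (\<lambda>t. (cmod (F' t))\<^sup>2) = integral {0..2 * pi} (\<lambda>t. (cmod (F' t))\<^sup>2)"
    by (rule integral_periodic) (use c per cont in \<open>auto intro!: continuous_intros\<close>)
  ultimately show ?thesis using main by simp
qed

section \<open>The Jacobian as a divergence, and the smooth area inequality\<close>

text \<open>The regularity that averages over squares of a merely continuous function possess: first
  derivatives and the mixed second derivative, taken in both orders. The mixed derivative is what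
  cancels when the Jacobian is written as a divergence.\<close>

definition C1_mixed :: "(complex \<Rightarrow> complex) \<Rightarrow> (complex \<Rightarrow> complex) \<Rightarrow> (complex \<Rightarrow> complex) \<Rightarrow> (complex \<Rightarrow> complex) \<Rightarrow> bool" where
  "C1_mixed g gx gy gxy \<longleftrightarrow>
    continuous_on UNIV gx \<and> continuous_on UNIV gy \<and> continuous_on UNIV gxy \<and>
    (\<forall>x y. ((\<lambda>x. g (Complex x y)) has_vector_derivative gx (Complex x y)) (at x)) \<and>
    (\<forall>x y. ((\<lambda>y. g (Complex x y)) has_vector_derivative gy (Complex x y)) (at y)) \<and>
    (\<forall>x y. ((\<lambda>y. gx (Complex x y)) has_vector_derivative gxy (Complex x y)) (at y)) \<and>
    (\<forall>x y. ((\<lambda>x. gy (Complex x y)) has_vector_derivative gxy (Complex x y)) (at x))"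

lemma C1_mixed_has_derivative:
  assumes "C1_mixed g gx gy gxy"
  shows "(g has_derivative (\<lambda>h. Re h *\<^sub>R gx z + Im h *\<^sub>R gy z)) (at z)"
proof -
  note C = assms[unfolded C1_mixed_def]
  have "((\<lambda>(x, y). g (Complex x y)) has_derivative (\<lambda>(tx, ty). tx *\<^sub>R gx z + blinfun_apply (blinfun_scaleR_left (gy (Complex (Re z) (Im z)))) ty)) (at (Re z, Im z) within UNIV \<times> UNIV)"
  proof (rule has_derivative_partialsI)
    show "((\<lambda>x. g (Complex x (Im z))) has_derivative (\<lambda>tx. tx *\<^sub>R gx z)) (at (Re z) within UNIV)"
      using C by (simp add: has_vector_derivative_def[symmetric]) (metis complex.collapse)
    show "((\<lambda>y. g (Complex x y)) has_derivative blinfun_apply (blinfun_scaleR_left (gy (Complex x y)))) (at y within UNIV)" for x y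
      using C by (simp add: has_vector_derivative_def)
    have "continuous_on UNIV (\<lambda>p :: real \<times> real. gy (Complex (fst p) (snd p)))"
      using C by (intro continuous_on_compose2[of UNIV gy UNIV "\<lambda>p. Complex (fst p) (snd p)"])
        (auto simp: Complex_eq intro!: continuous_intros)
    then have "isCont (\<lambda>p :: real \<times> real. gy (Complex (fst p) (snd p))) (Re z, Im z)"
      by (simp add: continuous_on_eq_continuous_at)
    then have "isCont (\<lambda>p :: real \<times> real. blinfun_scaleR_left (gy (Complex (fst p) (snd p)))) (Re z, Im z)"
      by (intro continuous_intros)
    then show "continuous (at (Re z, Im z) within UNIV \<times> UNIV) (\<lambda>(x, y). blinfun_scaleR_left (gy (Complex x y)))"
      by (simp add: case_prod_beta')
  qed auto
  then have "((\<lambda>(x, y). g (Complex x y)) has_derivative (\<lambda>(tx, ty). tx *\<^sub>R gx z + ty *\<^sub>R gy z)) (at (Re z, Im z))" by simp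
  moreover have "((\<lambda>z. (Re z, Im z)) has_derivative (\<lambda>h. (Re h, Im h))) (at z)"
    by (intro derivative_intros)
  ultimately have "((\<lambda>(x, y). g (Complex x y)) \<circ> (\<lambda>z. (Re z, Im z)) has_derivative (\<lambda>(tx, ty). tx *\<^sub>R gx z + ty *\<^sub>R gy z) \<circ> (\<lambda>h. (Re h, Im h))) (at z)"
    by (intro diff_chain_at) auto
  then show ?thesis by (simp add: o_def)
qed

text \<open>If \<open>P\<close> and \<open>Q\<close> are the partial derivatives of a function, this is its derivative with respect to the
  polar angle around the origin.\<close>

definition angular :: "(complex \<Rightarrow> complex) \<Rightarrow> (complex \<Rightarrow> complex) \<Rightarrow> complex \<Rightarrow> complex" where
  "angular P Q z = Re z *\<^sub>R Q z - Im z *\<^sub>R P z"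

text \<open>\<open>\<eta>\<close> is a radial cut-off function with gradient \<open>- w z\<close>, the derivative being allowed to fail on
  finitely many circles.\<close>

definition radial_cutoff :: "real \<Rightarrow> real set \<Rightarrow> (complex \<Rightarrow> real) \<Rightarrow> (complex \<Rightarrow> real) \<Rightarrow> bool" where
  "radial_cutoff R S \<eta> w \<longleftrightarrow> R > 0 \<and> finite S \<and> continuous_on UNIV \<eta> \<and> (\<forall>z. cmod z \<ge> R \<longrightarrow> \<eta> z = 0) \<and>
     w \<in> borel_measurable borel \<and> (\<exists>B. \<forall>z. \<bar>w z\<bar> \<le> B) \<and> (\<forall>z. w z \<ge> 0) \<and> (\<forall>z. cmod z \<ge> R \<longrightarrow> w z = 0) \<and>
     (\<forall>c z. cmod c = 1 \<longrightarrow> w (c * z) = w z) \<and>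
     (\<forall>x y. x\<^sup>2 + y\<^sup>2 \<notin> S \<longrightarrow> ((\<lambda>x. \<eta> (Complex x y)) has_real_derivative - (w (Complex x y) * x)) (at x)) \<and>
     (\<forall>x y. x\<^sup>2 + y\<^sup>2 \<notin> S \<longrightarrow> ((\<lambda>y. \<eta> (Complex x y)) has_real_derivative - (w (Complex x y) * y)) (at y))"

lemma C1_mixed_continuous:
  assumes "C1_mixed g gx gy gxy"
  shows "continuous_on A g"
  by (rule continuous_at_imp_continuous_on, rule ballI,
      rule has_derivative_continuous[OF C1_mixed_has_derivative[OF assms]])

lemma continuous_bounded_on_cball:
  fixes G :: "complex \<Rightarrow> real"
  assumes "continuous_on UNIV G"
  obtains C where "\<And>z. cmod z \<le> R \<Longrightarrow> \<bar>G z\<bar> \<le> C"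
proof -
  have "bounded (G ` cball 0 R)"
    using continuous_on_subset[OF assms] by (intro compact_imp_bounded compact_continuous_image) auto
  then obtain C where "\<forall>x\<in>G ` cball 0 R. norm x \<le> C"
    unfolding bounded_iff by (rule exE)
  then show ?thesis by (intro that[of C]) auto
qed

lemma integrable_compact_support:
  fixes m :: "complex \<Rightarrow> real" and G :: "complex \<Rightarrow> real"
  assumes [measurable]: "m \<in> borel_measurable borel" and B: "\<And>z. \<bar>m z\<bar> \<le> B" and m0: "\<And>z. cmod z \<ge> R \<Longrightarrow> m z = 0"
    and G: "continuous_on UNIV G"
  shows "integrable lborel (\<lambda>z. m z * G z)"
proof -
  have [measurable]: "G \<in> borel_measurable borel" by (rule borel_measurable_continuous_onI[OF G])
  obtain C where C: "\<And>z. cmod z \<le> R \<Longrightarrow> \<bar>G z\<bar> \<le> C"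
    using continuous_bounded_on_cball[OF G] by blast
  have B0: "B \<ge> 0" using B[of 0] by linarith
  show ?thesis
  proof (rule integrableI_bounded_set[where A = "cball 0 R" and B = "B * C"])
    show "AE z in lborel. z \<in> cball 0 R \<longrightarrow> norm (m z * G z) \<le> B * C"
      using B C B0 by (auto simp: abs_mult intro!: mult_mono)
    show "AE z in lborel. z \<notin> cball 0 R \<longrightarrow> m z * G z = 0" using m0 by auto
    show "emeasure lborel (cball (0::complex) R) < \<infinity>" by (rule emeasure_lborel_cball_finite)
  qed auto
qed

lemma line_integral_zero:
  fixes \<Phi> h :: "real \<Rightarrow> real"
  assumes "finite S" "R > 0" "continuous_on UNIV \<Phi>"
    and der: "\<And>x. x \<notin> S \<Longrightarrow> (\<Phi> has_real_derivative h x) (at x)"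
    and "\<Phi> R = 0" "\<Phi> (- R) = 0" and h0: "\<And>x. \<bar>x\<bar> > R \<Longrightarrow> h x = 0"
  shows "(\<integral>x. h x \<partial>lborel) = 0"
proof -
  have "(h has_integral (\<Phi> R - \<Phi> (- R))) {- R..R}"
    by (rule fundamental_theorem_of_calculus_strong[OF assms(1)])
      (use assms(2) der continuous_on_subset[OF assms(3)] in \<open>auto simp: has_real_derivative_iff_has_vector_derivative[symmetric]\<close>)
  then have "(h has_integral 0) {- R..R}" using assms by simp
  then have "(h has_integral 0) UNIV"
    by (rule has_integral_on_superset) (use h0 in \<open>auto simp: abs_if not_le\<close>)
  \<comment> \<open>If \<open>h\<close> is not Lebesgue integrable its integral is 0 by convention;
    otherwise it agrees with the gauge integral.\<close>
  then show ?thesis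
    using has_integral_integral_lborel[of h] has_integral_unique not_integrable_integral_eq by blast
qed

text \<open>A line meets each circle in at most two points, so a radial cut-off is differentiable at
  all but finitely many points of the line.\<close>

lemma finite_circle_slice: "finite S \<Longrightarrow> finite {x::real. x\<^sup>2 + c \<in> S}"
proof -
  assume S: "finite S"
  have "{x. x\<^sup>2 + c \<in> S} \<subseteq> (\<Union>s\<in>S. {sqrt (s - c), - sqrt (s - c)})"
  proof
    fix x assume "x \<in> {x. x\<^sup>2 + c \<in> S}"
    then have s: "x\<^sup>2 + c \<in> S" by simp
    have "x = sqrt (x\<^sup>2 + c - c) \<or> x = - sqrt (x\<^sup>2 + c - c)" by (auto simp: abs_if)
    then show "x \<in> (\<Union>s\<in>S. {sqrt (s - c), - sqrt (s - c)})" using s by blast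
  qed
  then show ?thesis using S finite_subset by blast
qed

lemma continuous_on_line:
  assumes "continuous_on UNIV G"
  shows "continuous_on A (\<lambda>x. G (Complex x y))" "continuous_on A (\<lambda>y. G (Complex x y))"
  by (rule continuous_on_compose2[OF assms]; auto simp: Complex_eq intro!: continuous_intros)+

lemma Im_mult_has_real_derivative:
  assumes "(p has_vector_derivative p') (at t)" "(q has_vector_derivative q') (at t)"
  shows "((\<lambda>t. Im (cnj (p t) * q t)) has_real_derivative Im (cnj p' * q t + cnj (p t) * q')) (at t)"
proof -
  have "((\<lambda>t. cnj (p t)) has_vector_derivative cnj p') (at t)"
    by (rule bounded_linear.has_vector_derivative[OF bounded_linear_cnj assms(1)])
  then have "((\<lambda>t. cnj (p t) * q t) has_vector_derivative (cnj (p t) * q' + cnj p' * q t)) (at t)"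
    by (intro has_vector_derivative_mult assms(2))
  from bounded_linear.has_vector_derivative[OF bounded_linear_Im this]
  show ?thesis by (simp add: has_real_derivative_iff_has_vector_derivative add.commute)
qed

text \<open>Twice the Jacobian is the divergence
  \<open>d/dx Im (cnj g gy) - d/dy Im (cnj g gx)\<close>, the terms with the mixed derivative
  cancelling. Integration by parts on horizontal and on vertical lines moves the derivatives to
  \<open>\<eta>\<close>, and its gradient \<open>- w z\<close> combines the two partial derivatives
  of \<open>g\<close> into the angular one.\<close>

lemma null_lagrangian:
  assumes g: "C1_mixed g gx gy gxy" and cut: "radial_cutoff R S \<eta> w"
  shows "2 * (\<integral>z. \<eta> z * Im (cnj (gx z) * gy z) \<partial>lborel) = (\<integral>z. w z * Im (cnj (g z) * angular gx gy z) \<partial>lborel)"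
proof -
  note C = g[unfolded C1_mixed_def]
  note U = cut[unfolded radial_cutoff_def]
  have cg: "continuous_on UNIV g" by (rule C1_mixed_continuous[OF g])
  have cgx: "continuous_on UNIV gx" and cgy: "continuous_on UNIV gy" and cgxy: "continuous_on UNIV gxy"
    and c\<eta>: "continuous_on UNIV \<eta>" using C U by auto
  have [measurable]: "\<eta> \<in> borel_measurable borel" by (rule borel_measurable_continuous_onI[OF c\<eta>])
  have wm[measurable]: "w \<in> borel_measurable borel" using U by blast
  have R: "R > 0" using U by blast
  obtain Bw where Bw: "\<And>z. \<bar>w z\<bar> \<le> Bw" using U by blast
  have w0: "w z = 0" and \<eta>0: "\<eta> z = 0" if "cmod z \<ge> R" for z using U that by blast+
  obtain B\<eta> where B\<eta>: "\<And>z. \<bar>\<eta> z\<bar> \<le> B\<eta>"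
  proof -
    obtain b where b: "\<And>z. cmod z \<le> R \<Longrightarrow> \<bar>\<eta> z\<bar> \<le> b"
      using continuous_bounded_on_cball[OF c\<eta>] by blast
    have "\<bar>\<eta> z\<bar> \<le> max b 0" for z using b[of z] \<eta>0[of z] by (cases "cmod z \<le> R") auto
    then show ?thesis using that by blast
  qed
  have big: "cmod (Complex x y) \<ge> R" if "\<bar>x\<bar> \<ge> R \<or> \<bar>y\<bar> \<ge> R" for x y
    using that abs_Re_le_cmod[of "Complex x y"] abs_Im_le_cmod[of "Complex x y"] by auto
  \<comment> \<open>In \<open>k1\<close> and \<open>k2\<close> the derivative falls on the cut-off,
    in \<open>j1\<close> and \<open>j2\<close> on the factor formed from \<open>g\<close>.\<close>
  define k1 where "k1 z = w z * (- Re z * Im (cnj (g z) * gy z))" for z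
  define k2 where "k2 z = w z * (- Im z * Im (cnj (g z) * gx z))" for z
  define j1 where "j1 z = \<eta> z * Im (cnj (gx z) * gy z + cnj (g z) * gxy z)" for z
  define j2 where "j2 z = \<eta> z * Im (cnj (gy z) * gx z + cnj (g z) * gxy z)" for z
  have ik1: "integrable lborel k1" and ik2: "integrable lborel k2"
    unfolding k1_def[abs_def] k2_def[abs_def]
    by (rule integrable_compact_support[OF wm Bw w0]; auto intro!: continuous_intros cg cgx cgy)+
  have ij1: "integrable lborel j1" and ij2: "integrable lborel j2"
    unfolding j1_def[abs_def] j2_def[abs_def]
    by (rule integrable_compact_support[OF _ B\<eta> \<eta>0]; auto intro!: continuous_intros cg cgx cgy cgxy)+
  have x0: "(\<integral>x. k1 (Complex x y) + j1 (Complex x y) \<partial>lborel) = 0" for y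
  proof (rule line_integral_zero[where R = R and S = "{x. x\<^sup>2 + y\<^sup>2 \<in> S}" and \<Phi> = "\<lambda>x. \<eta> (Complex x y) * Im (cnj (g (Complex x y)) * gy (Complex x y))"])
    show "finite {x. x\<^sup>2 + y\<^sup>2 \<in> S}" using U by (intro finite_circle_slice) auto
    show "continuous_on UNIV (\<lambda>x. \<eta> (Complex x y) * Im (cnj (g (Complex x y)) * gy (Complex x y)))"
      by (intro continuous_intros continuous_on_line cg cgy c\<eta>)
    fix x assume "x \<notin> {x. x\<^sup>2 + y\<^sup>2 \<in> S}"
    then have d\<eta>: "((\<lambda>x. \<eta> (Complex x y)) has_real_derivative - (w (Complex x y) * x)) (at x)" using U by blast
    have "((\<lambda>x. Im (cnj (g (Complex x y)) * gy (Complex x y))) has_real_derivative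
        Im (cnj (gx (Complex x y)) * gy (Complex x y) + cnj (g (Complex x y)) * gxy (Complex x y))) (at x)"
      by (rule Im_mult_has_real_derivative) (use C in blast)+
    from DERIV_mult[OF d\<eta> this]
    show "((\<lambda>x. \<eta> (Complex x y) * Im (cnj (g (Complex x y)) * gy (Complex x y))) has_real_derivative k1 (Complex x y) + j1 (Complex x y)) (at x)"
      by (rule DERIV_cong) (simp add: k1_def j1_def algebra_simps)
  qed (use R big w0 \<eta>0 in \<open>auto simp: k1_def j1_def\<close>)
  have y0: "(\<integral>y. k2 (Complex x y) + j2 (Complex x y) \<partial>lborel) = 0" for x
  proof (rule line_integral_zero[where R = R and S = "{y. y\<^sup>2 + x\<^sup>2 \<in> S}" and \<Phi> = "\<lambda>y. \<eta> (Complex x y) * Im (cnj (g (Complex x y)) * gx (Complex x y))"])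
    show "finite {y. y\<^sup>2 + x\<^sup>2 \<in> S}" using U by (intro finite_circle_slice) auto
    show "continuous_on UNIV (\<lambda>y. \<eta> (Complex x y) * Im (cnj (g (Complex x y)) * gx (Complex x y)))"
      by (intro continuous_intros continuous_on_line cg cgx c\<eta>)
    fix y assume "y \<notin> {y. y\<^sup>2 + x\<^sup>2 \<in> S}"
    then have "x\<^sup>2 + y\<^sup>2 \<notin> S" by (simp add: add.commute)
    then have d\<eta>: "((\<lambda>y. \<eta> (Complex x y)) has_real_derivative - (w (Complex x y) * y)) (at y)" using U by blast
    have "((\<lambda>y. Im (cnj (g (Complex x y)) * gx (Complex x y))) has_real_derivative
        Im (cnj (gy (Complex x y)) * gx (Complex x y) + cnj (g (Complex x y)) * gxy (Complex x y))) (at y)"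
      by (rule Im_mult_has_real_derivative) (use C in blast)+
    from DERIV_mult[OF d\<eta> this]
    show "((\<lambda>y. \<eta> (Complex x y) * Im (cnj (g (Complex x y)) * gx (Complex x y))) has_real_derivative k2 (Complex x y) + j2 (Complex x y)) (at y)"
      by (rule DERIV_cong) (simp add: k2_def j2_def algebra_simps)
  qed (use R big w0 \<eta>0 in \<open>auto simp: k2_def j2_def\<close>)
  have z1: "(\<integral>z. k1 z + j1 z \<partial>lborel) = 0"
    using integral_complex_yx[OF Bochner_Integration.integrable_add[OF ik1 ij1]] by (simp add: x0)
  have z2: "(\<integral>z. k2 z + j2 z \<partial>lborel) = 0"
    using integral_complex_xy[OF Bochner_Integration.integrable_add[OF ik2 ij2]] by (simp add: y0)
  have iJ: "integrable lborel (\<lambda>z. \<eta> z * Im (cnj (gx z) * gy z))"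
    by (rule integrable_compact_support[OF _ B\<eta> \<eta>0]; auto intro!: continuous_intros cgx cgy)
  have iW: "integrable lborel (\<lambda>z. w z * Im (cnj (g z) * angular gx gy z))"
    unfolding angular_def by (rule integrable_compact_support[OF wm Bw w0]; auto intro!: continuous_intros cg cgx cgy)
  have "(k1 z + j1 z) - (k2 z + j2 z) = 2 * (\<eta> z * Im (cnj (gx z) * gy z)) - w z * Im (cnj (g z) * angular gx gy z)" for z
    by (simp add: k1_def k2_def j1_def j2_def angular_def algebra_simps)
  then have "(\<integral>z. 2 * (\<eta> z * Im (cnj (gx z) * gy z)) - w z * Im (cnj (g z) * angular gx gy z) \<partial>lborel) = (\<integral>z. (k1 z + j1 z) - (k2 z + j2 z) \<partial>lborel)"
    by simp
  also have "\<dots> = 0"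
    using z1 z2 ik1 ik2 ij1 ij2 by (subst Bochner_Integration.integral_diff) auto
  finally show ?thesis using iJ iW by simp
qed

lemma cis_measurable [measurable]: "cis \<in> borel_measurable borel"
  by (intro borel_measurable_continuous_onI continuous_on_cis continuous_on_id)

text \<open>Both \<open>w\<close> and Lebesgue measure are invariant under rotations, so the
  integral equals its average over all rotations of \<open>H\<close>. Exchanging the integrals
  leaves integrals over circles; this stands in for polar coordinates.\<close>

lemma radial_weight_nonpos:
  fixes H :: "complex \<Rightarrow> real"
  assumes cut: "radial_cutoff R S \<eta> w" and H: "continuous_on UNIV H"
    and circ: "\<And>z. integral {0..2 * pi} (\<lambda>t. H (cis t * z)) \<le> 0"
  shows "(\<integral>z. w z * H z \<partial>lborel) \<le> 0"
proof -
  note U = cut[unfolded radial_cutoff_def]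
  have [measurable]: "w \<in> borel_measurable borel" using U by blast
  have [measurable]: "H \<in> borel_measurable borel" by (rule borel_measurable_continuous_onI[OF H])
  obtain Bw where Bw: "\<And>z. \<bar>w z\<bar> \<le> Bw" using U by blast
  have w0: "w z = 0" if "cmod z \<ge> R" for z using U that by blast
  have Bw0: "Bw \<ge> 0" using Bw[of 0] by linarith
  obtain C where C: "\<And>z. cmod z \<le> R \<Longrightarrow> \<bar>H z\<bar> \<le> C"
    using continuous_bounded_on_cball[OF H] by blast
  define k where "k t z = indicator {0..2 * pi} t * (w z * H (cis t * z))" for t z
  have ik: "integrable (lborel \<Otimes>\<^sub>M lborel) (\<lambda>(t, z). k t z)"
  proof (rule integrableI_bounded_set[where A = "{0..2 * pi} \<times> cball 0 R" and B = "Bw * C"])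
    show "(\<lambda>(t, z). k t z) \<in> borel_measurable (lborel \<Otimes>\<^sub>M lborel)" unfolding k_def by measurable
    have "emeasure (lborel \<Otimes>\<^sub>M lborel) ({0..2 * pi} \<times> cball (0::complex) R) = emeasure lborel {0..2 * pi} * emeasure lborel (cball (0::complex) R)"
      by (rule lborel.emeasure_pair_measure_Times) auto
    also have "\<dots> < \<infinity>" using emeasure_lborel_cball_finite[of "0::complex" R] by (simp add: ennreal_mult_less_top)
    finally show "emeasure (lborel \<Otimes>\<^sub>M lborel) ({0..2 * pi} \<times> cball (0::complex) R) < \<infinity>" .
    show "AE p in lborel \<Otimes>\<^sub>M lborel. p \<in> {0..2 * pi} \<times> cball 0 R \<longrightarrow> norm (case p of (t, z) \<Rightarrow> k t z) \<le> Bw * C"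
    proof (rule AE_I2, rule impI)
      fix p :: "real \<times> complex" assume "p \<in> {0..2 * pi} \<times> cball 0 R"
      then obtain t z where p: "p = (t, z)" "t \<in> {0..2 * pi}" "z \<in> cball 0 R" by auto
      have "\<bar>w z\<bar> * \<bar>H (cis t * z)\<bar> \<le> Bw * C"
        using p Bw Bw0 C[of "cis t * z"] by (intro mult_mono) (auto simp: norm_mult)
      then show "norm (case p of (t, z) \<Rightarrow> k t z) \<le> Bw * C" using p by (simp add: k_def abs_mult)
    qed
    show "AE p in lborel \<Otimes>\<^sub>M lborel. p \<notin> {0..2 * pi} \<times> cball 0 R \<longrightarrow> (case p of (t, z) \<Rightarrow> k t z) = 0"
    proof (rule AE_I2, rule impI)
      fix p :: "real \<times> complex" assume p: "p \<notin> {0..2 * pi} \<times> cball 0 R"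
      obtain t z where tz: "p = (t, z)" by (cases p)
      have "t \<notin> {0..2 * pi} \<or> cmod z \<ge> R" using p tz by auto
      then show "(case p of (t, z) \<Rightarrow> k t z) = 0" using w0[of z] tz by (auto simp: k_def)
    qed
  qed auto
  have rot: "(\<integral>z. w z * H (cis t * z) \<partial>lborel) = (\<integral>z. w z * H z \<partial>lborel)" for t
  proof -
    have "(\<integral>z. w z * H (cis t * z) \<partial>lborel) = (\<integral>z. w (cis t * z) * H (cis t * z) \<partial>lborel)"
      using U by (intro Bochner_Integration.integral_cong) auto
    also have "\<dots> = (\<integral>z. w z * H z \<partial>distr lborel borel ((*) (cis t)))"
      by (subst integral_distr) auto
    also have "\<dots> = (\<integral>z. w z * H z \<partial>lborel)" by (subst lborel_rotation) auto
    finally show ?thesis .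
  qed
  have inner: "(\<integral>t. k t z \<partial>lborel) \<le> 0" for z
  proof -
    have ch: "continuous_on {0..2 * pi} (\<lambda>t. H (cis t * z))"
      by (rule continuous_on_compose2[OF H]) (auto intro!: continuous_intros)
    have "(LBINT t:{0..2 * pi}. H (cis t * z)) = integral {0..2 * pi} (\<lambda>t. H (cis t * z))"
      by (rule set_borel_integral_eq_integral(2)) (rule borel_integrable_atLeastAtMost', rule ch)
    then have "(LBINT t:{0..2 * pi}. H (cis t * z)) \<le> 0" using circ by simp
    moreover have "(\<integral>t. k t z \<partial>lborel) = w z * (LBINT t:{0..2 * pi}. H (cis t * z))"
      unfolding k_def set_lebesgue_integral_def
      by (subst integral_mult_right_zero[symmetric]) (auto intro!: Bochner_Integration.integral_cong simp: mult_ac)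
    ultimately show ?thesis using U by (simp add: mult_nonneg_nonpos)
  qed
  have "2 * pi * (\<integral>z. w z * H z \<partial>lborel) = (\<integral>t. indicator {0..2 * pi} t * (\<integral>z. w z * H z \<partial>lborel) \<partial>lborel)"
    by simp
  also have "\<dots> = (\<integral>t. \<integral>z. k t z \<partial>lborel \<partial>lborel)"
    unfolding k_def by (simp add: rot)
  also have "\<dots> = (\<integral>z. \<integral>t. k t z \<partial>lborel \<partial>lborel)"
    by (rule lborel_pair.Fubini_integral[symmetric]) (rule ik)
  also have "\<dots> \<le> 0"
  proof -
    have "0 \<le> (\<integral>z. - (\<integral>t. k t z \<partial>lborel) \<partial>lborel)"
      by (rule Bochner_Integration.integral_nonneg) (use inner in simp)
    then show ?thesis by simp
  qed
  finally show ?thesis using pi_gt_zero by (simp add: mult_le_0_iff)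
qed

text \<open>By \<open>null_lagrangian\<close> the left side is the integral of
  \<open>Im (cnj g * angular gx gy)\<close> with weight \<open>w\<close>. On each circle
  \<open>angular gx gy\<close> is the derivative of \<open>g\<close> with respect to the angle, so
  \<open>wirtinger_circle\<close> applies.\<close>

lemma smooth_area_inequality:
  assumes g: "C1_mixed g gx gy gxy" and cut: "radial_cutoff R S \<eta> w"
  shows "2 * (\<integral>z. \<eta> z * Im (cnj (gx z) * gy z) \<partial>lborel) \<le> (\<integral>z. w z * (cmod (angular gx gy z))\<^sup>2 \<partial>lborel)"
proof -
  note C = g[unfolded C1_mixed_def]
  note U = cut[unfolded radial_cutoff_def]
  have cg: "continuous_on UNIV g" by (rule C1_mixed_continuous[OF g])
  have ca: "continuous_on UNIV (angular gx gy)"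
    unfolding angular_def[abs_def] using C by (intro continuous_intros) auto
  have wm: "w \<in> borel_measurable borel" using U by blast
  obtain Bw where Bw: "\<And>z. \<bar>w z\<bar> \<le> Bw" using U by blast
  have w0: "w z = 0" if "cmod z \<ge> R" for z using U that by blast
  have cis': "(cis has_vector_derivative \<i> * cis t) (at t)" for t
    unfolding cis_conv_exp by (rule derivative_eq_intros has_vector_derivative_real_field refl | simp)+
  have cont_circ: "continuous_on A (\<lambda>t. G (cis t * z))" if "continuous_on UNIV G" for A z and G :: "complex \<Rightarrow> complex"
    by (rule continuous_on_compose2[OF that]) (auto intro!: continuous_intros)
  have circ: "integral {0..2 * pi} (\<lambda>t. Im (cnj (g (cis t * z)) * angular gx gy (cis t * z)) - (cmod (angular gx gy (cis t * z)))\<^sup>2) \<le> 0" for z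
  proof -
    have der: "((\<lambda>t. g (cis t * z)) has_vector_derivative angular gx gy (cis t * z)) (at t)" for t
    proof -
      have "((\<lambda>t. cis t * z) has_vector_derivative (\<i> * cis t) * z) (at t)"
        by (intro has_vector_derivative_mult_left cis')
      then have "((\<lambda>t. cis t * z) has_derivative (\<lambda>h. h *\<^sub>R (\<i> * cis t * z))) (at t)"
        by (simp add: has_vector_derivative_def)
      from diff_chain_at[OF this C1_mixed_has_derivative[OF g, of "cis t * z"]]
      have "((\<lambda>t. g (cis t * z)) has_derivative (\<lambda>h. h *\<^sub>R (Re (\<i> * cis t * z) *\<^sub>R gx (cis t * z) + Im (\<i> * cis t * z) *\<^sub>R gy (cis t * z)))) (at t)"
        by (simp add: o_def scaleR_add_right)
      then show ?thesis unfolding has_vector_derivative_def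
        by (rule has_derivative_eq_rhs) (simp add: angular_def fun_eq_iff algebra_simps)
    qed
    have "integral {0..2 * pi} (\<lambda>t. Im (cnj (g (cis t * z)) * angular gx gy (cis t * z))) \<le> integral {0..2 * pi} (\<lambda>t. (cmod (angular gx gy (cis t * z)))\<^sup>2)"
      by (rule wirtinger_circle[OF der]) (auto intro!: cont_circ ca simp: cis_mult[symmetric])
    then show ?thesis
      by (subst integral_diff) (auto intro!: integrable_continuous_interval continuous_intros cont_circ cg ca)
  qed
  have "(\<integral>z. w z * (Im (cnj (g z) * angular gx gy z) - (cmod (angular gx gy z))\<^sup>2) \<partial>lborel) \<le> 0"
    by (rule radial_weight_nonpos[OF cut _ circ]) (intro continuous_intros cg ca)
  moreover have "integrable lborel (\<lambda>z. w z * Im (cnj (g z) * angular gx gy z))" "integrable lborel (\<lambda>z. w z * (cmod (angular gx gy z))\<^sup>2)"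
    by (rule integrable_compact_support[OF wm Bw w0]; auto intro!: continuous_intros cg ca)+
  ultimately show ?thesis using null_lagrangian[OF g cut] by (simp add: right_diff_distrib)
qed

subsection \<open>Steklov averages\<close>

text \<open>The majorants vary with \<open>n\<close>; by Scheffe's lemma, \<open>sup\<close> makes
  them converge in mean. Then \<open>|u n - u'|\<close> is at most
  \<open>min |u n - u'| (2 * v')\<close>, which has a fixed majorant, plus
  \<open>|v n - v'|\<close>.\<close>

lemma generalized_dominated_convergence:
  fixes u v :: "nat \<Rightarrow> 'a \<Rightarrow> real"
  assumes um[measurable]: "\<And>n. u n \<in> borel_measurable M" "u' \<in> borel_measurable M"
    and v: "\<And>n. integrable M (v n)" "integrable M v'"
    and bnd: "\<And>n. AE x in M. \<bar>u n x\<bar> \<le> v n x"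
    and u_lim: "AE x in M. (\<lambda>n. u n x) \<longlonglongrightarrow> u' x"
    and v_lim: "AE x in M. (\<lambda>n. v n x) \<longlonglongrightarrow> v' x"
    and sup: "limsup (\<lambda>n. \<integral>\<^sup>+ x. norm (v n x) \<partial>M) \<le> (\<integral>\<^sup>+ x. norm (v' x) \<partial>M)"
  shows "integrable M u'" "(\<lambda>n. \<integral>x. u n x \<partial>M) \<longlonglongrightarrow> (\<integral>x. u' x \<partial>M)"
proof -
  have [measurable]: "\<And>n. v n \<in> borel_measurable M" "v' \<in> borel_measurable M" using v by auto
  have iu: "integrable M (u n)" for n
    by (rule Bochner_Integration.integrable_bound[OF v(1)[of n]]) (use bnd[of n] in \<open>auto elim!: eventually_mono\<close>)
  have bndall: "AE x in M. \<forall>n. \<bar>u n x\<bar> \<le> v n x" using bnd by (simp add: AE_all_countable)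
  have u'v': "AE x in M. \<bar>u' x\<bar> \<le> v' x"
    using bndall u_lim v_lim
  proof eventually_elim
    case (elim x)
    show ?case by (rule LIMSEQ_le[OF tendsto_rabs[OF elim(2)] elim(3)]) (use elim(1) in auto)
  qed
  show iu': "integrable M u'"
    by (rule Bochner_Integration.integrable_bound[OF v(2)]) (use u'v' in \<open>auto elim!: eventually_mono\<close>)
  have S: "(\<lambda>n. \<integral>x. \<bar>v n x - v' x\<bar> \<partial>M) \<longlonglongrightarrow> 0"
  proof -
    have "(\<lambda>n. \<integral>\<^sup>+ x. norm (v n x - v' x) \<partial>M) \<longlonglongrightarrow> 0"
      by (rule Scheffe_lemma1[OF v v_lim sup])
    moreover have "(\<integral>\<^sup>+ x. norm (v n x - v' x) \<partial>M) = ennreal (\<integral>x. \<bar>v n x - v' x\<bar> \<partial>M)" for n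
      using v by (subst nn_integral_eq_integral) auto
    ultimately have "(\<lambda>n. ennreal (\<integral>x. \<bar>v n x - v' x\<bar> \<partial>M)) \<longlonglongrightarrow> ennreal 0" by simp
    then show ?thesis by (subst (asm) tendsto_ennreal_iff) auto
  qed
  have D: "(\<lambda>n. \<integral>x. min \<bar>u n x - u' x\<bar> (2 * v' x) \<partial>M) \<longlonglongrightarrow> (\<integral>x. 0 \<partial>M)"
  proof (rule integral_dominated_convergence[where w = "\<lambda>x. 2 * \<bar>v' x\<bar>"])
    show "AE x in M. (\<lambda>n. min \<bar>u n x - u' x\<bar> (2 * v' x)) \<longlonglongrightarrow> 0"
      using u_lim u'v'
    proof eventually_elim
      case (elim x)
      have "(\<lambda>n. \<bar>u n x - u' x\<bar>) \<longlonglongrightarrow> \<bar>u' x - u' x\<bar>" by (intro tendsto_intros elim)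
      then have "(\<lambda>n. min \<bar>u n x - u' x\<bar> (2 * v' x)) \<longlonglongrightarrow> min 0 (2 * v' x)" by (intro tendsto_min) auto
      moreover have "min 0 (2 * v' x) = 0" using elim(2) by auto
      ultimately show ?case by simp
    qed
    show "AE x in M. norm (min \<bar>u n x - u' x\<bar> (2 * v' x)) \<le> 2 * \<bar>v' x\<bar>" for n
      using u'v' by eventually_elim auto
  qed (use v in auto)
  have lim0: "(\<lambda>n. (\<integral>x. min \<bar>u n x - u' x\<bar> (2 * v' x) \<partial>M) + (\<integral>x. \<bar>v n x - v' x\<bar> \<partial>M)) \<longlonglongrightarrow> 0"
    using tendsto_add[OF D S] by simp
  have le0: "norm ((\<integral>x. u n x \<partial>M) - (\<integral>x. u' x \<partial>M)) \<le> (\<integral>x. min \<bar>u n x - u' x\<bar> (2 * v' x) \<partial>M) + (\<integral>x. \<bar>v n x - v' x\<bar> \<partial>M)" for n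
  proof -
    have im: "integrable M (\<lambda>x. min \<bar>u n x - u' x\<bar> (2 * v' x))"
      using iu[of n] iu' v by (intro Bochner_Integration.integrable_min) auto
    have "norm ((\<integral>x. u n x \<partial>M) - (\<integral>x. u' x \<partial>M)) = norm (\<integral>x. u n x - u' x \<partial>M)"
      using iu iu' by simp
    also have "\<dots> \<le> (\<integral>x. \<bar>u n x - u' x\<bar> \<partial>M)" using integral_norm_bound[of M "\<lambda>x. u n x - u' x"] by simp
    also have "\<dots> \<le> (\<integral>x. min \<bar>u n x - u' x\<bar> (2 * v' x) + \<bar>v n x - v' x\<bar> \<partial>M)"
    proof (rule integral_mono_AE)
      show "AE x in M. \<bar>u n x - u' x\<bar> \<le> min \<bar>u n x - u' x\<bar> (2 * v' x) + \<bar>v n x - v' x\<bar>"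
        using u'v' bnd[of n] by eventually_elim auto
    qed (use iu iu' v im in auto)
    also have "\<dots> = (\<integral>x. min \<bar>u n x - u' x\<bar> (2 * v' x) \<partial>M) + (\<integral>x. \<bar>v n x - v' x\<bar> \<partial>M)"
      using im v by simp
    finally show ?thesis .
  qed
  have "(\<lambda>n. (\<integral>x. u n x \<partial>M) - (\<integral>x. u' x \<partial>M)) \<longlonglongrightarrow> 0"
    by (rule Lim_null_comparison[OF always_eventually[OF allI[OF le0]] lim0])
  then show "(\<lambda>n. \<integral>x. u n x \<partial>M) \<longlonglongrightarrow> (\<integral>x. u' x \<partial>M)" by (simp add: LIM_zero_iff)
qed

lemma set_nn_integral_eq_integral:
  fixes f :: "'a \<Rightarrow> real"
  assumes f: "set_integrable M A f" and nn: "\<And>x. f x \<ge> 0"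
  shows "(\<integral>\<^sup>+x\<in>A. ennreal (f x) \<partial>M) = ennreal (LINT x:A|M. f x)"
proof -
  have "(\<integral>\<^sup>+x\<in>A. ennreal (f x) \<partial>M) = (\<integral>\<^sup>+x. ennreal (indicator A x *\<^sub>R f x) \<partial>M)"
    by (intro nn_integral_cong) (simp add: indicator_def)
  also have "\<dots> = ennreal (LINT x:A|M. f x)"
    unfolding set_lebesgue_integral_def
    by (rule nn_integral_eq_integral) (use f nn in \<open>auto simp: set_integrable_def\<close>)
  finally show ?thesis .
qed

text \<open>The point \<open>z\<close> is the lower left corner, not the centre, so derivatives of
  the averages are forward differences of line integrals.\<close>

definition cell :: "real \<Rightarrow> complex \<Rightarrow> complex set" where
  "cell h z = cbox z (z + Complex h h)"

definition savg :: "real \<Rightarrow> (complex \<Rightarrow> 'a::real_normed_vector) \<Rightarrow> complex \<Rightarrow> 'a" where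
  "savg h F z = integral (cell h z) F /\<^sub>R h\<^sup>2"

lemma One_complex: "(One :: complex) = Complex 1 1"
  by (simp add: Basis_complex_def complex_eq_iff)

text \<open>Lebesgue's differentiation theorem for squares that have the point as a corner.\<close>

lemma savg_tendsto:
  fixes F :: "complex \<Rightarrow> 'b::euclidean_space"
  assumes "\<And>a b. F integrable_on cbox a b"
  shows "AE z in lborel. (\<lambda>n. savg (1 / real (Suc n)) F z) \<longlonglongrightarrow> F z"
proof -
  obtain N where N: "negligible N" "\<And>x e. \<lbrakk>x \<notin> N; 0 < e\<rbrakk> \<Longrightarrow>
      \<exists>d>0. \<forall>h. 0 < h \<and> h < d \<longrightarrow> norm (integral (cbox x (x + h *\<^sub>R One)) F /\<^sub>R h ^ DIM(complex) - F x) < e"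
    using integrable_ccontinuous_explicit[OF assms] by blast
  have "h *\<^sub>R (One::complex) = Complex h h" for h by (simp only: One_complex) (simp add: complex_eq_iff)
  then have S: "integral (cbox x (x + h *\<^sub>R One)) F /\<^sub>R h ^ DIM(complex) = savg h F x" for x h
    by (simp add: savg_def cell_def)
  have "AE z in lebesgue. z \<notin> N" using N(1) by (intro AE_not_in) (simp add: negligible_iff_null_sets)
  then have "AE z in lborel. z \<notin> N" by (simp only: AE_completion_iff)
  then show ?thesis
  proof eventually_elim
    case (elim z)
    show ?case
    proof (rule LIMSEQ_I)
      fix e :: real assume "e > 0"
      then obtain d where d: "d > 0" "\<And>h. 0 < h \<Longrightarrow> h < d \<Longrightarrow> norm (savg h F z - F z) < e"
        using N(2)[OF elim, of e] unfolding S by blast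
      obtain n0 where n0: "inverse (real (Suc n0)) < d" using reals_Archimedean[OF d(1)] by blast
      have "norm (savg (1 / real (Suc n)) F z - F z) < e" if "n \<ge> n0" for n
      proof (rule d(2))
        have "1 / real (Suc n) \<le> 1 / real (Suc n0)" using that by (intro divide_left_mono) auto
        then show "1 / real (Suc n) < d" using n0 by (simp add: inverse_eq_divide)
      qed simp
      then show "\<exists>no. \<forall>n\<ge>no. norm (savg (1 / real (Suc n)) F z - F z) < e" by blast
    qed
  qed
qed

lemma cell_measurable [measurable]: "cell h z \<in> sets borel" by (simp add: cell_def)

lemma emeasure_cell: "h \<ge> 0 \<Longrightarrow> emeasure lborel (cell h z) = ennreal (h\<^sup>2)"
  unfolding cell_def by (subst emeasure_lborel_cbox) (auto simp: Basis_complex_def power2_eq_square)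

lemma indicator_cell: "indicator (cell h z) (z + w) = indicator (cell h 0) w"
  by (auto simp: cell_def indicator_def cbox_def Basis_complex_def)

lemma nn_integral_cell:
  assumes [measurable]: "F \<in> borel_measurable borel"
  shows "(\<integral>\<^sup>+w\<in>cell h z. F w \<partial>lborel) = (\<integral>\<^sup>+w\<in>cell h 0. F (z + w) \<partial>lborel)"
  by (subst nn_integral_translation[symmetric, of _ z]) (auto simp: indicator_cell)

lemma cball_measurable [measurable]: "cball (z::complex) R \<in> sets borel" by simp

section \<open>Averages of a pair of locally square integrable functions\<close>

locale local_L2 =
  fixes P Q :: "complex \<Rightarrow> complex" and G :: "complex \<Rightarrow> real"
  assumes Pm[measurable]: "P \<in> borel_measurable borel" and Qm[measurable]: "Q \<in> borel_measurable borel"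
    and G_def: "\<And>z. G z = (cmod (P z))\<^sup>2 + (cmod (Q z))\<^sup>2"
    and fin: "\<And>R. (\<integral>\<^sup>+z\<in>cball 0 R. ennreal (G z) \<partial>lborel) < \<infinity>"
begin

lemma G_measurable [measurable]: "G \<in> borel_measurable borel"
  unfolding G_def[abs_def] by measurable

lemma G_nonneg: "G z \<ge> 0" by (simp add: G_def)

lemma G_finite_bounded:
  assumes "bounded B" "B \<in> sets borel"
  shows "(\<integral>\<^sup>+z\<in>B. ennreal (G z) \<partial>lborel) < \<infinity>"
proof -
  obtain R where "\<And>x. x \<in> B \<Longrightarrow> norm x \<le> R" using assms(1) by (auto simp: bounded_iff)
  then have "B \<subseteq> cball 0 R" by auto
  then have "(\<integral>\<^sup>+z\<in>B. ennreal (G z) \<partial>lborel) \<le> (\<integral>\<^sup>+z\<in>cball 0 R. ennreal (G z) \<partial>lborel)"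
    by (intro nn_integral_mono) (auto simp: indicator_def)
  then show ?thesis using fin[of R] by (rule le_less_trans)
qed

lemma set_integrable_bounded:
  fixes F :: "complex \<Rightarrow> 'b::euclidean_space"
  assumes B: "bounded B" "B \<in> sets borel" and [measurable]: "F \<in> borel_measurable borel"
    and le: "\<And>z. norm (F z) \<le> 1 + G z"
  shows "set_integrable lborel B F"
  unfolding set_integrable_def
proof (rule integrableI_bounded)
  show "(\<lambda>x. indicator B x *\<^sub>R F x) \<in> borel_measurable lborel" using B(2) by measurable
  have "(\<integral>\<^sup>+x. ennreal (norm (indicator B x *\<^sub>R F x)) \<partial>lborel) \<le> (\<integral>\<^sup>+x. indicator B x + ennreal (G x) * indicator B x \<partial>lborel)"
  proof (rule nn_integral_mono)
    fix x
    have "ennreal (norm (F x)) \<le> 1 + ennreal (G x)"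
      using le[of x] G_nonneg[of x] by (metis ennreal_1 ennreal_leI ennreal_plus zero_le_one)
    then show "ennreal (norm (indicator B x *\<^sub>R F x)) \<le> indicator B x + ennreal (G x) * indicator B x"
      by (simp add: indicator_def)
  qed
  also have "\<dots> = emeasure lborel B + (\<integral>\<^sup>+x\<in>B. ennreal (G x) \<partial>lborel)"
    using B(2) by (subst nn_integral_add) auto
  also have "\<dots> < \<infinity>"
    using G_finite_bounded[OF B] emeasure_bounded_finite[OF B(1)] by (simp add: ennreal_add_less_top)
  finally show "(\<integral>\<^sup>+x. ennreal (norm (indicator B x *\<^sub>R F x)) \<partial>lborel) < \<infinity>" .
qed

lemma norm_le_G: "cmod (P z) \<le> 1 + G z" "cmod (Q z) \<le> 1 + G z" "norm (G z) \<le> 1 + G z"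
proof -
  have *: "x \<le> 1 + x\<^sup>2" for x :: real
  proof -
    have "0 \<le> (x - 1/2)\<^sup>2" by simp
    then show ?thesis by (simp add: power2_eq_square algebra_simps)
  qed
  show "cmod (P z) \<le> 1 + G z" using *[of "cmod (P z)"] unfolding G_def by (smt (verit) zero_le_power2)
  show "cmod (Q z) \<le> 1 + G z" using *[of "cmod (Q z)"] unfolding G_def by (smt (verit) zero_le_power2)
  show "norm (G z) \<le> 1 + G z" using G_nonneg[of z] by simp
qed

lemmas integrable_cell =
  set_integrable_bounded[OF bounded_cbox borel_closed[OF closed_cbox] Pm norm_le_G(1)]
  set_integrable_bounded[OF bounded_cbox borel_closed[OF closed_cbox] Qm norm_le_G(2)]
  set_integrable_bounded[OF bounded_cbox borel_closed[OF closed_cbox] G_measurable norm_le_G(3)]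

lemmas integrable_on_cell = integrable_cell[THEN set_borel_integral_eq_integral(1)]

text \<open>As a nonnegative integral over a fixed cell, the average is visibly measurable in
  \<open>z\<close>.\<close>

lemma savg_G: "savg h G z = enn2real ((\<integral>\<^sup>+w\<in>cell h 0. ennreal (G (z + w)) \<partial>lborel) / ennreal (h\<^sup>2))" if "h > 0"
proof -
  have "(\<integral>\<^sup>+w\<in>cell h 0. ennreal (G (z + w)) \<partial>lborel) = (\<integral>\<^sup>+w\<in>cell h z. ennreal (G w) \<partial>lborel)"
    by (rule nn_integral_cell[symmetric]) measurable
  also have "\<dots> = ennreal (LBINT w:cell h z. G w)"
    unfolding cell_def by (rule set_nn_integral_eq_integral) (use integrable_cell(3) G_nonneg in auto)
  also have "(LBINT w:cell h z. G w) = integral (cell h z) G"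
    unfolding cell_def by (rule set_borel_integral_eq_integral(2)[OF integrable_cell(3)])
  finally have *: "(\<integral>\<^sup>+w\<in>cell h 0. ennreal (G (z + w)) \<partial>lborel) = ennreal (integral (cell h z) G)" .
  have "integral (cell h z) G \<ge> 0"
    unfolding cell_def using integrable_on_cell(3) G_nonneg by (intro integral_nonneg) auto
  then show ?thesis using that unfolding * savg_def by (simp add: divide_ennreal divide_inverse_commute)
qed

lemma savg_G_measurable [measurable]: "h > 0 \<Longrightarrow> savg h G \<in> borel_measurable borel"
proof -
  assume h: "h > 0"
  have "(\<lambda>z. enn2real ((\<integral>\<^sup>+w\<in>cell h 0. ennreal (G (z + w)) \<partial>lborel) / ennreal (h\<^sup>2))) \<in> borel_measurable borel" by measurable
  moreover have "savg h G = (\<lambda>z. enn2real ((\<integral>\<^sup>+w\<in>cell h 0. ennreal (G (z + w)) \<partial>lborel) / ennreal (h\<^sup>2)))"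
    by (rule ext) (rule savg_G[OF h])
  ultimately show ?thesis by (simp only:)
qed

lemma savg_G_nonneg: "h > 0 \<Longrightarrow> savg h G z \<ge> 0" by (simp add: savg_G)

text \<open>Jensen's inequality for the square, obtained from Cauchy-Schwarz against the constant 1
  on a cell of area \<open>h^2\<close>.\<close>

lemma savg_square_le:
  assumes h: "h > 0" and F: "F = P \<or> F = Q"
  shows "(cmod (savg h F z))\<^sup>2 \<le> savg h (\<lambda>z. (cmod (F z))\<^sup>2) z"
proof -
  have Fi: "set_integrable lborel (cell h z) F" and F2m: "F \<in> borel_measurable borel"
    using F integrable_cell(1,2) Pm Qm unfolding cell_def by auto
  note [measurable] = F2m
  have F2: "set_integrable lborel (cell h z) (\<lambda>z. (cmod (F z))\<^sup>2)"
    unfolding cell_def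
    by (rule set_integrable_bounded) (use F in \<open>auto simp: G_def\<close>)
  let ?I = "LBINT w:cell h z. (cmod (F w))\<^sup>2"
  have nF: "set_integrable lborel (cell h z) (\<lambda>w. cmod (F w))" using Fi by (rule set_integrable_norm)
  have I0: "?I \<ge> 0" unfolding set_lebesgue_integral_def by (intro Bochner_Integration.integral_nonneg) auto
  have a: "cmod (integral (cell h z) F) \<le> (LBINT w:cell h z. cmod (F w))"
  proof -
    have "integral (cell h z) F = (LBINT w:cell h z. F w)"
      using set_borel_integral_eq_integral(2)[OF Fi] by simp
    also have "cmod \<dots> \<le> (LBINT w:cell h z. cmod (F w))" by (rule set_integral_norm_bound[OF Fi])
    finally show ?thesis .
  qed
  have "(ennreal (LBINT w:cell h z. cmod (F w)))\<^sup>2 = (\<integral>\<^sup>+w. (ennreal (cmod (F w)) * indicator (cell h z) w) * indicator (cell h z) w \<partial>lborel)\<^sup>2"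
  proof -
    have "ennreal (LBINT w:cell h z. cmod (F w)) = (\<integral>\<^sup>+w\<in>cell h z. ennreal (cmod (F w)) \<partial>lborel)"
      by (rule set_nn_integral_eq_integral[symmetric]) (use nF in auto)
    also have "\<dots> = (\<integral>\<^sup>+w. (ennreal (cmod (F w)) * indicator (cell h z) w) * indicator (cell h z) w \<partial>lborel)"
      by (intro nn_integral_cong) (simp add: indicator_def)
    finally show ?thesis by simp
  qed
  also have "\<dots> \<le> (\<integral>\<^sup>+w. (ennreal (cmod (F w)) * indicator (cell h z) w)\<^sup>2 \<partial>lborel) * (\<integral>\<^sup>+w. (indicator (cell h z) w)\<^sup>2 \<partial>lborel)"
    by (rule Cauchy_Schwarz_nn_integral) measurable
  also have "(\<integral>\<^sup>+w. (indicator (cell h z) w)\<^sup>2 \<partial>lborel) = (\<integral>\<^sup>+w. indicator (cell h z) w \<partial>lborel)"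
    by (intro nn_integral_cong) (simp add: indicator_def)
  also have "\<dots> = ennreal (h\<^sup>2)" using emeasure_cell[of h z] h by simp
  also have "(\<integral>\<^sup>+w. (ennreal (cmod (F w)) * indicator (cell h z) w)\<^sup>2 \<partial>lborel) = (\<integral>\<^sup>+w\<in>cell h z. ennreal ((cmod (F w))\<^sup>2) \<partial>lborel)"
    by (intro nn_integral_cong) (simp add: indicator_def ennreal_power)
  also have "\<dots> = ennreal ?I"
    by (rule set_nn_integral_eq_integral) (use F2 in auto)
  finally have "(ennreal (LBINT w:cell h z. cmod (F w)))\<^sup>2 \<le> ennreal (?I * h\<^sup>2)" using I0 by (simp add: ennreal_mult)
  moreover have L0: "0 \<le> (LBINT w:cell h z. cmod (F w))"
    unfolding set_lebesgue_integral_def by (intro Bochner_Integration.integral_nonneg) auto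
  ultimately have "(LBINT w:cell h z. cmod (F w))\<^sup>2 \<le> ?I * h\<^sup>2"
    using I0 by (simp add: ennreal_power)
  then have b: "(cmod (integral (cell h z) F))\<^sup>2 \<le> ?I * h\<^sup>2"
    using power_mono[OF a, of 2] by simp
  have "integral (cell h z) (\<lambda>w. (cmod (F w))\<^sup>2) = ?I"
    using set_borel_integral_eq_integral(2)[OF F2] by simp
  then show ?thesis using b h
    by (simp add: savg_def power_mult_distrib norm_divide divide_simps power2_eq_square)
qed

lemma savg_norm_le:
  assumes h: "h > 0"
  shows "(cmod (savg h P z))\<^sup>2 + (cmod (savg h Q z))\<^sup>2 \<le> savg h G z"
proof -
  have i: "(\<lambda>z. (cmod (P z))\<^sup>2) integrable_on cell h z" "(\<lambda>z. (cmod (Q z))\<^sup>2) integrable_on cell h z"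
    unfolding cell_def
    by (rule set_borel_integral_eq_integral(1), rule set_integrable_bounded; (auto simp: G_def)?)+
  have "G = (\<lambda>z. (cmod (P z))\<^sup>2 + (cmod (Q z))\<^sup>2)" using G_def by auto
  then have "savg h G z = savg h (\<lambda>z. (cmod (P z))\<^sup>2) z + savg h (\<lambda>z. (cmod (Q z))\<^sup>2) z"
    using i by (simp add: savg_def integral_add distrib_left)
  then show ?thesis using savg_square_le[OF h, of P z] savg_square_le[OF h, of Q z] by simp
qed

text \<open>Exchanging the integrals turns the average over a cell into an average of integrals over
  translates of the ball, and a point of the cell translates by at most
  \<open>2 * h\<close>.\<close>

lemma savg_G_integral_le:
  assumes h: "0 < h"
  shows "(\<integral>\<^sup>+z\<in>cball 0 R. ennreal (savg h G z) \<partial>lborel) \<le> (\<integral>\<^sup>+z\<in>cball 0 (R + 2 * h). ennreal (G z) \<partial>lborel)"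
proof -
  let ?I = "\<integral>\<^sup>+z\<in>cball 0 (R + 2 * h). ennreal (G z) \<partial>lborel"
  have "(\<integral>\<^sup>+z\<in>cball 0 R. ennreal (savg h G z) \<partial>lborel)
     \<le> (\<integral>\<^sup>+z. (\<integral>\<^sup>+w. (ennreal (G (z + w)) * indicator (cball 0 R) z) * indicator (cell h 0) w \<partial>lborel) / ennreal (h\<^sup>2) \<partial>lborel)"
  proof (rule nn_integral_mono)
    fix z
    \<comment> \<open>\<open>enn2real\<close> sends infinity to 0, so only this direction is
      claimed.\<close>
    have "ennreal (savg h G z) \<le> (\<integral>\<^sup>+w\<in>cell h 0. ennreal (G (z + w)) \<partial>lborel) / ennreal (h\<^sup>2)"
      unfolding savg_G[OF h] by (simp add: ennreal_enn2real_if)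
    then show "ennreal (savg h G z) * indicator (cball 0 R) z \<le> (\<integral>\<^sup>+w. (ennreal (G (z + w)) * indicator (cball 0 R) z) * indicator (cell h 0) w \<partial>lborel) / ennreal (h\<^sup>2)"
      by (simp add: indicator_def)
  qed
  also have "\<dots> = (\<integral>\<^sup>+z. (\<integral>\<^sup>+w. (ennreal (G (z + w)) * indicator (cball 0 R) z) * indicator (cell h 0) w \<partial>lborel) \<partial>lborel) / ennreal (h\<^sup>2)"
    by (rule nn_integral_divide) measurable
  also have "(\<integral>\<^sup>+z. (\<integral>\<^sup>+w. (ennreal (G (z + w)) * indicator (cball 0 R) z) * indicator (cell h 0) w \<partial>lborel) \<partial>lborel)
     = (\<integral>\<^sup>+w. (\<integral>\<^sup>+z. (ennreal (G (z + w)) * indicator (cball 0 R) z) * indicator (cell h 0) w \<partial>lborel) \<partial>lborel)"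
    by (rule lborel_pair.Fubini') measurable
  also have "\<dots> \<le> (\<integral>\<^sup>+w. ?I * indicator (cell h 0) w \<partial>lborel)"
  proof (rule nn_integral_mono)
    fix w :: complex
    show "(\<integral>\<^sup>+z. (ennreal (G (z + w)) * indicator (cball 0 R) z) * indicator (cell h 0) w \<partial>lborel) \<le> ?I * indicator (cell h 0) w"
    proof (cases "w \<in> cell h 0")
      case True
      then have "\<bar>Re w\<bar> \<le> h" "\<bar>Im w\<bar> \<le> h" using h by (auto simp: cell_def cbox_def Basis_complex_def)
      then have w: "cmod w \<le> 2 * h" using cmod_le[of w] by linarith
      have "(\<integral>\<^sup>+z. ennreal (G (z + w)) * indicator (cball 0 R) z \<partial>lborel) \<le> (\<integral>\<^sup>+z. ennreal (G (w + z)) * indicator (cball 0 (R + 2 * h)) (w + z) \<partial>lborel)"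
      proof (rule nn_integral_mono)
        fix z :: complex
        have "w + z \<in> cball 0 (R + 2 * h)" if "z \<in> cball 0 R" using that w norm_triangle_ineq[of w z] by simp
        then show "ennreal (G (z + w)) * indicator (cball 0 R) z \<le> ennreal (G (w + z)) * indicator (cball 0 (R + 2 * h)) (w + z)"
          by (auto simp: indicator_def add.commute)
      qed
      also have "\<dots> = ?I" by (rule nn_integral_translation) measurable
      finally show ?thesis using True by simp
    qed simp
  qed
  also have "\<dots> = ?I * ennreal (h\<^sup>2)" using h by (subst nn_integral_cmult_indicator) (auto simp: emeasure_cell)
  finally have "(\<integral>\<^sup>+z\<in>cball 0 R. ennreal (savg h G z) \<partial>lborel) \<le> ?I * ennreal (h\<^sup>2) / ennreal (h\<^sup>2)"
    by (simp add: divide_right_mono_ennreal)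
  also have "\<dots> = ?I" using h by (simp add: ennreal_mult_divide_eq)
  finally show ?thesis .
qed

text \<open>Together with \<open>savg_G_integral_le\<close> this bounds the limit superior of the
  integrals of the averages. The ball is closed, so it is exactly the intersection of the shrinking
  balls.\<close>

lemma G_cball_limit:
  "(\<lambda>n. \<integral>\<^sup>+z\<in>cball 0 (R + 2 * (1 / real (Suc n))). ennreal (G z) \<partial>lborel) \<longlonglongrightarrow> (\<integral>\<^sup>+z\<in>cball 0 R. ennreal (G z) \<partial>lborel)"
proof (rule nn_integral_dominated_convergence[where w = "\<lambda>z. ennreal (G z) * indicator (cball 0 (R + 2)) z"])
  show "(\<integral>\<^sup>+z. ennreal (G z) * indicator (cball 0 (R + 2)) z \<partial>lborel) < \<infinity>" by (rule fin)
  have le1: "2 * (1 / real (Suc n)) \<le> 2" for n by (simp add: divide_le_eq)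
  show "AE z in lborel. ennreal (G z) * indicator (cball 0 (R + 2 * (1 / real (Suc n)))) z \<le> ennreal (G z) * indicator (cball 0 (R + 2)) z" for n
    using le1[of n] by (intro AE_I2) (auto simp: indicator_def)
  show "AE z in lborel. (\<lambda>n. ennreal (G z) * indicator (cball 0 (R + 2 * (1 / real (Suc n)))) z) \<longlonglongrightarrow> ennreal (G z) * indicator (cball 0 R) z"
  proof (rule AE_I2)
    fix z :: complex
    have "\<forall>\<^sub>F n in sequentially. ennreal (G z) * indicator (cball 0 (R + 2 * (1 / real (Suc n)))) z = ennreal (G z) * indicator (cball 0 R) z"
    proof (cases "cmod z \<le> R")
      case True
      have "cmod z \<le> R + 2 * (1 / real (Suc n))" for n using True by (simp add: add_increasing2)
      then show ?thesis using True by (simp add: indicator_def)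
    next
      case False
      have "(\<lambda>n. R + 2 * (1 / real (Suc n))) \<longlonglongrightarrow> R + 2 * 0"
        using LIMSEQ_inverse_real_of_nat by (intro tendsto_intros) (simp add: inverse_eq_divide)
      then have "\<forall>\<^sub>F n in sequentially. R + 2 * (1 / real (Suc n)) < cmod z"
        by (rule order_tendstoD(2)) (use False in simp)
      then show ?thesis by eventually_elim (use False in \<open>auto simp: indicator_def\<close>)
    qed
    then show "(\<lambda>n. ennreal (G z) * indicator (cball 0 (R + 2 * (1 / real (Suc n)))) z) \<longlonglongrightarrow> ennreal (G z) * indicator (cball 0 R) z"
      by (rule tendsto_eventually)
  qed
qed measurable

end

lemma radial_cutoff_bounded:
  assumes "radial_cutoff R S \<eta> w"
  obtains B where "\<And>z. \<bar>\<eta> z\<bar> \<le> B"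
proof -
  note U = assms[unfolded radial_cutoff_def]
  obtain b where b: "\<And>z. cmod z \<le> R \<Longrightarrow> \<bar>\<eta> z\<bar> \<le> b"
    using continuous_bounded_on_cball[of \<eta> R] U by blast
  have "\<bar>\<eta> z\<bar> \<le> max b 0" for z
    using b[of z] U[THEN conjunct2, THEN conjunct2, THEN conjunct2, THEN conjunct1, rule_format, of z]
    by (cases "cmod z \<le> R") auto
  then show ?thesis by (rule that)
qed

lemma angular_bound:
  assumes "cmod z \<le> R"
  shows "(cmod (angular P Q z))\<^sup>2 \<le> 2 * R\<^sup>2 * ((cmod (P z))\<^sup>2 + (cmod (Q z))\<^sup>2)"
proof -
  have R: "R \<ge> 0" using assms norm_ge_zero[of z] by linarith
  have "cmod (angular P Q z) \<le> cmod (Re z *\<^sub>R Q z) + cmod (Im z *\<^sub>R P z)"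
    unfolding angular_def by (rule norm_triangle_ineq4)
  also have "\<dots> \<le> R * cmod (Q z) + R * cmod (P z)"
    using abs_Re_le_cmod[of z] abs_Im_le_cmod[of z] assms by (auto intro!: add_mono mult_right_mono)
  finally have "(cmod (angular P Q z))\<^sup>2 \<le> (R * cmod (Q z) + R * cmod (P z))\<^sup>2" by (rule power_mono) simp
  also have "\<dots> = R\<^sup>2 * (cmod (Q z) + cmod (P z))\<^sup>2" by (simp add: power2_eq_square algebra_simps)
  also have "\<dots> \<le> R\<^sup>2 * (2 * ((cmod (P z))\<^sup>2 + (cmod (Q z))\<^sup>2))"
  proof (rule mult_left_mono)
    have "0 \<le> (cmod (P z) - cmod (Q z))\<^sup>2" by simp
    then show "(cmod (Q z) + cmod (P z))\<^sup>2 \<le> 2 * ((cmod (P z))\<^sup>2 + (cmod (Q z))\<^sup>2)"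
      by (simp add: power2_eq_square algebra_simps)
  qed simp
  finally show ?thesis by (simp add: algebra_simps)
qed

context local_L2
begin

text \<open>Both integrands of the area inequality are dominated by a constant times the average of
  the energy density \<open>G\<close>. These majorants satisfy the demands of
  \<open>generalized_dominated_convergence\<close>: they converge almost everywhere, and in the
  limit their integrals do not exceed that of the limit function.\<close>

lemma dominating_sequence:
  fixes c R :: real
  assumes c: "c \<ge> 0"
  defines "v n z \<equiv> c * (indicator (cball 0 R) z * savg (1 / real (Suc n)) G z)"
    and "v' z \<equiv> c * (indicator (cball 0 R) z * G z)"
  shows "integrable lborel (v n)" "integrable lborel v'" "AE z in lborel. (\<lambda>n. v n z) \<longlonglongrightarrow> v' z"
    "limsup (\<lambda>n. \<integral>\<^sup>+ z. norm (v n z) \<partial>lborel) \<le> (\<integral>\<^sup>+ z. norm (v' z) \<partial>lborel)"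
proof -
  have [measurable]: "savg (1 / real (Suc n)) G \<in> borel_measurable borel" for n by (rule savg_G_measurable) simp
  have s0: "savg (1 / real (Suc n)) G z \<ge> 0" for n z by (rule savg_G_nonneg) simp
  have nv: "(\<integral>\<^sup>+ z. norm (v n z) \<partial>lborel) = ennreal c * (\<integral>\<^sup>+z\<in>cball 0 R. ennreal (savg (1 / real (Suc n)) G z) \<partial>lborel)" for n
    unfolding v_def using c s0
    by (subst nn_integral_cmult[symmetric]) (auto intro!: nn_integral_cong simp: indicator_def ennreal_mult)
  have nv': "(\<integral>\<^sup>+ z. norm (v' z) \<partial>lborel) = ennreal c * (\<integral>\<^sup>+z\<in>cball 0 R. ennreal (G z) \<partial>lborel)"
    unfolding v'_def using c G_nonneg
    by (subst nn_integral_cmult[symmetric]) (auto intro!: nn_integral_cong simp: indicator_def ennreal_mult)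
  have le: "(\<integral>\<^sup>+ z. norm (v n z) \<partial>lborel) \<le> ennreal c * (\<integral>\<^sup>+z\<in>cball 0 (R + 2 * (1 / real (Suc n))). ennreal (G z) \<partial>lborel)" for n
    unfolding nv by (intro mult_left_mono savg_G_integral_le) auto
  show "integrable lborel (v n)"
  proof (rule integrableI_bounded)
    show "v n \<in> borel_measurable lborel" unfolding v_def by measurable
    show "(\<integral>\<^sup>+ z. norm (v n z) \<partial>lborel) < \<infinity>"
      using le[of n] fin[of "R + 2 * (1 / real (Suc n))"] by (auto simp: ennreal_mult_less_top intro: le_less_trans)
  qed
  show "integrable lborel v'"
  proof (rule integrableI_bounded)
    show "v' \<in> borel_measurable lborel" unfolding v'_def by measurable
    show "(\<integral>\<^sup>+ z. norm (v' z) \<partial>lborel) < \<infinity>"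
      using nv' fin[of R] by (auto simp: ennreal_mult_less_top)
  qed
  have "AE z in lborel. (\<lambda>n. savg (1 / real (Suc n)) G z) \<longlonglongrightarrow> G z"
    by (rule savg_tendsto) (rule integrable_on_cell(3))
  then show "AE z in lborel. (\<lambda>n. v n z) \<longlonglongrightarrow> v' z"
    unfolding v_def v'_def by eventually_elim (intro tendsto_intros)
  have "limsup (\<lambda>n. \<integral>\<^sup>+ z. norm (v n z) \<partial>lborel) \<le> limsup (\<lambda>n. ennreal c * (\<integral>\<^sup>+z\<in>cball 0 (R + 2 * (1 / real (Suc n))). ennreal (G z) \<partial>lborel))"
    by (intro Limsup_mono always_eventually allI le)
  also have "\<dots> = ennreal c * (\<integral>\<^sup>+z\<in>cball 0 R. ennreal (G z) \<partial>lborel)"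
    by (intro lim_imp_Limsup ennreal_tendsto_cmult G_cball_limit) auto
  finally show "limsup (\<lambda>n. \<integral>\<^sup>+ z. norm (v n z) \<partial>lborel) \<le> (\<integral>\<^sup>+ z. norm (v' z) \<partial>lborel)" unfolding nv' .
qed

text \<open>The averages of \<open>P\<close> and \<open>Q\<close> are partial derivatives of smooth
  functions, so the smooth inequality holds for them. Both sides converge under the majorants of
  \<open>dominating_sequence\<close>, whose constant is a bound of \<open>\<eta>\<close> on the left
  and \<open>2 * R^2\<close> times a bound of \<open>w\<close> on the right.\<close>

lemma area_inequality_limit:
  assumes sm: "\<And>h. h > 0 \<Longrightarrow> \<exists>g gxy. C1_mixed g (savg h P) (savg h Q) gxy" and cut: "radial_cutoff R S \<eta> w"
  shows "integrable lborel (\<lambda>z. \<eta> z * Im (cnj (P z) * Q z))" "integrable lborel (\<lambda>z. w z * (cmod (angular P Q z))\<^sup>2)"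
    "2 * (\<integral>z. \<eta> z * Im (cnj (P z) * Q z) \<partial>lborel) \<le> (\<integral>z. w z * (cmod (angular P Q z))\<^sup>2 \<partial>lborel)"
proof -
  note U = cut[unfolded radial_cutoff_def]
  define p where "p n = savg (1 / real (Suc n)) P" for n
  define q where "q n = savg (1 / real (Suc n)) Q" for n
  define s where "s n = savg (1 / real (Suc n)) G" for n
  have C1: "\<exists>g gxy. C1_mixed g (p n) (q n) gxy" for n unfolding p_def q_def by (rule sm) simp
  have pm[measurable]: "p n \<in> borel_measurable borel" and qm[measurable]: "q n \<in> borel_measurable borel" for n
    using C1[of n] unfolding C1_mixed_def by (auto intro: borel_measurable_continuous_onI)
  have \<eta>m[measurable]: "\<eta> \<in> borel_measurable borel" using U by (intro borel_measurable_continuous_onI) blast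
  have wm[measurable]: "w \<in> borel_measurable borel" using U by blast
  obtain Bw where Bw: "\<And>z. \<bar>w z\<bar> \<le> Bw" using U by blast
  have w0: "w z = 0" and \<eta>0: "\<eta> z = 0" if "cmod z \<ge> R" for z using U that by blast+
  obtain B where B: "\<And>z. \<bar>\<eta> z\<bar> \<le> B" using radial_cutoff_bounded[OF cut] by blast
  have B0: "B \<ge> 0" "Bw \<ge> 0" using B[of 0] Bw[of 0] by linarith+
  have le: "(cmod (p n z))\<^sup>2 + (cmod (q n z))\<^sup>2 \<le> s n z" for n z
    unfolding p_def q_def s_def by (rule savg_norm_le) simp
  have Im_le: "\<bar>Im (cnj a * b)\<bar> \<le> (cmod a)\<^sup>2 + (cmod b)\<^sup>2" for a b
  proof -
    have "\<bar>Im (cnj a * b)\<bar> \<le> cmod a * cmod b" using abs_Im_le_cmod[of "cnj a * b"] by (simp add: norm_mult)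
    also have "\<dots> \<le> (cmod a)\<^sup>2 + (cmod b)\<^sup>2"
      using sum_squares_bound[of "cmod a" "cmod b"] mult_nonneg_nonneg[OF norm_ge_zero[of a] norm_ge_zero[of b]] by linarith
    finally show ?thesis .
  qed
  have plim: "AE z in lborel. (\<lambda>n. p n z) \<longlonglongrightarrow> P z" and qlim: "AE z in lborel. (\<lambda>n. q n z) \<longlonglongrightarrow> Q z"
    unfolding p_def q_def by (rule savg_tendsto, rule integrable_on_cell)+
  have ball: "cmod z \<le> R \<longleftrightarrow> z \<in> cball 0 R" for z by simp
  have bndJ: "AE z in lborel. \<bar>\<eta> z * Im (cnj (p n z) * q n z)\<bar> \<le> B * (indicator (cball 0 R) z * savg (1 / real (Suc n)) G z)" for n
    proof (rule AE_I2)
      fix z :: complex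
      show "\<bar>\<eta> z * Im (cnj (p n z) * q n z)\<bar> \<le> B * (indicator (cball 0 R) z * savg (1 / real (Suc n)) G z)"
      proof (cases "cmod z \<le> R")
        case True
        have "\<bar>\<eta> z * Im (cnj (p n z) * q n z)\<bar> \<le> B * s n z"
          unfolding abs_mult using B B0 order_trans[OF Im_le le[of n z]] by (intro mult_mono) auto
        then show ?thesis using True by (simp add: s_def)
      next
        case False then show ?thesis using \<eta>0[of z] by simp
      qed
    qed
  have limJ: "AE z in lborel. (\<lambda>n. \<eta> z * Im (cnj (p n z) * q n z)) \<longlonglongrightarrow> \<eta> z * Im (cnj (P z) * Q z)"
    using plim qlim by eventually_elim (intro tendsto_intros)
  have mJ: "(\<lambda>z. \<eta> z * Im (cnj (p n z) * q n z)) \<in> borel_measurable lborel" "(\<lambda>z. \<eta> z * Im (cnj (P z) * Q z)) \<in> borel_measurable lborel" for n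
    by measurable
  note dJ = dominating_sequence[OF B0(1), where R = R]
  note J = generalized_dominated_convergence[OF mJ dJ(1,2) bndJ limJ dJ(3,4)]
  have c2: "Bw * (2 * R\<^sup>2) \<ge> 0" using B0 by simp
  have bndW: "AE z in lborel. \<bar>w z * (cmod (angular (p n) (q n) z))\<^sup>2\<bar> \<le> Bw * (2 * R\<^sup>2) * (indicator (cball 0 R) z * savg (1 / real (Suc n)) G z)" for n
    proof (rule AE_I2)
      fix z :: complex
      show "\<bar>w z * (cmod (angular (p n) (q n) z))\<^sup>2\<bar> \<le> Bw * (2 * R\<^sup>2) * (indicator (cball 0 R) z * savg (1 / real (Suc n)) G z)"
      proof (cases "cmod z \<le> R")
        case True
        have "(cmod (angular (p n) (q n) z))\<^sup>2 \<le> 2 * R\<^sup>2 * s n z"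
          using angular_bound[OF True, of "p n" "q n"] mult_left_mono[OF le[of n z], of "2 * R\<^sup>2"] by simp
        then have "\<bar>w z\<bar> * (cmod (angular (p n) (q n) z))\<^sup>2 \<le> Bw * (2 * R\<^sup>2 * s n z)"
          using Bw B0 by (intro mult_mono) auto
        then show ?thesis using True by (simp add: s_def abs_mult mult_ac)
      next
        case False then show ?thesis using w0[of z] by simp
      qed
    qed
  have limW: "AE z in lborel. (\<lambda>n. w z * (cmod (angular (p n) (q n) z))\<^sup>2) \<longlonglongrightarrow> w z * (cmod (angular P Q z))\<^sup>2"
    unfolding angular_def using plim qlim by eventually_elim (intro tendsto_intros)
  have mW: "(\<lambda>z. w z * (cmod (angular (p n) (q n) z))\<^sup>2) \<in> borel_measurable lborel" "(\<lambda>z. w z * (cmod (angular P Q z))\<^sup>2) \<in> borel_measurable lborel" for n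
    unfolding angular_def by measurable
  note dW = dominating_sequence[OF c2, where R = R]
  note W = generalized_dominated_convergence[OF mW dW(1,2) bndW limW dW(3,4)]
  show "integrable lborel (\<lambda>z. \<eta> z * Im (cnj (P z) * Q z))" "integrable lborel (\<lambda>z. w z * (cmod (angular P Q z))\<^sup>2)"
    by (rule J(1), rule W(1))
  show "2 * (\<integral>z. \<eta> z * Im (cnj (P z) * Q z) \<partial>lborel) \<le> (\<integral>z. w z * (cmod (angular P Q z))\<^sup>2 \<partial>lborel)"
  proof (rule LIMSEQ_le)
    show "(\<lambda>n. 2 * (\<integral>z. \<eta> z * Im (cnj (p n z) * q n z) \<partial>lborel)) \<longlonglongrightarrow> 2 * (\<integral>z. \<eta> z * Im (cnj (P z) * Q z) \<partial>lborel)"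
      by (intro tendsto_intros J(2))
    show "\<exists>N. \<forall>n\<ge>N. 2 * (\<integral>z. \<eta> z * Im (cnj (p n z) * q n z) \<partial>lborel) \<le> (\<integral>z. w z * (cmod (angular (p n) (q n) z))\<^sup>2 \<partial>lborel)"
    proof (intro exI allI impI)
      fix n
      obtain g gxy where "C1_mixed g (p n) (q n) gxy" using C1 by blast
      then show "2 * (\<integral>z. \<eta> z * Im (cnj (p n z) * q n z) \<partial>lborel) \<le> (\<integral>z. w z * (cmod (angular (p n) (q n) z))\<^sup>2 \<partial>lborel)"
        using cut by (rule smooth_area_inequality)
    qed
  qed (rule W(2))
qed

end

section \<open>Regularity of averages of a continuous function\<close>

lemma has_vector_derivative_shift_iff:
  fixes I :: "real \<Rightarrow> 'a::real_normed_vector"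
  shows "((\<lambda>t. I (c + t)) has_vector_derivative D) (at x) \<longleftrightarrow> (I has_vector_derivative D) (at (c + x))"
  unfolding has_vector_derivative_iff_quotient by (simp add: add.assoc)

lemma sliding_integral_derivative:
  fixes c :: "real \<Rightarrow> complex"
  assumes c: "continuous_on UNIV c" and h: "h > 0"
  shows "((\<lambda>x. integral {x..x + h} c) has_vector_derivative (c (x + h) - c x)) (at x)"
proof -
  \<comment> \<open>The base point lies to the left of \<open>x\<close>, so that near
    \<open>x\<close> the sliding integral is a difference of two values of one primitive.\<close>
  define I where "I t = integral {x - 1..t} c" for t
  have int: "c integrable_on {a..b}" for a b
    using continuous_on_subset[OF c] by (intro integrable_continuous_interval) auto
  have dI: "(I has_vector_derivative c t) (at t)" if t: "x - 1 < t" for t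
  proof -
    have "(I has_vector_derivative c t) (at t within {x - 1..t + 1})"
      unfolding I_def[abs_def] by (rule integral_has_vector_derivative) (use t continuous_on_subset[OF c] in auto)
    then show ?thesis using t by (simp add: at_within_Icc_at)
  qed
  have "((\<lambda>t. I (h + t)) has_vector_derivative c (h + x)) (at x)"
    unfolding has_vector_derivative_shift_iff by (rule dI) (use h in simp)
  then have "((\<lambda>t. I (h + t) - I t) has_vector_derivative (c (h + x) - c x)) (at x)"
    by (intro has_vector_derivative_diff dI) auto
  then have "((\<lambda>x. integral {x..x + h} c) has_vector_derivative (c (h + x) - c x)) (at x)"
  proof (rule has_vector_derivative_transform_within_open[of _ _ _ "{x - 1<..}"])
    fix t assume "t \<in> {x - 1<..}"
    then show "I (h + t) - I t = integral {t..t + h} c"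
      using Henstock_Kurzweil_Integration.integral_combine[of "x - 1" t "t + h" c] int h
      by (simp add: I_def add.commute algebra_simps)
  qed auto
  then show ?thesis by (simp add: add.commute)
qed

text \<open>Differentiating the iterated integral in one variable removes one integration and leaves
  a difference of line integrals; differentiating in the other variable removes the second one and
  leaves the four corner values. Swapping the order of integration treats both variables
  alike.\<close>

lemma steklov_C1_mixed:
  fixes f :: "complex \<Rightarrow> complex"
  assumes f: "continuous_on UNIV f" and h: "h > 0"
  defines "k s y \<equiv> integral {y..y + h} (\<lambda>t. f (Complex s t))"
    and "l x t \<equiv> integral {x..x + h} (\<lambda>s. f (Complex s t))"
  shows "C1_mixed (\<lambda>z. integral {Re z..Re z + h} (\<lambda>s. k s (Im z)))
    (\<lambda>z. k (Re z + h) (Im z) - k (Re z) (Im z)) (\<lambda>z. l (Re z) (Im z + h) - l (Re z) (Im z))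
    (\<lambda>z. f (Complex (Re z + h) (Im z + h)) - f (Complex (Re z + h) (Im z)) - (f (Complex (Re z) (Im z + h)) - f (Complex (Re z) (Im z))))"
proof -
  have cfl: "continuous_on A (\<lambda>t. f (Complex s t))" "continuous_on A (\<lambda>s. f (Complex s t))" for A s t
    by (rule continuous_on_line[OF f])+
  have ck: "continuous_on UNIV (\<lambda>z. k (Re z) (Im z))"
  proof -
    \<comment> \<open>Over a fixed interval this is a parameter integral, continuous in
      \<open>z\<close> by the usual theorem.\<close>
    have "k (Re z) (Im z) = integral (cbox 0 h) (\<lambda>t. f (z + Complex 0 t))" for z
    proof -
      have "k (Re z) (Im z) = integral {Im z..Im z + h} (\<lambda>t. f (Complex (Re z) t))" by (simp add: k_def)
      also have "\<dots> = integral {0..h} (\<lambda>t. f (Complex (Re z) (t + Im z)))"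
        using integral_shift_real_ivl[of "Im z" "Im z" "Im z + h" "\<lambda>t. f (Complex (Re z) t)"] by simp
      also have "(\<lambda>t. f (Complex (Re z) (t + Im z))) = (\<lambda>t. f (z + Complex 0 t))"
        by (rule ext) (rule arg_cong[of _ _ f], simp add: complex_eq_iff)
      finally show ?thesis by simp
    qed
    moreover have "continuous_on UNIV (\<lambda>z. integral (cbox 0 h) (\<lambda>t. f (z + Complex 0 t)))"
    proof (rule integral_continuous_on_param)
      show "continuous_on (UNIV \<times> cbox 0 h) (\<lambda>(z, t). f (z + Complex 0 t))"
        unfolding case_prod_beta'
        by (rule continuous_on_compose2[OF f]) (auto simp: Complex_eq intro!: continuous_intros)
    qed
    ultimately show ?thesis by simp
  qed
  have cl: "continuous_on UNIV (\<lambda>z. l (Re z) (Im z))"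
  proof -
    have "l (Re z) (Im z) = integral (cbox 0 h) (\<lambda>s. f (z + Complex s 0))" for z
    proof -
      have "l (Re z) (Im z) = integral {Re z..Re z + h} (\<lambda>s. f (Complex s (Im z)))" by (simp add: l_def)
      also have "\<dots> = integral {0..h} (\<lambda>s. f (Complex (s + Re z) (Im z)))"
        using integral_shift_real_ivl[of "Re z" "Re z" "Re z + h" "\<lambda>s. f (Complex s (Im z))"] by simp
      also have "(\<lambda>s. f (Complex (s + Re z) (Im z))) = (\<lambda>s. f (z + Complex s 0))"
        by (rule ext) (rule arg_cong[of _ _ f], simp add: complex_eq_iff)
      finally show ?thesis by simp
    qed
    moreover have "continuous_on UNIV (\<lambda>z. integral (cbox 0 h) (\<lambda>s. f (z + Complex s 0)))"
    proof (rule integral_continuous_on_param)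
      show "continuous_on (UNIV \<times> cbox 0 h) (\<lambda>(z, s). f (z + Complex s 0))"
        unfolding case_prod_beta'
        by (rule continuous_on_compose2[OF f]) (auto simp: Complex_eq intro!: continuous_intros)
    qed
    ultimately show ?thesis by simp
  qed
  have shift: "continuous_on UNIV (\<lambda>z. G (Re z + a) (Im z + b))" if "continuous_on UNIV (\<lambda>z. G (Re z) (Im z))" for G :: "real \<Rightarrow> real \<Rightarrow> complex" and a b
  proof -
    have "continuous_on UNIV (\<lambda>z. z + Complex a b)" by (intro continuous_intros)
    from continuous_on_compose2[OF that this] show ?thesis by simp
  qed
  have ckx: "continuous_on UNIV (\<lambda>s. k s y)" for y
    using continuous_on_line(1)[OF ck] by simp
  have cly: "continuous_on UNIV (\<lambda>t. l x t)" for x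
    using continuous_on_line(2)[OF cl] by simp
  have cff: "continuous_on UNIV (\<lambda>z. f (Complex (Re z + a) (Im z + b)))" for a b
    by (rule shift[of "\<lambda>x y. f (Complex x y)"]) (simp add: f)
  have swap: "integral {x..x + h} (\<lambda>s. k s y) = integral {y..y + h} (\<lambda>t. l x t)" for x y
  proof -
    have "continuous_on (cbox (x, y) (x + h, y + h)) (\<lambda>(s, t). f (Complex s t))"
      unfolding case_prod_beta'
      by (rule continuous_on_compose2[OF f]) (auto simp: Complex_eq intro!: continuous_intros)
    from integral_swap_continuous[OF this] show ?thesis by (simp add: k_def[abs_def] l_def[abs_def])
  qed
  show ?thesis
    unfolding C1_mixed_def complex.sel
  proof (intro conjI allI)
    show "continuous_on UNIV (\<lambda>z. k (Re z + h) (Im z) - k (Re z) (Im z))"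
      using shift[OF ck, of h 0] ck by (intro continuous_intros) simp_all
    show "continuous_on UNIV (\<lambda>z. l (Re z) (Im z + h) - l (Re z) (Im z))"
      using shift[OF cl, of 0 h] cl by (intro continuous_intros) simp_all
    show "continuous_on UNIV (\<lambda>z. f (Complex (Re z + h) (Im z + h)) - f (Complex (Re z + h) (Im z)) - (f (Complex (Re z) (Im z + h)) - f (Complex (Re z) (Im z))))"
      using cff[of h h] cff[of h 0] cff[of 0 h] cff[of 0 0] by (intro continuous_intros) (simp_all add: f)
    fix x y :: real
    show "((\<lambda>x. integral {x..x + h} (\<lambda>s. k s y)) has_vector_derivative k (x + h) y - k x y) (at x)"
      by (rule sliding_integral_derivative[OF ckx h])
    show "((\<lambda>y. integral {x..x + h} (\<lambda>s. k s y)) has_vector_derivative l x (y + h) - l x y) (at y)"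
      unfolding swap by (rule sliding_integral_derivative[OF cly h])
    show "((\<lambda>y. k (x + h) y - k x y) has_vector_derivative
        f (Complex (x + h) (y + h)) - f (Complex (x + h) y) - (f (Complex x (y + h)) - f (Complex x y))) (at y)"
      unfolding k_def by (intro has_vector_derivative_diff sliding_integral_derivative cfl h)
    have "((\<lambda>x. l x (y + h) - l x y) has_vector_derivative
        (f (Complex (x + h) (y + h)) - f (Complex x (y + h))) - (f (Complex (x + h) y) - f (Complex x y))) (at x)"
      unfolding l_def by (intro has_vector_derivative_diff sliding_integral_derivative cfl h)
    then show "((\<lambda>x. l x (y + h) - l x y) has_vector_derivative
        f (Complex (x + h) (y + h)) - f (Complex (x + h) y) - (f (Complex x (y + h)) - f (Complex x y))) (at x)"
      by (simp add: algebra_simps)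
  qed
qed

lemma C1_mixed_scaleR:
  assumes "C1_mixed g gx gy gxy"
  shows "C1_mixed (\<lambda>z. c *\<^sub>R g z) (\<lambda>z. c *\<^sub>R gx z) (\<lambda>z. c *\<^sub>R gy z) (\<lambda>z. c *\<^sub>R gxy z)"
  using assms unfolding C1_mixed_def
  by (auto intro!: continuous_intros bounded_linear.has_vector_derivative[OF bounded_linear_scaleR_right])

lemma C1_mixed_translate:
  assumes "C1_mixed g gx gy gxy"
  shows "C1_mixed (\<lambda>z. g (c + z)) (\<lambda>z. gx (c + z)) (\<lambda>z. gy (c + z)) (\<lambda>z. gxy (c + z))"
proof -
  note C = assms[unfolded C1_mixed_def]
  have t: "c + Complex x y = Complex (Re c + x) (Im c + y)" for x y by (simp add: complex_eq_iff)
  have ct: "continuous_on UNIV (\<lambda>z. G (c + z))" if "continuous_on UNIV G" for G :: "complex \<Rightarrow> complex"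
    by (rule continuous_on_compose2[OF that]) (auto intro!: continuous_intros)
  have sx: "((\<lambda>x. G (Complex (Re c + x) y)) has_vector_derivative D) (at x) \<longleftrightarrow> ((\<lambda>x. G (Complex x y)) has_vector_derivative D) (at (Re c + x))" for G D x y
    by (rule has_vector_derivative_shift_iff[of "\<lambda>x. G (Complex x y)"])
  have sy: "((\<lambda>y. G (Complex x (Im c + y))) has_vector_derivative D) (at y) \<longleftrightarrow> ((\<lambda>y. G (Complex x y)) has_vector_derivative D) (at (Im c + y))" for G D x y
    by (rule has_vector_derivative_shift_iff[of "\<lambda>y. G (Complex x y)"])
  show ?thesis unfolding C1_mixed_def t sx sy using C ct by simp
qed

subsection \<open>Growth of the area integral\<close>

text \<open>The cut-off is \<open>|z|^(-2\<beta>) - R^(-2\<beta>)\<close> on the annulus, constant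
  inside radius \<open>r\<close> and 0 outside radius \<open>R\<close>. The gradient of
  \<open>|z|^(-2\<beta>)\<close> is \<open>-2\<beta> |z|^(-2\<beta>-2) z\<close>, whence
  \<open>w\<close>. A power is chosen because then \<open>w |z|^2\<close> is proportional to the
  leading term of the cut-off.\<close>

lemma radial_cutoff_powr:
  fixes \<beta> r R :: real
  assumes \<beta>: "\<beta> > 0" and rR: "0 < r" "r < R"
  shows "radial_cutoff R {r\<^sup>2, R\<^sup>2}
    (\<lambda>z. max 0 (max ((cmod z)\<^sup>2) (r\<^sup>2) powr (- \<beta>) - (R\<^sup>2) powr (- \<beta>)))
    (\<lambda>z. if r\<^sup>2 < (cmod z)\<^sup>2 \<and> (cmod z)\<^sup>2 < R\<^sup>2 then 2 * \<beta> * ((cmod z)\<^sup>2) powr (- \<beta> - 1) else 0)"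
proof -
  \<comment> \<open>In terms of \<open>s = |z|^2\<close> the chain rule passes through the
    polynomial \<open>x^2 + y^2\<close>. The two exceptional values of \<open>s\<close> are the
    corners of the profile.\<close>
  define e where "e s = max 0 (max s (r\<^sup>2) powr (- \<beta>) - (R\<^sup>2) powr (- \<beta>))" for s
  define \<omega> where "\<omega> s = (if r\<^sup>2 < s \<and> s < R\<^sup>2 then 2 * \<beta> * s powr (- \<beta> - 1) else 0)" for s
  have r2: "r\<^sup>2 > 0" "r\<^sup>2 < R\<^sup>2" using rR by (auto intro: power_strict_mono)
  have mono: "b powr (- \<beta>) \<le> a powr (- \<beta>)" if "0 < a" "a \<le> b" for a b
    using that \<beta> by (intro powr_mono2') auto
  have de: "(e has_real_derivative - (\<omega> s / 2)) (at s)" if s: "s \<notin> {r\<^sup>2, R\<^sup>2}" for s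
  proof -
    consider "s < r\<^sup>2" | "r\<^sup>2 < s" "s < R\<^sup>2" | "s > R\<^sup>2" using s by force
    then show ?thesis
    proof cases
      case 1
      have "((\<lambda>s. max 0 ((r\<^sup>2) powr (- \<beta>) - (R\<^sup>2) powr (- \<beta>))) has_real_derivative 0) (at s)" by simp
      then have "(e has_real_derivative 0) (at s)"
        by (rule has_field_derivative_transform_within_open[of _ _ _ "{..<r\<^sup>2}"]) (use 1 in \<open>auto simp: e_def\<close>)
      then show ?thesis using 1 by (simp add: \<omega>_def)
    next
      case 2
      have s0: "s > 0" using 2 r2 by linarith
      have "((\<lambda>s. s powr (- \<beta>) - (R\<^sup>2) powr (- \<beta>)) has_real_derivative (- \<beta>) * s powr (- \<beta> - 1)) (at s)"
        using s0 by (auto intro!: derivative_eq_intros)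
      then have "(e has_real_derivative (- \<beta>) * s powr (- \<beta> - 1)) (at s)"
      proof (rule has_field_derivative_transform_within_open[of _ _ _ "{r\<^sup>2<..<R\<^sup>2}"])
        fix t assume t: "t \<in> {r\<^sup>2<..<R\<^sup>2}"
        then have tt: "r\<^sup>2 < t" "t \<le> R\<^sup>2" by auto
        then have "t > 0" using r2(1) by linarith
        then have "(R\<^sup>2) powr (- \<beta>) \<le> t powr (- \<beta>)" using tt(2) by (rule mono)
        then show "t powr (- \<beta>) - (R\<^sup>2) powr (- \<beta>) = e t" using t by (simp add: e_def)
      qed (use 2 in auto)
      then show ?thesis using 2 by (simp add: \<omega>_def)
    next
      case 3
      have "((\<lambda>s. 0 :: real) has_real_derivative 0) (at s)" by simp
      then have "(e has_real_derivative 0) (at s)"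
      proof (rule has_field_derivative_transform_within_open[of _ _ _ "{R\<^sup>2<..}"])
        fix t assume t: "t \<in> {R\<^sup>2<..}"
        then have "t powr (- \<beta>) \<le> (R\<^sup>2) powr (- \<beta>)" using rR by (intro mono) auto
        then show "0 = e t" using t r2 by (simp add: e_def)
      qed (use 3 in auto)
      then show ?thesis using 3 by (simp add: \<omega>_def)
    qed
  qed
  have \<omega>0: "\<omega> s \<ge> 0" for s using \<beta> by (simp add: \<omega>_def)
  have \<omega>B: "\<bar>\<omega> s\<bar> \<le> 2 * \<beta> * (r\<^sup>2) powr (- \<beta> - 1)" for s
  proof (cases "r\<^sup>2 < s \<and> s < R\<^sup>2")
    case True
    then have "s powr (- \<beta> - 1) \<le> (r\<^sup>2) powr (- \<beta> - 1)" using r2 \<beta> by (intro powr_mono2') auto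
    then show ?thesis using True \<beta> by (simp add: \<omega>_def)
  next
    case False
    then have "\<omega> s = 0" by (auto simp: \<omega>_def)
    then show ?thesis using \<beta> by simp
  qed
  have q: "(cmod (Complex x y))\<^sup>2 = x\<^sup>2 + y\<^sup>2" for x y by (simp add: cmod_power2)
  have [measurable]: "\<omega> \<in> borel_measurable borel" unfolding \<omega>_def[abs_def] by measurable
  have "radial_cutoff R {r\<^sup>2, R\<^sup>2} (\<lambda>z. e ((cmod z)\<^sup>2)) (\<lambda>z. \<omega> ((cmod z)\<^sup>2))"
    unfolding radial_cutoff_def
  proof (intro conjI allI impI exI)
    show "R > 0" "finite {r\<^sup>2, R\<^sup>2}" using rR by auto
    show "continuous_on UNIV (\<lambda>z::complex. e ((cmod z)\<^sup>2))"
      unfolding e_def using r2 by (intro continuous_intros) (auto simp: max_def)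
    show "(\<lambda>z::complex. \<omega> ((cmod z)\<^sup>2)) \<in> borel_measurable borel" by measurable
    show "e ((cmod z)\<^sup>2) = 0" if "cmod z \<ge> R" for z :: complex
    proof -
      have "R\<^sup>2 \<le> (cmod z)\<^sup>2" using that rR by (intro power_mono) auto
      then have "((cmod z)\<^sup>2) powr (- \<beta>) \<le> (R\<^sup>2) powr (- \<beta>)" "max ((cmod z)\<^sup>2) (r\<^sup>2) = (cmod z)\<^sup>2"
        using r2 by (auto intro!: mono)
      then show ?thesis by (simp add: e_def)
    qed
    show "\<omega> ((cmod z)\<^sup>2) = 0" if "cmod z \<ge> R" for z :: complex
    proof -
      have "R\<^sup>2 \<le> (cmod z)\<^sup>2" using that rR by (intro power_mono) auto
      then show ?thesis by (simp add: \<omega>_def)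
    qed
    show "\<bar>\<omega> ((cmod z)\<^sup>2)\<bar> \<le> 2 * \<beta> * (r\<^sup>2) powr (- \<beta> - 1)" for z :: complex by (rule \<omega>B)
    show "0 \<le> \<omega> ((cmod z)\<^sup>2)" for z :: complex by (rule \<omega>0)
    show "\<omega> ((cmod (c * z))\<^sup>2) = \<omega> ((cmod z)\<^sup>2)" if "cmod c = 1" for c z using that by (simp add: norm_mult)
    fix x y :: real assume s: "x\<^sup>2 + y\<^sup>2 \<notin> {r\<^sup>2, R\<^sup>2}"
    show "((\<lambda>x. e ((cmod (Complex x y))\<^sup>2)) has_real_derivative - (\<omega> ((cmod (Complex x y))\<^sup>2) * x)) (at x)"
      unfolding q by (rule DERIV_cong[OF DERIV_chain2[where g = "\<lambda>x. x\<^sup>2 + y\<^sup>2", OF de[OF s]]]) (rule derivative_eq_intros refl | simp)+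
    show "((\<lambda>y. e ((cmod (Complex x y))\<^sup>2)) has_real_derivative - (\<omega> ((cmod (Complex x y))\<^sup>2) * y)) (at y)"
      unfolding q by (rule DERIV_cong[OF DERIV_chain2[where g = "\<lambda>y. x\<^sup>2 + y\<^sup>2", OF de[OF s]]]) (rule derivative_eq_intros refl | simp)+
  qed
  then show ?thesis unfolding e_def \<omega>_def .
qed

section \<open>Area growth and Hoelder estimate for quasiconformal mappings\<close>

context qc_plane
begin

lemma jac_integral_le: "(\<integral>\<^sup>+z\<in>X. ennreal (jac f z) \<partial>lborel) \<le> emeasure lborel (f ` X)" if X[measurable]: "X \<in> sets borel"
proof -
  have [measurable]: "f ` X \<in> sets borel" by (rule image_f_measurable[OF X])
  have "(\<integral>\<^sup>+z\<in>X. ennreal (jac f z) \<partial>lborel) = (\<integral>\<^sup>+z. ennreal (jac f z) * indicator (f ` X) (f z) \<partial>lborel)"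
    by (intro nn_integral_cong) (simp add: image_f indicator_def)
  also have "\<dots> \<le> (\<integral>\<^sup>+w. indicator (f ` X) w \<partial>lborel)" by (rule area_bound) measurable
  also have "\<dots> = emeasure lborel (f ` X)" by simp
  finally show ?thesis .
qed

lemma jac_integral_finite: "(\<integral>\<^sup>+z\<in>cball c R. ennreal (jac f z) \<partial>lborel) < \<infinity>"
proof -
  have "(\<integral>\<^sup>+z\<in>cball c R. ennreal (jac f z) \<partial>lborel) \<le> emeasure lborel (f ` cball c R)" by (rule jac_integral_le) simp
  also have "\<dots> < \<infinity>"
    by (intro emeasure_compact_finite compact_continuous_image continuous_f compact_cball)
  finally show ?thesis .
qed

lemma ae_line_integral:
  shows ae_line_integral_x: "AE y in lborel. \<forall>a b. a \<le> b \<longrightarrow> ((\<lambda>x. dird 1 f (Complex x y)) has_integral (f (Complex b y) - f (Complex a y))) {a..b}"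
    and ae_line_integral_y: "AE x in lborel. \<forall>a b. a \<le> b \<longrightarrow> ((\<lambda>y. dird \<i> f (Complex x y)) has_integral (f (Complex x b) - f (Complex x a))) {a..b}"
proof -
  have neg: "negligible {t. \<not> P t}" if P: "AE t in lborel. P t" for P :: "real \<Rightarrow> bool"
  proof -
    obtain N where "{t. \<not> P t} \<subseteq> N" "N \<in> null_sets lborel" using P unfolding eventually_ae_filter by auto
    then show ?thesis using negligible_subset[of N "{t. \<not> P t}"] by (auto simp: negligible_iff_null_sets intro: null_sets_completionI)
  qed
  have gx: "AE y in lborel. AE x in lborel. Complex x y \<in> dirset 1 f"
    using ae_dirset_x by (subst (asm) AE_complex_yx) auto
  have gy: "AE x in lborel. AE y in lborel. Complex x y \<in> dirset \<i> f"
    using ae_dirset_y by (subst (asm) AE_complex_xy) auto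
  show "AE y in lborel. \<forall>a b. a \<le> b \<longrightarrow> ((\<lambda>x. dird 1 f (Complex x y)) has_integral (f (Complex b y) - f (Complex a y))) {a..b}"
    using ae_line_x gx
  proof eventually_elim
    case (elim y)
    show ?case
    proof (intro allI impI)
      fix a b :: real assume ab: "a \<le> b"
      show "((\<lambda>x. dird 1 f (Complex x y)) has_integral (f (Complex b y) - f (Complex a y))) {a..b}"
      proof (rule abs_continuous_on_has_integral[OF elim(1)[rule_format] ab neg[OF elim(2)]])
        fix x assume "x \<in> {a<..<b} - {x. Complex x y \<notin> dirset 1 f}"
        then show "((\<lambda>x. f (Complex x y)) has_vector_derivative dird 1 f (Complex x y)) (at x)"
          unfolding line_derivative_iff by (intro dirset_tendsto) simp
      qed
    qed
  qed
  show "AE x in lborel. \<forall>a b. a \<le> b \<longrightarrow> ((\<lambda>y. dird \<i> f (Complex x y)) has_integral (f (Complex x b) - f (Complex x a))) {a..b}"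
    using ae_line_y gy
  proof eventually_elim
    case (elim x)
    show ?case
    proof (intro allI impI)
      fix a b :: real assume ab: "a \<le> b"
      show "((\<lambda>y. dird \<i> f (Complex x y)) has_integral (f (Complex x b) - f (Complex x a))) {a..b}"
      proof (rule abs_continuous_on_has_integral[OF elim(1)[rule_format] ab neg[OF elim(2)]])
        fix y assume "y \<in> {a<..<b} - {y. Complex x y \<notin> dirset \<i> f}"
        then show "((\<lambda>y. f (Complex x y)) has_vector_derivative dird \<i> f (Complex x y)) (at y)"
          unfolding line_derivative_iff by (intro dirset_tendsto) simp
      qed
    qed
  qed
qed

text \<open>The centre \<open>c\<close> is moved to the origin, to which \<open>angular\<close> and
  \<open>radial_cutoff\<close> refer. Finiteness holds because the energy density is at most
  \<open>2 * K\<close> times the Jacobian, whose integral over a disc is at most the area of a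
  compact image.\<close>

lemma local_L2_translate:
  "local_L2 (\<lambda>z. dird 1 f (c + z)) (\<lambda>z. dird \<i> f (c + z)) (\<lambda>z. (cmod (dird 1 f (c + z)))\<^sup>2 + (cmod (dird \<i> f (c + z)))\<^sup>2)"
proof
  show "(\<lambda>z. dird 1 f (c + z)) \<in> borel_measurable borel" "(\<lambda>z. dird \<i> f (c + z)) \<in> borel_measurable borel" by measurable
  fix R
  have "(\<integral>\<^sup>+z\<in>cball 0 R. ennreal ((cmod (dird 1 f (c + z)))\<^sup>2 + (cmod (dird \<i> f (c + z)))\<^sup>2) \<partial>lborel)
     = (\<integral>\<^sup>+z. ennreal ((cmod (dird 1 f (c + z)))\<^sup>2 + (cmod (dird \<i> f (c + z)))\<^sup>2) * indicator (cball c R) (c + z) \<partial>lborel)"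
    by (intro nn_integral_cong) (simp add: indicator_def dist_norm)
  also have "\<dots> = (\<integral>\<^sup>+z\<in>cball c R. ennreal ((cmod (dird 1 f z))\<^sup>2 + (cmod (dird \<i> f z))\<^sup>2) \<partial>lborel)"
    by (rule nn_integral_translation) measurable
  also have "\<dots> \<le> (\<integral>\<^sup>+z. ennreal (2 * K) * (ennreal (jac f z) * indicator (cball c R) z) \<partial>lborel)"
  proof (rule nn_integral_mono_AE)
    show "AE z in lborel. ennreal ((cmod (dird 1 f z))\<^sup>2 + (cmod (dird \<i> f z))\<^sup>2) * indicator (cball c R) z \<le> ennreal (2 * K) * (ennreal (jac f z) * indicator (cball c R) z)"
      using ae_good_point
    proof eventually_elim
      case (elim z)
      have "(cmod (dird 1 f z))\<^sup>2 + (cmod (dird \<i> f z))\<^sup>2 \<le> 2 * K * jac f z"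
        using good_point_dilatation[OF elim, of 1 0] good_point_dilatation[OF elim, of 0 1] by simp
      then have "ennreal ((cmod (dird 1 f z))\<^sup>2 + (cmod (dird \<i> f z))\<^sup>2) \<le> ennreal (2 * K * jac f z)"
        by (rule ennreal_leI)
      also have "\<dots> = ennreal (2 * K) * ennreal (jac f z)"
        using K good_point_jac(1)[OF elim] by (intro ennreal_mult) auto
      finally have "ennreal ((cmod (dird 1 f z))\<^sup>2 + (cmod (dird \<i> f z))\<^sup>2) \<le> ennreal (2 * K) * ennreal (jac f z)" .
      then show ?case by (simp add: indicator_def)
    qed
  qed
  also have "\<dots> = ennreal (2 * K) * (\<integral>\<^sup>+z\<in>cball c R. ennreal (jac f z) \<partial>lborel)" by (rule nn_integral_cmult) measurable
  also have "\<dots> < \<infinity>" using jac_integral_finite[of c R] by (simp add: ennreal_mult_less_top)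
  finally show "(\<integral>\<^sup>+z\<in>cball 0 R. ennreal ((cmod (dird 1 f (c + z)))\<^sup>2 + (cmod (dird \<i> f (c + z)))\<^sup>2) \<partial>lborel) < \<infinity>" .
qed simp

text \<open>Fubini's theorem on the cell and the fundamental theorem of calculus on almost every
  line: the derivatives of the averages of \<open>f\<close> are the averages of its partial
  derivatives.\<close>

lemma steklov_derivative:
  assumes h: "h > 0"
  shows "integral {Im z..Im z + h} (\<lambda>t. f (Complex (Re z + h) t)) - integral {Im z..Im z + h} (\<lambda>t. f (Complex (Re z) t)) = integral (cell h z) (dird 1 f)"
    and "integral {Re z..Re z + h} (\<lambda>s. f (Complex s (Im z + h))) - integral {Re z..Re z + h} (\<lambda>s. f (Complex s (Im z))) = integral (cell h z) (dird \<i> f)"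
proof -
  interpret L: local_L2 "dird 1 f" "dird \<i> f" "\<lambda>z. (cmod (dird 1 f z))\<^sup>2 + (cmod (dird \<i> f z))\<^sup>2"
    using local_L2_translate[of 0] unfolding add_0_left .
  have cf: "continuous_on A (\<lambda>t. f (Complex s t))" "continuous_on A (\<lambda>s. f (Complex s t))" for A s t
    by (rule continuous_on_line[OF continuous_f])+
  have ind: "indicator (cell h z) (Complex x y) = (indicator {Re z..Re z + h} x * indicator {Im z..Im z + h} y :: real)" for x y
    by (auto simp: cell_def cbox_def Basis_complex_def indicator_def)
  have I1: "set_integrable lborel (cell h z) (dird 1 f)" and I2: "set_integrable lborel (cell h z) (dird \<i> f)"
    unfolding cell_def by (rule L.integrable_cell)+
  have "integral (cell h z) (dird 1 f) = (\<integral>w. indicator (cell h z) w *\<^sub>R dird 1 f w \<partial>lborel)"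
    using set_borel_integral_eq_integral(2)[OF I1] by (simp add: set_lebesgue_integral_def)
  also have "\<dots> = (\<integral>y. \<integral>x. indicator (cell h z) (Complex x y) *\<^sub>R dird 1 f (Complex x y) \<partial>lborel \<partial>lborel)"
    using I1 by (intro integral_complex_yx) (simp add: set_integrable_def)
  also have "\<dots> = (\<integral>y. indicator {Im z..Im z + h} y *\<^sub>R (f (Complex (Re z + h) y) - f (Complex (Re z) y)) \<partial>lborel)"
  proof (rule integral_cong_AE)
    have "AE y in lborel. integrable lborel (\<lambda>x. indicator (cell h z) (Complex x y) *\<^sub>R dird 1 f (Complex x y))"
      using I1 by (intro integrable_complex_x) (simp add: set_integrable_def)
    then show "AE y in lborel. (\<integral>x. indicator (cell h z) (Complex x y) *\<^sub>R dird 1 f (Complex x y) \<partial>lborel) =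
        indicator {Im z..Im z + h} y *\<^sub>R (f (Complex (Re z + h) y) - f (Complex (Re z) y))"
      using ae_line_integral_x
    proof eventually_elim
      case (elim y)
      show ?case
      proof (cases "y \<in> {Im z..Im z + h}")
        case True
        then have "set_integrable lborel {Re z..Re z + h} (\<lambda>x. dird 1 f (Complex x y))"
          using elim(1) unfolding set_integrable_def ind by simp
        from set_borel_integral_eq_integral(2)[OF this]
        have "(LBINT x:{Re z..Re z + h}. dird 1 f (Complex x y)) = f (Complex (Re z + h) y) - f (Complex (Re z) y)"
          using elim(2)[rule_format, of "Re z" "Re z + h"] h by (simp add: integral_unique)
        then show ?thesis using True unfolding set_lebesgue_integral_def ind by simp
      next
        case False then show ?thesis unfolding ind by simp
      qed
    qed
    show "(\<lambda>y. indicator {Im z..Im z + h} y *\<^sub>R (f (Complex (Re z + h) y) - f (Complex (Re z) y))) \<in> borel_measurable lborel" by measurable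
    show "(\<lambda>y. \<integral>x. indicator (cell h z) (Complex x y) *\<^sub>R dird 1 f (Complex x y) \<partial>lborel) \<in> borel_measurable lborel" by measurable
  qed
  also have "\<dots> = integral {Im z..Im z + h} (\<lambda>y. f (Complex (Re z + h) y) - f (Complex (Re z) y))"
    using set_borel_integral_eq_integral(2)[OF borel_integrable_atLeastAtMost'[of "Im z" "Im z + h" "\<lambda>y. f (Complex (Re z + h) y) - f (Complex (Re z) y)"]]
    by (simp add: set_lebesgue_integral_def continuous_on_diff cf)
  also have "\<dots> = integral {Im z..Im z + h} (\<lambda>t. f (Complex (Re z + h) t)) - integral {Im z..Im z + h} (\<lambda>t. f (Complex (Re z) t))"
    by (intro integral_diff integrable_continuous_interval cf)
  finally show "integral {Im z..Im z + h} (\<lambda>t. f (Complex (Re z + h) t)) - integral {Im z..Im z + h} (\<lambda>t. f (Complex (Re z) t)) = integral (cell h z) (dird 1 f)" by simp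
  have "integral (cell h z) (dird \<i> f) = (\<integral>w. indicator (cell h z) w *\<^sub>R dird \<i> f w \<partial>lborel)"
    using set_borel_integral_eq_integral(2)[OF I2] by (simp add: set_lebesgue_integral_def)
  also have "\<dots> = (\<integral>x. \<integral>y. indicator (cell h z) (Complex x y) *\<^sub>R dird \<i> f (Complex x y) \<partial>lborel \<partial>lborel)"
    using I2 by (intro integral_complex_xy) (simp add: set_integrable_def)
  also have "\<dots> = (\<integral>x. indicator {Re z..Re z + h} x *\<^sub>R (f (Complex x (Im z + h)) - f (Complex x (Im z))) \<partial>lborel)"
  proof (rule integral_cong_AE)
    have "AE x in lborel. integrable lborel (\<lambda>y. indicator (cell h z) (Complex x y) *\<^sub>R dird \<i> f (Complex x y))"
      using I2 by (intro integrable_complex_y) (simp add: set_integrable_def)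
    then show "AE x in lborel. (\<integral>y. indicator (cell h z) (Complex x y) *\<^sub>R dird \<i> f (Complex x y) \<partial>lborel) =
        indicator {Re z..Re z + h} x *\<^sub>R (f (Complex x (Im z + h)) - f (Complex x (Im z)))"
      using ae_line_integral_y
    proof eventually_elim
      case (elim x)
      show ?case
      proof (cases "x \<in> {Re z..Re z + h}")
        case True
        then have "set_integrable lborel {Im z..Im z + h} (\<lambda>y. dird \<i> f (Complex x y))"
          using elim(1) unfolding set_integrable_def ind by simp
        from set_borel_integral_eq_integral(2)[OF this]
        have "(LBINT y:{Im z..Im z + h}. dird \<i> f (Complex x y)) = f (Complex x (Im z + h)) - f (Complex x (Im z))"
          using elim(2)[rule_format, of "Im z" "Im z + h"] h by (simp add: integral_unique)
        then show ?thesis using True unfolding set_lebesgue_integral_def ind by simp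
      next
        case False then show ?thesis unfolding ind by simp
      qed
    qed
    show "(\<lambda>x. indicator {Re z..Re z + h} x *\<^sub>R (f (Complex x (Im z + h)) - f (Complex x (Im z)))) \<in> borel_measurable lborel" by measurable
    show "(\<lambda>x. \<integral>y. indicator (cell h z) (Complex x y) *\<^sub>R dird \<i> f (Complex x y) \<partial>lborel) \<in> borel_measurable lborel" by measurable
  qed
  also have "\<dots> = integral {Re z..Re z + h} (\<lambda>x. f (Complex x (Im z + h)) - f (Complex x (Im z)))"
    using set_borel_integral_eq_integral(2)[OF borel_integrable_atLeastAtMost'[of "Re z" "Re z + h" "\<lambda>x. f (Complex x (Im z + h)) - f (Complex x (Im z))"]]
    by (simp add: set_lebesgue_integral_def continuous_on_diff cf)
  also have "\<dots> = integral {Re z..Re z + h} (\<lambda>s. f (Complex s (Im z + h))) - integral {Re z..Re z + h} (\<lambda>s. f (Complex s (Im z)))"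
    by (intro integral_diff integrable_continuous_interval cf)
  finally show "integral {Re z..Re z + h} (\<lambda>s. f (Complex s (Im z + h))) - integral {Re z..Re z + h} (\<lambda>s. f (Complex s (Im z))) = integral (cell h z) (dird \<i> f)" by simp
qed

lemma steklov_approximation:
  assumes h: "h > 0"
  shows "\<exists>g gxy. C1_mixed g (savg h (\<lambda>z. dird 1 f (c + z))) (savg h (\<lambda>z. dird \<i> f (c + z))) gxy"
proof -
  have sh: "integral (cell h (c + z)) F = integral (cell h z) (\<lambda>w. F (c + w))" for z and F :: "complex \<Rightarrow> complex"
    using integral_shift_cbox[of "c + z" c "c + z + Complex h h" F] by (simp add: cell_def algebra_simps)
  note C1_mixed_translate[OF C1_mixed_scaleR[OF steklov_C1_mixed[OF continuous_f h]], of "inverse (h\<^sup>2)" c]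
  then show ?thesis
    unfolding steklov_derivative[OF h] sh savg_def[symmetric] savg_def[abs_def, symmetric] by blast
qed

lemma ae_good_point_shift: "AE z in lborel. good_point (c + z)"
proof -
  have "AE z in distr lborel borel ((+) c). good_point z" unfolding lborel_distr_plus by (rule ae_good_point)
  then show ?thesis by (subst (asm) AE_distr_iff) (simp_all add: pred_def[symmetric])
qed

text \<open>With \<open>\<beta> = 1 / K\<close> the dilatation bound gives
  \<open>w |angular P Q|^2 \<le> 2 |z|^(-2\<beta>) J\<close>, which cancels the leading part of
  \<open>2 \<eta> J\<close> on the annulus. What survives of the area inequality is
  \<open>r^(-2\<beta>) W r \<le> R^(-2\<beta>) W R\<close>, where \<open>W\<close> is the integral
  of the Jacobian over the disc.\<close>

lemma jac_integral_growth:
  assumes r: "0 < r" "r < R"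
  shows "(\<integral>\<^sup>+z\<in>cball c r. ennreal (jac f z) \<partial>lborel) \<le> ennreal ((r / R) powr (2 / K)) * (\<integral>\<^sup>+z\<in>cball c R. ennreal (jac f z) \<partial>lborel)"
proof -
  define \<beta> where "\<beta> = 1 / K"
  have \<beta>: "\<beta> > 0" "K * \<beta> = 1" using K by (auto simp: \<beta>_def)
  define J where "J z = jac f (c + z)" for z
  have [measurable]: "J \<in> borel_measurable borel" unfolding J_def[abs_def] by measurable
  define P where "P z = dird 1 f (c + z)" for z
  define Q where "Q z = dird \<i> f (c + z)" for z
  define \<eta> where "\<eta> z = max 0 (max ((cmod z)\<^sup>2) (r\<^sup>2) powr (- \<beta>) - (R\<^sup>2) powr (- \<beta>))" for z :: complex
  define w where "w z = (if r\<^sup>2 < (cmod z)\<^sup>2 \<and> (cmod z)\<^sup>2 < R\<^sup>2 then 2 * \<beta> * ((cmod z)\<^sup>2) powr (- \<beta> - 1) else 0)" for z :: complex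
  have cut: "radial_cutoff R {r\<^sup>2, R\<^sup>2} \<eta> w"
    unfolding \<eta>_def[abs_def] w_def[abs_def] by (rule radial_cutoff_powr[OF \<beta>(1) r])
  interpret L: local_L2 P Q "\<lambda>z. (cmod (P z))\<^sup>2 + (cmod (Q z))\<^sup>2"
    unfolding P_def[abs_def] Q_def[abs_def] by (rule local_L2_translate)
  have sm: "\<exists>g gxy. C1_mixed g (savg h P) (savg h Q) gxy" if "h > 0" for h
    using steklov_approximation[OF that] unfolding P_def[abs_def] Q_def[abs_def] .
  have Jeq: "Im (cnj (P z) * Q z) = J z" for z by (simp add: J_def P_def Q_def jac_def)
  note area = L.area_inequality_limit[OF sm cut, unfolded Jeq]
  have J0: "AE z in lborel. J z \<ge> 0"
    using ae_good_point_shift[of c] by eventually_elim (simp add: J_def good_point_jac)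
  define W where "W \<rho> = (\<integral>z. indicator (cball 0 \<rho>) z * J z \<partial>lborel)" for \<rho>
  have nnW: "(\<integral>\<^sup>+z\<in>cball c \<rho>. ennreal (jac f z) \<partial>lborel) = (\<integral>\<^sup>+z. ennreal (indicator (cball 0 \<rho>) z * J z) \<partial>lborel)" for \<rho>
  proof -
    have "(\<integral>\<^sup>+z\<in>cball c \<rho>. ennreal (jac f z) \<partial>lborel) = (\<integral>\<^sup>+z. ennreal (jac f (c + z)) * indicator (cball c \<rho>) (c + z) \<partial>lborel)"
      by (rule nn_integral_translation[symmetric]) measurable
    also have "\<dots> = (\<integral>\<^sup>+z. ennreal (indicator (cball 0 \<rho>) z * J z) \<partial>lborel)"
      by (intro nn_integral_cong) (simp add: indicator_def dist_norm J_def)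
    finally show ?thesis .
  qed
  have WI: "integrable lborel (\<lambda>z. indicator (cball 0 \<rho>) z * J z)" for \<rho>
  proof (rule integrableI_nonneg)
    show "AE z in lborel. 0 \<le> indicator (cball 0 \<rho>) z * J z"
      using J0 by eventually_elim simp
    show "(\<integral>\<^sup>+z. ennreal (indicator (cball 0 \<rho>) z * J z) \<partial>lborel) < \<infinity>"
      using jac_integral_finite[of c \<rho>] unfolding nnW .
  qed measurable
  have Weq: "(\<integral>\<^sup>+z\<in>cball c \<rho>. ennreal (jac f z) \<partial>lborel) = ennreal (W \<rho>)" for \<rho>
    unfolding nnW W_def by (rule nn_integral_eq_integral[OF WI]) (use J0 in eventually_elim, simp)
  have W0: "W \<rho> \<ge> 0" for \<rho>
    unfolding W_def by (rule Bochner_Integration.integral_nonneg_AE) (use J0 in eventually_elim, simp)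
  let ?a = "(r\<^sup>2) powr (- \<beta>)" and ?b = "(R\<^sup>2) powr (- \<beta>)"
  have ab: "?b \<le> ?a" using r \<beta> by (intro powr_mono2') (auto intro: power_mono)
  have "2 * (?a * W r - ?b * W R) = (\<integral>z. 2 * (?a * (indicator (cball 0 r) z * J z) - ?b * (indicator (cball 0 R) z * J z)) \<partial>lborel)"
    unfolding W_def using WI[of r] WI[of R] by simp
  \<comment> \<open>The comparison is pointwise: equality on the inner disc, the cancellation on the
    annulus, and from radius \<open>R\<close> on the right side is 0 while the left side is at most
    0.\<close>
  also have "\<dots> \<le> (\<integral>z. 2 * (\<eta> z * J z) - w z * (cmod (angular P Q z))\<^sup>2 \<partial>lborel)"
  proof (rule integral_mono_AE)
    show "AE z in lborel. 2 * (?a * (indicator (cball 0 r) z * J z) - ?b * (indicator (cball 0 R) z * J z)) \<le> 2 * (\<eta> z * J z) - w z * (cmod (angular P Q z))\<^sup>2"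
      using ae_good_point_shift[of c]
    proof eventually_elim
      case (elim z)
      have Jz: "J z \<ge> 0" using good_point_jac(1)[OF elim] by (simp add: J_def)
      consider "cmod z \<le> r" | "r < cmod z" "cmod z < R" | "R \<le> cmod z" by linarith
      then show ?case
      proof cases
        case 1
        then have "(cmod z)\<^sup>2 \<le> r\<^sup>2" by (intro power_mono) auto
        then have "\<eta> z = ?a - ?b" "w z = 0" using ab by (auto simp: \<eta>_def w_def max_def)
        moreover have "indicator (cball 0 r) z = (1 :: real)" "indicator (cball 0 R) z = (1 :: real)" using 1 r by auto
        ultimately show ?thesis by (simp only: mult_1_left mult_zero_left diff_0_right left_diff_distrib order_refl)
      next
        case 2
        define s where "s = (cmod z)\<^sup>2"
        have s: "r\<^sup>2 < s" "s < R\<^sup>2" "s > 0"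
          unfolding s_def using 2 r by (auto intro: power_strict_mono)
        have "?b \<le> s powr (- \<beta>)" using s \<beta> by (intro powr_mono2') auto
        then have \<eta>: "\<eta> z = s powr (- \<beta>) - ?b" using s by (simp add: \<eta>_def s_def[symmetric] max_def)
        have w: "w z = 2 * \<beta> * s powr (- \<beta> - 1)" using s by (simp add: w_def s_def[symmetric])
        have "angular P Q z = of_real (- Im z) * dird 1 f (c + z) + of_real (Re z) * dird \<i> f (c + z)"
          by (simp add: angular_def P_def Q_def scaleR_conv_of_real)
        then have "(cmod (angular P Q z))\<^sup>2 \<le> K * J z * s"
          using good_point_dilatation[OF elim, of "- Im z" "Re z"] by (simp add: J_def s_def cmod_power2 add.commute)
        then have "w z * (cmod (angular P Q z))\<^sup>2 \<le> w z * (K * J z * s)"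
          using w \<beta> by (intro mult_left_mono) auto
        also have "\<dots> = 2 * (K * \<beta>) * (s powr (- \<beta> - 1) * s) * J z" by (simp add: w)
        also have "s powr (- \<beta> - 1) * s = s powr (- \<beta>)" using s(3) powr_add[of s "- \<beta> - 1" 1] by simp
        finally have "w z * (cmod (angular P Q z))\<^sup>2 \<le> 2 * s powr (- \<beta>) * J z" using \<beta>(2) by simp
        then show ?thesis using 2 by (simp add: \<eta> algebra_simps)
      next
        case 3
        have "\<eta> z = 0" "w z = 0" using cut 3 unfolding radial_cutoff_def by blast+
        moreover have "cmod z > r" using 3 r by simp
        ultimately show ?thesis using Jz by simp
      qed
    qed
    show "integrable lborel (\<lambda>z. 2 * (?a * (indicator (cball 0 r) z * J z) - ?b * (indicator (cball 0 R) z * J z)))"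
      using WI[of r] WI[of R] by simp
    show "integrable lborel (\<lambda>z. 2 * (\<eta> z * J z) - w z * (cmod (angular P Q z))\<^sup>2)"
      using area(1,2) by simp
  qed
  also have "\<dots> = 2 * (\<integral>z. \<eta> z * J z \<partial>lborel) - (\<integral>z. w z * (cmod (angular P Q z))\<^sup>2 \<partial>lborel)"
    using area(1,2) by simp
  also have "\<dots> \<le> 0" using area(3) by simp
  finally have "?a * W r \<le> ?b * W R" by simp
  moreover have "?a > 0" using r by simp
  ultimately have "W r \<le> ?b / ?a * W R" by (simp add: field_simps)
  also have "?b / ?a = (r / R) powr (2 / K)"
  proof -
    have "(t\<^sup>2) powr (- \<beta>) = t powr (- (2 / K))" if "t > 0" for t
      using that by (simp add: \<beta>_def powr_powr flip: powr_numeral)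
    then show ?thesis using r by (simp add: powr_divide powr_minus field_simps)
  qed
  finally have "ennreal (W r) \<le> ennreal ((r / R) powr (2 / K) * W R)" by (rule ennreal_leI)
  also have "\<dots> = ennreal ((r / R) powr (2 / K)) * ennreal (W R)" by (rule ennreal_mult) (use W0 in auto)
  finally show ?thesis unfolding Weq .
qed

text \<open>\<open>distortion\<close> bounds the image area of the disc of radius \<open>|z|\<close>
  about \<open>z\<close>, \<open>jac_integral_growth\<close> scales the Jacobian integral down to
  radius \<open>4 * d\<close>, and the length-area estimate with the maximum principle turns it into
  a bound for \<open>|f z - f z'|\<close>. The constant 320 is \<open>2 * 40 * 4\<close>: two points
  are compared with the same contour point, and \<open>4 powr (1 / K) \<le> 4\<close>.\<close>

lemma hoelder_estimate:
  assumes f0: "f 0 = 0" and N: "96 * sqrt (K * (4 * pi * (real N + 1))) < real N * ln 2"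
    and z: "z \<noteq> 0" and near: "cmod (z - z') < cmod z / 4" "z' \<noteq> z"
  shows "cmod (f z - f z') \<le> 320 * sqrt (K * pi) * 2 ^ N * cmod (f z) * (cmod (z - z') / cmod z) powr (1 / K)"
proof -
  define R where "R = cmod z"
  define d where "d = cmod (z - z')"
  define M where "M = 2 ^ N * cmod (f z)"
  have R: "R > 0" using z by (simp add: R_def)
  have d: "d > 0" "4 * d < R" using near by (auto simp: d_def R_def)
  have "f z \<noteq> f 0" using z gf by metis
  then have M: "M > 0" using f0 by (simp add: M_def)
  \<comment> \<open>The ratio \<open>4 * d / R\<close> is below 1 because \<open>z'\<close> is near
    \<open>z\<close>. Its power \<open>2 / K\<close> appears as the square of \<open>t\<close>, so
    that \<open>sqrt E\<close> contains \<open>t\<close> itself.\<close>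
  define t where "t = (4 * d / R) powr (1 / K)"
  have t: "t > 0" "t\<^sup>2 = (4 * d / R) powr (2 / K)"
    using d R by (simp_all add: t_def power2_eq_square flip: powr_add)
  define E where "E = K * (pi * M\<^sup>2) * t\<^sup>2"
  have E: "E > 0" "sqrt E = sqrt (K * pi) * M * t"
    using K M t(1) by (simp_all add: E_def real_sqrt_mult)
  \<comment> \<open>The factor 1 is the local Lipschitz constant of the identity, written out to
    match the form in \<open>upper_gradient_compose\<close>.\<close>
  define \<rho> where "\<rho> w = ennreal (1 * sqrt (K * jac f w))" for w
  have ug: "upper_gradient f \<rho>"
    unfolding \<rho>_def[abs_def]
  proof (rule upper_gradient_compose[of "\<lambda>w. w" 1 "\<lambda>w. 1"])
    fix w :: complex and \<epsilon> :: real assume "\<epsilon> > 0"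
    then show "\<forall>\<^sub>F w' in nhds w. cmod (w' - w) \<le> (1 + \<epsilon>) * cmod (w' - w)"
      by (intro always_eventually) (simp add: algebra_simps)
  qed simp_all
  have [measurable]: "\<rho> \<in> borel_measurable borel" unfolding \<rho>_def[abs_def] by measurable
  have "f ` cball z R \<subseteq> cball 0 M"
  proof
    fix w assume "w \<in> f ` cball z R"
    then obtain v where v: "w = f v" "cmod (z - v) \<le> R" by (auto simp: dist_norm)
    have "cmod v \<le> cmod z + cmod (z - v)" using norm_triangle_sub[of v z] by (simp add: norm_minus_commute)
    then have "cmod v \<le> 2 * cmod z" using v(2) by (simp add: R_def)
    then show "w \<in> cball 0 M" using distortion[OF f0 N z, of v] v(1) by (simp add: M_def)
  qed
  then have "emeasure lborel (f ` cball z R) \<le> emeasure lborel (cball (0 :: complex) M)"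
    by (intro emeasure_mono) auto
  also have "\<dots> = ennreal (pi * M\<^sup>2)" using M by (simp add: emeasure_cball unit_ball_vol_2)
  finally have area: "(\<integral>\<^sup>+w\<in>cball z R. ennreal (jac f w) \<partial>lborel) \<le> ennreal (pi * M\<^sup>2)"
    using jac_integral_le[of "cball z R"] by (meson borel_closed closed_cball order_trans)
  have sq: "square z (2 * d) \<subseteq> cball z (4 * d)"
  proof
    fix w assume "w \<in> square z (2 * d)"
    then have "\<bar>Re (z - w)\<bar> \<le> 2 * d" "\<bar>Im (z - w)\<bar> \<le> 2 * d" by (auto simp: square_def)
    then have "cmod (z - w) \<le> 4 * d" using cmod_le[of "z - w"] by linarith
    then show "w \<in> cball z (4 * d)" by (simp add: dist_norm)
  qed
  have "(\<integral>\<^sup>+w\<in>square z (2 * d). (\<rho> w)\<^sup>2 \<partial>lborel) \<le> (\<integral>\<^sup>+w. ennreal K * (ennreal (jac f w) * indicator (cball z (4 * d)) w) \<partial>lborel)"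
  proof (rule nn_integral_mono_AE)
    show "AE w in lborel. (\<rho> w)\<^sup>2 * indicator (square z (2 * d)) w \<le> ennreal K * (ennreal (jac f w) * indicator (cball z (4 * d)) w)"
      using ae_good_point
    proof eventually_elim
      case (elim w)
      have J: "jac f w \<ge> 0" by (rule good_point_jac(1)[OF elim])
      then have KJ: "0 \<le> K * jac f w" using K by simp
      have "(\<rho> w)\<^sup>2 = ennreal ((sqrt (K * jac f w))\<^sup>2)"
        unfolding \<rho>_def mult_1_left using KJ by (intro ennreal_power) simp
      also have "\<dots> = ennreal (K * jac f w)" by (simp only: real_sqrt_pow2[OF KJ])
      also have "\<dots> = ennreal K * ennreal (jac f w)" using K J by (intro ennreal_mult) auto
      finally have "(\<rho> w)\<^sup>2 = ennreal K * ennreal (jac f w)" .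
      then show ?case using sq by (auto simp: indicator_def)
    qed
  qed
  also have "\<dots> = ennreal K * (\<integral>\<^sup>+w\<in>cball z (4 * d). ennreal (jac f w) \<partial>lborel)"
    by (rule nn_integral_cmult) measurable
  also have "\<dots> \<le> ennreal K * (ennreal (t\<^sup>2) * ennreal (pi * M\<^sup>2))"
  proof (rule mult_left_mono)
    have "(\<integral>\<^sup>+w\<in>cball z (4 * d). ennreal (jac f w) \<partial>lborel) \<le> ennreal (t\<^sup>2) * (\<integral>\<^sup>+w\<in>cball z R. ennreal (jac f w) \<partial>lborel)"
      unfolding t(2) using d by (intro jac_integral_growth) auto
    also have "\<dots> \<le> ennreal (t\<^sup>2) * ennreal (pi * M\<^sup>2)" by (rule mult_left_mono[OF area]) simp
    finally show "(\<integral>\<^sup>+w\<in>cball z (4 * d). ennreal (jac f w) \<partial>lborel) \<le> ennreal (t\<^sup>2) * ennreal (pi * M\<^sup>2)" .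
  qed simp
  also have "\<dots> = ennreal K * ennreal (t\<^sup>2 * (pi * M\<^sup>2))"
    using ennreal_mult[of "t\<^sup>2" "pi * M\<^sup>2"] by simp
  also have "\<dots> = ennreal (K * (t\<^sup>2 * (pi * M\<^sup>2)))"
    using K by (intro ennreal_mult[symmetric]) auto
  also have "K * (t\<^sup>2 * (pi * M\<^sup>2)) = E" by (simp add: E_def)
  finally have "(\<integral>\<^sup>+w\<in>square z (2 * d). (\<rho> w)\<^sup>2 \<partial>lborel) \<le> ennreal E" .
  from square_oscillation[OF ug _ d(1) E(1) this]
  obtain s where s: "d < s" "s < 2 * d"
    and osc: "\<And>p q. p \<in> square_bd z s \<Longrightarrow> q \<in> square_bd z s \<Longrightarrow> cmod (f p - f q) \<le> 40 * sqrt E" by auto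
  define p where "p = z + of_real s"
  have p: "p \<in> square_bd z s" using s d by (simp add: p_def square_bd_def)
  have near_p: "cmod (f v - f p) \<le> 40 * sqrt E" if "v \<in> square z s" for v
    using oscillation_max_principle[OF that p] osc[OF _ p] by blast
  have "z \<in> square z s" using s d by (simp add: square_def)
  moreover have "z' \<in> square z s"
    using abs_Re_le_cmod[of "z - z'"] abs_Im_le_cmod[of "z - z'"] s by (auto simp: square_def d_def abs_minus_commute)
  ultimately have "cmod (f z - f p) \<le> 40 * sqrt E" "cmod (f z' - f p) \<le> 40 * sqrt E" by (auto intro: near_p)
  then have "cmod (f z - f z') \<le> 80 * sqrt E"
    using norm_triangle_ineq4[of "f z - f p" "f z' - f p"] by simp
  also have "\<dots> = 80 * (sqrt (K * pi) * M) * t" by (simp add: E(2))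
  also have "\<dots> \<le> 80 * (sqrt (K * pi) * M) * (4 * (d / R) powr (1 / K))"
  proof (rule mult_left_mono)
    have "t = 4 powr (1 / K) * (d / R) powr (1 / K)"
      unfolding t_def using d R by (simp add: powr_mult[symmetric])
    moreover have "4 powr (1 / K) \<le> (4 :: real) powr 1" using K by (intro powr_mono) auto
    ultimately show "t \<le> 4 * (d / R) powr (1 / K)" by (simp add: mult_right_mono)
    show "0 \<le> 80 * (sqrt (K * pi) * M)" using K M by simp
  qed
  finally show ?thesis by (simp add: M_def d_def R_def algebra_simps)
qed

end

subsection \<open>Angles\<close>

text \<open>Up to \<open>pi / 3\<close> the difference \<open>2 * sin x - x\<close> increases
  because \<open>cos\<close> is at least \<open>1 / 2\<close> there; beyond,
  \<open>2 * sin x \<ge> sqrt 3 \<ge> 8 / 5 \<ge> pi / 2\<close>.\<close>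

lemma le_2_sin_of_acute: "x \<le> 2 * sin x" if "0 \<le> x" "x \<le> pi / 2" for x :: real
proof (cases "x \<le> pi / 3")
  case True
  have "2 * sin 0 - 0 \<le> 2 * sin x - x"
  proof (rule DERIV_nonneg_imp_nondecreasing[OF that(1)])
    fix u assume u: "0 \<le> u" "u \<le> x"
    have "cos (pi / 3) \<le> cos u" using u True by (intro cos_monotone_0_pi_le) auto
    then have "2 * cos u - 1 \<ge> 0" by (simp add: cos_60)
    moreover have "((\<lambda>x. 2 * sin x - x) has_real_derivative 2 * cos u - 1) (at u)"
      by (auto intro!: derivative_eq_intros)
    ultimately show "\<exists>y. ((\<lambda>x. 2 * sin x - x) has_real_derivative y) (at u) \<and> 0 \<le> y" by blast
  qed
  then show ?thesis by simp
next
  case False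
  have "sin (pi / 3) \<le> sin x" using False that by (intro sin_monotone_2pi_le) auto
  then have "sqrt 3 \<le> 2 * sin x" by (simp add: sin_60)
  moreover have "(8 / 5 :: real) \<le> sqrt 3" by (rule real_le_rsqrt) (simp add: power2_eq_square)
  moreover have "pi \<le> 16 / 5" using pi_approx by simp
  ultimately show ?thesis using that(2) by linarith
qed

text \<open>The squared chord between the unit vectors is 2 minus twice the cosine of the angle, and
  the half-angle formula makes this a square.\<close>

lemma convex_angle_chord:
  assumes "a \<noteq> 0" "b \<noteq> 0"
  shows "0 \<le> convex_angle a b" "convex_angle a b \<le> pi"
    "2 * sin (convex_angle a b / 2) = cmod (sgn a - sgn b)"
proof -
  define t where "t = sgn a \<bullet> sgn b"
  have t: "\<bar>t\<bar> \<le> 1" using Cauchy_Schwarz_ineq2[of "sgn a" "sgn b"] assms by (simp add: t_def norm_sgn)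
  have ang: "convex_angle a b = arccos t"
    by (simp add: convex_angle_def t_def sgn_div_norm divide_inverse mult_ac)
  show 0: "0 \<le> convex_angle a b" "convex_angle a b \<le> pi"
    unfolding ang using t by (auto intro: arccos_lbound arccos_ubound)
  have "(cmod (sgn a - sgn b))\<^sup>2 = 2 - 2 * t"
    using assms by (simp add: power2_norm_eq_inner inner_diff inner_commute t_def) (simp add: norm_sgn flip: power2_norm_eq_inner)
  also have "t = cos (2 * (convex_angle a b / 2))" using t by (simp add: ang)
  also have "\<dots> = 1 - 2 * (sin (convex_angle a b / 2))\<^sup>2" by (rule cos_double_sin)
  finally have "(2 * sin (convex_angle a b / 2))\<^sup>2 = (cmod (sgn a - sgn b))\<^sup>2" by (simp add: power_mult_distrib)
  then show "2 * sin (convex_angle a b / 2) = cmod (sgn a - sgn b)"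
    by (rule power2_eq_imp_eq) (use 0 in \<open>auto intro!: sin_ge_zero\<close>)
qed

lemma dist_le_convex_angle:
  assumes "a \<noteq> 0" "cmod a = cmod b"
  shows "cmod (a - b) \<le> cmod a * convex_angle a b"
proof -
  have b: "b \<noteq> 0" using assms by auto
  have "a = cmod a *\<^sub>R sgn a" "b = cmod a *\<^sub>R sgn b" using assms b by (simp_all add: sgn_div_norm flip: assms(2))
  then have "cmod (a - b) = cmod (cmod a *\<^sub>R (sgn a - sgn b))" by (simp add: scaleR_diff_right)
  also have "\<dots> = cmod a * (2 * sin (convex_angle a b / 2))"
    by (simp add: convex_angle_chord(3)[OF assms(1) b])
  also have "\<dots> \<le> cmod a * (2 * (convex_angle a b / 2))"
    using convex_angle_chord(1)[OF assms(1) b] by (intro mult_left_mono sin_x_le_x) auto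
  finally show ?thesis by simp
qed

text \<open>From \<open>|a| (sgn a - sgn b) = (a - b) + (|b| - |a|) sgn b\<close>, the chord between
  the directions is at most \<open>2 |a - b| / |a|\<close>; the other factor 2 comes from
  \<open>le_2_sin_of_acute\<close>.\<close>

lemma convex_angle_le_dist:
  assumes "a \<noteq> 0" "b \<noteq> 0"
  shows "convex_angle a b \<le> 4 * cmod (a - b) / cmod a"
proof -
  have "convex_angle a b / 2 \<le> 2 * sin (convex_angle a b / 2)"
    using convex_angle_chord(1,2)[OF assms] by (intro le_2_sin_of_acute) auto
  then have "convex_angle a b \<le> 2 * cmod (sgn a - sgn b)" by (simp add: convex_angle_chord(3)[OF assms])
  also have "cmod (sgn a - sgn b) \<le> 2 * (cmod (a - b) / cmod a)"
  proof -
    have eq: "cmod a *\<^sub>R (sgn a - sgn b) = (a - b) + (cmod b - cmod a) *\<^sub>R sgn b"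
      using assms by (simp add: sgn_div_norm algebra_simps)
    have "cmod a * cmod (sgn a - sgn b) = cmod (cmod a *\<^sub>R (sgn a - sgn b))" by simp
    also have "\<dots> \<le> cmod (a - b) + cmod ((cmod b - cmod a) *\<^sub>R sgn b)" unfolding eq by (rule norm_triangle_ineq)
    also have "cmod ((cmod b - cmod a) *\<^sub>R sgn b) = \<bar>cmod b - cmod a\<bar>" using assms by (simp add: norm_sgn)
    also have "\<dots> \<le> cmod (a - b)" using norm_triangle_ineq3[of b a] by (simp add: norm_minus_commute)
    finally show ?thesis using assms(1) by (simp add: field_simps)
  qed
  finally show ?thesis by simp
qed

theorem proposition2p8:
  fixes K :: real
  assumes "1 \<le> K"
  shows "\<exists>c::real. \<forall>f z1 z2 \<theta> \<theta>'.
    quasiconformal_plane K f \<and> f 0 = 0 \<and>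
    z1 \<noteq> 0 \<and> z2 \<noteq> 0 \<and> cmod z1 = cmod z2 \<and>
    \<theta> = convex_angle z1 z2 \<and> \<theta>' = convex_angle (f z1) (f z2) \<longrightarrow>
      \<theta>' \<le> c * max (\<theta> powr (1 / K)) \<theta> \<and>
      (\<theta> \<le> 1 \<longrightarrow> \<theta>' \<le> c * \<theta> powr (1 / K))"
proof -
  obtain N where N: "96 * sqrt (K * (4 * pi * (real N + 1))) < real N * ln 2"
    using distortion_constant_exists[OF assms] by (rule exE)
  \<comment> \<open>The outer factor 4 is that of \<open>convex_angle_le_dist\<close>; the rest is
    the constant of \<open>hoelder_estimate\<close>.\<close>
  define C where "C = 4 * (320 * sqrt (K * pi) * 2 ^ N)"
  have C: "C \<ge> 0" using assms by (simp add: C_def)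
  show ?thesis
  \<comment> \<open>The summand \<open>4 * pi\<close> serves the angles
    \<open>\<theta> \<ge> 1 / 4\<close>, for which \<open>\<theta>' \<le> pi\<close> is enough;
    \<open>C\<close> serves the small ones.\<close>
  proof (rule exI[of _ "4 * pi + C"], intro allI impI)
    fix f z1 z2 and \<theta> \<theta>' :: real
    assume A: "quasiconformal_plane K f \<and> f 0 = 0 \<and> z1 \<noteq> 0 \<and> z2 \<noteq> 0 \<and> cmod z1 = cmod z2 \<and>
      \<theta> = convex_angle z1 z2 \<and> \<theta>' = convex_angle (f z1) (f z2)"
    then have f0: "f 0 = 0" and z: "z1 \<noteq> 0" "z2 \<noteq> 0" "cmod z1 = cmod z2"
      and \<theta>: "\<theta> = convex_angle z1 z2" and \<theta>': "\<theta>' = convex_angle (f z1) (f z2)" by auto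
    obtain g where "homeomorphism UNIV UNIV f g" using A by (auto simp: quasiconformal_plane_def quasiconformal_def)
    then interpret qc_plane K f g
      using A by unfold_locales (auto simp: quasiconformal_plane_def quasiconformal_def)
    have fz: "f z1 \<noteq> 0" "f z2 \<noteq> 0" using z(1,2) f0 gf by metis+
    have \<theta>0: "\<theta> \<ge> 0" and \<theta>'pi: "\<theta>' \<le> pi"
      unfolding \<theta> \<theta>' using convex_angle_chord(1)[OF z(1,2)] convex_angle_chord(2)[OF fz] by auto
    have dist: "cmod (z1 - z2) / cmod z1 \<le> \<theta>"
      using dist_le_convex_angle[OF z(1,3)] z(1) by (simp add: \<theta> field_simps)
    \<comment> \<open>The threshold \<open>1 / 4\<close> is the closeness required by
      \<open>hoelder_estimate\<close>, which also asks for distinct points.\<close>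
    consider "z2 = z1" | "\<theta> \<ge> 1 / 4" | "z2 \<noteq> z1" "\<theta> < 1 / 4" by linarith
    \<comment> \<open>This implies both claims: the conditional value is at most the maximum, and it
      is the power itself when \<open>\<theta> \<le> 1\<close>.\<close>
    then have "\<theta>' \<le> (4 * pi + C) * (if \<theta> \<le> 1 then \<theta> powr (1 / K) else \<theta>)"
    proof cases
      case 1
      then have "\<theta>' = 0" using convex_angle_le_dist[OF fz] convex_angle_chord(1)[OF fz] by (simp add: \<theta>')
      then show ?thesis using C \<theta>0 by simp
    next
      case 2
      have "(1 :: real) / 4 \<le> (if \<theta> \<le> 1 then \<theta> powr (1 / K) else \<theta>)"
      proof (cases "\<theta> \<le> 1")
        case True
        then have "\<theta> powr 1 \<le> \<theta> powr (1 / K)" using 2 assms by (intro powr_mono') auto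
        then show ?thesis using 2 True by simp
      qed simp
      then have "(4 * pi + C) * (1 / 4) \<le> (4 * pi + C) * (if \<theta> \<le> 1 then \<theta> powr (1 / K) else \<theta>)"
        using C by (intro mult_left_mono) auto
      then show ?thesis using \<theta>'pi C by simp
    next
      case 3
      then have "cmod (z1 - z2) / cmod z1 < 1 / 4" using dist by linarith
      then have near: "cmod (z1 - z2) < cmod z1 / 4" using z(1) by (simp add: field_simps)
      have "\<theta>' \<le> 4 * cmod (f z1 - f z2) / cmod (f z1)" unfolding \<theta>' by (rule convex_angle_le_dist[OF fz])
      also have "\<dots> \<le> 4 * (320 * sqrt (K * pi) * 2 ^ N * cmod (f z1) * (cmod (z1 - z2) / cmod z1) powr (1 / K)) / cmod (f z1)"
        using hoelder_estimate[OF f0 N z(1) near 3(1)] by (intro divide_right_mono mult_left_mono) auto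
      also have "\<dots> = C * (cmod (z1 - z2) / cmod z1) powr (1 / K)" using fz by (simp add: C_def)
      also have "\<dots> \<le> C * \<theta> powr (1 / K)"
        using dist assms C by (intro mult_left_mono powr_mono2) auto
      also have "\<dots> \<le> (4 * pi + C) * \<theta> powr (1 / K)" by (intro mult_right_mono) auto
      finally show ?thesis using 3 by simp
    qed
    moreover have "(4 * pi + C) * (if \<theta> \<le> 1 then \<theta> powr (1 / K) else \<theta>) \<le> (4 * pi + C) * max (\<theta> powr (1 / K)) \<theta>"
      using C by (intro mult_left_mono) auto
    ultimately show "\<theta>' \<le> (4 * pi + C) * max (\<theta> powr (1 / K)) \<theta> \<and> (\<theta> \<le> 1 \<longrightarrow> \<theta>' \<le> (4 * pi + C) * \<theta> powr (1 / K))"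
      by auto
  qed
qed

end
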